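(* Let $n\ge 1$, let $k\in\frac12\mathbb Z$ with $k\ge \frac n2$, let $\Gamma\subset \mathrm{Sp}_n(\mathbb Z)$ be any congruence subgroup, and let $F\in M^n_k(\Gamma)$. Suppose there is a real number $c<k-\frac{n+1}{2}$ such that the Fourier coefficients of $F$ at the cusp $\infty$ satisfy $a_F(T)\ll_F \det(T)^c$ for all $T\in\Lambda_n^+$. Then $F$ is a cusp form, i.e. $F\in S^n_k(\Gamma)$.
   Context: $\mathbf H_n$ is the Siegel upper half-space of degree $n$. $\Lambda_n$ denotes the set of half-integral (integer diagonal, off-diagonal entries in $\frac12\mathbb Z$) symmetric positive semi-definite $n\times n$ matrices, and $\Lambda_n^+\subset\Lambda_n$ the positive definite ones. For a congruence subgroup $\Gamma\subset\mathrm{Sp}_n(\mathbb Z)$ and $k\in\frac12\mathbb Z$, $M^n_k(\Gamma)$ is the space of holomorphic Siegel modular forms of weight $k$ on $\Gamma$ (for non-integral $k$, on the corresponding congruence subgroup of the metaplectic double cover, with the standard automorphy factor; for $n=1$ boundedness at all cusps is imposed). Each $F\in M^n_k(\Gamma)$ has a Fourier expansion $F(Z)=\sum_{T\in\Lambda_n}a_F(T)\,e(\mathrm{tr}(TZ)/M)$ for some integer $M\ge1$, where $e(x)=e^{2\pi i x}$; this is the expansion "at the cusp $\infty$". $F$ is a cusp form ($F\in S^n_k(\Gamma)$) iff for every $\gamma\in\mathrm{Sp}_n(\mathbb Z)$ the Fourier expansion of $F|_k\gamma$ is supported on positive definite matrices. *)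

theory Defs
  imports "HOL-Analysis.Analysis"
begin

text \<open>Degree n is encoded by a finite index type 'n (n = CARD('n) >= 1).
  An element of Sp_n(Z) is a block quadruple (A,B,C,D) of integer n x n matrices.\<close>

type_synonym 'n imat = "int^'n^'n"
type_synonym 'n cmat = "complex^'n^'n"
type_synonym 'n spel = "'n imat \<times> 'n imat \<times> 'n imat \<times> 'n imat"
type_synonym 'n mpel = "'n spel \<times> ('n cmat \<Rightarrow> complex)"

definition cmat :: "int^'n^'m \<Rightarrow> complex^'n^'m" where
  "cmat A = (\<chi> i j. of_int (A$i$j))"

definition rcmat :: "real^'n^'m \<Rightarrow> complex^'n^'m" where
  "rcmat A = (\<chi> i j. of_real (A$i$j))"

definition Im_mat :: "complex^'n^'m \<Rightarrow> real^'n^'m" where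
  "Im_mat Z = (\<chi> i j. Im (Z$i$j))"

definition msc :: "complex \<Rightarrow> complex^'n^'m \<Rightarrow> complex^'n^'m" where
  "msc w X = (\<chi> i j. w * X$i$j)"

definition sym_mat :: "'a^('n::finite)^'n \<Rightarrow> bool" where
  "sym_mat X \<longleftrightarrow> transpose X = X"

definition pos_def :: "real^('n::finite)^'n \<Rightarrow> bool" where
  "pos_def Y \<longleftrightarrow> sym_mat Y \<and> (\<forall>x. x \<noteq> 0 \<longrightarrow> x \<bullet> (Y *v x) > 0)"

definition pos_semidef :: "real^('n::finite)^'n \<Rightarrow> bool" where
  "pos_semidef Y \<longleftrightarrow> sym_mat Y \<and> (\<forall>x. x \<bullet> (Y *v x) \<ge> 0)"

definition siegel_H :: "('n::finite) cmat set" where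
  "siegel_H = {Z. sym_mat Z \<and> pos_def (Im_mat Z)}"

definition half_integral :: "real^('n::finite)^'n \<Rightarrow> bool" where
  "half_integral T \<longleftrightarrow> sym_mat T \<and> (\<forall>i. T$i$i \<in> \<int>) \<and> (\<forall>i j. 2 * T$i$j \<in> \<int>)"

definition Lambda :: "(real^('n::finite)^'n) set" where
  "Lambda = {T. half_integral T \<and> pos_semidef T}"

definition Lambda_plus :: "(real^('n::finite)^'n) set" where
  "Lambda_plus = {T. half_integral T \<and> pos_def T}"

definition Sp :: "('n::finite) spel set" where
  "Sp = {(A,B,C,D). transpose A ** C = transpose C ** A \<and> transpose B ** D = transpose D ** B
          \<and> transpose A ** D - transpose C ** B = mat 1}"

definition sp_one :: "('n::finite) spel" where "sp_one = (mat 1, 0, 0, mat 1)"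

fun sp_mult :: "('n::finite) spel \<Rightarrow> 'n spel \<Rightarrow> 'n spel" where
  "sp_mult (A,B,C,D) (A',B',C',D') =
     (A ** A' + B ** C', A ** B' + B ** D', C ** A' + D ** C', C ** B' + D ** D')"

fun sp_inv :: "('n::finite) spel \<Rightarrow> 'n spel" where
  "sp_inv (A,B,C,D) = (transpose D, - transpose B, - transpose C, transpose A)"

definition principal_congruence :: "int \<Rightarrow> ('n::finite) spel set" where
  "principal_congruence N = {(A,B,C,D) \<in> Sp. \<forall>i j. N dvd (A - mat 1)$i$j \<and> N dvd B$i$j
                                 \<and> N dvd C$i$j \<and> N dvd (D - mat 1)$i$j}"

definition congruence_subgroup :: "('n::finite) spel set \<Rightarrow> bool" where
  "congruence_subgroup \<Gamma> \<longleftrightarrow> \<Gamma> \<subseteq> Sp \<and> sp_one \<in> \<Gamma> \<and> (\<forall>g\<in>\<Gamma>. \<forall>h\<in>\<Gamma>. sp_mult g h \<in> \<Gamma>)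
      \<and> (\<forall>g\<in>\<Gamma>. sp_inv g \<in> \<Gamma>) \<and> (\<exists>N>0. principal_congruence N \<subseteq> \<Gamma>)"

fun sp_act :: "('n::finite) spel \<Rightarrow> 'n cmat \<Rightarrow> 'n cmat" where
  "sp_act (A,B,C,D) Z = (cmat A ** Z + cmat B) ** matrix_inv (cmat C ** Z + cmat D)"

fun j_det :: "('n::finite) spel \<Rightarrow> 'n cmat \<Rightarrow> complex" where
  "j_det (A,B,C,D) Z = det (cmat C ** Z + cmat D)"

text \<open>Metaplectic double cover Mp_n(Z): pairs (g, phi) with phi a continuous (hence holomorphic)
  square root of det(CZ+D) on H_n (normalised to 0 off H_n).\<close>
definition Mp :: "('n::finite) mpel set" where
  "Mp = {(g,\<phi>). g \<in> Sp \<and> continuous_on siegel_H \<phi> \<and> (\<forall>Z\<in>siegel_H. (\<phi> Z)\<^sup>2 = j_det g Z)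
               \<and> (\<forall>Z. Z \<notin> siegel_H \<longrightarrow> \<phi> Z = 0)}"

definition mp_one :: "('n::finite) mpel" where
  "mp_one = (sp_one, \<lambda>Z. if Z \<in> siegel_H then 1 else 0)"

fun mp_mult :: "('n::finite) mpel \<Rightarrow> 'n mpel \<Rightarrow> 'n mpel" where
  "mp_mult (g,\<phi>) (h,\<psi>) = (sp_mult g h, \<lambda>Z. if Z \<in> siegel_H then \<phi> (sp_act h Z) * \<psi> Z else 0)"

fun mp_inv :: "('n::finite) mpel \<Rightarrow> 'n mpel" where
  "mp_inv (g,\<phi>) = (sp_inv g, \<lambda>Z. if Z \<in> siegel_H then 1 / \<phi> (sp_act (sp_inv g) Z) else 0)"

definition mp_subgroup :: "('n::finite) mpel set \<Rightarrow> bool" where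
  "mp_subgroup G \<longleftrightarrow> G \<subseteq> Mp \<and> mp_one \<in> G \<and> (\<forall>x\<in>G. \<forall>y\<in>G. mp_mult x y \<in> G)
      \<and> (\<forall>x\<in>G. mp_inv x \<in> G)"

text \<open>Slash operator of weight k (k in (1/2)Z): (F|_k (g,phi))(Z) = phi(Z)^(-2k) F(gZ).\<close>
fun slash :: "real \<Rightarrow> ('n::finite) mpel \<Rightarrow> ('n cmat \<Rightarrow> complex) \<Rightarrow> 'n cmat \<Rightarrow> complex" where
  "slash k (g,\<phi>) F Z = (\<phi> Z) powi (- \<lfloor>2 * k\<rfloor>) * F (sp_act g Z)"

text \<open>Holomorphy on H_n: holomorphic along every complex line in the space of symmetric matrices
  (by Hartogs' theorem this is equivalent to joint holomorphy).\<close>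
definition siegel_holomorphic :: "(('n::finite) cmat \<Rightarrow> complex) \<Rightarrow> bool" where
  "siegel_holomorphic F \<longleftrightarrow> (\<forall>Z\<in>siegel_H. \<forall>X. sym_mat X \<longrightarrow>
      ((\<lambda>w. F (Z + msc w X)) field_differentiable at 0))"

definition e :: "complex \<Rightarrow> complex" where
  "e x = exp (2 * pi * \<i> * x)"

definition fourier_expansion :: "(('n::finite) cmat \<Rightarrow> complex) \<Rightarrow> nat \<Rightarrow> (real^'n^'n \<Rightarrow> complex) \<Rightarrow> bool" where
  "fourier_expansion F M a \<longleftrightarrow> M \<ge> 1 \<and> (\<forall>Z\<in>siegel_H.
      ((\<lambda>T. a T * e (trace (rcmat T ** Z) / of_nat M)) has_sum F Z) Lambda)"

definition modular_form :: "real \<Rightarrow> ('n::finite) mpel set \<Rightarrow> ('n cmat \<Rightarrow> complex) \<Rightarrow> bool" where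
  "modular_form k G F \<longleftrightarrow> siegel_holomorphic F
     \<and> (\<forall>x\<in>G. \<forall>Z\<in>siegel_H. slash k x F Z = F Z)
     \<and> (CARD('n) = 1 \<longrightarrow> (\<forall>x\<in>Mp. \<exists>C. \<forall>Z\<in>siegel_H.
            (\<forall>i. Im (Z$i$i) \<ge> 1) \<longrightarrow> norm (slash k x F Z) \<le> C))"

definition cusp_form :: "real \<Rightarrow> ('n::finite) mpel set \<Rightarrow> ('n cmat \<Rightarrow> complex) \<Rightarrow> bool" where
  "cusp_form k G F \<longleftrightarrow> modular_form k G F
     \<and> (\<forall>x\<in>Mp. \<exists>M a. fourier_expansion (slash k x F) M a \<and> (\<forall>T \<in> Lambda - Lambda_plus. a T = 0))"

end

theory Submission
  imports Defs "HOL-Complex_Analysis.Cauchy_Integral_Formula" "HOL-Computational_Algebra.Polynomial"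
begin

text \<open>Suppose that F slashed by g has a nonzero coefficient at a singular T. After a translation the
  lower left block C of g is nonsingular, and F at a point A C^(-1) + K^T Z K is a power of the
  automorphy factor times the slashed form at a point affine in -Z^(-1). Apply the determinant of the
  matrix of derivatives in Z to this relation. On the side of F it multiplies each term by det T, so only
  positive definite T survive, and the hypothesis on their coefficients bounds the result. On the other
  side a Capelli-type expansion shows that, as one diagonal entry y of the argument tends to infinity,
  the terms with T_pp = 0 would grow faster than this bound unless a polynomial with infinitely many
  zeros has vanishing constant coefficient; since k is at least n/2 this forces the sum of the terms with
  T_pp = 0 to vanish. An integral change of variables that makes one of these terms the unique one of
  minimal trace then kills its coefficient.\<close>

subsection \<open>Positive semidefinite matrices and the Siegel upper half-space\<close>

text \<open>The hypothesis speaks of one cusp and of positive definite T only, so the singular terms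
  of F have to disappear before any growth estimate; the determinantal operator removes them and
  still leaves the other side explicit, since antisymmetrising over the columns cancels all products
  but the diagonal ones. The threshold for c is a count of powers of y. The side of F is of order c
  + 1 + (n+1)/2, the 1 being the new factor det T; the automorphy factor has exact order k; the
  terms with T_pp = 0 carry exactly one factor y. So c < k - (n+1)/2 says that these terms would
  outgrow the bound. What must vanish is at first only a combination of sums weighted by minors of
  T. All diagonal entries other than y are therefore given one common value i eta + q j; the
  exponentials with T_pp = 0 do not see the integer j, which provides the infinitely many zeros. The
  constant coefficient carries the product of the numbers -k + j/2 with j < n, nonzero for k \<ge>
  n/2. Expansions at all cusps belong to the conclusion, so they are constructed too, by Fourier
  series and the Koecher principle.\<close>

lemma sym_mat_iff: "sym_mat X \<longleftrightarrow> (\<forall>i j. X$i$j = X$j$i)"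
  unfolding sym_mat_def transpose_def by (auto simp: vec_eq_iff)

lemma sym_matD: "sym_mat X \<Longrightarrow> X$i$j = X$j$i"
  by (simp add: sym_mat_iff)

lemma quad_form_axis:
  fixes T :: "real^'n^'n"
  shows "(s *\<^sub>R axis i 1 + t *\<^sub>R axis j 1) \<bullet> (T *v (s *\<^sub>R axis i 1 + t *\<^sub>R axis j 1))
       = s^2 * T$i$i + s * t * (T$i$j + T$j$i) + t^2 * T$j$j"
proof -
  have c: "axis k 1 \<bullet> (T *v axis l 1) = T$k$l" for k l
    by (simp add: matrix_vector_mult_basis inner_axis' column_def)
  show ?thesis
    by (simp add: matrix_vector_right_distrib matrix_vector_mult_scaleR inner_add_left inner_add_right c
        power2_eq_square algebra_simps)
qed

lemma pos_semidef_diag: "pos_semidef T \<Longrightarrow> T$i$i \<ge> 0"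
proof -
  assume "pos_semidef T"
  then have "0 \<le> axis i 1 \<bullet> (T *v axis i 1)" unfolding pos_semidef_def by blast
  then show ?thesis using quad_form_axis[of 1 i 0 i T] by simp
qed

lemma pos_semidef_entry:
  assumes "pos_semidef T"
  shows "(T$i$j)^2 \<le> T$i$i * T$j$j"
proof -
  define a b c where "a = T$i$i" and "b = T$i$j" and "c = T$j$j"
  have q: "s^2 * a + 2 * s * t * b + t^2 * c \<ge> 0" for s t
  proof -
    have "T$j$i = b" using assms sym_matD[of T j i] unfolding pos_semidef_def b_def by blast
    moreover have "0 \<le> (s *\<^sub>R axis i 1 + t *\<^sub>R axis j 1) \<bullet> (T *v (s *\<^sub>R axis i 1 + t *\<^sub>R axis j 1))"
      using assms unfolding pos_semidef_def by blast
    ultimately show ?thesis unfolding quad_form_axis a_def b_def c_def by (simp add: algebra_simps)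
  qed
  have a0: "a \<ge> 0" using pos_semidef_diag[OF assms] by (simp add: a_def)
  show ?thesis
  proof (cases "a = 0")
    case True
    have "b = 0"
    proof (rule ccontr)
      assume b: "b \<noteq> 0"
      \<comment> \<open>With a = 0 the form at these values is -(c+1) + c = -1.\<close>
      show False using q[of "-(c+1)/(2*b)" 1] True b by (simp add: field_simps)
    qed
    then show ?thesis using True by (simp add: a_def b_def)
  next
    case False
    \<comment> \<open>The vector (-b, a) is chosen because the form there equals a times the
      determinant of the two by two block.\<close>
    have "0 \<le> (-b)^2 * a + 2 * (-b) * a * b + a^2 * c" using q[of "-b" a] by simp
    also have "\<dots> = a * (a * c - b^2)" by (simp add: power2_eq_square algebra_simps)
    finally have "0 \<le> a * c - b^2" using a0 False by (simp add: zero_le_mult_iff)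
    then show ?thesis by (simp add: a_def b_def c_def)
  qed
qed

lemma pos_semidef_entry_le:
  assumes "pos_semidef T"
  shows "\<bar>T$i$j\<bar> \<le> sqrt (T$i$i) * sqrt (T$j$j)"
proof -
  have "sqrt ((T$i$j)^2) \<le> sqrt (T$i$i * T$j$j)" by (rule real_sqrt_le_mono[OF pos_semidef_entry[OF assms]])
  then show ?thesis by (simp only: real_sqrt_abs real_sqrt_mult)
qed

lemma pos_semidef_entry_mean:
  assumes "pos_semidef T"
  shows "\<bar>T$i$j\<bar> \<le> (T$i$i + T$j$j) / 2"
  using pos_semidef_entry_le[OF assms, of i j] arith_geo_mean_sqrt[of "T$i$i" "T$j$j"]
    pos_semidef_diag[OF assms] by (simp add: real_sqrt_mult)

lemma pos_semidef_entry_trace: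
  assumes "pos_semidef T"
  shows "\<bar>T$i$j\<bar> \<le> trace T"
proof -
  have "T$i$i \<le> trace T" for i
    unfolding trace_def by (rule member_le_sum) (auto simp: pos_semidef_diag[OF assms])
  from this[of i] this[of j] show ?thesis using pos_semidef_entry_mean[OF assms, of i j] by simp
qed

lemma pos_semidef_trace_nonneg: "pos_semidef T \<Longrightarrow> trace T \<ge> 0"
  unfolding trace_def by (intro sum_nonneg) (auto simp: pos_semidef_diag)

lemma pos_def_imp_semidef: "pos_def Y \<Longrightarrow> pos_semidef Y"
  unfolding pos_def_def pos_semidef_def
proof (elim conjE, intro conjI allI)
  fix x assume "\<forall>x. x \<noteq> 0 \<longrightarrow> 0 < x \<bullet> (Y *v x)"
  then show "0 \<le> x \<bullet> (Y *v x)" by (cases "x = 0") (auto intro: less_imp_le)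
qed

lemma quad_form_sum:
  "x \<bullet> (T *v x) = (\<Sum>i\<in>UNIV. \<Sum>j\<in>UNIV. x$i * T$i$j * x$j)" for T :: "real^'n^'n"
  unfolding inner_vec_def matrix_vector_mult_def
  by (simp add: sum_distrib_left mult.assoc)

text \<open>Cholesky elimination: a positive semidefinite matrix loses one diagonal entry after
  subtracting a rank one matrix.\<close>
lemma trace_mult_nonneg:
  fixes T Y :: "real^'n^'n"
  assumes "pos_semidef T" "pos_semidef Y"
  shows "trace (T ** Y) \<ge> 0"
  using assms(1)
proof (induction "card {i. T$i$i \<noteq> 0}" arbitrary: T rule: less_induct)
  case less
  show ?case
  proof (cases "\<exists>p. T$p$p \<noteq> 0")
    case False
    then have "T = 0" using pos_semidef_entry[OF less.prems] by (simp add: vec_eq_iff)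
    then show ?thesis by (simp add: trace_def)
  next
    case True
    then obtain p where p: "T$p$p \<noteq> 0" by blast
    then have pp: "T$p$p > 0" using pos_semidef_diag[OF less.prems, of p] by simp
    have sT: "T$i$j = T$j$i" for i j using less.prems sym_matD[of T i j] unfolding pos_semidef_def by blast
    define v where "v = column p T"
    have v: "v$i = T$i$p" for i by (simp add: v_def column_def)
    define T' where "T' = (\<chi> i j. T$i$j - v$i * v$j / T$p$p)"
    have qT': "x \<bullet> (T' *v x) = x \<bullet> (T *v x) - (v \<bullet> x)^2 / T$p$p" for x
    proof -
      have "x \<bullet> (T' *v x) = (\<Sum>i\<in>UNIV. \<Sum>j\<in>UNIV. x$i * T$i$j * x$j)
           - (\<Sum>i\<in>UNIV. \<Sum>j\<in>UNIV. (v$i * x$i) * (v$j * x$j)) / T$p$p"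
        unfolding quad_form_sum T'_def
        by (simp add: sum_divide_distrib flip: sum_subtractf) (simp add: field_simps)
      also have "(\<Sum>i\<in>UNIV. \<Sum>j\<in>UNIV. (v$i * x$i) * (v$j * x$j)) = (v \<bullet> x)^2"
        by (simp add: power2_eq_square inner_vec_def sum_product)
      finally show ?thesis by (simp add: quad_form_sum)
    qed
    have psd: "pos_semidef T'"
      unfolding pos_semidef_def
    proof (intro conjI allI)
      show "sym_mat T'" unfolding sym_mat_iff T'_def using sT by (simp add: mult.commute)
      fix x
      \<comment> \<open>The minimiser of the form of \<open>T\<close> on the line through x in
        direction p; its minimum there is the form of \<open>T'\<close> at x.\<close>
      define t where "t = - (v \<bullet> x) / T$p$p"
      have "0 \<le> (x + t *\<^sub>R axis p 1) \<bullet> (T *v (x + t *\<^sub>R axis p 1))"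
        using less.prems unfolding pos_semidef_def by blast
      also have "\<dots> = x \<bullet> (T *v x) + 2 * t * (v \<bullet> x) + t^2 * T$p$p"
      proof -
        have a: "T *v axis p 1 = v" by (simp add: matrix_vector_mult_basis v_def)
        have b: "axis p 1 \<bullet> (T *v x) = v \<bullet> x"
        proof -
          have "axis p 1 \<bullet> (T *v x) = (T *v x)$p" by (simp add: inner_axis')
          also have "\<dots> = (\<Sum>j\<in>UNIV. T$p$j * x$j)" by (simp add: matrix_vector_mult_def)
          also have "\<dots> = v \<bullet> x" unfolding inner_vec_def v by (simp add: sT[of p])
          finally show ?thesis .
        qed
        have c: "axis p 1 \<bullet> v = T$p$p" by (simp add: inner_axis' v)
        show ?thesis
          by (simp add: matrix_vector_right_distrib matrix_vector_mult_scaleR inner_add_left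
              inner_add_right a b c power2_eq_square inner_commute[of x v] algebra_simps)
      qed
      also have "\<dots> = x \<bullet> (T' *v x)"
        using pp by (simp add: qT' t_def power2_eq_square field_simps)
      finally show "0 \<le> x \<bullet> (T' *v x)" .
    qed
    \<comment> \<open>Diagonal entries of \<open>T'\<close> are at most those of \<open>T\<close>
      and still nonnegative, so zeros stay zeros; the entry at p becomes a new zero and the
      induction measure drops.\<close>
    have "{i. T'$i$i \<noteq> 0} \<subset> {i. T$i$i \<noteq> 0}"
    proof -
      have "T'$p$p = 0" using pp by (simp add: T'_def v)
      moreover have "T'$i$i = 0" if "T$i$i = 0" for i
      proof -
        have "T'$i$i = - (v$i * v$i / T$p$p)" using that by (simp add: T'_def)
        moreover have "v$i * v$i / T$p$p \<ge> 0" using pp by simp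
        ultimately show ?thesis using pos_semidef_diag[OF psd, of i] by linarith
      qed
      ultimately show ?thesis using p by auto
    qed
    then have "card {i. T'$i$i \<noteq> 0} < card {i. T$i$i \<noteq> 0}" by (intro psubset_card_mono) auto
    from less.hyps[OF this psd] have 1: "0 \<le> trace (T' ** Y)" .
    have "trace (T ** Y) = trace (T' ** Y) + (v \<bullet> (Y *v v)) / T$p$p"
    proof -
      have "trace (T' ** Y) = trace (T ** Y) - (\<Sum>i\<in>UNIV. \<Sum>k\<in>UNIV. v$i * v$k * Y$k$i) / T$p$p"
        unfolding trace_def matrix_matrix_mult_def T'_def
        by (simp add: sum_divide_distrib flip: sum_subtractf) (simp add: algebra_simps)
      also have "(\<Sum>i\<in>UNIV. \<Sum>k\<in>UNIV. v$i * v$k * Y$k$i) = v \<bullet> (Y *v v)"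
        unfolding quad_form_sum by (subst sum.swap) (simp add: mult_ac)
      finally show ?thesis by simp
    qed
    moreover have "v \<bullet> (Y *v v) \<ge> 0" using assms(2) unfolding pos_semidef_def by blast
    ultimately show ?thesis using 1 pp by simp
  qed
qed

lemma norm_matrix_vector_mult_le:
  fixes E :: "real^'n^'m"
  shows "norm (E *v x) \<le> norm E * norm x"
proof -
  have "norm (E *v x) = L2_set (\<lambda>i. norm ((E *v x)$i)) UNIV" by (simp add: norm_vec_def)
  also have "\<dots> \<le> L2_set (\<lambda>i. norm (E$i) * norm x) UNIV"
    by (intro L2_set_mono) (auto simp: matrix_vector_mul_component Cauchy_Schwarz_ineq2)
  also have "\<dots> = norm E * norm x"
    by (simp add: norm_vec_def L2_set_left_distrib)
  finally show ?thesis .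
qed

lemma quad_form_bound:
  fixes E :: "real^'n^'n"
  shows "\<bar>x \<bullet> (E *v x)\<bar> \<le> norm E * (norm x)^2"
proof -
  have "\<bar>x \<bullet> (E *v x)\<bar> \<le> norm x * norm (E *v x)" by (rule Cauchy_Schwarz_ineq2)
  also have "\<dots> \<le> norm x * (norm E * norm x)"
    by (intro mult_left_mono norm_matrix_vector_mult_le) auto
  finally show ?thesis by (simp add: power2_eq_square mult_ac)
qed

text \<open>Compactness of the unit sphere gives the constant, homogeneity of degree two extends it
  to all vectors.\<close>

lemma pos_def_lower:
  fixes Y :: "real^'n^'n"
  assumes "pos_def Y"
  obtains \<eta> where "\<eta> > 0" "\<And>x. \<eta> * (norm x)^2 \<le> x \<bullet> (Y *v x)"
proof -
  let ?S = "sphere (0::real^'n) 1"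
  have "continuous_on ?S (\<lambda>x. x \<bullet> (Y *v x))"
    by (intro continuous_intros linear_continuous_on matrix_vector_mul_bounded_linear)
  moreover have "?S \<noteq> {}" by simp
  ultimately obtain z where z: "z \<in> ?S" "\<And>x. x \<in> ?S \<Longrightarrow> z \<bullet> (Y *v z) \<le> x \<bullet> (Y *v x)"
    using continuous_attains_inf[of ?S "\<lambda>x. x \<bullet> (Y *v x)"] by auto
  have "z \<noteq> 0" using z(1) by auto
  then have pos: "z \<bullet> (Y *v z) > 0" using assms by (simp add: pos_def_def)
  have "z \<bullet> (Y *v z) * (norm x)^2 \<le> x \<bullet> (Y *v x)" for x
  proof (cases "x = 0")
    case False
    then have "(x /\<^sub>R norm x) \<in> ?S" by simp
    from z(2)[OF this] have "z \<bullet> (Y *v z) \<le> (x \<bullet> (Y *v x)) / (norm x)^2"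
      by (simp add: matrix_vector_mult_scaleR power2_eq_square field_simps)
    then show ?thesis using False by (simp add: field_simps)
  qed simp
  with pos that show ?thesis by blast
qed

text \<open>The half is what series estimates need: near a point the imaginary part stays above half
  of its value there, so the series at the halved point dominates a whole neighbourhood. A
  perturbation of norm below half the lower constant of the form cannot do more damage.\<close>

lemma pos_def_perturb:
  fixes Y :: "real^'n^'n"
  assumes "pos_def Y"
  obtains r where "r > 0" "\<And>Y'. sym_mat Y' \<Longrightarrow> norm (Y' - Y) < r \<Longrightarrow> pos_def Y' \<and> pos_semidef (Y' - (1/2) *\<^sub>R Y)"
proof -
  obtain \<eta> where \<eta>: "\<eta> > 0" "\<And>x. \<eta> * (norm x)^2 \<le> x \<bullet> (Y *v x)" using pos_def_lower[OF assms] by blast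
  have "pos_def Y' \<and> pos_semidef (Y' - (1/2) *\<^sub>R Y)" if "sym_mat Y'" "norm (Y' - Y) < \<eta>/2" for Y'
  proof -
    have *: "x \<bullet> (Y' *v x) \<ge> (1/2) * (x \<bullet> (Y *v x))" for x
    proof -
      have "Y' *v x = Y *v x + (Y' - Y) *v x" by (simp add: matrix_vector_mult_diff_rdistrib)
      then have "x \<bullet> (Y' *v x) = x \<bullet> (Y *v x) + x \<bullet> ((Y' - Y) *v x)" by (simp add: inner_add_right)
      moreover have "\<bar>x \<bullet> ((Y' - Y) *v x)\<bar> \<le> norm (Y' - Y) * (norm x)^2" by (rule quad_form_bound)
      moreover have "norm (Y' - Y) * (norm x)^2 \<le> \<eta>/2 * (norm x)^2"
        using that by (intro mult_right_mono) auto
      moreover have "\<eta>/2 * (norm x)^2 \<le> (1/2) * (x \<bullet> (Y *v x))" using \<eta>(2)[of x] by simp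
      ultimately show ?thesis by linarith
    qed
    have "pos_def Y'" unfolding pos_def_def
    proof (intro conjI allI impI)
      fix x :: "real^'n" assume "x \<noteq> 0"
      then have "x \<bullet> (Y *v x) > 0" using assms by (simp add: pos_def_def)
      then show "x \<bullet> (Y' *v x) > 0" using *[of x] by linarith
    qed fact
    moreover have "pos_semidef (Y' - (1/2) *\<^sub>R Y)" unfolding pos_semidef_def
    proof (intro conjI allI)
      show "sym_mat (Y' - (1/2) *\<^sub>R Y)" using that(1) assms unfolding pos_def_def sym_mat_iff by simp
      show "0 \<le> x \<bullet> ((Y' - (1/2) *\<^sub>R Y) *v x)" for x
        using *[of x] by (simp add: matrix_vector_mult_diff_rdistrib inner_diff_right scaleR_matrix_vector_assoc[symmetric])
    qed
    ultimately show ?thesis ..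
  qed
  with \<eta>(1) that[of "\<eta>/2"] show ?thesis by simp
qed

lemma Im_mat_nth [simp]: "Im_mat Z $ i $ j = Im (Z$i$j)" by (simp add: Im_mat_def)
lemma msc_nth [simp]: "msc w X $ i $ j = w * X$i$j" by (simp add: msc_def)
lemma cmat_nth [simp]: "cmat A $ i $ j = of_int (A$i$j)" by (simp add: cmat_def)
lemma rcmat_nth [simp]: "rcmat A $ i $ j = of_real (A$i$j)" by (simp add: rcmat_def)
lemma Im_mat_diff: "Im_mat (Z - W) = Im_mat Z - Im_mat W" by (simp add: vec_eq_iff)

lemma norm_Im_mat_le: "norm (Im_mat Z) \<le> norm Z"
  unfolding norm_vec_def by (intro L2_set_mono) (auto simp: abs_Im_le_cmod)

lemma siegel_HD:
  assumes "Z \<in> siegel_H"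
  shows "sym_mat Z" "pos_def (Im_mat Z)"
  using assms by (auto simp: siegel_H_def)

lemma siegel_H_nbhd:
  assumes "Z \<in> siegel_H"
  obtains r where "r > 0" "\<And>Z'. sym_mat Z' \<Longrightarrow> dist Z' Z < r \<Longrightarrow>
     Z' \<in> siegel_H \<and> pos_semidef (Im_mat Z' - (1/2) *\<^sub>R Im_mat Z)"
proof -
  obtain r where r: "r > 0" "\<And>Y'. sym_mat Y' \<Longrightarrow> norm (Y' - Im_mat Z) < r \<Longrightarrow>
      pos_def Y' \<and> pos_semidef (Y' - (1/2) *\<^sub>R Im_mat Z)"
    using pos_def_perturb[OF siegel_HD(2)[OF assms]] by blast
  show ?thesis
  proof (rule that[OF r(1)])
    fix Z' :: "'a cmat" assume *: "sym_mat Z'" "dist Z' Z < r"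
    have "sym_mat (Im_mat Z')" using * by (auto simp: sym_mat_iff)
    moreover have "norm (Im_mat Z' - Im_mat Z) < r"
      using norm_Im_mat_le[of "Z' - Z"] * by (simp add: Im_mat_diff dist_norm)
    ultimately show "Z' \<in> siegel_H \<and> pos_semidef (Im_mat Z' - (1/2) *\<^sub>R Im_mat Z)"
      using r(2) * by (auto simp: siegel_H_def)
  qed
qed

text \<open>Used in two ways: connectedness fixes the sign of a continuous square root of 1, and the
  parameter set of every complex line in the half-space is convex.\<close>

lemma convex_siegel_H: "convex (siegel_H :: ('n::finite) cmat set)"
proof (rule convexI)
  fix Z W :: "'n cmat" and u v :: real
  assume *: "Z \<in> siegel_H" "W \<in> siegel_H" "0 \<le> u" "0 \<le> v" "u + v = 1"
  have "Im_mat (u *\<^sub>R Z + v *\<^sub>R W) = u *\<^sub>R Im_mat Z + v *\<^sub>R Im_mat W" by (simp add: vec_eq_iff)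
  moreover have "pos_def (u *\<^sub>R Im_mat Z + v *\<^sub>R Im_mat W)"
    unfolding pos_def_def
  proof (intro conjI allI impI)
    show "sym_mat (u *\<^sub>R Im_mat Z + v *\<^sub>R Im_mat W)"
      using *(1,2) unfolding siegel_H_def pos_def_def sym_mat_iff by auto
    fix x :: "real^'n" assume x: "x \<noteq> 0"
    have "x \<bullet> (Im_mat Z *v x) > 0" "x \<bullet> (Im_mat W *v x) > 0"
      using *(1,2) x unfolding siegel_H_def pos_def_def by auto
    moreover have "u > 0 \<or> v > 0" using * by linarith
    ultimately have "u * (x \<bullet> (Im_mat Z *v x)) + v * (x \<bullet> (Im_mat W *v x)) > 0"
      using *(3,4) by (elim disjE) (simp_all add: add_pos_nonneg add_nonneg_pos less_imp_le)
    then show "0 < x \<bullet> ((u *\<^sub>R Im_mat Z + v *\<^sub>R Im_mat W) *v x)"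
      by (simp add: matrix_vector_mult_add_rdistrib inner_add_right scaleR_matrix_vector_assoc[symmetric])
  qed
  moreover have "sym_mat (u *\<^sub>R Z + v *\<^sub>R W)" using *(1,2) unfolding siegel_H_def sym_mat_iff by auto
  ultimately show "u *\<^sub>R Z + v *\<^sub>R W \<in> siegel_H" by (simp add: siegel_H_def)
qed

lemma e_add: "e (x + y) = e x * e y" by (simp add: e_def distrib_left exp_add)
lemma e_0 [simp]: "e 0 = 1" by (simp add: e_def)
lemma norm_e: "norm (e x) = exp (- 2 * pi * Im x)" by (simp add: e_def norm_exp_eq_Re)
lemma e_Ints: "x \<in> \<int> \<Longrightarrow> e x = 1"
proof (elim Ints_cases)
  fix n :: int assume "x = of_int n"
  then show "e x = 1" using exp_integer_2pi[of "of_int n"] by (simp add: e_def mult_ac)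
qed
lemma e_nonzero [simp]: "e x \<noteq> 0" by (simp add: e_def)

text \<open>The trace of TZ, written entrywise so that it is visibly a finite linear combination of
  the coordinate functions of Z.\<close>

definition cpair :: "real^'n^'n \<Rightarrow> complex^'n^'n \<Rightarrow> complex" where
  "cpair T Z = (\<Sum>i\<in>UNIV. \<Sum>j\<in>UNIV. of_real (T$i$j) * Z$j$i)"

lemma trace_rcmat_mult: "trace (rcmat T ** Z) = cpair T Z"
  by (simp add: trace_def matrix_matrix_mult_def cpair_def)

lemma Im_cpair: "Im (cpair T Z) = trace (T ** Im_mat Z)"
  by (simp add: cpair_def trace_def matrix_matrix_mult_def)

lemma norm_e_cpair: "norm (e (cpair T Z)) = exp (- 2 * pi * trace (T ** Im_mat Z))"
  by (simp add: norm_e Im_cpair)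

subsection \<open>Holomorphic functions on the half-space\<close>

text \<open>Continuity in all variables accompanies holomorphy along lines because derivatives will
  be written as circle integrals, whose dependence on the centre is governed by joint
  continuity.\<close>

definition cholo :: "(('n::finite) cmat \<Rightarrow> complex) \<Rightarrow> bool" where
  "cholo f \<longleftrightarrow> continuous_on siegel_H f \<and> siegel_holomorphic f"

definition delta :: "('n::finite) cmat \<Rightarrow> ('n cmat \<Rightarrow> complex) \<Rightarrow> 'n cmat \<Rightarrow> complex" where
  "delta X f Z = deriv (\<lambda>w. f (Z + msc w X)) 0"

lemma msc_add: "msc (a + b) X = msc a X + msc b X" by (simp add: vec_eq_iff algebra_simps)
lemma msc_0 [simp]: "msc 0 X = 0" by (simp add: vec_eq_iff)

lemma bounded_linear_msc: "bounded_linear (\<lambda>w. msc w X)"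
proof -
  have "linear (\<lambda>w. msc w X)" by (rule linearI) (auto simp: vec_eq_iff algebra_simps)
  then show ?thesis by (simp add: linear_conv_bounded_linear)
qed

lemma continuous_on_msc [continuous_intros]:
  "continuous_on S g \<Longrightarrow> continuous_on S (\<lambda>x. msc (g x) X)"
  by (rule bounded_linear.continuous_on[OF bounded_linear_msc])

lemma norm_msc: "norm (msc w X) = norm w * norm X"
  unfolding norm_vec_def by (simp add: norm_mult norm_vec_def L2_set_right_distrib)

lemma sym_mat_add: "sym_mat Z \<Longrightarrow> sym_mat W \<Longrightarrow> sym_mat (Z + W)"
  by (auto simp: sym_mat_iff)
lemma sym_mat_msc: "sym_mat X \<Longrightarrow> sym_mat (msc w X)"
  by (auto simp: sym_mat_iff)

text \<open>The point is that one radius \<open>r\<close> serves all base points near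
  \<open>Z0\<close>, as circle integrals with a moving centre require.\<close>

lemma siegel_H_line_nbhd:
  assumes Z0: "Z0 \<in> siegel_H" and X: "sym_mat X"
  obtains \<rho> r where "\<rho> > 0" "r > 0"
    "\<And>Z w. Z \<in> siegel_H \<Longrightarrow> dist Z Z0 < \<rho> \<Longrightarrow> norm w \<le> r \<Longrightarrow> Z + msc w X \<in> siegel_H"
proof -
  obtain s where s: "s > 0" "\<And>Z'. sym_mat Z' \<Longrightarrow> dist Z' Z0 < s \<Longrightarrow> Z' \<in> siegel_H"
    using siegel_H_nbhd[OF Z0] by metis
  define r where "r = s / (2 * (norm X + 1))"
  have np: "norm X + 1 > 0" using norm_ge_zero[of X] by linarith
  have r: "r > 0" using s np unfolding r_def by simp
  have "Z + msc w X \<in> siegel_H" if "Z \<in> siegel_H" "dist Z Z0 < s/2" "norm w \<le> r" for Z w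
  proof (rule s(2))
    show "sym_mat (Z + msc w X)" using siegel_HD(1)[OF that(1)] X by (intro sym_mat_add sym_mat_msc)
    have "norm (msc w X) \<le> r * norm X" unfolding norm_msc using that(3) by (intro mult_right_mono) auto
    also have "\<dots> \<le> s/2" using s np by (simp add: r_def field_simps)
    finally have a: "norm (msc w X) \<le> s/2" .
    have "dist (Z + msc w X) Z0 \<le> dist Z Z0 + norm (msc w X)"
      using norm_triangle_ineq[of "Z - Z0" "msc w X"] by (simp add: dist_norm algebra_simps)
    then show "dist (Z + msc w X) Z0 < s" using that a by linarith
  qed
  with that[of "s/2" r] s r show ?thesis by simp
qed

lemma open_line: "sym_mat X \<Longrightarrow> open {w. Z + msc w X \<in> siegel_H}"
proof (rule openI)
  fix w assume X: "sym_mat X" and "w \<in> {w. Z + msc w X \<in> siegel_H}"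
  then have w: "Z + msc w X \<in> siegel_H" by simp
  obtain \<rho> r where r: "\<rho> > 0" "r > 0" "\<And>Z' w'. Z' \<in> siegel_H \<Longrightarrow> dist Z' (Z + msc w X) < \<rho> \<Longrightarrow> norm w' \<le> r
      \<Longrightarrow> Z' + msc w' X \<in> siegel_H"
    using siegel_H_line_nbhd[OF w X] by metis
  have "ball w r \<subseteq> {w. Z + msc w X \<in> siegel_H}"
  proof
    fix v assume "v \<in> ball w r"
    then have "norm (v - w) \<le> r" by (simp add: dist_norm norm_minus_commute)
    then have "(Z + msc w X) + msc (v - w) X \<in> siegel_H" using r w by simp
    moreover have "(Z + msc w X) + msc (v - w) X = Z + msc v X" by (simp add: vec_eq_iff algebra_simps)
    ultimately show "v \<in> {w. Z + msc w X \<in> siegel_H}" by simp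
  qed
  with r(2) show "\<exists>T>0. ball w T \<subseteq> {w. Z + msc w X \<in> siegel_H}" by blast
qed

lemma convex_line: "convex {w. Z + msc w X \<in> siegel_H}"
proof (rule convexI)
  fix a b :: complex and u v :: real
  assume *: "a \<in> {w. Z + msc w X \<in> siegel_H}" "b \<in> {w. Z + msc w X \<in> siegel_H}" "0 \<le> u" "0 \<le> v" "u + v = 1"
  have "u *\<^sub>R (Z + msc a X) + v *\<^sub>R (Z + msc b X) = (u + v) *\<^sub>R Z + msc (u *\<^sub>R a + v *\<^sub>R b) X"
    by (simp add: vec_eq_iff algebra_simps)
  moreover have "u *\<^sub>R (Z + msc a X) + v *\<^sub>R (Z + msc b X) \<in> siegel_H"
    using convexD[OF convex_siegel_H] * by blast
  ultimately show "u *\<^sub>R a + v *\<^sub>R b \<in> {w. Z + msc w X \<in> siegel_H}" using * by simp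
qed

lemma siegel_holomorphic_DERIV:
  assumes f: "siegel_holomorphic f" and X: "sym_mat X" and w: "Z + msc w X \<in> siegel_H"
  shows "((\<lambda>w. f (Z + msc w X)) has_field_derivative delta X f (Z + msc w X)) (at w)"
proof -
  have "(\<lambda>v. f ((Z + msc w X) + msc v X)) field_differentiable at 0"
    using f X w unfolding siegel_holomorphic_def by blast
  then have "((\<lambda>v. f ((Z + msc w X) + msc v X)) has_field_derivative delta X f (Z + msc w X)) (at 0)"
    unfolding delta_def by (rule field_differentiable_derivI)
  moreover have "(\<lambda>v. f ((Z + msc w X) + msc v X)) = (\<lambda>v. f (Z + msc (v + w) X))"
    by (auto simp: msc_add add_ac)
  ultimately have "((\<lambda>v. f (Z + msc (v + w) X)) has_field_derivative delta X f (Z + msc w X)) (at 0)" by simp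
  then show ?thesis using DERIV_shift[of "\<lambda>v. f (Z + msc v X)" _ 0 w] by simp
qed

lemma siegel_holomorphic_DERIV0:
  assumes "siegel_holomorphic f" "sym_mat X" "Z \<in> siegel_H"
  shows "((\<lambda>w. f (Z + msc w X)) has_field_derivative delta X f Z) (at 0)"
  using siegel_holomorphic_DERIV[OF assms(1,2), of Z 0] assms(3) by simp

lemma siegel_holomorphic_line:
  assumes "siegel_holomorphic f" "sym_mat X" "\<And>w. w \<in> U \<Longrightarrow> Z + msc w X \<in> siegel_H"
  shows "(\<lambda>w. f (Z + msc w X)) holomorphic_on U"
  unfolding holomorphic_on_def field_differentiable_def
  using siegel_holomorphic_DERIV[OF assms(1,2)] assms(3) has_field_derivative_at_within by blast

lemma deltaI:
  "((\<lambda>w. f (Z + msc w X)) has_field_derivative d) (at 0) \<Longrightarrow> delta X f Z = d"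
  unfolding delta_def by (rule DERIV_imp_deriv)

text \<open>Cauchy's formula for the derivative, on a circle parametrised by the unit interval: the
  velocity 2 pi i q of the circle cancels one of the two powers of q in the denominator. In this
  form continuity and differentiation in \<open>Z\<close> can be carried under the integral
  sign.\<close>

lemma delta_circle_integral:
  assumes f: "cholo f" and X: "sym_mat X" and r: "r > 0" and U: "\<And>w. norm w \<le> r \<Longrightarrow> Z + msc w X \<in> siegel_H"
  shows "delta X f Z = integral (cbox 0 1) (\<lambda>t::real. f (Z + msc (r * exp (2 * of_real pi * \<i> * of_real t)) X)
                                                / (r * exp (2 * of_real pi * \<i> * of_real t)))"
proof -
  let ?f = "\<lambda>w. f (Z + msc w X)"
  have hol: "?f holomorphic_on cball 0 r"
    using f X U by (intro siegel_holomorphic_line) (auto simp: cholo_def)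
  have d: "(?f has_field_derivative (1 / (2 * of_real pi * \<i>) *
        contour_integral (circlepath 0 r) (\<lambda>u. ?f u / (u - 0)^2))) (at 0)"
    using r by (intro Cauchy_derivative_integral_circlepath(2) holomorphic_on_imp_continuous_on[OF hol]
        holomorphic_on_subset[OF hol]) auto
  have vd: "vector_derivative (circlepath 0 r) (at t) = 2 * of_real pi * \<i> * (r * exp (2 * of_real pi * \<i> * of_real t))" for t
    by (simp add: vector_derivative_circlepath)
  have cp: "circlepath 0 r t = r * exp (2 * of_real pi * \<i> * of_real t)" for t
    by (simp add: circlepath)
  have "contour_integral (circlepath 0 r) (\<lambda>u. ?f u / (u - 0)^2)
      = integral {0..1} (\<lambda>t. ?f (circlepath 0 r t) / (circlepath 0 r t)^2 *
           vector_derivative (circlepath 0 r) (at t))"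
    by (simp add: contour_integral_integral)
  also have "\<dots> = integral {0..1} (\<lambda>t. (2 * of_real pi * \<i>) * (?f (r * exp (2 * of_real pi * \<i> * of_real t))
         / (r * exp (2 * of_real pi * \<i> * of_real t))))"
  proof (intro arg_cong[where f = "integral {0..1}"] ext)
    fix t :: real
    define q where "q = r * exp (2 * of_real pi * \<i> * of_real t)"
    have "q \<noteq> 0" using r by (simp add: q_def)
    then show "?f (circlepath 0 r t) / (circlepath 0 r t)^2 * vector_derivative (circlepath 0 r) (at t)
       = (2 * of_real pi * \<i>) * (?f (r * exp (2 * of_real pi * \<i> * of_real t)) / (r * exp (2 * of_real pi * \<i> * of_real t)))"
      unfolding vd cp q_def[symmetric] by (simp add: power2_eq_square)
  qed
  also have "\<dots> = (2 * of_real pi * \<i>) * integral {0..1} (\<lambda>t. ?f (r * exp (2 * of_real pi * \<i> * of_real t))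
         / (r * exp (2 * of_real pi * \<i> * of_real t)))"
    by (rule integral_mult_right)
  finally show ?thesis using deltaI[OF d] by (simp add: cbox_interval)
qed

lemma continuous_on_locally:
  fixes f :: "'a::metric_space \<Rightarrow> 'b::topological_space"
  assumes "\<And>x. x \<in> S \<Longrightarrow> \<exists>r>0. continuous_on (S \<inter> ball x r) f"
  shows "continuous_on S f"
  unfolding continuous_on_eq_continuous_within
proof
  fix x assume x: "x \<in> S"
  obtain r where r: "r > 0" "continuous_on (S \<inter> ball x r) f" using assms[OF x] by blast
  have "at x within S = at x within (S \<inter> ball x r)"
    by (rule at_within_nhd[of _ "ball x r"]) (use r in auto)
  moreover have "continuous (at x within (S \<inter> ball x r)) f"
    using r x by (auto simp: continuous_on_eq_continuous_within)
  ultimately show "continuous (at x within S) f" by (simp add: continuous_within)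
qed

lemma continuous_on_compose_H:
  assumes "continuous_on siegel_H f" "continuous_on S g" "\<And>x. x \<in> S \<Longrightarrow> g x \<in> siegel_H"
  shows "continuous_on S (\<lambda>x. f (g x))"
  by (rule continuous_on_compose2[OF assms(1,2)]) (use assms(3) in auto)

lemma continuous_on_delta:
  assumes f: "cholo f" and X: "sym_mat X"
  shows "continuous_on siegel_H (delta X f)"
proof (rule continuous_on_locally)
  have cf: "continuous_on siegel_H f" using f by (simp add: cholo_def)
  fix Z0 :: "'a cmat" assume Z0: "Z0 \<in> siegel_H"
  obtain \<rho> r where r: "\<rho> > 0" "r > 0" "\<And>Z w. Z \<in> siegel_H \<Longrightarrow> dist Z Z0 < \<rho> \<Longrightarrow> norm w \<le> r \<Longrightarrow> Z + msc w X \<in> siegel_H"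
    using siegel_H_line_nbhd[OF Z0 X] by metis
  let ?g = "\<lambda>Z t::real. f (Z + msc (r * exp (2 * of_real pi * \<i> * of_real t)) X) / (r * exp (2 * of_real pi * \<i> * of_real t))"
  have "continuous_on (siegel_H \<inter> ball Z0 \<rho>) (\<lambda>Z. integral (cbox 0 1) (?g Z))"
  proof (rule integral_continuous_on_param)
    have "continuous_on ((siegel_H \<inter> ball Z0 \<rho>) \<times> cbox 0 1)
       (\<lambda>x. f (fst x + msc (r * exp (2 * of_real pi * \<i> * of_real (snd x))) X) / (r * exp (2 * of_real pi * \<i> * of_real (snd x))))"
      using r by (intro continuous_intros continuous_on_compose_H[OF cf]) (auto simp: norm_mult dist_commute)
    then show "continuous_on ((siegel_H \<inter> ball Z0 \<rho>) \<times> cbox 0 1) (\<lambda>(x, t). ?g x t)"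
      by (simp add: case_prod_beta)
  qed
  then have "continuous_on (siegel_H \<inter> ball Z0 \<rho>) (delta X f)"
  proof (rule continuous_on_eq)
    fix Z assume "Z \<in> siegel_H \<inter> ball Z0 \<rho>"
    then have "Z \<in> siegel_H" "dist Z Z0 < \<rho>" by (auto simp: dist_commute)
    then show "integral (cbox 0 1) (?g Z) = delta X f Z"
      by (intro delta_circle_integral[symmetric] f X r)
  qed
  then show "\<exists>\<rho>>0. continuous_on (siegel_H \<inter> ball Z0 \<rho>) (delta X f)" using r by blast
qed

text \<open>Differentiating the circle integral for direction \<open>X\<close> under the integral
  sign gives holomorphy in every direction \<open>X'\<close>; hence directional derivatives can be
  iterated.\<close>

lemma cholo_delta:
  assumes f: "cholo f" and X: "sym_mat X"
  shows "cholo (delta X f)"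
  unfolding cholo_def siegel_holomorphic_def
proof (intro conjI ballI allI impI)
  have cf: "continuous_on siegel_H f" using f by (simp add: cholo_def)
  show "continuous_on siegel_H (delta X f)" using assms by (rule continuous_on_delta)
  fix Z0 X' :: "'a cmat" assume Z0: "Z0 \<in> siegel_H" and X': "sym_mat X'"
  obtain \<rho> r where r: "\<rho> > 0" "r > 0" "\<And>Z w. Z \<in> siegel_H \<Longrightarrow> dist Z Z0 < \<rho> \<Longrightarrow> norm w \<le> r \<Longrightarrow> Z + msc w X \<in> siegel_H"
    using siegel_H_line_nbhd[OF Z0 X] by metis
  obtain \<rho>' r' where r': "\<rho>' > 0" "r' > 0" "\<And>Z w. Z \<in> siegel_H \<Longrightarrow> dist Z Z0 < \<rho>' \<Longrightarrow> norm w \<le> r' \<Longrightarrow> Z + msc w X' \<in> siegel_H"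
    using siegel_H_line_nbhd[OF Z0 X'] by metis
  \<comment> \<open>Along \<open>X'\<close> the centre must stay within \<open>\<rho>\<close> of
    \<open>Z0\<close>, where circles of radius r in direction \<open>X\<close> still lie in the
    half-space. Adding 1 to the norm only avoids a zero denominator.\<close>
  define s where "s = min r' (\<rho> / (norm X' + 1))"
  have np: "norm X' + 1 > 0" using norm_ge_zero[of X'] by linarith
  have s: "s > 0" using r r' np by (simp add: s_def)
  have in1: "Z0 + msc w X' \<in> siegel_H \<and> dist (Z0 + msc w X') Z0 < \<rho>" if "w \<in> ball 0 s" for w
  proof -
    have w: "norm w < r'" "norm w < \<rho> / (norm X' + 1)" using that by (auto simp: s_def)
    have "norm w * norm X' \<le> norm w * (norm X' + 1)" by (simp add: mult_left_mono)
    also have "\<dots> < \<rho>" using w np by (simp add: field_simps)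
    finally have "dist (Z0 + msc w X') Z0 < \<rho>" by (simp add: dist_norm norm_msc)
    moreover have "Z0 + msc w X' \<in> siegel_H" using r' Z0 w by simp
    ultimately show ?thesis by blast
  qed
  let ?c = "\<lambda>t::real. r * exp (2 * of_real pi * \<i> * of_real t)"
  have nc: "norm (?c t) = r" for t using r by (simp add: norm_mult)
  have in2: "Z0 + msc w X' + msc (?c t) X \<in> siegel_H" if "w \<in> ball 0 s" for w t
    using r(3)[of "Z0 + msc w X'" "?c t"] in1[OF that] nc by simp
  have "(\<lambda>w. integral (cbox 0 1) (\<lambda>t::real. f (Z0 + msc w X' + msc (?c t) X) / ?c t)) holomorphic_on ball 0 s"
  proof (rule leibniz_rule_holomorphic[where fx = "\<lambda>w t. delta X' f (Z0 + msc w X' + msc (?c t) X) / ?c t"])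
    fix w :: complex and t :: real assume w: "w \<in> ball 0 s"
    have "((\<lambda>w. f ((Z0 + msc (?c t) X) + msc w X')) has_field_derivative delta X' f ((Z0 + msc (?c t) X) + msc w X')) (at w)"
      using f in2[OF w, of t] by (intro siegel_holomorphic_DERIV X') (auto simp: cholo_def add_ac)
    then have "((\<lambda>w. f (Z0 + msc w X' + msc (?c t) X)) has_field_derivative delta X' f (Z0 + msc w X' + msc (?c t) X)) (at w)"
      by (simp add: add_ac)
    then have "((\<lambda>w. f (Z0 + msc w X' + msc (?c t) X) / ?c t) has_field_derivative
           delta X' f (Z0 + msc w X' + msc (?c t) X) / ?c t) (at w)" by (rule DERIV_cdivide)
    then show "((\<lambda>w. f (Z0 + msc w X' + msc (?c t) X) / ?c t) has_field_derivative
           delta X' f (Z0 + msc w X' + msc (?c t) X) / ?c t) (at w within ball 0 s)"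
      by (rule has_field_derivative_at_within)
  next
    fix w :: complex assume w: "w \<in> ball 0 s"
    show "(\<lambda>t::real. f (Z0 + msc w X' + msc (?c t) X) / ?c t) integrable_on cbox 0 1"
      using in2[OF w] r by (intro integrable_continuous continuous_intros continuous_on_compose_H[OF cf]) auto
  next
    have "continuous_on (ball 0 s \<times> cbox 0 1)
       (\<lambda>x. delta X' f (Z0 + msc (fst x) X' + msc (?c (snd x)) X) / ?c (snd x))"
      using in2 r by (intro continuous_intros continuous_on_compose_H[OF continuous_on_delta[OF f X']]) auto
    then show "continuous_on (ball 0 s \<times> cbox 0 1) (\<lambda>(w, t). delta X' f (Z0 + msc w X' + msc (?c t) X) / ?c t)"
      by (simp add: case_prod_beta)
  qed (rule convex_ball)
  then have "(\<lambda>w. delta X f (Z0 + msc w X')) holomorphic_on ball 0 s"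
  proof (rule holomorphic_transform)
    fix w :: complex assume w: "w \<in> ball 0 s"
    show "integral (cbox 0 1) (\<lambda>t::real. f (Z0 + msc w X' + msc (?c t) X) / ?c t) = delta X f (Z0 + msc w X')"
      using r in1[OF w] by (intro delta_circle_integral[symmetric] f X) auto
  qed
  then show "(\<lambda>w. delta X f (Z0 + msc w X')) field_differentiable at 0"
    using s by (auto simp: holomorphic_on_def at_within_open[of _ "ball 0 s"])
qed

lemma delta_norm_le:
  assumes f: "siegel_holomorphic f" and X: "sym_mat X" and r: "r > 0" and U: "\<And>w. norm w \<le> r \<Longrightarrow> Z + msc w X \<in> siegel_H"
    and B: "\<And>w. norm w \<le> r \<Longrightarrow> norm (f (Z + msc w X)) \<le> B"
  shows "norm (delta X f Z) \<le> B / r"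
proof -
  have hol: "(\<lambda>w. f (Z + msc w X)) holomorphic_on cball 0 r"
    using f X U by (intro siegel_holomorphic_line) auto
  have "norm ((deriv ^^ 1) (\<lambda>w. f (Z + msc w X)) 0) \<le> fact 1 * B / r^1"
    using r B by (intro Cauchy_inequality holomorphic_on_imp_continuous_on[OF hol]
        holomorphic_on_subset[OF hol]) auto
  then show ?thesis by (simp add: delta_def)
qed

lemma delta_cong:
  assumes "\<And>Z. Z \<in> siegel_H \<Longrightarrow> f Z = g Z" "Z \<in> siegel_H" "sym_mat X"
  shows "delta X f Z = delta X g Z"
  unfolding delta_def
proof (rule deriv_cong_ev)
  have "\<forall>\<^sub>F w in nhds 0. w \<in> {w. Z + msc w X \<in> siegel_H}"
    by (rule eventually_nhds_in_open[OF open_line[OF assms(3)]]) (use assms in simp)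
  then show "\<forall>\<^sub>F w in nhds 0. f (Z + msc w X) = g (Z + msc w X)"
    by eventually_elim (use assms in auto)
qed simp

lemma siegel_holomorphic_cong:
  assumes "siegel_holomorphic f" "\<And>Z. Z \<in> siegel_H \<Longrightarrow> f Z = g Z"
  shows "siegel_holomorphic g"
  unfolding siegel_holomorphic_def
proof (intro ballI allI impI)
  fix Z X :: "'a cmat" assume Z: "Z \<in> siegel_H" and X: "sym_mat X"
  have 1: "((\<lambda>w. f (Z + msc w X)) has_field_derivative delta X f Z) (at 0)"
    by (rule siegel_holomorphic_DERIV0[OF assms(1) X Z])
  have "((\<lambda>w. g (Z + msc w X)) has_field_derivative delta X f Z) (at 0)"
    by (rule has_field_derivative_transform_within_open[OF 1 open_line[OF X, of Z]])
      (use Z assms in auto)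
  then show "(\<lambda>w. g (Z + msc w X)) field_differentiable at 0" by (auto simp: field_differentiable_def)
qed

lemma cholo_cong: "cholo f \<Longrightarrow> (\<And>Z. Z \<in> siegel_H \<Longrightarrow> f Z = g Z) \<Longrightarrow> cholo g"
  unfolding cholo_def by (auto intro: siegel_holomorphic_cong continuous_on_eq)

lemma cholo_const [intro]: "cholo (\<lambda>_. c)" by (simp add: cholo_def siegel_holomorphic_def)

lemma cholo_add [intro]: "cholo f \<Longrightarrow> cholo g \<Longrightarrow> cholo (\<lambda>Z. f Z + g Z)"
  unfolding cholo_def siegel_holomorphic_def
  by (auto intro!: continuous_intros Derivative.field_differentiable_add)

lemma cholo_mult [intro]: "cholo f \<Longrightarrow> cholo g \<Longrightarrow> cholo (\<lambda>Z. f Z * g Z)"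
  unfolding cholo_def siegel_holomorphic_def
  by (auto intro!: continuous_intros Derivative.field_differentiable_mult)

lemma cholo_sum: "(\<And>i. i \<in> I \<Longrightarrow> cholo (f i)) \<Longrightarrow> cholo (\<lambda>Z. \<Sum>i\<in>I. f i Z)"
  by (induction I rule: infinite_finite_induct) auto

lemma cholo_prod: "(\<And>i. i \<in> I \<Longrightarrow> cholo (f i)) \<Longrightarrow> cholo (\<lambda>Z. \<Prod>i\<in>I. f i Z)"
  by (induction I rule: infinite_finite_induct) auto

lemma cholo_compose:
  assumes "cholo f" "g holomorphic_on U" "open U" "\<And>Z. Z \<in> siegel_H \<Longrightarrow> f Z \<in> U"
  shows "cholo (\<lambda>Z. g (f Z))"
  unfolding cholo_def siegel_holomorphic_def
proof (intro conjI ballI allI impI)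
  show "continuous_on siegel_H (\<lambda>Z. g (f Z))"
    using assms by (intro continuous_on_compose2[OF holomorphic_on_imp_continuous_on[OF assms(2)]]) (auto simp: cholo_def)
  fix Z X :: "'a cmat" assume Z: "Z \<in> siegel_H" and X: "sym_mat X"
  have "(g \<circ> (\<lambda>w. f (Z + msc w X))) field_differentiable at 0"
    using assms Z X by (intro field_differentiable_compose)
      (auto simp: cholo_def siegel_holomorphic_def holomorphic_on_open field_differentiable_def)
  then show "(\<lambda>w. g (f (Z + msc w X))) field_differentiable at 0" by (simp add: o_def)
qed

lemma delta_add:
  assumes "cholo f" "cholo g" "sym_mat X" "Z \<in> siegel_H"
  shows "delta X (\<lambda>Z. f Z + g Z) Z = delta X f Z + delta X g Z"
  by (rule deltaI) (use assms in \<open>auto simp: cholo_def intro!: derivative_eq_intros siegel_holomorphic_DERIV0\<close>)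

lemma delta_mult:
  assumes "cholo f" "cholo g" "sym_mat X" "Z \<in> siegel_H"
  shows "delta X (\<lambda>Z. f Z * g Z) Z = delta X f Z * g Z + f Z * delta X g Z"
  by (rule deltaI) (use assms in \<open>auto simp: cholo_def intro!: derivative_eq_intros siegel_holomorphic_DERIV0\<close>)

lemma delta_const: "delta X (\<lambda>Z. c) Z = 0" by (simp add: delta_def)

lemma delta_sum:
  assumes "\<And>i. i \<in> I \<Longrightarrow> cholo (f i)" "sym_mat X" "Z \<in> siegel_H"
  shows "delta X (\<lambda>Z. \<Sum>i\<in>I. f i Z) Z = (\<Sum>i\<in>I. delta X (f i) Z)"
  using assms(1)
  by (induction I rule: infinite_finite_induct) (auto simp: delta_const delta_add cholo_sum assms)

section \<open>Locally dominated series and termwise differentiation\<close>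

definition loc_summable :: "'i set \<Rightarrow> ('i \<Rightarrow> ('n::finite) cmat \<Rightarrow> complex) \<Rightarrow> bool" where
  "loc_summable L u \<longleftrightarrow> (\<forall>T\<in>L. cholo (u T)) \<and>
     (\<forall>Z\<in>siegel_H. \<exists>r>0. \<exists>B. B summable_on L \<and> (\<forall>T\<in>L. \<forall>Z'\<in>siegel_H. dist Z' Z < r \<longrightarrow> norm (u T Z') \<le> B T))"

lemma loc_summableE:
  assumes "loc_summable L u" "Z \<in> siegel_H"
  obtains r B where "r > 0" "B summable_on L" "\<And>T Z'. T \<in> L \<Longrightarrow> Z' \<in> siegel_H \<Longrightarrow> dist Z' Z < r \<Longrightarrow> norm (u T Z') \<le> B T"
  using assms unfolding loc_summable_def by metis

lemma loc_summable_summable: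
  assumes "loc_summable L u" "Z \<in> siegel_H"
  shows "(\<lambda>T. norm (u T Z)) summable_on L"
proof -
  obtain r B where "r > 0" "B summable_on L" "\<And>T Z'. T \<in> L \<Longrightarrow> Z' \<in> siegel_H \<Longrightarrow> dist Z' Z < r \<Longrightarrow> norm (u T Z') \<le> B T"
    using loc_summableE[OF assms] by metis
  then show ?thesis using assms(2) by (intro Infinite_Sum.abs_summable_on_comparison_test'[of B L]) auto
qed

text \<open>Cauchy's inequality on discs of one radius, the same for all indices, turns a dominating
  family for the terms into one for their derivatives. Pointwise summability would not survive
  differentiation; local domination does.\<close>

lemma loc_summable_delta:
  fixes u :: "'i \<Rightarrow> ('n::finite) cmat \<Rightarrow> complex"
  assumes u: "loc_summable L u" and X: "sym_mat X"
  shows "loc_summable L (\<lambda>T. delta X (u T))"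
  unfolding loc_summable_def
proof (intro conjI ballI)
  show "cholo (delta X (u T))" if "T \<in> L" for T using u that X by (auto simp: loc_summable_def intro: cholo_delta)
  fix Z :: "'n cmat" assume Z: "Z \<in> siegel_H"
  obtain s B where s: "s > 0" "B summable_on L" "\<And>T Z'. T \<in> L \<Longrightarrow> Z' \<in> siegel_H \<Longrightarrow> dist Z' Z < s \<Longrightarrow> norm (u T Z') \<le> B T"
    using loc_summableE[OF u Z] by metis
  obtain \<rho> r where r: "\<rho> > 0" "r > 0" "\<And>Z' w. Z' \<in> siegel_H \<Longrightarrow> dist Z' Z < \<rho> \<Longrightarrow> norm w \<le> r \<Longrightarrow> Z' + msc w X \<in> siegel_H"
    using siegel_H_line_nbhd[OF Z X] by metis
  have np: "norm X + 1 > 0" using norm_ge_zero[of X] by linarith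
  \<comment> \<open>Half of \<open>s\<close> is reserved for the base point and half for the disc
    around it.\<close>
  define r' where "r' = min r (s / (2 * (norm X + 1)))"
  have r': "r' > 0" "r' \<le> r" "r' \<le> s / (2 * (norm X + 1))" using r s np by (auto simp: r'_def)
  have near: "dist (Z' + msc w X) Z < s" if "dist Z' Z < s/2" "norm w \<le> r'" for Z' w
  proof -
    have "norm w * norm X \<le> r' * (norm X + 1)" using that r' by (intro mult_mono) auto
    also have "\<dots> \<le> s / (2 * (norm X + 1)) * (norm X + 1)" using r' np by (intro mult_right_mono) auto
    also have "\<dots> = s/2" using np by (simp add: field_simps)
    finally have "norm (msc w X) \<le> s/2" by (simp add: norm_msc)
    moreover have "dist (Z' + msc w X) Z \<le> dist Z' Z + norm (msc w X)"
      using norm_triangle_ineq[of "Z' - Z" "msc w X"] by (simp add: dist_norm algebra_simps)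
    ultimately show ?thesis using that by linarith
  qed
  have "norm (delta X (u T) Z') \<le> B T / r'" if "T \<in> L" "Z' \<in> siegel_H" "dist Z' Z < min \<rho> (s/2)" for T Z'
    using that u r r' near s(3) by (intro delta_norm_le X) (auto simp: loc_summable_def cholo_def)
  moreover have "(\<lambda>T. B T / r') summable_on L" using s(2) by (simp add: divide_inverse summable_on_cmult_left)
  moreover have "min \<rho> (s/2) > 0" using r s by simp
  ultimately show "\<exists>r>0. \<exists>B. B summable_on L \<and> (\<forall>T\<in>L. \<forall>Z'\<in>siegel_H. dist Z' Z < r \<longrightarrow> norm (delta X (u T) Z') \<le> B T)"
    by blast
qed

text \<open>On each complex line this is the M-test followed by the theorem that locally uniform
  limits commute with differentiation. The index set has no order, so the limit runs over the filter
  of finite subsets.\<close>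

lemma loc_summable_cholo_delta:
  fixes u :: "'i \<Rightarrow> ('n::finite) cmat \<Rightarrow> complex"
  assumes u: "loc_summable L u"
  shows "cholo (\<lambda>Z. \<Sum>\<^sub>\<infinity>T\<in>L. u T Z)"
    and "Z \<in> siegel_H \<Longrightarrow> sym_mat X \<Longrightarrow> delta X (\<lambda>Z. \<Sum>\<^sub>\<infinity>T\<in>L. u T Z) Z = (\<Sum>\<^sub>\<infinity>T\<in>L. delta X (u T) Z)"
proof -
  let ?f = "\<lambda>Z. \<Sum>\<^sub>\<infinity>T\<in>L. u T Z"
  have ul: "uniform_limit (siegel_H \<inter> ball Z r) (\<lambda>A Z. \<Sum>T\<in>A. u T Z) ?f (finite_subsets_at_top L)"
    if "B summable_on L" "\<And>T Z'. T \<in> L \<Longrightarrow> Z' \<in> siegel_H \<Longrightarrow> dist Z' Z < r \<Longrightarrow> norm (u T Z') \<le> B T" for Z r B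
    using that by (intro Weierstrass_m_test_general[where M = B]) (auto simp: dist_commute)
  have fin: "\<forall>\<^sub>F A in finite_subsets_at_top L. finite A \<and> A \<subseteq> L"
    by (simp add: eventually_finite_subsets_at_top_weakI)
  have cont: "continuous_on siegel_H ?f"
  proof (rule continuous_on_locally)
    fix Z :: "'n cmat" assume Z: "Z \<in> siegel_H"
    obtain r B where r: "r > 0" "B summable_on L" "\<And>T Z'. T \<in> L \<Longrightarrow> Z' \<in> siegel_H \<Longrightarrow> dist Z' Z < r \<Longrightarrow> norm (u T Z') \<le> B T"
      using loc_summableE[OF u Z] by metis
    have "continuous_on (siegel_H \<inter> ball Z r) ?f"
    proof (rule uniform_limit_theorem[OF _ ul[OF r(2,3)]])
      show "\<forall>\<^sub>F A in finite_subsets_at_top L. continuous_on (siegel_H \<inter> ball Z r) (\<lambda>Z. \<Sum>T\<in>A. u T Z)"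
        using fin by eventually_elim
          (use u in \<open>auto intro!: continuous_on_sum simp: loc_summable_def cholo_def intro: continuous_on_subset\<close>)
    qed auto
    then show "\<exists>r>0. continuous_on (siegel_H \<inter> ball Z r) ?f" using r by blast
  qed
  have der: "((\<lambda>w. ?f (Z + msc w X)) has_field_derivative (\<Sum>\<^sub>\<infinity>T\<in>L. delta X (u T) Z)) (at 0)"
    if Z: "Z \<in> siegel_H" and X: "sym_mat X" for Z X
  proof -
    obtain s B where s: "s > 0" "B summable_on L" "\<And>T Z'. T \<in> L \<Longrightarrow> Z' \<in> siegel_H \<Longrightarrow> dist Z' Z < s \<Longrightarrow> norm (u T Z') \<le> B T"
      using loc_summableE[OF u Z] by metis
    obtain \<rho> r where r: "\<rho> > 0" "r > 0" "\<And>Z' w. Z' \<in> siegel_H \<Longrightarrow> dist Z' Z < \<rho> \<Longrightarrow> norm w \<le> r \<Longrightarrow> Z' + msc w X \<in> siegel_H"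
      using siegel_H_line_nbhd[OF Z X] by metis
    have np: "norm X + 1 > 0" using norm_ge_zero[of X] by linarith
    define r' where "r' = min r (s / (2 * (norm X + 1)))"
    have r': "r' > 0" "r' \<le> r" "r' \<le> s / (2 * (norm X + 1))" using r s np by (auto simp: r'_def)
    have near: "Z + msc w X \<in> siegel_H \<and> dist (Z + msc w X) Z < s" if "norm w \<le> r'" for w
    proof -
      have "norm w * norm X \<le> r' * norm X" using that r' by (intro mult_right_mono) auto
      also have "\<dots> \<le> s / (2 * (norm X + 1)) * (norm X + 1)" using r' np s by (intro mult_mono) auto
      also have "\<dots> = s/2" using np by (simp add: field_simps)
      also have "\<dots> < s" using s by simp
      finally show ?thesis using r(3)[of Z w] Z that r' r by (simp add: norm_msc dist_norm)
    qed
    have ul': "uniform_limit (cball 0 r') (\<lambda>A w. \<Sum>T\<in>A. u T (Z + msc w X)) (\<lambda>w. ?f (Z + msc w X)) (finite_subsets_at_top L)"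
      using s near by (intro Weierstrass_m_test_general[where M = B]) auto
    have du: "((\<lambda>w. u T (Z + msc w X)) has_field_derivative delta X (u T) (Z + msc w X)) (at w)"
      if "T \<in> L" "norm w \<le> r'" for T w
      using u that near X by (intro siegel_holomorphic_DERIV) (auto simp: loc_summable_def cholo_def)
    have ev: "\<forall>\<^sub>F A in finite_subsets_at_top L. continuous_on (cball 0 r') (\<lambda>w. \<Sum>T\<in>A. u T (Z + msc w X)) \<and>
        (\<forall>w\<in>ball 0 r'. ((\<lambda>w. \<Sum>T\<in>A. u T (Z + msc w X)) has_field_derivative (\<Sum>T\<in>A. delta X (u T) (Z + msc w X))) (at w))"
      using fin
    proof eventually_elim
      case (elim A)
      show ?case
      proof (intro conjI ballI)
        show "continuous_on (cball 0 r') (\<lambda>w. \<Sum>T\<in>A. u T (Z + msc w X))"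
        proof (rule continuous_on_sum)
          fix T assume "T \<in> A"
          then have cu: "continuous_on siegel_H (u T)" using elim u by (auto simp: loc_summable_def cholo_def)
          show "continuous_on (cball 0 r') (\<lambda>w. u T (Z + msc w X))"
            using near by (intro continuous_on_compose_H[OF cu] continuous_intros) auto
        qed
        show "((\<lambda>w. \<Sum>T\<in>A. u T (Z + msc w X)) has_field_derivative (\<Sum>T\<in>A. delta X (u T) (Z + msc w X))) (at w)"
          if "w \<in> ball 0 r'" for w
          using elim that by (intro DERIV_sum du) auto
      qed
    qed
    obtain g' where g': "\<And>w. w \<in> ball 0 r' \<Longrightarrow> ((\<lambda>w. ?f (Z + msc w X)) has_field_derivative (g' w)) (at w) \<and>
        ((\<lambda>A. \<Sum>T\<in>A. delta X (u T) (Z + msc w X)) \<longlongrightarrow> g' w) (finite_subsets_at_top L)"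
      using has_complex_derivative_uniform_limit[OF ev ul' finite_subsets_at_top_neq_bot r'(1)] by blast
    have "((\<lambda>T. delta X (u T) Z) has_sum g' 0) L" using g'[of 0] r' by (simp add: has_sum_def)
    then show ?thesis using g'[of 0] r' by (simp add: infsumI)
  qed
  show "cholo ?f" unfolding cholo_def siegel_holomorphic_def using cont der by (auto simp: field_differentiable_def)
  show "delta X ?f Z = (\<Sum>\<^sub>\<infinity>T\<in>L. delta X (u T) Z)" if "Z \<in> siegel_H" "sym_mat X"
    by (rule deltaI) (rule der[OF that])
qed

subsection \<open>Fourier series on the torus\<close>

definition er :: "real \<Rightarrow> complex" where "er x = e (of_real x)"

lemma er_add: "er (x + y) = er x * er y" by (simp add: er_def e_add)
lemma er_0 [simp]: "er 0 = 1" by (simp add: er_def)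
lemma er_nonzero [simp]: "er x \<noteq> 0" by (simp add: er_def)
lemma norm_er [simp]: "norm (er x) = 1" by (simp add: er_def norm_e)
lemma er_Ints: "x \<in> \<int> \<Longrightarrow> er x = 1"
  unfolding er_def by (rule e_Ints) (auto elim!: Ints_cases)
lemma continuous_on_e [continuous_intros]: "continuous_on S f \<Longrightarrow> continuous_on S (\<lambda>x. e (f x))"
  unfolding e_def by (intro continuous_intros)
lemma continuous_on_er [continuous_intros]: "continuous_on S f \<Longrightarrow> continuous_on S (\<lambda>x. er (f x))"
  unfolding er_def by (intro continuous_intros)
lemma ball_split_elem: "b \<in> S \<Longrightarrow> (\<forall>i\<in>S. P i) \<longleftrightarrow> P b \<and> (\<forall>i\<in>S - {b}. P i)" by auto

definition zlat :: "'a::euclidean_space set" where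
  "zlat = {m. \<forall>b\<in>Basis. m \<bullet> b \<in> \<int>}"

definition periodic :: "('a::euclidean_space \<Rightarrow> complex) \<Rightarrow> bool" where
  "periodic f \<longleftrightarrow> continuous_on UNIV f \<and> (\<forall>x. \<forall>b\<in>Basis. f (x + b) = f x)"

definition fcoef :: "('a::euclidean_space \<Rightarrow> complex) \<Rightarrow> 'a \<Rightarrow> complex" where
  "fcoef f m = integral (cbox 0 One) (\<lambda>x. f x * er (- (m \<bullet> x)))"

lemma Basis_in_zlat: "b \<in> Basis \<Longrightarrow> b \<in> zlat"
  by (auto simp: zlat_def inner_Basis)
lemma zlat_diff: "m \<in> zlat \<Longrightarrow> k \<in> zlat \<Longrightarrow> m - k \<in> zlat"
  by (auto simp: zlat_def inner_diff_left)
lemma zlat_add: "m \<in> zlat \<Longrightarrow> k \<in> zlat \<Longrightarrow> m + k \<in> zlat"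
  by (auto simp: zlat_def inner_add_left)

lemma periodic_continuous: "periodic f \<Longrightarrow> continuous_on S f"
  unfolding periodic_def by (auto intro: continuous_on_subset)

lemma periodic_mult: "periodic f \<Longrightarrow> periodic g \<Longrightarrow> periodic (\<lambda>x. f x * g x)"
  unfolding periodic_def by (auto intro: continuous_intros)
lemma periodic_add: "periodic f \<Longrightarrow> periodic g \<Longrightarrow> periodic (\<lambda>x. f x + g x)"
  unfolding periodic_def by (auto intro: continuous_intros)
lemma periodic_const: "periodic (\<lambda>x. c)"
  unfolding periodic_def by auto
lemma periodic_er: "m \<in> zlat \<Longrightarrow> periodic (\<lambda>x. er (m \<bullet> x))"
  unfolding periodic_def
  by (auto intro!: continuous_intros simp: inner_add_right er_add zlat_def er_Ints)
lemma periodic_er': "m \<in> zlat \<Longrightarrow> periodic (\<lambda>x. er (- (m \<bullet> x)))"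
  using periodic_er[of "-m"] by (simp add: zlat_def)

lemma periodic_shift: "periodic f \<Longrightarrow> periodic (\<lambda>x. f (x + v))"
  unfolding periodic_def
proof (elim conjE, intro conjI allI ballI)
  fix x b :: 'a
  assume f: "\<forall>x. \<forall>b\<in>Basis. f (x + b) = f x" and b: "b \<in> Basis"
  have "f ((x + v) + b) = f (x + v)" using f b by blast
  then show "f (x + b + v) = f (x + v)" by (simp add: add_ac)
next
  assume "continuous_on UNIV f"
  then show "continuous_on UNIV (\<lambda>x. f (x + v))"
    by (rule continuous_on_compose2) (auto intro!: continuous_intros)
qed

lemma integral_cbox_shift:
  fixes f :: "'a::euclidean_space \<Rightarrow> complex"
  assumes f: "continuous_on UNIV f"
  shows "integral (cbox a b) (\<lambda>x. f (x + c)) = integral (cbox (a + c) (b + c)) f"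
proof -
  have "(f has_integral integral (cbox (a + c) (b + c)) f) (cbox (a + c) (b + c))"
    by (intro integrable_integral integrable_continuous continuous_on_subset[OF f]) auto
  from has_integral_affinity[OF this, of 1 c]
  have "((\<lambda>x. f (x + c)) has_integral integral (cbox (a + c) (b + c)) f) ((\<lambda>x. x - c) ` cbox (a + c) (b + c))"
    by simp
  moreover have "(\<lambda>x. x - c) ` cbox (a + c) (b + c) = cbox a b"
  proof (intro set_eqI iffI)
    fix y assume "y \<in> cbox a b"
    then have "y + c \<in> cbox (a + c) (b + c)" by (auto simp: mem_box inner_add_left)
    then show "y \<in> (\<lambda>x. x - c) ` cbox (a + c) (b + c)" by (intro image_eqI[of _ _ "y + c"]) auto
  qed (auto simp: mem_box inner_simps le_diff_eq diff_le_eq)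
  ultimately show ?thesis by (simp add: integral_unique)
qed

lemma cbox_cut_le:
  fixes b :: "'a::euclidean_space"
  assumes "b \<in> Basis" "\<And>i. i \<in> Basis \<Longrightarrow> i \<noteq> b \<Longrightarrow> v' \<bullet> i = v \<bullet> i" "v' \<bullet> b = c" "c \<le> v \<bullet> b"
  shows "cbox u v \<inter> {x. x \<bullet> b \<le> c} = cbox u v'"
  using assms(2-4) by (intro set_eqI) (auto simp: mem_box ball_split_elem[OF assms(1)])

lemma cbox_cut_ge:
  fixes b :: "'a::euclidean_space"
  assumes "b \<in> Basis" "\<And>i. i \<in> Basis \<Longrightarrow> i \<noteq> b \<Longrightarrow> u' \<bullet> i = u \<bullet> i" "u' \<bullet> b = c" "u \<bullet> b \<le> c"
  shows "cbox u v \<inter> {x. x \<bullet> b \<ge> c} = cbox u' v"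
  using assms(2-4) by (intro set_eqI) (auto simp: mem_box ball_split_elem[OF assms(1)])

text \<open>The shifted unit box is cut at height 1 in direction b; periodicity moves the upper
  slice down by b, where it fills the gap that the shift has left.\<close>

lemma torus_shift_unit:
  fixes f :: "'a::euclidean_space \<Rightarrow> complex"
  assumes f: "periodic f" and b: "b \<in> Basis" and t: "0 \<le> t" "t \<le> 1"
  shows "integral (cbox 0 One) (\<lambda>x. f (x + t *\<^sub>R b)) = integral (cbox 0 One) f"
proof -
  have c: "continuous_on UNIV f" using f by (simp add: periodic_def)
  have i: "f integrable_on cbox u v" for u v by (intro integrable_continuous continuous_on_subset[OF c]) auto
  have "integral (cbox 0 One) (\<lambda>x. f (x + t *\<^sub>R b)) = integral (cbox (t *\<^sub>R b) (One + t *\<^sub>R b)) f"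
    using integral_cbox_shift[OF c, of 0 One "t *\<^sub>R b"] by simp
  also have "\<dots> = integral (cbox (t *\<^sub>R b) (One + t *\<^sub>R b) \<inter> {x. x \<bullet> b \<le> 1}) f
                + integral (cbox (t *\<^sub>R b) (One + t *\<^sub>R b) \<inter> {x. x \<bullet> b \<ge> 1}) f"
    by (rule integral_split[OF i b])
  also have "cbox (t *\<^sub>R b) (One + t *\<^sub>R b) \<inter> {x. x \<bullet> b \<le> 1} = cbox (t *\<^sub>R b) One"
    using b t by (intro cbox_cut_le) (simp_all add: inner_add_left inner_Basis)
  also have "cbox (t *\<^sub>R b) (One + t *\<^sub>R b) \<inter> {x. x \<bullet> b \<ge> 1} = cbox (0 + b) ((One + (t - 1) *\<^sub>R b) + b)"
  proof -
    have "One + t *\<^sub>R b = (One + (t - 1) *\<^sub>R b) + b" by (simp add: algebra_simps)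
    then show ?thesis using b t by (simp only:) (intro cbox_cut_ge; simp add: inner_add_left inner_Basis)
  qed
  also have "integral (cbox (0 + b) ((One + (t - 1) *\<^sub>R b) + b)) f = integral (cbox 0 (One + (t - 1) *\<^sub>R b)) f"
    unfolding integral_cbox_shift[OF c, symmetric] using f b by (simp add: periodic_def)
  also have "cbox 0 (One + (t - 1) *\<^sub>R b) = cbox 0 One \<inter> {x. x \<bullet> b \<le> t}"
    using b t by (intro cbox_cut_le[symmetric]) (simp_all add: inner_add_left inner_Basis)
  also have "cbox (t *\<^sub>R b) One = cbox 0 One \<inter> {x. x \<bullet> b \<ge> t}"
    using b t by (intro cbox_cut_ge[symmetric]) (simp_all add: inner_add_left inner_Basis)
  also have "integral (cbox 0 One \<inter> {x. x \<bullet> b \<ge> t}) f + integral (cbox 0 One \<inter> {x. x \<bullet> b \<le> t}) f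
           = integral (cbox 0 One) f"
    using integral_split[OF i b, of 0 One t] by (simp add: add.commute)
  finally show ?thesis .
qed

lemma periodic_int:
  assumes f: "periodic f" and b: "b \<in> Basis"
  shows "f (x + of_int n *\<^sub>R b) = f x"
proof -
  have nat: "f (x + of_nat k *\<^sub>R b) = f x" for k x
  proof (induction k)
    case (Suc k)
    have "f ((x + of_nat k *\<^sub>R b) + b) = f (x + of_nat k *\<^sub>R b)" using f b unfolding periodic_def by blast
    then show ?case using Suc by (simp add: algebra_simps)
  qed simp
  show ?thesis
  proof (cases "n \<ge> 0")
    case True then show ?thesis using nat[of x "nat n"] by simp
  next
    case False
    then show ?thesis using nat[of "x + of_int n *\<^sub>R b" "nat (-n)"] by simp
  qed
qed

lemma torus_shift_Basis:
  assumes f: "periodic f" and b: "b \<in> Basis"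
  shows "integral (cbox 0 One) (\<lambda>x. f (x + t *\<^sub>R b)) = integral (cbox 0 One) f"
proof -
  have "f (x + t *\<^sub>R b) = f (x + frac t *\<^sub>R b)" for x
    using periodic_int[OF f b, of "x + frac t *\<^sub>R b" "\<lfloor>t\<rfloor>"]
    by (simp add: frac_def algebra_simps)
  then show ?thesis using torus_shift_unit[OF f b, of "frac t"] frac_lt_1[of t] by simp
qed

lemma torus_shift:
  fixes f :: "'a::euclidean_space \<Rightarrow> complex"
  assumes f: "periodic f"
  shows "integral (cbox 0 One) (\<lambda>x. f (x + v)) = integral (cbox 0 One) f"
proof -
  have "integral (cbox 0 One) (\<lambda>x. f (x + (\<Sum>b\<in>B. (v \<bullet> b) *\<^sub>R b))) = integral (cbox 0 One) f"
    if "finite B" "B \<subseteq> Basis" for B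
    using that
  proof (induction B rule: finite_induct)
    case (insert b B)
    have "integral (cbox 0 One) (\<lambda>x. f (x + (\<Sum>b\<in>insert b B. (v \<bullet> b) *\<^sub>R b)))
        = integral (cbox 0 One) (\<lambda>x. (\<lambda>x. f (x + (\<Sum>b\<in>B. (v \<bullet> b) *\<^sub>R b))) (x + (v \<bullet> b) *\<^sub>R b))"
      using insert by (simp add: add_ac)
    also have "\<dots> = integral (cbox 0 One) (\<lambda>x. f (x + (\<Sum>b\<in>B. (v \<bullet> b) *\<^sub>R b)))"
      using insert by (intro torus_shift_Basis periodic_shift f) auto
    finally show ?case using insert by simp
  qed simp
  from this[of Basis] show ?thesis by (simp add: euclidean_representation)
qed

text \<open>Translations act on a coefficient by a unimodular number. Every vanishing statement for
  coefficients below comes from a translation whose multiplier is -1.\<close>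

lemma fcoef_shift:
  assumes f: "periodic f" and m: "m \<in> zlat"
  shows "fcoef (\<lambda>x. f (x + v)) m = er (m \<bullet> v) * fcoef f m"
proof -
  have "fcoef (\<lambda>x. f (x + v)) m = integral (cbox 0 One) (\<lambda>x. er (m \<bullet> v) * (f (x + v) * er (- (m \<bullet> (x + v)))))"
    unfolding fcoef_def
  proof (rule arg_cong[where f = "integral _"], rule ext)
    fix x
    have "er (- (m \<bullet> x)) = er (m \<bullet> v) * er (- (m \<bullet> (x + v)))"
      unfolding er_add[symmetric] by (simp add: inner_add_right)
    then show "f (x + v) * er (- (m \<bullet> x)) = er (m \<bullet> v) * (f (x + v) * er (- (m \<bullet> (x + v))))" by simp
  qed
  also have "\<dots> = er (m \<bullet> v) * integral (cbox 0 One) (\<lambda>x. f (x + v) * er (- (m \<bullet> (x + v))))"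
    by (rule integral_mult_right)
  also have "integral (cbox 0 One) (\<lambda>x. f (x + v) * er (- (m \<bullet> (x + v)))) = fcoef f m"
    unfolding fcoef_def by (rule torus_shift) (intro periodic_mult f periodic_er' m)
  finally show ?thesis .
qed

text \<open>Orthogonality without computing an integral: along a shift on which the two characters
  differ by the sign -1, the coefficient equals its own negative.\<close>

lemma fcoef_er:
  fixes m k :: "'a::euclidean_space"
  assumes m: "m \<in> zlat" and k: "k \<in> zlat"
  shows "fcoef (\<lambda>x. er (m \<bullet> x)) k = (if m = k then 1 else 0)"
proof (cases "m = k")
  case True
  have "er (k \<bullet> x) * er (- (k \<bullet> x)) = 1" for x unfolding er_add[symmetric] by simp
  then show ?thesis using True by (simp add: fcoef_def)
next
  case False
  then obtain b where b: "b \<in> Basis" "m \<bullet> b \<noteq> k \<bullet> b" by (auto simp: euclidean_eq_iff[of m k])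
  \<comment> \<open>Normalised so that m - k takes the value 1/2 on v, and \<open>er\<close> is -1
    at 1/2.\<close>
  define v where "v = (1 / (2 * ((m - k) \<bullet> b))) *\<^sub>R b"
  have nz: "(m - k) \<bullet> b \<noteq> 0" using b by (simp add: inner_diff_left)
  have "(m - k) \<bullet> v = 1/2" using nz by (simp add: v_def)
  then have "m \<bullet> v = k \<bullet> v + 1/2" by (simp add: inner_diff_left)
  then have mv: "er (m \<bullet> v) = er (k \<bullet> v) * er (1/2)" by (simp only: er_add)
  have h: "er (1/2) = -1" by (simp add: er_def e_def)
  have "fcoef (\<lambda>x. er (m \<bullet> (x + v))) k = er (k \<bullet> v) * fcoef (\<lambda>x. er (m \<bullet> x)) k"
    by (rule fcoef_shift[OF periodic_er[OF m] k])
  moreover have "fcoef (\<lambda>x. er (m \<bullet> (x + v))) k = er (m \<bullet> v) * fcoef (\<lambda>x. er (m \<bullet> x)) k"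
    unfolding fcoef_def by (simp only: inner_add_right er_add mult.assoc mult.left_commute[of _ "er (m \<bullet> v)"] integral_mult_right)
  ultimately have "er (k \<bullet> v) * fcoef (\<lambda>x. er (m \<bullet> x)) k = 0"
    unfolding mv h by (simp add: eq_neg_iff_add_eq_0 flip: mult_2)
  then show ?thesis using False by simp
qed

lemma fcoef_integrable: "periodic f \<Longrightarrow> m \<in> zlat \<Longrightarrow> (\<lambda>x. f x * er (- (m \<bullet> x))) integrable_on cbox u v"
  by (intro integrable_continuous periodic_continuous periodic_mult periodic_er')

lemma fcoef_lincomb:
  assumes f: "periodic f" and g: "periodic g" and m: "m \<in> zlat"
  shows "fcoef (\<lambda>x. a * f x + b * g x) m = a * fcoef f m + b * fcoef g m"
proof -
  have h: "((\<lambda>x. f x * er (- (m \<bullet> x))) has_integral fcoef f m) (cbox 0 One)" if "periodic f" for f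
    unfolding fcoef_def by (intro integrable_integral fcoef_integrable that m)
  have "((\<lambda>x. a * (f x * er (- (m \<bullet> x))) + b * (g x * er (- (m \<bullet> x)))) has_integral a * fcoef f m + b * fcoef g m) (cbox 0 One)"
    by (intro has_integral_add has_integral_mult_right h f g)
  then show ?thesis unfolding fcoef_def[of "\<lambda>x. a * f x + b * g x"] distrib_right mult.assoc by (rule integral_unique)
qed

lemma fcoef_mult_er:
  "fcoef (\<lambda>x. f x * er (k \<bullet> x)) m = fcoef f (m - k)"
proof -
  have "er (k \<bullet> x) * er (- (m \<bullet> x)) = er (- ((m - k) \<bullet> x))" for x
    unfolding er_add[symmetric] by (simp add: inner_diff_left)
  then show ?thesis by (simp add: fcoef_def mult.assoc)
qed

section \<open>Uniqueness of Fourier coefficients\<close>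

definition fnull :: "('a::euclidean_space \<Rightarrow> complex) \<Rightarrow> bool" where
  "fnull f \<longleftrightarrow> periodic f \<and> (\<forall>m\<in>zlat. fcoef f m = 0)"

text \<open>The square of sin(pi s), written as a trigonometric polynomial of period 1;
  multiplication by it merely combines shifted coefficients.\<close>

definition csin2 :: "real \<Rightarrow> complex" where "csin2 s = (2 - er s - er (-s)) / 4"

lemma csin2: "csin2 s = of_real ((sin (pi * s))^2)"
proof -
  have 1: "er s + er (- s) = 2 * of_real (cos (2 * pi * s))"
    by (simp add: er_def e_def exp_eq_polar complex_eq_iff cis.ctr mult_ac)
  have "cos (2 * (pi * s)) = 1 - 2 * (sin (pi * s))^2" by (rule cos_double_sin)
  then have "csin2 s = (2 - 2 * of_real (1 - 2 * (sin (pi * s))^2)) / 4"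
    unfolding csin2_def diff_diff_eq 1 by (simp add: mult.assoc)
  then show ?thesis by simp
qed

lemma fnull_csin2:
  assumes f: "fnull f" and b: "b \<in> Basis"
  shows "fnull (\<lambda>x. f x * csin2 (b \<bullet> x))"
proof -
  have bz: "b \<in> zlat" "-b \<in> zlat" using Basis_in_zlat[OF b] by (auto simp: zlat_def)
  have pf: "periodic f" using f by (simp add: fnull_def)
  have g: "(\<lambda>x. f x * csin2 (b \<bullet> x)) = (\<lambda>x. (1/2) * f x + (-1/4) * (f x * er (b \<bullet> x)) + (-1/4) * (f x * er (- b \<bullet> x)))"
    by (simp add: csin2_def fun_eq_iff field_simps)
  have "fcoef (\<lambda>x. f x * csin2 (b \<bullet> x)) m = 0" if m: "m \<in> zlat" for m
  proof -
    have p: "periodic (\<lambda>x. f x * er (b \<bullet> x))" "periodic (\<lambda>x. f x * er (-b \<bullet> x))"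
      by (intro periodic_mult pf periodic_er bz)+
    have "fcoef (\<lambda>x. f x * csin2 (b \<bullet> x)) m = (1/2) * fcoef f m + (-1/4) * fcoef (\<lambda>x. f x * er (b \<bullet> x)) m
           + (-1/4) * fcoef (\<lambda>x. f x * er (- b \<bullet> x)) m"
      using fcoef_lincomb[OF periodic_add[OF periodic_mult[OF periodic_const pf] periodic_mult[OF periodic_const p(1)]] p(2) m,
          of 1 "1/2" "-1/4" "-1/4"] fcoef_lincomb[OF pf p(1) m, of "1/2" "-1/4"]
      unfolding g by (simp only: mult_1)
    then show ?thesis unfolding fcoef_mult_er using f m bz by (simp add: fnull_def zlat_diff zlat_add)
  qed
  moreover have "periodic (\<lambda>x. f x * csin2 (b \<bullet> x))"
    unfolding g by (intro periodic_add periodic_mult periodic_const pf periodic_er bz)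
  ultimately show ?thesis by (simp add: fnull_def)
qed

text \<open>On the unit cube the product of squared sines equals 1 at the centre only and is smaller
  elsewhere, so its powers form a peaking kernel; all coefficients remain zero under multiplication
  by it.\<close>

lemma fnull_kernel:
  assumes f: "fnull f"
  shows "fnull (\<lambda>x. f x * of_real ((\<Prod>b\<in>Basis. (sin (pi * (b \<bullet> x)))^2) ^ N))"
proof (induction N)
  case 0 then show ?case using f by simp
next
  case (Suc N)
  have "fnull (\<lambda>x. f x * of_real ((\<Prod>b\<in>B. (sin (pi * (b \<bullet> x)))^2)))"
    if "finite B" "B \<subseteq> Basis" "fnull f" for B and f :: "'a \<Rightarrow> complex"
    using that
  proof (induction B rule: finite_induct)
    case (insert b B)
    have "fnull (\<lambda>x. f x * of_real ((\<Prod>b\<in>B. (sin (pi * (b \<bullet> x)))^2)) * csin2 (b \<bullet> x))"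
      using insert by (intro fnull_csin2) auto
    then show ?case using insert by (simp add: csin2 mult_ac)
  qed simp
  from this[of Basis, OF _ _ Suc] show ?case by (simp add: mult_ac)
qed

lemma Re_mult_of_real: "Re (z * of_real r) = Re z * r" by simp

text \<open>If h were positive at the peak, the integrand would be at least a \<open>\<mu>\<close>^N
  on a box of positive volume, nonnegative on the rest of \<open>U\<close>, and at least -H
  \<open>\<kappa>\<close>^N off \<open>U\<close>. Since \<open>\<kappa>\<close> <
  \<open>\<mu>\<close>, the integral would be positive for large N.\<close>

lemma real_null_contra:
  fixes h K :: "'a::euclidean_space \<Rightarrow> real"
  assumes h: "continuous_on UNIV h" and K: "continuous_on UNIV K"
    and c: "c \<in> box 0 One" and K1: "K c = 1" and K0: "\<And>x. 0 \<le> K x"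
    and Kl: "\<And>x. x \<in> cbox 0 One \<Longrightarrow> x \<noteq> c \<Longrightarrow> K x < 1"
    and int: "\<And>N. integral (cbox 0 One) (\<lambda>x. h x * K x ^ N) = 0"
  shows "h c \<le> 0"
proof (rule ccontr)
  assume "\<not> h c \<le> 0"
  then have hc: "h c > 0" by simp
  define a where "a = h c / 2"
  have a: "a > 0" "h c > a" using hc by (auto simp: a_def)
  define U where "U = {x. h x > a}"
  have oU: "open U" unfolding U_def using h by (intro open_Collect_less continuous_intros) auto
  have cU: "c \<in> U" using a by (simp add: U_def)
  have "compact (cbox 0 One - U)" using oU by (intro compact_diff) auto
  have "\<exists>\<kappa>. 0 < \<kappa> \<and> \<kappa> < 1 \<and> (\<forall>x\<in>cbox 0 One - U. K x \<le> \<kappa>)"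
  proof (cases "cbox 0 One - U = {}")
    case True then show ?thesis by (intro exI[of _ "1/2"]) auto
  next
    case False
    then obtain z where z: "z \<in> cbox 0 One - U" "\<And>x. x \<in> cbox 0 One - U \<Longrightarrow> K x \<le> K z"
      using continuous_attains_sup[OF \<open>compact (cbox 0 One - U)\<close> False, of K] continuous_on_subset[OF K] by auto
    have "K z < 1" using z(1) cU by (intro Kl) auto
    then show ?thesis using z(2) by (intro exI[of _ "max (1/2) (K z)"]) (auto simp: le_max_iff_disj)
  qed
  then obtain \<kappa> where \<kappa>: "0 < \<kappa>" "\<kappa> < 1" "\<And>x. x \<in> cbox 0 One - U \<Longrightarrow> K x \<le> \<kappa>" by blast
  \<comment> \<open>Strictly between \<open>\<kappa>\<close> and 1, so that K exceeds it near the
    peak while staying below it off \<open>U\<close>.\<close>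
  define \<mu> where "\<mu> = (1 + \<kappa>) / 2"
  have \<mu>: "\<kappa> < \<mu>" "\<mu> < 1" using \<kappa> by (auto simp: \<mu>_def)
  define V where "V = U \<inter> {x. K x > \<mu>} \<inter> box 0 One"
  have "open V" unfolding V_def using oU K by (intro open_Int open_Collect_less continuous_intros open_box) auto
  moreover have "c \<in> V" using cU c K1 \<mu> by (simp add: V_def)
  ultimately obtain p q where pq: "cbox p q \<subseteq> V" "c \<in> box p q" "\<forall>i\<in>Basis. p \<bullet> i < q \<bullet> i"
    using open_contains_cbox by blast
  have sub: "cbox p q \<subseteq> cbox 0 One" using pq(1) box_subset_cbox by (auto simp: V_def intro: subsetD[OF box_subset_cbox])
  define v where "v = measure lborel (cbox p q)"
  have v: "v > 0" unfolding v_def using pq(3) by (intro content_pos_lt) auto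
  obtain H where H: "\<And>x. x \<in> cbox 0 One \<Longrightarrow> \<bar>h x\<bar> \<le> H" "H > 0"
  proof -
    have "bounded (h ` cbox 0 One)"
      by (intro compact_imp_bounded compact_continuous_image continuous_on_subset[OF h]) auto
    then show ?thesis using that by (auto simp: bounded_pos)
  qed
  have key: "a * \<mu>^N * v \<le> H * \<kappa>^N" for N
  proof -
    have i1: "((\<lambda>x. if x \<in> cbox p q then a * \<mu>^N else 0) has_integral (v * (a * \<mu>^N))) (cbox 0 One)"
      using has_integral_restrict_closed_subinterval[OF has_integral_const sub, of "a * \<mu>^N"] by (simp add: v_def)
    have i2: "((\<lambda>x::'a. H * \<kappa>^N) has_integral (H * \<kappa>^N)) (cbox 0 One)"
      using has_integral_const[of "H * \<kappa>^N" 0 "One::'a"] by simp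
    have i3: "((\<lambda>x. h x * K x ^ N) has_integral 0) (cbox 0 One)"
    proof -
      have "continuous_on (cbox 0 One) (\<lambda>x. h x * K x ^ N)"
        by (intro continuous_intros continuous_on_subset[OF h] continuous_on_subset[OF K]) auto
      from integrable_integral[OF integrable_continuous[OF this]] show ?thesis unfolding int .
    qed
    have "v * (a * \<mu>^N) - H * \<kappa>^N \<le> 0"
    proof (rule has_integral_le[OF has_integral_diff[OF i1 i2] i3])
      fix x :: 'a assume x: "x \<in> cbox 0 One"
      show "(if x \<in> cbox p q then a * \<mu>^N else 0) - H * \<kappa>^N \<le> h x * K x ^ N"
      proof (cases "x \<in> U")
        case True
        then have hx: "h x > a" by (simp add: U_def)
        have 1: "(if x \<in> cbox p q then a * \<mu>^N else 0) \<le> h x * K x ^ N"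
        proof (cases "x \<in> cbox p q")
          case True
          then have "K x > \<mu>" using pq(1) by (auto simp: V_def)
          then have "\<mu>^N \<le> K x ^ N" using \<mu> \<kappa> by (intro power_mono) auto
          then show ?thesis using True hx a \<mu> \<kappa> by (auto intro!: mult_mono)
        next
          case False
          then show ?thesis using hx a K0[of x] by simp
        qed
        have "0 \<le> H * \<kappa>^N" using H(2) \<kappa> by simp
        then show ?thesis using 1 by linarith
      next
        case False
        then have "x \<notin> cbox p q" using pq(1) by (auto simp: V_def)
        moreover have "\<bar>h x * K x ^ N\<bar> \<le> H * \<kappa>^N"
          unfolding abs_mult using H(1)[OF x] H(2) \<kappa>(3)[of x] False x K0[of x]
          by (intro mult_mono) (auto intro: power_mono)
        ultimately show ?thesis by (auto simp: abs_le_iff)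
      qed
    qed
    then show ?thesis by (simp add: mult_ac)
  qed
  have "(\<lambda>N. (\<kappa>/\<mu>)^N) \<longlonglongrightarrow> 0" using \<kappa> \<mu> by (intro LIMSEQ_power_zero) auto
  then have "\<forall>\<^sub>F N in sequentially. (\<kappa>/\<mu>)^N < a * v / H"
    using a v H by (intro order_tendstoD) auto
  then obtain N where N: "(\<kappa>/\<mu>)^N < a * v / H" by (auto simp: eventually_sequentially)
  have "\<mu>^N > 0" using \<mu> \<kappa> by simp
  then have "H * \<kappa>^N < a * \<mu>^N * v" using N H(2) by (simp add: power_divide field_simps)
  with key[of N] show False by simp
qed

lemma fnull_eq_0:
  fixes f :: "'a::euclidean_space \<Rightarrow> complex"
  assumes f: "fnull f"
  shows "f x = 0"
proof -
  define c :: 'a where "c = (1/2) *\<^sub>R One"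
  \<comment> \<open>Moves the point x to the centre c of the cube, where the kernel peaks.\<close>
  define g where "g = (\<lambda>y. f (y + (x - c)))"
  have pf: "periodic f" using f by (simp add: fnull_def)
  have "fcoef g m = 0" if "m \<in> zlat" for m unfolding g_def using fcoef_shift[OF pf that] f that by (simp add: fnull_def)
  then have g: "fnull g" using periodic_shift[OF pf] by (simp add: fnull_def g_def)
  define K where "K = (\<lambda>x::'a. \<Prod>b\<in>Basis. (sin (pi * (b \<bullet> x)))^2)"
  have cg: "continuous_on UNIV g" using g by (simp add: fnull_def periodic_def)
  \<comment> \<open>Real valued, with the squared modulus of g(c) as its value at c; an upper bound
    0 there forces g(c) = 0.\<close>
  define h where "h = (\<lambda>y. Re (cnj (g c) * g y))"
  have "h c \<le> 0"
  proof (rule real_null_contra[of h K c])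
    show "continuous_on UNIV h" unfolding h_def by (intro continuous_intros cg)
    show "continuous_on UNIV K" unfolding K_def by (intro continuous_intros)
    show "c \<in> box 0 One" by (auto simp: mem_box c_def)
    show "K c = 1" unfolding K_def c_def by (intro prod.neutral) (auto simp: inner_commute[of _ One])
    show "0 \<le> K x" for x unfolding K_def by (intro prod_nonneg) auto
    show "K y < 1" if y: "y \<in> cbox 0 One" "y \<noteq> c" for y
    proof -
      obtain b where b: "b \<in> Basis" "y \<bullet> b \<noteq> c \<bullet> b" using y(2) by (auto simp: euclidean_eq_iff[of y c])
      have b': "0 \<le> y \<bullet> b" "y \<bullet> b \<le> 1" using y(1) b by (auto simp: mem_box)
      have bc: "y \<bullet> b \<noteq> 1/2" using b by (simp add: c_def)
      have "sin (pi * (b \<bullet> y)) ^ 2 < 1"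
      proof -
        have "sin (pi * (b \<bullet> y)) \<noteq> 1"
        proof
          assume "sin (pi * (b \<bullet> y)) = 1"
          then have c0: "cos (pi * (b \<bullet> y)) = cos (pi/2)" using sin_cos_squared_add[of "pi * (b \<bullet> y)"] by simp
          have r: "0 \<le> pi * (b \<bullet> y)" "pi * (b \<bullet> y) \<le> pi" using b' by (simp_all add: inner_commute)
          have "pi * (b \<bullet> y) = pi/2" by (rule cos_inj_pi[OF r _ _ c0]) simp_all
          then show False using bc by (simp add: inner_commute)
        qed
        then have "sin (pi * (b \<bullet> y)) < 1" using sin_le_one[of "pi * (b \<bullet> y)"] by linarith
        moreover have "sin (pi * (b \<bullet> y)) \<ge> 0" using b' by (intro sin_ge_zero) (auto simp: inner_commute)
        ultimately show ?thesis by (simp add: power_less_one_iff abs_square_less_1)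
      qed
      moreover have "K y = sin (pi * (b \<bullet> y)) ^ 2 * (\<Prod>b\<in>Basis - {b}. (sin (pi * (b \<bullet> y)))^2)"
        unfolding K_def using b by (intro prod.remove) auto
      moreover have "(\<Prod>b\<in>Basis - {b}. (sin (pi * (b \<bullet> y)))^2) \<le> 1"
        by (intro prod_le_1) (auto simp: abs_square_le_1)
      moreover have "sin (pi * (b \<bullet> y)) ^ 2 * (\<Prod>b\<in>Basis - {b}. (sin (pi * (b \<bullet> y)))^2) \<le> sin (pi * (b \<bullet> y)) ^ 2 * 1"
        by (intro mult_left_mono) (use calculation in auto)
      ultimately show ?thesis by linarith
    qed
    fix N
    have "fnull (\<lambda>x. g x * of_real (K x ^ N))" unfolding K_def by (rule fnull_kernel[OF g])
    then have "fcoef (\<lambda>x. g x * of_real (K x ^ N)) 0 = 0" by (simp add: fnull_def zlat_def)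
    then have i0: "integral (cbox 0 One) (\<lambda>x. g x * of_real (K x ^ N)) = 0" by (simp add: fcoef_def)
    have "continuous_on UNIV (\<lambda>x. g x * of_real (K x ^ N))" unfolding K_def by (intro continuous_intros cg)
    then have "((\<lambda>x. g x * of_real (K x ^ N)) has_integral 0) (cbox 0 One)"
      unfolding i0[symmetric] by (intro integrable_integral integrable_continuous) (rule continuous_on_subset, auto)
    then have I: "((\<lambda>x. cnj (g c) * (g x * of_real (K x ^ N))) has_integral cnj (g c) * 0) (cbox 0 One)"
      by (rule has_integral_mult_right)
    have "((\<lambda>x. Re (cnj (g c) * (g x * of_real (K x ^ N)))) has_integral Re (cnj (g c) * 0)) (cbox 0 One)"
      using has_integral_linear[OF I bounded_linear_Re] unfolding o_def .
    moreover have "Re (cnj (g c) * (g x * of_real (K x ^ N))) = h x * K x ^ N" for x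
      unfolding h_def mult.assoc[symmetric] by (rule Re_mult_of_real)
    ultimately have "((\<lambda>x. h x * K x ^ N) has_integral Re (cnj (g c) * 0)) (cbox 0 One)" by simp
    then show "integral (cbox 0 One) (\<lambda>x. h x * K x ^ N) = 0" by (simp add: integral_unique)
  qed
  then have "(norm (g c))^2 \<le> 0" unfolding cmod_power2 by (simp add: h_def power2_eq_square)
  then have "g c = 0" by simp
  then show ?thesis by (simp add: g_def)
qed

text \<open>Absolute summability makes the Fourier series converge uniformly. Its limit has the same
  coefficients as f, by exchanging limit and integral, so the difference of the two has only zero
  coefficients and is zero.\<close>

theorem fourier_has_sum:
  fixes f :: "'a::euclidean_space \<Rightarrow> complex"
  assumes f: "periodic f" and s: "(\<lambda>m. norm (fcoef f m)) summable_on zlat"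
  shows "((\<lambda>m. fcoef f m * er (m \<bullet> x)) has_sum f x) zlat"
proof -
  let ?p = "\<lambda>A x. \<Sum>m\<in>A. fcoef f m * er (m \<bullet> x)"
  define g where "g = (\<lambda>x. \<Sum>\<^sub>\<infinity>m\<in>zlat. fcoef f m * er (m \<bullet> x))"
  have ul: "uniform_limit UNIV ?p g (finite_subsets_at_top zlat)"
    unfolding g_def by (intro Weierstrass_m_test_general[OF _ s]) (simp add: norm_mult)
  have hs: "((\<lambda>m. fcoef f m * er (m \<bullet> x)) has_sum g x) zlat" for x
    unfolding has_sum_def using tendsto_uniform_limitI[OF ul, of x] by simp
  have "continuous_on UNIV g"
    by (rule uniform_limit_theorem[OF _ ul]) (auto intro!: always_eventually continuous_intros)
  moreover have "g (x + b) = g x" if "b \<in> Basis" for x b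
    unfolding g_def by (intro infsum_cong) (use that in \<open>auto simp: inner_add_right er_add zlat_def er_Ints\<close>)
  ultimately have pg: "periodic g" by (simp add: periodic_def)
  have cg: "fcoef g k = fcoef f k" if k: "k \<in> zlat" for k
  proof (rule tendsto_unique[OF finite_subsets_at_top_neq_bot])
    show "((\<lambda>A. fcoef (?p A) k) \<longlongrightarrow> fcoef g k) (finite_subsets_at_top zlat)"
    proof -
      have "uniform_limit (cbox 0 One) (\<lambda>A x. ?p A x * er (- (k \<bullet> x))) (\<lambda>x. g x * er (- (k \<bullet> x))) (finite_subsets_at_top zlat)"
      proof (rule uniform_limitI)
        fix \<epsilon> :: real assume "\<epsilon> > 0"
        from uniform_limitD[OF ul this] show "\<forall>\<^sub>F A in finite_subsets_at_top zlat. \<forall>x\<in>cbox 0 One.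
            dist (?p A x * er (- (k \<bullet> x))) (g x * er (- (k \<bullet> x))) < \<epsilon>"
        proof eventually_elim
          case (elim A)
          show ?case
          proof
            fix x
            have "dist (?p A x * er (- (k \<bullet> x))) (g x * er (- (k \<bullet> x))) = norm ((?p A x - g x) * er (- (k \<bullet> x)))"
              by (simp only: dist_norm left_diff_distrib)
            also have "\<dots> = dist (?p A x) (g x)" by (simp only: norm_mult norm_er dist_norm mult_1_right)
            finally show "dist (?p A x * er (- (k \<bullet> x))) (g x * er (- (k \<bullet> x))) < \<epsilon>" using elim by auto
          qed
        qed
      qed
      then obtain I J where IJ: "\<And>A. ((\<lambda>x. ?p A x * er (- (k \<bullet> x))) has_integral I A) (cbox 0 One)"
         "((\<lambda>x. g x * er (- (k \<bullet> x))) has_integral J) (cbox 0 One)" "(I \<longlongrightarrow> J) (finite_subsets_at_top zlat)"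
        by (rule uniform_limit_integral_cbox) (auto intro!: continuous_intros)
      have "fcoef g k = J" "\<And>A. fcoef (?p A) k = I A"
        unfolding fcoef_def[of g] fcoef_def[of "?p _"] using IJ by (auto intro: integral_unique)
      then show ?thesis using IJ(3) by simp
    qed
    have "\<forall>\<^sub>F A in finite_subsets_at_top zlat. fcoef (?p A) k = fcoef f k"
    proof -
      have ev: "\<forall>\<^sub>F A in finite_subsets_at_top zlat. finite A \<and> A \<subseteq> zlat \<and> k \<in> A"
        unfolding eventually_finite_subsets_at_top by (rule exI[of _ "{k}"]) (use k in auto)
      then show ?thesis
      proof eventually_elim
        case (elim A)
        have "fcoef (?p A) k = (\<Sum>m\<in>A. fcoef f m * fcoef (\<lambda>x. er (m \<bullet> x)) k)"
          unfolding fcoef_def[of _ k] sum_distrib_right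
          using elim k by (subst integral_sum)
             (auto simp: mult.assoc intro!: integrable_on_mult_right fcoef_integrable[of "\<lambda>x. er (_ \<bullet> x)"] periodic_er)
        also have "\<dots> = (\<Sum>m\<in>A. if m = k then fcoef f m else 0)"
          using elim k by (intro sum.cong) (auto simp: fcoef_er)
        also have "\<dots> = fcoef f k" using elim by simp
        finally show ?case .
      qed
    qed
    then show "((\<lambda>A. fcoef (?p A) k) \<longlongrightarrow> fcoef f k) (finite_subsets_at_top zlat)"
      by (rule tendsto_eventually)
  qed
  have "fnull (\<lambda>x. g x + (-1) * f x)"
    unfolding fnull_def
  proof (intro conjI ballI)
    show "periodic (\<lambda>x. g x + (-1) * f x)" by (intro periodic_add periodic_mult periodic_const pg f)
    fix k :: 'a assume k: "k \<in> zlat"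
    have "fcoef (\<lambda>x. g x + (-1) * f x) k = fcoef g k + (-1) * fcoef f k"
      using fcoef_lincomb[OF pg f k, of 1 "-1"] by (simp only: mult_1)
    then show "fcoef (\<lambda>x. g x + (-1) * f x) k = 0" using cg[OF k] by simp
  qed
  from fnull_eq_0[OF this, of x] have "g x = f x" by simp
  with hs[of x] show ?thesis by simp
qed

section \<open>Exponential sums over lattice points\<close>

lemma int_geometric_le:
  fixes r :: real
  assumes "0 \<le> r" "r < 1"
  shows "(\<Sum>s\<in>{-int N..int N}. r ^ nat \<bar>s\<bar>) \<le> 2 / (1 - r)"
proof -
  have g: "(\<Sum>s\<le>N. r ^ s) \<le> 1 / (1 - r)"
    using assms sum_le_suminf[of "\<lambda>s. r ^ s" "{..N}"] by (simp add: suminf_geometric summable_geometric)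
  have "{-int N..int N} \<subseteq> int ` {..N} \<union> (\<lambda>s. - int s) ` {..N}"
  proof
    fix s assume s: "s \<in> {-int N..int N}"
    show "s \<in> int ` {..N} \<union> (\<lambda>s. - int s) ` {..N}"
    proof (cases "s \<ge> 0")
      case True then have "s = int (nat s)" "nat s \<le> N" using s by auto
      then show ?thesis by blast
    next
      case False then have "s = - int (nat (-s))" "nat (-s) \<le> N" using s by auto
      then show ?thesis by blast
    qed
  qed
  then have "(\<Sum>s\<in>{-int N..int N}. r ^ nat \<bar>s\<bar>) \<le> (\<Sum>s\<in>int ` {..N} \<union> (\<lambda>s. - int s) ` {..N}. r ^ nat \<bar>s\<bar>)"
    using assms by (intro sum_mono2) auto
  also have "\<dots> \<le> (\<Sum>s\<in>int ` {..N}. r ^ nat \<bar>s\<bar>) + (\<Sum>s\<in>(\<lambda>s. - int s) ` {..N}. r ^ nat \<bar>s\<bar>)"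
    using assms by (subst sum_Un) (auto intro!: sum_nonneg)
  also have "\<dots> = (\<Sum>s\<le>N. r ^ s) + (\<Sum>s\<le>N. r ^ s)"
    by (simp add: sum.reindex inj_on_def)
  finally show ?thesis using g by simp
qed

text \<open>\<open>K\<close> may be smaller than the full basis when its coordinates already
  determine the points of \<open>A\<close>, as happens for symmetric matrices. The sum is then at
  most a product of two-sided geometric series over \<open>K\<close>, which keeps the exponent of
  the final bound small.\<close>

lemma lattice_exp_sum_le:
  fixes A :: "'a::euclidean_space set" and a :: "'a \<Rightarrow> real"
  assumes A: "finite A" "A \<subseteq> zlat" and K: "K \<subseteq> Basis" and a: "\<And>b. b \<in> K \<Longrightarrow> a b > 0"
    and inj: "\<And>m m'. m \<in> A \<Longrightarrow> m' \<in> A \<Longrightarrow> (\<And>b. b \<in> K \<Longrightarrow> m \<bullet> b = m' \<bullet> b) \<Longrightarrow> m = m'"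
  shows "(\<Sum>m\<in>A. exp (- (\<Sum>b\<in>K. a b * \<bar>m \<bullet> b\<bar>))) \<le> (\<Prod>b\<in>K. 2 / (1 - exp (- a b)))"
proof -
  have fK: "finite K" using K finite_Basis finite_subset by blast
  obtain N :: nat where N: "\<And>m b. m \<in> A \<Longrightarrow> b \<in> K \<Longrightarrow> \<bar>m \<bullet> b\<bar> \<le> N"
  proof -
    have "finite ((\<lambda>(m,b). \<bar>m \<bullet> b\<bar>) ` (A \<times> K))" using A fK by simp
    then obtain B where B: "\<forall>y\<in>(\<lambda>(m,b). \<bar>m \<bullet> b\<bar>) ` (A \<times> K). y \<le> B"
      using bdd_above_finite bdd_above_def by metis
    obtain N where "B \<le> of_nat N" using real_arch_simple by blast
    with B show ?thesis by (intro that[of N]) force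
  qed
  \<comment> \<open>The integer coordinates in \<open>K\<close>, which embed \<open>A\<close> into a
    finite box of integer-valued functions on \<open>K\<close>.\<close>
  define \<phi> where "\<phi> = (\<lambda>m. restrict (\<lambda>b. \<lfloor>m \<bullet> b\<rfloor>) K)"
  have fl: "of_int \<lfloor>m \<bullet> b\<rfloor> = m \<bullet> b" if "m \<in> A" "b \<in> K" for m b
  proof -
    have "m \<bullet> b \<in> \<int>" using that A K by (auto simp: zlat_def)
    then show ?thesis by (auto elim: Ints_cases)
  qed
  have inj': "inj_on \<phi> A"
  proof (rule inj_onI)
    fix m m' assume m: "m \<in> A" "m' \<in> A" "\<phi> m = \<phi> m'"
    show "m = m'"
    proof (rule inj[OF m(1,2)])
      fix b assume b: "b \<in> K"
      have "\<phi> m b = \<phi> m' b" using m by simp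
      then have "of_int \<lfloor>m \<bullet> b\<rfloor> = (of_int \<lfloor>m' \<bullet> b\<rfloor> :: real)" using b by (simp add: \<phi>_def)
      then show "m \<bullet> b = m' \<bullet> b" using fl m b by simp
    qed
  qed
  have im: "\<phi> ` A \<subseteq> PiE K (\<lambda>_. {-int N..int N})"
  proof
    fix x assume "x \<in> \<phi> ` A"
    then obtain m where m: "m \<in> A" "x = \<phi> m" by blast
    have "\<lfloor>m \<bullet> b\<rfloor> \<in> {-int N..int N}" if "b \<in> K" for b
      using N[OF m(1) that] fl[OF m(1) that] by (auto simp: abs_le_iff)
    then show "x \<in> PiE K (\<lambda>_. {-int N..int N})" using m by (auto simp: \<phi>_def)
  qed
  have "(\<Sum>m\<in>A. exp (- (\<Sum>b\<in>K. a b * \<bar>m \<bullet> b\<bar>))) = (\<Sum>m\<in>A. \<Prod>b\<in>K. exp (- a b) ^ nat \<bar>\<phi> m b\<bar>)"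
  proof (rule sum.cong[OF refl])
    fix m assume m: "m \<in> A"
    have "exp (- (\<Sum>b\<in>K. a b * \<bar>m \<bullet> b\<bar>)) = (\<Prod>b\<in>K. exp (- (a b * \<bar>m \<bullet> b\<bar>)))"
      by (simp add: sum_negf[symmetric] exp_sum fK)
    also have "\<dots> = (\<Prod>b\<in>K. exp (- a b) ^ nat \<bar>\<phi> m b\<bar>)"
    proof (rule prod.cong[OF refl])
      fix b assume b: "b \<in> K"
      have "real (nat \<bar>\<phi> m b\<bar>) = \<bar>of_int \<lfloor>m \<bullet> b\<rfloor>\<bar>" using b by (simp add: \<phi>_def)
      then have "real (nat \<bar>\<phi> m b\<bar>) = \<bar>m \<bullet> b\<bar>" by (simp only: fl[OF m b])
      then show "exp (- (a b * \<bar>m \<bullet> b\<bar>)) = exp (- a b) ^ nat \<bar>\<phi> m b\<bar>"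
        by (simp add: exp_of_nat_mult[symmetric] mult.commute)
    qed
    finally show "exp (- (\<Sum>b\<in>K. a b * \<bar>m \<bullet> b\<bar>)) = (\<Prod>b\<in>K. exp (- a b) ^ nat \<bar>\<phi> m b\<bar>)" .
  qed
  also have "\<dots> = (\<Sum>g\<in>\<phi> ` A. \<Prod>b\<in>K. exp (- a b) ^ nat \<bar>g b\<bar>)"
    by (simp add: sum.reindex[OF inj'])
  also have "\<dots> \<le> (\<Sum>g\<in>PiE K (\<lambda>_. {-int N..int N}). \<Prod>b\<in>K. exp (- a b) ^ nat \<bar>g b\<bar>)"
    by (intro sum_mono2 im finite_PiE fK) (auto intro!: prod_nonneg)
  also have "\<dots> = (\<Prod>b\<in>K. \<Sum>s\<in>{-int N..int N}. exp (- a b) ^ nat \<bar>s\<bar>)"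
    by (simp add: prod_sum_PiE fK)
  also have "\<dots> \<le> (\<Prod>b\<in>K. 2 / (1 - exp (- a b)))"
    using a by (intro prod_mono conjI int_geometric_le sum_nonneg) auto
  finally show ?thesis .
qed

lemma lattice_exp_summable:
  assumes "a > 0"
  shows "(\<lambda>m::'a::euclidean_space. exp (- a * (\<Sum>b\<in>Basis. \<bar>m \<bullet> b\<bar>))) summable_on zlat"
proof (rule nonneg_bdd_above_summable_on)
  have "(\<Sum>m\<in>A. exp (- a * (\<Sum>b\<in>Basis. \<bar>m \<bullet> b\<bar>))) \<le> (\<Prod>b\<in>(Basis::'a set). 2 / (1 - exp (- a)))"
    if "finite A" "A \<subseteq> zlat" for A :: "'a set"
  proof -
    have "(\<Sum>m\<in>A. exp (- (\<Sum>b\<in>Basis. a * \<bar>m \<bullet> b\<bar>))) \<le> (\<Prod>b\<in>(Basis::'a set). 2 / (1 - exp (- a)))"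
      by (rule lattice_exp_sum_le[OF that subset_refl]) (use assms in \<open>auto intro: euclidean_eqI\<close>)
    then show ?thesis by (simp flip: sum_distrib_left)
  qed
  then show "bdd_above (sum (\<lambda>m::'a. exp (- a * (\<Sum>b\<in>Basis. \<bar>m \<bullet> b\<bar>))) ` {F. F \<subseteq> zlat \<and> finite F})"
    by (intro bdd_aboveI[of _ "\<Prod>b\<in>(Basis::'a set). 2 / (1 - exp (- a))"]) auto
qed auto

subsection \<open>The symplectic action\<close>

lemma mat_add_rdistrib: "(A + B) ** C = A ** C + B ** C" for A B :: "'a::semiring_1^'n^'m"
  by (simp add: matrix_matrix_mult_def vec_eq_iff sum.distrib algebra_simps)
lemma mat_mult_minus_left: "(- A) ** B = - (A ** B)" for A :: "'a::ring_1^'n^'m"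
  by (simp add: matrix_matrix_mult_def vec_eq_iff sum_negf)
lemma mat_mult_minus_right: "A ** (- B) = - (A ** B)" for A :: "'a::ring_1^'n^'m"
  by (simp add: matrix_matrix_mult_def vec_eq_iff sum_negf)
lemma mat_mult_0_left: "0 ** B = 0" for B :: "'a::semiring_1^'n^'m"
  by (simp add: matrix_matrix_mult_def vec_eq_iff)
lemma mat_mult_0_right: "B ** 0 = 0" for B :: "'a::semiring_1^'n^'m"
  by (simp add: matrix_matrix_mult_def vec_eq_iff)
lemma mat_diff_rdistrib: "(A - B) ** C = A ** C - B ** C" for A B :: "'a::ring_1^'n^'m"
  by (simp add: matrix_matrix_mult_def vec_eq_iff sum_subtractf algebra_simps)
lemma mat_diff_ldistrib: "A ** (B - C) = A ** B - A ** C" for A :: "'a::ring_1^'n^'m"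
  by (simp add: matrix_matrix_mult_def vec_eq_iff sum_subtractf algebra_simps)
lemma transpose_nth [simp]: "transpose A $ i $ j = A $ j $ i" by (simp add: transpose_def)
lemma transpose_add: "transpose (A + B) = transpose A + transpose B" by (simp add: vec_eq_iff)
lemma transpose_diff: "transpose (A - B) = transpose A - transpose B" by (simp add: vec_eq_iff)
lemma transpose_minus: "transpose (- A) = - transpose A" by (simp add: vec_eq_iff)

lemma cmat_mult: "cmat (A ** B) = cmat A ** cmat B" by (simp add: vec_eq_iff matrix_matrix_mult_def)
lemma cmat_add: "cmat (A + B) = cmat A + cmat B" by (simp add: vec_eq_iff)
lemma cmat_minus: "cmat (- A) = - cmat A" by (simp add: vec_eq_iff)
lemma cmat_0 [simp]: "cmat 0 = 0" by (simp add: vec_eq_iff)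
lemma cmat_1 [simp]: "cmat (mat 1) = mat 1" by (simp add: vec_eq_iff mat_def)
lemma cmat_transpose: "cmat (transpose A) = transpose (cmat A)" by (simp add: vec_eq_iff)
lemma det_cmat: "det (cmat A) = of_int (det A)" by (simp add: det_def)
lemma rcmat_mult: "rcmat (A ** B) = rcmat A ** rcmat B" by (simp add: vec_eq_iff matrix_matrix_mult_def)
lemma rcmat_1 [simp]: "rcmat (mat 1) = mat 1" by (simp add: vec_eq_iff mat_def)
lemma rcmat_transpose: "rcmat (transpose A) = transpose (rcmat A)" by (simp add: vec_eq_iff)
lemma matrix_inv_right:
  fixes A :: "'a::field^'n^'n"
  assumes "det A \<noteq> 0"
  shows "A ** matrix_inv A = mat 1" "matrix_inv A ** A = mat 1"
proof -
  have "\<exists>A'. A ** A' = mat 1 \<and> A' ** A = mat 1"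
    using assms invertible_det_nz[of A] by (simp add: invertible_def)
  from someI_ex[OF this] show "A ** matrix_inv A = mat 1" "matrix_inv A ** A = mat 1"
    unfolding matrix_inv_def by auto
qed

lemma det_nz_if_right_inverse:
  fixes A :: "'a::field^'n^'n"
  assumes "A ** B = mat 1"
  shows "det A \<noteq> 0"
proof -
  have "det A * det B = 1" unfolding det_mul[symmetric] assms by simp
  then show ?thesis by auto
qed

lemma matrix_inv_unique:
  fixes A :: "'a::field^'n^'n"
  assumes "A ** B = mat 1"
  shows "matrix_inv A = B"
proof -
  have "matrix_inv A = matrix_inv A ** (A ** B)" by (simp add: assms)
  also have "\<dots> = B" by (simp add: matrix_mul_assoc matrix_inv_right(2)[OF det_nz_if_right_inverse[OF assms]])
  finally show ?thesis .
qed

lemma matrix_inv_mult: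
  fixes A B :: "'a::field^'n^'n"
  assumes "det A \<noteq> 0" "det B \<noteq> 0"
  shows "matrix_inv (A ** B) = matrix_inv B ** matrix_inv A"
proof (rule matrix_inv_unique)
  have "A ** B ** (matrix_inv B ** matrix_inv A) = A ** (B ** matrix_inv B) ** matrix_inv A" by (simp only: matrix_mul_assoc)
  then show "A ** B ** (matrix_inv B ** matrix_inv A) = mat 1"
    using assms by (simp add: matrix_inv_right)
qed

lemma transpose_matrix_inv:
  fixes A :: "'a::field^'n^'n"
  assumes "det A \<noteq> 0"
  shows "transpose (matrix_inv A) = matrix_inv (transpose A)"
  by (rule matrix_inv_unique[symmetric])
    (simp add: matrix_inv_right[OF assms] flip: matrix_transpose_mul)

text \<open>Cramer's rule. It serves twice: the entries of an inverse are holomorphic, and for an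
  integral matrix the determinant clears their denominators.\<close>

lemma matrix_inv_nth:
  fixes A :: "'a::field^'n^'n"
  assumes "det A \<noteq> 0"
  shows "matrix_inv A $ k $ l = det (\<chi> i j. if j = k then (if i = l then 1 else 0) else A$i$j) / det A"
proof -
  have "A *v (matrix_inv A *v axis l 1) = axis l 1"
    by (simp add: matrix_vector_mul_assoc matrix_inv_right[OF assms])
  then have "matrix_inv A *v axis l 1 = (\<chi> k. det (\<chi> i j. if j = k then axis l 1 $ i else A$i$j) / det A)"
    using cramer[OF assms] by blast
  then have "(matrix_inv A *v axis l 1) $ k = det (\<chi> i j. if j = k then axis l 1 $ i else A$i$j) / det A" by simp
  moreover have "(matrix_inv A *v axis l 1) $ k = matrix_inv A $ k $ l"
    by (simp add: matrix_vector_mult_def axis_def if_distrib cong: if_cong)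
  moreover have "(\<chi> i j. if j = k then axis l 1 $ i else A$i$j) = (\<chi> i j. if j = k then (if i = l then 1 else 0) else A$i$j)"
    by (simp add: vec_eq_iff axis_def)
  ultimately show ?thesis by simp
qed

definition conjm :: "complex^'n^'m \<Rightarrow> complex^'n^'m" where "conjm Z = (\<chi> i j. cnj (Z$i$j))"
text \<open>Bilinear and not Hermitian, so that adjoints are plain transposes; conjugation is always
  written out by \<open>conjv\<close>.\<close>

definition vdot :: "complex^'n \<Rightarrow> complex^'n \<Rightarrow> complex" where "vdot x y = (\<Sum>i\<in>UNIV. x$i * y$i)"
definition conjv :: "complex^'n \<Rightarrow> complex^'n" where "conjv x = (\<chi> i. cnj (x$i))"

lemma conjm_nth [simp]: "conjm Z $ i $ j = cnj (Z$i$j)" by (simp add: conjm_def)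
lemma conjv_nth [simp]: "conjv x $ i = cnj (x$i)" by (simp add: conjv_def)
lemma conjm_mult: "conjm (A ** B) = conjm A ** conjm B" by (simp add: vec_eq_iff matrix_matrix_mult_def)
lemma conjm_add: "conjm (A + B) = conjm A + conjm B" by (simp add: vec_eq_iff)
lemma conjm_cmat [simp]: "conjm (cmat A) = cmat A" by (simp add: vec_eq_iff)
lemma conjm_vec: "conjm A *v conjv x = conjv (A *v x)" by (simp add: vec_eq_iff matrix_vector_mult_def)

lemma vdot_mult: "vdot x (M *v y) = vdot (transpose M *v x) y"
proof -
  have "vdot x (M *v y) = (\<Sum>i\<in>UNIV. \<Sum>j\<in>UNIV. x$i * (M$i$j * y$j))"
    by (simp add: vdot_def matrix_vector_mult_def sum_distrib_left)
  also have "\<dots> = (\<Sum>j\<in>UNIV. \<Sum>i\<in>UNIV. x$i * (M$i$j * y$j))" by (rule sum.swap)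
  also have "\<dots> = (\<Sum>j\<in>UNIV. (transpose M *v x)$j * y$j)"
    unfolding matrix_vector_mult_def
    by (intro sum.cong refl) (simp add: sum_distrib_left sum_distrib_right mult_ac)
  finally show ?thesis by (simp add: vdot_def)
qed

text \<open>The mixed terms in the real and imaginary parts of u cancel because the imaginary part
  of Z is symmetric.\<close>

lemma vdot_Im:
  fixes Z :: "complex^'n^'n"
  assumes "sym_mat Z"
  defines "Y \<equiv> Im_mat Z"
  shows "vdot u ((Z - conjm Z) *v conjv u) =
     2 * \<i> * of_real ((\<chi> i. Re (u$i)) \<bullet> (Y *v (\<chi> i. Re (u$i))) + (\<chi> i. Im (u$i)) \<bullet> (Y *v (\<chi> i. Im (u$i))))"
proof -
  have sY: "Y$i$j = Y$j$i" for i j using assms(1) by (simp add: Y_def sym_mat_iff)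
  have "vdot u ((Z - conjm Z) *v conjv u) = (\<Sum>i\<in>UNIV. \<Sum>j\<in>UNIV. u$i * (2 * \<i> * Y$i$j) * cnj (u$j))"
    by (simp add: vdot_def matrix_vector_mult_def sum_distrib_left complex_diff_cnj Y_def mult_ac)
  also have "\<dots> = (\<Sum>i\<in>UNIV. \<Sum>j\<in>UNIV. 2 * \<i> * of_real (Re (u$i) * Y$i$j * Re (u$j) + Im (u$i) * Y$i$j * Im (u$j))
       - 2 * (of_real (Im (u$i) * Y$i$j * Re (u$j)) - of_real (Re (u$i) * Y$i$j * Im (u$j))))"
    by (intro sum.cong refl) (simp add: complex_eq_iff algebra_simps)
  also have "\<dots> = (\<Sum>i\<in>UNIV. \<Sum>j\<in>UNIV. 2 * \<i> * of_real (Re (u$i) * Y$i$j * Re (u$j) + Im (u$i) * Y$i$j * Im (u$j)))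
       - 2 * ((\<Sum>i\<in>UNIV. \<Sum>j\<in>UNIV. of_real (Im (u$i) * Y$i$j * Re (u$j))) - (\<Sum>i\<in>UNIV. \<Sum>j\<in>UNIV. of_real (Re (u$i) * Y$i$j * Im (u$j))))"
    by (simp add: sum_subtractf sum_distrib_left)
  also have "(\<Sum>i\<in>UNIV. \<Sum>j\<in>UNIV. complex_of_real (Im (u$i) * Y$i$j * Re (u$j))) = (\<Sum>i\<in>UNIV. \<Sum>j\<in>UNIV. of_real (Re (u$i) * Y$i$j * Im (u$j)))"
    by (subst sum.swap) (simp add: sY mult_ac)
  also have "(\<Sum>i\<in>UNIV. \<Sum>j\<in>UNIV. 2 * \<i> * of_real (Re (u$i) * Y$i$j * Re (u$j) + Im (u$i) * Y$i$j * Im (u$j)))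
     = 2 * \<i> * of_real ((\<chi> i. Re (u$i)) \<bullet> (Y *v (\<chi> i. Re (u$i))) + (\<chi> i. Im (u$i)) \<bullet> (Y *v (\<chi> i. Im (u$i))))"
    unfolding quad_form_sum by (simp add: sum_distrib_left sum.distrib algebra_simps)
  finally show ?thesis by simp
qed

context
  fixes A B C D :: "('n::finite) imat" and Z :: "'n cmat"
  assumes g: "(A,B,C,D) \<in> Sp" and Z: "Z \<in> siegel_H"
begin

private abbreviation (input) "Pm X \<equiv> cmat A ** X + cmat B"
private abbreviation (input) "Qm X \<equiv> cmat C ** X + cmat D"

text \<open>Invariance of the symplectic form, polarised to two points. Taking \<open>Z'\<close>
  equal to \<open>Z\<close> gives the symmetry of the image point, taking its complex conjugate
  gives the imaginary part of the image point.\<close>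

lemma Sp_pairing: "transpose (Pm Z) ** Qm Z' = transpose (Qm Z) ** Pm Z' + (Z - Z')"
proof -
  let ?A = "cmat A" and ?B = "cmat B" and ?C = "cmat C" and ?D = "cmat D"
  have sZ: "transpose Z = Z" using siegel_HD(1)[OF Z] by (simp add: sym_mat_def)
  have "transpose A ** C = transpose C ** A" "transpose B ** D = transpose D ** B"
    "transpose A ** D = mat 1 + transpose C ** B"
    using g by (auto simp: Sp_def algebra_simps)
  then have h1: "transpose ?A ** ?C = transpose ?C ** ?A" and h2: "transpose ?B ** ?D = transpose ?D ** ?B"
    and h3: "transpose ?A ** ?D = mat 1 + transpose ?C ** ?B"
    by (simp_all flip: cmat_transpose cmat_mult cmat_add cmat_1)
  have h4: "transpose ?D ** ?A = mat 1 + transpose ?B ** ?C"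
    using arg_cong[OF h3, of transpose] by (simp add: matrix_transpose_mul transpose_add)
  have "transpose (Pm Z) ** Qm Z' = Z ** (transpose ?A ** ?C) ** Z' + Z ** (transpose ?A ** ?D) + transpose ?B ** ?C ** Z' + transpose ?B ** ?D"
    by (simp add: transpose_add matrix_transpose_mul sZ matrix_add_ldistrib mat_add_rdistrib matrix_mul_assoc add_ac)
  also have "\<dots> = Z ** (transpose ?C ** ?A) ** Z' + (Z + Z ** (transpose ?C ** ?B)) + transpose ?B ** ?C ** Z' + transpose ?D ** ?B"
    by (simp only: h1 h2 h3 matrix_add_ldistrib matrix_mul_rid)
  moreover have "transpose (Qm Z) ** Pm Z' = Z ** (transpose ?C ** ?A) ** Z' + Z ** (transpose ?C ** ?B) + (transpose ?D ** ?A) ** Z' + transpose ?D ** ?B"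
    by (simp add: transpose_add matrix_transpose_mul sZ matrix_add_ldistrib mat_add_rdistrib matrix_mul_assoc add_ac)
  ultimately show ?thesis unfolding h4 by (simp add: mat_add_rdistrib)
qed

lemma Sp_pairing_form:
  "vdot (Pm Z *v u) (conjv (Qm Z *v u)) - vdot (Qm Z *v u) (conjv (Pm Z *v u)) = vdot u ((Z - conjm Z) *v conjv u)"
proof -
  have c: "conjv (Qm Z *v u) = Qm (conjm Z) *v conjv u" "conjv (Pm Z *v u) = Pm (conjm Z) *v conjv u"
    by (simp_all add: conjm_vec[symmetric] conjm_add conjm_mult)
  have l: "vdot (M *v u) (N *v w) = vdot u ((transpose M ** N) *v w)" for M N :: "'n cmat" and w
    by (subst vdot_mult, subst vdot_mult) (simp only: matrix_transpose_mul transpose_transpose matrix_vector_mul_assoc)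
  show ?thesis unfolding c l Sp_pairing
    by (simp add: matrix_vector_mult_add_rdistrib vdot_def distrib_left sum.distrib)
qed

text \<open>A vector u killed by CZ + D makes the invariant form at u zero, so the real and
  imaginary parts of u are isotropic for the positive definite imaginary part of Z.\<close>

lemma j_det_nonzero: "det (Qm Z) \<noteq> 0"
proof
  assume "det (Qm Z) = 0"
  then obtain u where u: "u \<noteq> 0" "Qm Z *v u = 0"
    using matrix_left_invertible_ker[of "Qm Z"] invertible_left_inverse[of "Qm Z"] invertible_det_nz[of "Qm Z"] by auto
  have "vdot u ((Z - conjm Z) *v conjv u) = 0"
    unfolding Sp_pairing_form[symmetric] u by (simp add: vdot_def conjv_def)
  then have eq: "(\<chi> i. Re (u$i)) \<bullet> (Im_mat Z *v (\<chi> i. Re (u$i))) + (\<chi> i. Im (u$i)) \<bullet> (Im_mat Z *v (\<chi> i. Im (u$i))) = 0"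
    unfolding vdot_Im[OF siegel_HD(1)[OF Z]] by (simp flip: of_real_add)
  have pd: "x \<bullet> (Im_mat Z *v x) \<ge> 0" "x \<bullet> (Im_mat Z *v x) = 0 \<Longrightarrow> x = 0" for x
    using siegel_HD(2)[OF Z] pos_def_imp_semidef unfolding pos_def_def pos_semidef_def by (blast, force)
  have "(\<chi> i. Re (u$i)) = 0" "(\<chi> i. Im (u$i)) = 0"
    using eq pd(1) by (auto intro!: pd(2) simp: add_nonneg_eq_0_iff)
  then have "u = 0" by (simp add: vec_eq_iff complex_eq_iff)
  with u show False by simp
qed

lemma sp_act_in_H: "sp_act (A,B,C,D) Z \<in> siegel_H"
proof -
  define W where "W = sp_act (A,B,C,D) Z"
  let ?P = "Pm Z" and ?Q = "Qm Z"
  have inv: "?Q ** matrix_inv ?Q = mat 1" "matrix_inv ?Q ** ?Q = mat 1" by (rule matrix_inv_right[OF j_det_nonzero])+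
  have W: "W = ?P ** matrix_inv ?Q" by (simp add: W_def)
  have WQ: "W ** ?Q = ?P" unfolding W by (simp add: inv flip: matrix_mul_assoc)
  have it: "transpose (matrix_inv ?Q) ** transpose ?Q = mat 1" using inv by (simp flip: matrix_transpose_mul)
  have "transpose W = transpose (matrix_inv ?Q) ** transpose ?P" unfolding W by (simp add: matrix_transpose_mul)
  also have "\<dots> = transpose (matrix_inv ?Q) ** (transpose ?P ** ?Q) ** matrix_inv ?Q"
    by (simp add: inv flip: matrix_mul_assoc)
  also have "transpose ?P ** ?Q = transpose ?Q ** ?P" using Sp_pairing[of Z] by simp
  also have "transpose (matrix_inv ?Q) ** (transpose ?Q ** ?P) ** matrix_inv ?Q = (transpose (matrix_inv ?Q) ** transpose ?Q) ** (?P ** matrix_inv ?Q)"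
    by (simp only: matrix_mul_assoc)
  also have "\<dots> = W" unfolding it W by simp
  finally have sW: "sym_mat W" by (simp add: sym_mat_def)
  have "pos_def (Im_mat W)" unfolding pos_def_def
  proof (intro conjI allI impI)
    show "sym_mat (Im_mat W)" using sW by (simp add: sym_mat_iff)
    fix x :: "real^'n" assume x: "x \<noteq> 0"
    define xc :: "complex^'n" where "xc = (\<chi> i. of_real (x$i))"
    \<comment> \<open>Writing the test vector as Q u carries the form of the imaginary part of
      \<open>W\<close> to that of \<open>Z\<close> at u, where positivity is known.\<close>
    define u where "u = matrix_inv ?Q *v xc"
    have Qu: "?Q *v u = xc" by (simp add: u_def matrix_vector_mul_assoc inv)
    have Pu: "?P *v u = W *v xc" unfolding WQ[symmetric] by (simp add: Qu flip: matrix_vector_mul_assoc)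
    have cx: "conjv xc = xc" by (simp add: xc_def vec_eq_iff)
    have "vdot (W *v xc) xc - vdot xc (conjv (W *v xc)) = vdot u ((Z - conjm Z) *v conjv u)"
      using Sp_pairing_form[of u] by (simp only: Qu Pu cx)
    moreover have "vdot (W *v xc) xc - vdot xc (conjv (W *v xc)) = 2 * \<i> * of_real (x \<bullet> (Im_mat W *v x))"
    proof -
      have "vdot (W *v xc) xc - vdot xc (conjv (W *v xc)) = vdot xc ((W - conjm W) *v conjv xc)"
        unfolding conjm_vec[symmetric] cx
        by (simp add: vdot_def matrix_vector_mult_diff_rdistrib right_diff_distrib sum_subtractf mult.commute)
      also have "\<dots> = 2 * \<i> * of_real (x \<bullet> (Im_mat W *v x))"
        unfolding vdot_Im[OF sW] by (simp add: xc_def) (simp add: zero_vec_def[symmetric])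
      finally show ?thesis .
    qed
    ultimately have eq: "x \<bullet> (Im_mat W *v x) = (\<chi> i. Re (u$i)) \<bullet> (Im_mat Z *v (\<chi> i. Re (u$i))) + (\<chi> i. Im (u$i)) \<bullet> (Im_mat Z *v (\<chi> i. Im (u$i)))"
      unfolding vdot_Im[OF siegel_HD(1)[OF Z]] by (simp only: mult_cancel_left of_real_eq_iff) simp
    have "u \<noteq> 0"
    proof
      assume "u = 0"
      then have "xc = 0" using Qu by simp
      then show False using x by (simp add: xc_def vec_eq_iff)
    qed
    then have ne: "(\<chi> i. Re (u$i)) \<noteq> 0 \<or> (\<chi> i. Im (u$i)) \<noteq> 0" by (auto simp: vec_eq_iff complex_eq_iff)
    have pd: "x \<bullet> (Im_mat Z *v x) \<ge> 0" "x \<noteq> 0 \<Longrightarrow> x \<bullet> (Im_mat Z *v x) > 0" for x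
      using siegel_HD(2)[OF Z] pos_def_imp_semidef unfolding pos_def_def pos_semidef_def by (blast, force)
    show "0 < x \<bullet> (Im_mat W *v x)" unfolding eq using ne pd by (metis add_nonneg_pos add_pos_nonneg)
  qed
  then show ?thesis using sW by (simp add: siegel_H_def W_def)
qed

end

text \<open>The two blocks AZ + B and CZ + D of \<open>h\<close> are W Q and Q for the image point
  W. Multiplying this column by \<open>g\<close> and factoring Q out on the right gives the action
  law and, by determinants, the cocycle law.\<close>

lemma sp_cocycle:
  assumes g: "g \<in> Sp" and h: "h \<in> Sp" and Z: "Z \<in> siegel_H"
  shows "sp_act (sp_mult g h) Z = sp_act g (sp_act h Z)"
    and "j_det (sp_mult g h) Z = j_det g (sp_act h Z) * j_det h Z"
proof -
  obtain A B C D where gg: "g = (A,B,C,D)" by (cases g) auto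
  obtain A' B' C' D' where hh: "h = (A',B',C',D')" by (cases h) auto
  define P Q where "P = cmat A' ** Z + cmat B'" and "Q = cmat C' ** Z + cmat D'"
  define W where "W = P ** matrix_inv Q"
  have W: "sp_act h Z = W" by (simp add: hh W_def P_def Q_def)
  have dQ: "det Q \<noteq> 0" unfolding Q_def using j_det_nonzero h Z hh by blast
  have WQ: "W ** Q = P" unfolding W_def by (simp add: matrix_inv_right[OF dQ] flip: matrix_mul_assoc)
  have WH: "W \<in> siegel_H" using sp_act_in_H h Z hh W by metis
  have 1: "cmat (A ** A' + B ** C') ** Z + cmat (A ** B' + B ** D') = (cmat A ** W + cmat B) ** Q" for A B
    by (simp add: mat_add_rdistrib WQ flip: matrix_mul_assoc)
       (simp add: P_def Q_def cmat_add cmat_mult matrix_add_ldistrib mat_add_rdistrib matrix_mul_assoc add_ac)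
  have dj: "det (cmat C ** W + cmat D) \<noteq> 0" using j_det_nonzero g WH gg by blast
  show "j_det (sp_mult g h) Z = j_det g (sp_act h Z) * j_det h Z"
    unfolding W by (simp add: gg hh 1 det_mul Q_def[symmetric])
  have "sp_act (sp_mult g h) Z = ((cmat A ** W + cmat B) ** Q) ** (matrix_inv Q ** matrix_inv (cmat C ** W + cmat D))"
    by (simp add: gg hh 1 matrix_inv_mult[OF dj dQ])
  also have "\<dots> = (cmat A ** W + cmat B) ** (Q ** matrix_inv Q) ** matrix_inv (cmat C ** W + cmat D)"
    by (simp only: matrix_mul_assoc)
  also have "\<dots> = sp_act g W" by (simp add: matrix_inv_right[OF dQ] gg)
  finally show "sp_act (sp_mult g h) Z = sp_act g (sp_act h Z)" by (simp add: W)
qed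

lemma J_in_Sp: "(0, - mat 1, mat 1, 0) \<in> Sp"
  by (simp add: Sp_def mat_mult_0_left mat_mult_0_right mat_mult_minus_left mat_mult_minus_right transpose_minus)
     (simp add: vec_eq_iff)?

text \<open>The general statements at the element J, for which CZ + D is Z itself and the image
  point is the negative inverse.\<close>

lemma siegel_H_inv:
  assumes "Z \<in> siegel_H"
  shows "det Z \<noteq> 0" "- matrix_inv Z \<in> siegel_H"
  using j_det_nonzero[OF J_in_Sp assms] sp_act_in_H[OF J_in_Sp assms]
  by (simp_all add: mat_mult_0_left cmat_minus mat_mult_minus_left)

section \<open>Holomorphy of matrix expressions and of exponential series\<close>

lemma cholo_nth: "cholo (\<lambda>Z. Z $ i $ j)"
  unfolding cholo_def siegel_holomorphic_def
  by (auto intro!: continuous_intros derivative_intros)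

lemma cholo_det:
  assumes "\<And>i j. cholo (\<lambda>Z. M Z $ i $ j)"
  shows "cholo (\<lambda>Z. det (M Z))"
  unfolding det_def by (intro cholo_sum cholo_mult cholo_const cholo_prod assms)

lemma cholo_divide:
  assumes f: "cholo f" and g: "cholo g" and nz: "\<And>Z. Z \<in> siegel_H \<Longrightarrow> g Z \<noteq> 0"
  shows "cholo (\<lambda>Z. f Z / g Z)"
proof -
  have "cholo (\<lambda>Z. inverse (g Z))"
    by (rule cholo_compose[OF g, of inverse "- {0}"]) (use nz in \<open>auto intro!: holomorphic_intros\<close>)
  from cholo_mult[OF f this] show ?thesis by (simp add: divide_inverse)
qed

lemma cholo_if: "cholo f \<Longrightarrow> cholo g \<Longrightarrow> cholo (\<lambda>Z. if c then f Z else g Z)"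
  by (cases c) simp_all

lemma cholo_matrix_inv:
  assumes M: "\<And>i j. cholo (\<lambda>Z. M Z $ i $ j)" and nz: "\<And>Z. Z \<in> siegel_H \<Longrightarrow> det (M Z) \<noteq> 0"
  shows "cholo (\<lambda>Z. matrix_inv (M Z) $ k $ l)"
proof -
  have "cholo (\<lambda>Z. det (\<chi> i j. if j = k then (if i = l then 1 else 0) else M Z$i$j) / det (M Z))"
    by (intro cholo_divide cholo_det nz M) (auto intro!: M cholo_const cholo_if)
  then show ?thesis by (rule cholo_cong) (simp add: matrix_inv_nth nz)
qed

lemma cholo_matrix_mult:
  assumes "\<And>i j. cholo (\<lambda>Z. M Z $ i $ j)" "\<And>i j. cholo (\<lambda>Z. N Z $ i $ j)"
  shows "cholo (\<lambda>Z. (M Z ** N Z) $ i $ j)"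
  unfolding matrix_matrix_mult_def by (simp, intro cholo_sum cholo_mult assms)

lemma cholo_sp_act:
  assumes g: "g \<in> Sp"
  shows "cholo (\<lambda>Z. sp_act g Z $ i $ j)"
proof -
  obtain A B C D where gg: "g = (A,B,C,D)" by (cases g) auto
  have l: "cholo (\<lambda>Z. (cmat A ** Z + cmat B) $ i $ j)" for A B :: "'a imat" and i j
    unfolding vector_add_component by (intro cholo_add cholo_matrix_mult cholo_nth cholo_const)
  show ?thesis unfolding gg sp_act.simps
    by (intro cholo_matrix_mult cholo_matrix_inv l) (use g gg j_det_nonzero in blast)
qed

lemma continuous_on_matrix:
  assumes "\<And>i j. continuous_on S (\<lambda>x. f x $ i $ j)"
  shows "continuous_on S f"
proof -
  have "continuous_on S (\<lambda>x. \<chi> i j. f x $ i $ j)" by (intro continuous_on_vec_lambda assms)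
  then show ?thesis by simp
qed

lemma cpair_scaleR_left: "cpair (r *\<^sub>R T) Z = of_real r * cpair T Z"
  unfolding cpair_def sum_distrib_left
  by (intro sum.cong refl) (simp add: mult_ac)
lemma cpair_add_right: "cpair T (Z + W) = cpair T Z + cpair T W"
  unfolding cpair_def by (simp add: distrib_left sum.distrib)

lemma cholo_cpair: "(\<And>i j. cholo (\<lambda>Z. g Z $ i $ j)) \<Longrightarrow> cholo (\<lambda>Z. cpair T (g Z))"
  unfolding cpair_def by (intro cholo_sum cholo_mult cholo_const)

lemma cholo_e: "cholo f \<Longrightarrow> cholo (\<lambda>Z. e (f Z))"
  unfolding e_def by (rule cholo_compose[of f "\<lambda>z. exp (2 * pi * \<i> * z)" UNIV]) (auto intro!: holomorphic_intros)

lemma siegel_H_scale: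
  assumes "Z \<in> siegel_H" "r > 0" shows "r *\<^sub>R Z \<in> siegel_H"
proof -
  have "Im_mat (r *\<^sub>R Z) = r *\<^sub>R Im_mat Z" by (simp add: vec_eq_iff)
  then show ?thesis using assms
    by (auto simp: siegel_H_def sym_mat_iff pos_def_def scaleR_matrix_vector_assoc[symmetric])
qed

lemma trace_mult_mono:
  assumes "pos_semidef T" "pos_semidef (Y - Y')"
  shows "trace (T ** Y') \<le> trace (T ** Y)"
proof -
  have "trace (T ** Y) = trace (T ** Y') + trace (T ** (Y - Y'))"
    by (simp add: mat_diff_ldistrib trace_sub)
  with trace_mult_nonneg[OF assms] show ?thesis by simp
qed

text \<open>Near \<open>Z0\<close> the imaginary part of \<open>g Z\<close> is, in the semidefinite
  order, at least that of half of \<open>g Z0\<close>. Traces against semidefinite frequencies are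
  monotone, so each term is dominated by its value at this single point, where summability is
  assumed.\<close>

lemma loc_summable_series:
  fixes \<nu> :: "'i \<Rightarrow> real^'n^'n" and \<alpha> :: "'i \<Rightarrow> complex" and g :: "('n::finite) cmat \<Rightarrow> 'n cmat"
  assumes s: "\<And>Z. Z \<in> siegel_H \<Longrightarrow> (\<lambda>T. norm (\<alpha> T * e (cpair (\<nu> T) Z))) summable_on L"
    and \<nu>: "\<And>T. T \<in> L \<Longrightarrow> pos_semidef (\<nu> T)"
    and g: "\<And>i j. cholo (\<lambda>Z. g Z $ i $ j)" and gH: "\<And>Z. Z \<in> siegel_H \<Longrightarrow> g Z \<in> siegel_H"
    and \<kappa>: "cholo \<kappa>"
  shows "loc_summable L (\<lambda>T Z. \<kappa> Z * (\<alpha> T * e (cpair (\<nu> T) (g Z))))"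
  unfolding loc_summable_def
proof (intro conjI ballI)
  show "cholo (\<lambda>Z. \<kappa> Z * (\<alpha> T * e (cpair (\<nu> T) (g Z))))" for T
    by (intro cholo_mult \<kappa> cholo_const cholo_e cholo_cpair g)
  fix Z0 :: "'n cmat" assume Z0: "Z0 \<in> siegel_H"
  obtain s0 where s0: "s0 > 0" "\<And>Z'. sym_mat Z' \<Longrightarrow> dist Z' (g Z0) < s0 \<Longrightarrow>
     Z' \<in> siegel_H \<and> pos_semidef (Im_mat Z' - (1/2) *\<^sub>R Im_mat (g Z0))"
    using siegel_H_nbhd[OF gH[OF Z0]] by metis
  have cg: "continuous_on siegel_H g" by (rule continuous_on_matrix) (use g in \<open>simp add: cholo_def\<close>)
  have c\<kappa>: "continuous_on siegel_H \<kappa>" using \<kappa> by (simp add: cholo_def)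
  obtain r1 where r1: "r1 > 0" "\<And>Z. Z \<in> siegel_H \<Longrightarrow> dist Z Z0 < r1 \<Longrightarrow> dist (g Z) (g Z0) < s0"
    using cg Z0 s0(1) unfolding continuous_on_iff by metis
  obtain r2 where r2: "r2 > 0" "\<And>Z. Z \<in> siegel_H \<Longrightarrow> dist Z Z0 < r2 \<Longrightarrow> dist (\<kappa> Z) (\<kappa> Z0) < 1"
    using c\<kappa> Z0 unfolding continuous_on_iff by (metis zero_less_one)
  define W where "W = (1/2::real) *\<^sub>R g Z0"
  have W: "W \<in> siegel_H" unfolding W_def by (intro siegel_H_scale gH Z0) simp
  have ImW: "Im_mat W = (1/2) *\<^sub>R Im_mat (g Z0)" by (simp add: W_def vec_eq_iff)
  let ?B = "\<lambda>T. (norm (\<kappa> Z0) + 1) * norm (\<alpha> T * e (cpair (\<nu> T) W))"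
  have "norm (\<kappa> Z * (\<alpha> T * e (cpair (\<nu> T) (g Z)))) \<le> ?B T" if T: "T \<in> L" and Z: "Z \<in> siegel_H" "dist Z Z0 < min r1 r2" for T Z
  proof -
    have "dist (\<kappa> Z) (\<kappa> Z0) < 1" using r2 Z by simp
    then have k: "norm (\<kappa> Z) \<le> norm (\<kappa> Z0) + 1"
      using norm_triangle_ineq2[of "\<kappa> Z" "\<kappa> Z0"] by (simp add: dist_norm)
    have "pos_semidef (Im_mat (g Z) - Im_mat W)"
      unfolding ImW using s0(2)[of "g Z"] r1(2)[of Z] Z gH siegel_HD(1) by auto
    then have "trace (\<nu> T ** Im_mat W) \<le> trace (\<nu> T ** Im_mat (g Z))" by (rule trace_mult_mono[OF \<nu>[OF T]])
    then have "norm (e (cpair (\<nu> T) (g Z))) \<le> norm (e (cpair (\<nu> T) W))" by (simp add: norm_e_cpair)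
    then show ?thesis unfolding norm_mult using k by (intro mult_mono) auto
  qed
  moreover have "?B summable_on L" by (intro summable_on_cmult_right s W)
  moreover have "min r1 r2 > 0" using r1 r2 by simp
  ultimately show "\<exists>r>0. \<exists>B. B summable_on L \<and> (\<forall>T\<in>L. \<forall>Z'\<in>siegel_H. dist Z' Z0 < r \<longrightarrow> norm (\<kappa> Z' * (\<alpha> T * e (cpair (\<nu> T) (g Z')))) \<le> B T)"
    by blast
qed

text \<open>The difference quotient of the square root is that of its square divided by the sum of
  the two values, and by continuity this sum tends to twice a nonzero number.\<close>

lemma cholo_sqrt:
  assumes c: "continuous_on siegel_H \<phi>" and sq: "cholo (\<lambda>Z. (\<phi> Z)^2)" and nz: "\<And>Z. Z \<in> siegel_H \<Longrightarrow> \<phi> Z \<noteq> 0"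
  shows "cholo \<phi>"
  unfolding cholo_def siegel_holomorphic_def
proof (intro conjI ballI allI impI)
  fix Z X :: "'a cmat" assume Z: "Z \<in> siegel_H" and X: "sym_mat X"
  define p where "p = (\<lambda>w. \<phi> (Z + msc w X))"
  have p0: "p 0 \<noteq> 0" using nz Z by (simp add: p_def)
  have "((\<lambda>w. (p w)^2) has_field_derivative delta X (\<lambda>Z. (\<phi> Z)^2) Z) (at 0)"
    unfolding p_def using sq Z X by (intro siegel_holomorphic_DERIV0[of "\<lambda>Z. (\<phi> Z)^2"]) (auto simp: cholo_def)
  then have 1: "((\<lambda>w. ((p w)^2 - (p 0)^2) / (w - 0)) \<longlongrightarrow> delta X (\<lambda>Z. (\<phi> Z)^2) Z) (at 0)"
    by (simp add: has_field_derivative_iff)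
  let ?U = "{w. Z + msc w X \<in> siegel_H}"
  have U: "open ?U" "0 \<in> ?U" using open_line[OF X] Z by auto
  have "continuous_on ?U p" unfolding p_def
    by (intro continuous_on_compose_H[OF c] continuous_intros) auto
  then have "isCont p 0" using U by (simp add: continuous_on_eq_continuous_at)
  then have pc: "(p \<longlongrightarrow> p 0) (at 0)" by (simp add: isCont_def)
  then have 2: "((\<lambda>w. p w + p 0) \<longlongrightarrow> p 0 + p 0) (at 0)" by (intro tendsto_intros)
  have 3: "((\<lambda>w. ((p w)^2 - (p 0)^2) / (w - 0) / (p w + p 0)) \<longlongrightarrow> delta X (\<lambda>Z. (\<phi> Z)^2) Z / (p 0 + p 0)) (at 0)"
    by (rule tendsto_divide[OF 1 2]) (use p0 in \<open>simp flip: mult_2\<close>)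
  have "\<forall>\<^sub>F w in at 0. p w + p 0 \<noteq> 0"
    using 2 p0 by (intro tendsto_imp_eventually_ne[OF 2]) (simp flip: mult_2)
  then have "\<forall>\<^sub>F w in at 0. ((p w)^2 - (p 0)^2) / (w - 0) / (p w + p 0) = (p w - p 0) / (w - 0)"
  proof eventually_elim
    case (elim w)
    have "(p w)^2 - (p 0)^2 = (p w - p 0) * (p w + p 0)" by (simp add: power2_eq_square algebra_simps)
    then show ?case using elim by simp
  qed
  with 3 have "((\<lambda>w. (p w - p 0) / (w - 0)) \<longlongrightarrow> delta X (\<lambda>Z. (\<phi> Z)^2) Z / (p 0 + p 0)) (at 0)"
    by (rule Lim_transform_eventually)
  then have "(p has_field_derivative (delta X (\<lambda>Z. (\<phi> Z)^2) Z / (p 0 + p 0))) (at 0)"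
    by (simp add: has_field_derivative_iff)
  then show "(\<lambda>w. \<phi> (Z + msc w X)) field_differentiable at 0" by (auto simp: field_differentiable_def p_def)
qed (rule c)

subsection \<open>A Capelli-type expansion\<close>

text \<open>Symmetrised matrix units. The weights 1/2 make the trace pairing with a symmetric T
  equal to T_ab on and off the diagonal, so that the derivative in this direction multiplies e(tr
  TZ) by 2 pi i T_ab.\<close>

definition Eab :: "'n \<Rightarrow> 'n \<Rightarrow> ('n::finite) cmat" where
  "Eab a b = (\<chi> i j. (if i = a \<and> j = b then 1/2 else 0) + (if i = b \<and> j = a then 1/2 else 0))"

lemma sym_Eab: "sym_mat (Eab a b)" 
proof -
  have "(if i = a \<and> j = b then 1/2 else 0) + (if i = b \<and> j = a then 1/2 else 0)
     = (if j = a \<and> i = b then 1/2 else 0) + (if j = b \<and> i = a then 1/2 else (0::complex))" for i j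
    by (cases "i = a"; cases "j = b"; cases "i = b"; cases "j = a") simp_all
  then show ?thesis unfolding sym_mat_iff Eab_def by (simp only: vec_lambda_beta) blast
qed
lemma Eab_nth_commute: "Eab a b $ i $ j = Eab a b $ j $ i" by (rule sym_matD[OF sym_Eab])
lemma matrix_mult3_nth: "(A ** B ** C) $ i $ j = (\<Sum>m\<in>UNIV. (\<Sum>l\<in>UNIV. A $ i $ l * B $ l $ m) * C $ m $ j)"
  by (simp add: matrix_matrix_mult_def)

lemma sum_Eab: "(\<Sum>i\<in>UNIV. \<Sum>j\<in>UNIV. f i j * Eab a b $ i $ j) = (f a b + f b a) / 2"
proof -
  have "(\<Sum>i\<in>UNIV. \<Sum>j\<in>UNIV. f i j * Eab a b $ i $ j)
      = (\<Sum>i\<in>UNIV. \<Sum>j\<in>UNIV. (if i = a then if j = b then f i j / 2 else 0 else 0))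
        + (\<Sum>i\<in>UNIV. \<Sum>j\<in>UNIV. (if i = b then if j = a then f i j / 2 else 0 else 0))"
    unfolding sum.distrib[symmetric] by (intro sum.cong refl) (auto simp: Eab_def)
  moreover have "(\<Sum>i\<in>UNIV. \<Sum>j\<in>UNIV. (if i = a then if j = b then f i j / 2 else 0 else 0)) = f a b / 2" for a b
  proof -
    have "(\<Sum>j\<in>UNIV. (if i = a then if j = b then f i j / 2 else 0 else 0)) = (if i = a then f a b / 2 else 0)" for i
      by simp
    then show ?thesis by simp
  qed
  ultimately show ?thesis by (simp only: add_divide_distrib)
qed

lemma mult_Eab_nth: "(P ** Eab a b ** R) $ i $ j = (P$i$a * R$b$j + P$i$b * R$a$j) / 2"
proof -
  have "(P ** Eab a b ** R) $ i $ j = (\<Sum>k\<in>UNIV. \<Sum>l\<in>UNIV. (P$i$l * R$k$j) * Eab a b $ l $ k)"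
    by (simp add: matrix_matrix_mult_def sum_distrib_left sum_distrib_right mult_ac)
  also have "\<dots> = (\<Sum>l\<in>UNIV. \<Sum>k\<in>UNIV. (P$i$l * R$k$j) * Eab a b $ l $ k)" by (rule sum.swap)
  also have "\<dots> = (P$i$a * R$b$j + P$i$b * R$a$j) / 2" by (rule sum_Eab)
  finally show ?thesis .
qed

lemma cpair_Eab:
  assumes "sym_mat T" shows "cpair T (Eab a b) = of_real (T$a$b)"
proof -
  have "cpair T (Eab a b) = (\<Sum>i\<in>UNIV. \<Sum>j\<in>UNIV. of_real (T$i$j) * Eab a b $ i $ j)"
    unfolding cpair_def by (intro sum.cong refl arg_cong2[where f = "(*)"] Eab_nth_commute)
  also have "\<dots> = of_real (T$a$b)" unfolding sum_Eab using sym_matD[OF assms, of b a] by simp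
  finally show ?thesis .
qed

lemma delta_nth: "delta X (\<lambda>Z. Z $ i $ j) Z = X $ i $ j"
  by (rule deltaI) (auto intro!: derivative_eq_intros)

lemma delta_e_cpair: "delta X (\<lambda>Z. e (cpair T Z)) Z = (2 * of_real pi * \<i> * cpair T X) * e (cpair T Z)"
proof (rule deltaI)
  have c: "cpair T (Z + msc w X) = cpair T Z + w * cpair T X" for w
    unfolding cpair_def by (simp add: distrib_left sum.distrib sum_distrib_left mult_ac)
  show "((\<lambda>w. e (cpair T (Z + msc w X))) has_field_derivative (2 * of_real pi * \<i> * cpair T X) * e (cpair T Z)) (at 0)"
    unfolding c e_def by (auto intro!: derivative_eq_intros)
qed

lemma delta_compose:
  assumes "cholo f" "(g has_field_derivative g') (at (f Z))" "sym_mat X" "Z \<in> siegel_H"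
  shows "delta X (\<lambda>Z. g (f Z)) Z = g' * delta X f Z"
proof (rule deltaI)
  have "((\<lambda>w. f (Z + msc w X)) has_field_derivative delta X f Z) (at 0)"
    using assms by (intro siegel_holomorphic_DERIV0) (auto simp: cholo_def)
  then show "((\<lambda>w. g (f (Z + msc w X))) has_field_derivative g' * delta X f Z) (at 0)"
    by (rule DERIV_chain'[where g = g]) (use assms(2) in simp)
qed

lemma delta_prod:
  assumes "finite I" "\<And>i. i \<in> I \<Longrightarrow> cholo (f i)" "sym_mat X" "Z \<in> siegel_H"
  shows "delta X (\<lambda>Z. \<Prod>i\<in>I. f i Z) Z = (\<Sum>i\<in>I. delta X (f i) Z * (\<Prod>j\<in>I - {i}. f j Z))"
proof (rule deltaI)
  have "((\<lambda>w. \<Prod>i\<in>I. f i (Z + msc w X)) has_field_derivative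
      (\<Sum>i\<in>I. delta X (f i) Z * (\<Prod>j\<in>I - {i}. f j (Z + msc 0 X)))) (at 0)"
    using assms by (intro has_field_derivative_prod siegel_holomorphic_DERIV0) (auto simp: cholo_def)
  then show "((\<lambda>w. \<Prod>i\<in>I. f i (Z + msc w X)) has_field_derivative
      (\<Sum>i\<in>I. delta X (f i) Z * (\<Prod>j\<in>I - {i}. f j Z))) (at 0)" by simp
qed

abbreviation Pinv :: "'n \<Rightarrow> 'n \<Rightarrow> ('n::finite) cmat \<Rightarrow> complex" where
  "Pinv i j \<equiv> \<lambda>Z. matrix_inv Z $ i $ j"

text \<open>The gradient of -tr(T Z^(-1)) with respect to Z, hence the matrix produced by
  differentiating the exponentials after inversion.\<close>

definition Qinv :: "real^('n::finite)^'n \<Rightarrow> 'n cmat \<Rightarrow> 'n cmat" where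
  "Qinv T Z = matrix_inv Z ** rcmat T ** matrix_inv Z"

lemma cholo_Pinv: "cholo (Pinv i j)"
  by (rule cholo_matrix_inv) (simp_all add: cholo_nth siegel_H_inv)

lemma cholo_Qinv: "cholo (\<lambda>Z. Qinv T Z $ i $ j)"
  unfolding Qinv_def by (intro cholo_matrix_mult cholo_Pinv cholo_const)

lemma Pinv_sym: "Z \<in> siegel_H \<Longrightarrow> matrix_inv Z $ i $ j = matrix_inv Z $ j $ i"
  using siegel_HD(1)[OF siegel_H_inv(2), of Z] by (simp add: sym_mat_iff)

lemma Qinv_sym:
  assumes "Z \<in> siegel_H" "sym_mat T"
  shows "Qinv T Z $ i $ j = Qinv T Z $ j $ i"
proof -
  have 1: "transpose (matrix_inv Z) = matrix_inv Z" using Pinv_sym[OF assms(1)] by (simp add: vec_eq_iff)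
  have 2: "transpose (rcmat T) = rcmat T" using assms(2) by (simp add: sym_mat_iff vec_eq_iff)
  have "transpose (Qinv T Z) = Qinv T Z"
    unfolding Qinv_def by (simp add: matrix_transpose_mul 1 2 matrix_mul_assoc)
  then show ?thesis by (metis transpose_nth)
qed

text \<open>Differentiate Z Z^(-1) = 1 entrywise and multiply by the inverse from the left.\<close>

lemma delta_Pinv_matrix:
  assumes Z: "Z \<in> siegel_H" and X: "sym_mat X"
  shows "delta X (Pinv i j) Z = - ((matrix_inv Z ** X ** matrix_inv Z) $ i $ j)"
proof -
  define DP where "DP = (\<chi> i j. delta X (Pinv i j) Z)"
  have "(X ** matrix_inv Z + Z ** DP) $ i $ j = 0" for i j
  proof -
    have "delta X (\<lambda>Z. \<Sum>k\<in>UNIV. Z $ i $ k * matrix_inv Z $ k $ j) Z = delta X (\<lambda>Z. if i = j then 1 else 0) Z"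
    proof (rule delta_cong[OF _ Z X])
      fix Z :: "'a cmat" assume "Z \<in> siegel_H"
      then have "(Z ** matrix_inv Z) $ i $ j = mat 1 $ i $ j" using matrix_inv_right siegel_H_inv by metis
      then show "(\<Sum>k\<in>UNIV. Z $ i $ k * matrix_inv Z $ k $ j) = (if i = j then 1 else 0)"
        by (simp add: matrix_matrix_mult_def mat_def)
    qed
    then have "(\<Sum>k\<in>UNIV. X $ i $ k * matrix_inv Z $ k $ j + Z $ i $ k * delta X (Pinv k j) Z) = 0"
      by (simp add: delta_const delta_sum delta_mult delta_nth cholo_nth cholo_Pinv cholo_mult Z X)
    then show ?thesis by (simp add: matrix_matrix_mult_def DP_def sum.distrib)
  qed
  then have "Z ** DP = - (X ** matrix_inv Z)" by (simp add: vec_eq_iff add_eq_0_iff2)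
  then have "matrix_inv Z ** (Z ** DP) = - (matrix_inv Z ** X ** matrix_inv Z)"
    by (simp add: mat_mult_minus_right matrix_mul_assoc)
  then have "DP = - (matrix_inv Z ** X ** matrix_inv Z)"
    by (simp add: matrix_mul_assoc matrix_inv_right[OF siegel_H_inv(1)[OF Z]])
  then have "DP $ i $ j = - ((matrix_inv Z ** X ** matrix_inv Z) $ i $ j)" by simp
  then show ?thesis by (simp add: DP_def)
qed

lemma delta_Pinv:
  assumes "Z \<in> siegel_H"
  shows "delta (Eab a b) (Pinv i j) Z = - (Pinv i a Z * Pinv b j Z + Pinv i b Z * Pinv a j Z) / 2"
  unfolding delta_Pinv_matrix[OF assms sym_Eab] mult_Eab_nth by (simp only: minus_divide_left)

lemma delta_Qinv:
  assumes Z: "Z \<in> siegel_H"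
  shows "delta (Eab a b) (\<lambda>Z. Qinv T Z $ i $ j) Z =
    - (Pinv i a Z * Qinv T Z $ b $ j + Pinv i b Z * Qinv T Z $ a $ j) / 2
    - (Qinv T Z $ i $ a * Pinv b j Z + Qinv T Z $ i $ b * Pinv a j Z) / 2"
proof -
  let ?X = "Eab a b" and ?P = "matrix_inv Z"
  have q: "(\<lambda>Z. Qinv T Z $ i $ j) = (\<lambda>Z. \<Sum>m\<in>UNIV. (\<Sum>l\<in>UNIV. Pinv i l Z * of_real (T$l$m)) * Pinv m j Z)"
    by (simp add: Qinv_def matrix_matrix_mult_def)
  have "delta ?X (\<lambda>Z. Qinv T Z $ i $ j) Z =
    (\<Sum>m\<in>UNIV. (\<Sum>l\<in>UNIV. delta ?X (Pinv i l) Z * of_real (T$l$m)) * Pinv m j Z)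
    + (\<Sum>m\<in>UNIV. (\<Sum>l\<in>UNIV. Pinv i l Z * of_real (T$l$m)) * delta ?X (Pinv m j) Z)"
    unfolding q
    by (simp add: delta_sum delta_mult delta_const cholo_Pinv cholo_mult cholo_sum cholo_const Z sym_Eab sum.distrib)
  also have "\<dots> = - ((?P ** ?X ** ?P ** rcmat T ** ?P) $ i $ j) - ((?P ** rcmat T ** (?P ** ?X ** ?P)) $ i $ j)"
    unfolding delta_Pinv_matrix[OF Z sym_Eab] matrix_mult3_nth[of "?P ** ?X ** ?P" "rcmat T" ?P]
      matrix_mult3_nth[of ?P "rcmat T" "?P ** ?X ** ?P"] by (simp add: sum_negf)
  also have "?P ** ?X ** ?P ** rcmat T ** ?P = ?P ** ?X ** Qinv T Z" by (simp add: Qinv_def matrix_mul_assoc)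
  also have "?P ** rcmat T ** (?P ** ?X ** ?P) = Qinv T Z ** ?X ** ?P" by (simp add: Qinv_def matrix_mul_assoc)
  finally show ?thesis unfolding mult_Eab_nth by (simp only: minus_divide_left)
qed

text \<open>A permutation other than the identity moves at least two indices, so its Leibniz term
  vanishes to second order; the diagonal term alone contributes, with derivative the trace.\<close>

lemma DERIV_det_one_plus:
  fixes B :: "complex^'n^'n"
  shows "((\<lambda>w. det (mat 1 + msc w B)) has_field_derivative trace B) (at 0)"
proof -
  have "((\<lambda>w. \<Prod>i\<in>UNIV. (mat 1 + msc w B) $ i $ p i) has_field_derivative
      (\<Sum>i\<in>UNIV. B$i$p i * (\<Prod>j\<in>UNIV - {i}. (mat 1 + msc 0 B) $ j $ p j))) (at 0)" for p
    by (intro has_field_derivative_prod) (auto intro!: derivative_eq_intros)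
  then have "((\<lambda>w. det (mat 1 + msc w B)) has_field_derivative
     (\<Sum>p\<in>{p. p permutes UNIV}. of_int (sign p) * (\<Sum>i\<in>UNIV. B$i$p i * (\<Prod>j\<in>UNIV - {i}. mat 1 $ j $ p j)))) (at 0)"
    unfolding det_def by (auto intro!: derivative_eq_intros DERIV_sum)
  also have "(\<Sum>p\<in>{p. p permutes UNIV}. of_int (sign p) * (\<Sum>i\<in>UNIV. B$i$p i * (\<Prod>j\<in>UNIV - {i}. mat 1 $ j $ p j)))
     = (\<Sum>p\<in>{p. p permutes (UNIV::'n set)}. if p = id then trace B else 0)"
  proof (rule sum.cong[OF refl])
    fix p :: "'n \<Rightarrow> 'n" assume p: "p \<in> {p. p permutes UNIV}"
    show "of_int (sign p) * (\<Sum>i\<in>UNIV. B$i$p i * (\<Prod>j\<in>UNIV - {i}. mat 1 $ j $ p j)) = (if p = id then trace B else 0)"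
    proof (cases "p = id")
      case True
      then show ?thesis by (simp add: trace_def mat_def)
    next
      case False
      have z: "(\<Prod>j\<in>UNIV - {i}. mat 1 $ j $ p j) = (0::complex)" for i
      proof -
        have "\<exists>j. j \<noteq> i \<and> p j \<noteq> j"
        proof (rule ccontr)
          assume "\<not> ?thesis"
          then have fix1: "\<And>j. j \<noteq> i \<Longrightarrow> p j = j" by blast
          have "p i = i"
          proof (rule ccontr)
            assume ne: "p i \<noteq> i"
            then have "p (p i) = p i" by (rule fix1)
            moreover have "inj p" using p by (auto intro: permutes_inj)
            ultimately have "p i = i" by (simp add: inj_eq)
            with ne show False by simp
          qed
          with fix1 have "p = id" by (metis eq_id_iff)
          with False show False by simp
        qed
        then obtain j where "j \<noteq> i" "p j \<noteq> j" by blast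
        then show ?thesis by (intro prod_zero bexI[of _ j]) (auto simp: mat_def)
      qed
      show ?thesis using False by (simp only: z mult_zero_right sum.neutral_const if_False)
    qed
  qed
  also have "\<dots> = trace B" by (simp add: permutes_id finite_permutations)
  finally show ?thesis .
qed

lemma delta_det:
  assumes Z: "Z \<in> siegel_H"
  shows "delta X det Z = trace (matrix_inv Z ** X) * det Z"
proof (rule deltaI)
  have "det (Z + msc w X) = det Z * det (mat 1 + msc w (matrix_inv Z ** X))" for w
  proof -
    have "msc w (matrix_inv Z ** X) = matrix_inv Z ** msc w X"
      by (simp add: vec_eq_iff matrix_matrix_mult_def sum_distrib_left mult_ac)
    then have "Z ** (mat 1 + msc w (matrix_inv Z ** X)) = Z + msc w X"
      by (simp add: matrix_add_ldistrib matrix_mul_assoc matrix_inv_right[OF siegel_H_inv(1)[OF Z]])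
    then show ?thesis by (metis det_mul)
  qed
  then show "((\<lambda>w. det (Z + msc w X)) has_field_derivative trace (matrix_inv Z ** X) * det Z) (at 0)"
    using DERIV_cmult[OF DERIV_det_one_plus[of "matrix_inv Z ** X"], of "det Z"] by (simp add: mult.commute)
qed

lemma trace_Pinv_Eab:
  assumes "Z \<in> siegel_H" shows "trace (matrix_inv Z ** Eab a b) = Pinv a b Z"
proof -
  have "trace (matrix_inv Z ** Eab a b) = (\<Sum>i\<in>UNIV. \<Sum>j\<in>UNIV. Pinv i j Z * Eab a b $ i $ j)"
    unfolding trace_def matrix_matrix_mult_def
    by (simp, intro sum.cong refl arg_cong2[where f = "(*)"] Eab_nth_commute)
  also have "\<dots> = Pinv a b Z" unfolding sum_Eab using Pinv_sym[OF assms, of b a] by simp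
  finally show ?thesis .
qed

text \<open>\<open>\<kappa>\<close> is a constant times a branch of det^(-m/2), known through its
  square only. Differentiating the relation for the square gives the logarithmic derivative without
  choosing the branch.\<close>

lemma half_power_det:
  fixes \<kappa> :: "('n::finite) cmat \<Rightarrow> complex"
  assumes c: "continuous_on siegel_H \<kappa>" and sq: "\<And>Z. Z \<in> siegel_H \<Longrightarrow> (\<kappa> Z)^2 * det Z ^ m = c0" and c0: "c0 \<noteq> 0"
  shows "cholo \<kappa>" "Z \<in> siegel_H \<Longrightarrow> delta (Eab a b) \<kappa> Z = - (of_nat m / 2) * Pinv a b Z * \<kappa> Z"
proof -
  have nz: "\<kappa> Z \<noteq> 0" if "Z \<in> siegel_H" for Z using sq[OF that] c0 by auto
  have cd: "cholo det" by (rule cholo_det[of "\<lambda>Z. Z"]) (rule cholo_nth)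
  have cdm: "cholo (\<lambda>Z. det Z ^ m)"
    by (rule cholo_compose[OF cd, of "\<lambda>z. z^m" UNIV]) (auto intro!: holomorphic_intros)
  have "cholo (\<lambda>Z. c0 / det Z ^ m)" by (intro cholo_divide cholo_const cdm) (simp add: siegel_H_inv)
  then have "cholo (\<lambda>Z. (\<kappa> Z)^2)"
    by (rule cholo_cong) (use sq siegel_H_inv(1) in \<open>force simp: field_simps\<close>)
  then show ch: "cholo \<kappa>" by (rule cholo_sqrt[OF c]) (rule nz)
  assume Z: "Z \<in> siegel_H"
  let ?X = "Eab a b"
  have "delta ?X (\<lambda>Z. \<kappa> Z * \<kappa> Z * det Z ^ m) Z = delta ?X (\<lambda>Z. c0) Z"
    by (rule delta_cong[OF _ Z sym_Eab]) (use sq in \<open>simp add: power2_eq_square\<close>)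
  moreover have "delta ?X (\<lambda>Z. \<kappa> Z * \<kappa> Z * det Z ^ m) Z
      = (delta ?X \<kappa> Z * \<kappa> Z + \<kappa> Z * delta ?X \<kappa> Z) * det Z ^ m + \<kappa> Z * \<kappa> Z * delta ?X (\<lambda>Z. det Z ^ m) Z"
    by (simp add: delta_mult cholo_mult ch cdm sym_Eab Z)
  moreover have "delta ?X (\<lambda>Z. det Z ^ m) Z = of_nat m * det Z ^ m * Pinv a b Z"
  proof -
    have "delta ?X (\<lambda>Z. det Z ^ m) Z = (of_nat m * det Z ^ (m - 1)) * delta ?X det Z"
      by (rule delta_compose[OF cd _ sym_Eab Z, of "\<lambda>z. z^m"]) (auto intro!: derivative_eq_intros)
    then show ?thesis unfolding delta_det[OF Z] trace_Pinv_Eab[OF Z] by (cases m) auto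
  qed
  ultimately have "(delta ?X \<kappa> Z * \<kappa> Z + \<kappa> Z * delta ?X \<kappa> Z) * det Z ^ m + \<kappa> Z * \<kappa> Z * (of_nat m * det Z ^ m * Pinv a b Z) = 0"
    by (simp only: delta_const)
  then have "\<kappa> Z * det Z ^ m * (2 * delta ?X \<kappa> Z + of_nat m * Pinv a b Z * \<kappa> Z) = 0"
    by (simp add: algebra_simps)
  then have "2 * delta ?X \<kappa> Z + of_nat m * Pinv a b Z * \<kappa> Z = 0" using nz[OF Z] siegel_H_inv(1)[OF Z] by simp
  then have "2 * delta ?X \<kappa> Z = - (of_nat m * Pinv a b Z * \<kappa> Z)" by (simp only: add_eq_0_iff2)
  then show "delta ?X \<kappa> Z = - (of_nat m / 2) * Pinv a b Z * \<kappa> Z" by (simp add: field_simps)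
qed

section \<open>The antisymmetrised differential operator\<close>

definition Dop :: "('n \<Rightarrow> 'n) \<Rightarrow> 'n list \<Rightarrow> (('n::finite) cmat \<Rightarrow> complex) \<Rightarrow> 'n cmat \<Rightarrow> complex" where
  "Dop \<sigma> xs f = foldr (\<lambda>a. delta (Eab a (\<sigma> a))) xs f"

lemma Dop_Nil [simp]: "Dop \<sigma> [] f = f" by (simp add: Dop_def)
lemma Dop_Cons: "Dop \<sigma> (a # xs) f = delta (Eab a (\<sigma> a)) (Dop \<sigma> xs f)" by (simp add: Dop_def)
lemma Dop_append: "Dop \<sigma> (xs @ ys) f = Dop \<sigma> xs (Dop \<sigma> ys f)" by (simp add: Dop_def)

lemma cholo_Dop: "cholo f \<Longrightarrow> cholo (Dop \<sigma> xs f)"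
  by (induction xs) (auto simp: Dop_Cons intro: cholo_delta sym_Eab)

lemma Dop_cong: "(\<And>Z. Z \<in> siegel_H \<Longrightarrow> f Z = g Z) \<Longrightarrow> Z \<in> siegel_H \<Longrightarrow> Dop \<sigma> xs f Z = Dop \<sigma> xs g Z"
proof (induction xs arbitrary: Z)
  case (Cons a xs)
  show ?case unfolding Dop_Cons by (rule delta_cong) (use Cons sym_Eab in auto)
qed simp

lemma Dop_sum:
  assumes "\<And>i. i \<in> I \<Longrightarrow> cholo (f i)" "Z \<in> siegel_H"
  shows "Dop \<sigma> xs (\<lambda>Z. \<Sum>i\<in>I. f i Z) Z = (\<Sum>i\<in>I. Dop \<sigma> xs (f i) Z)"
  using assms(2)
proof (induction xs arbitrary: Z)
  case (Cons a xs)
  have "Dop \<sigma> (a # xs) (\<lambda>Z. \<Sum>i\<in>I. f i Z) Z = delta (Eab a (\<sigma> a)) (\<lambda>Z. \<Sum>i\<in>I. Dop \<sigma> xs (f i) Z) Z"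
    unfolding Dop_Cons by (rule delta_cong) (use Cons sym_Eab in auto)
  also have "\<dots> = (\<Sum>i\<in>I. Dop \<sigma> (a # xs) (f i) Z)"
    unfolding Dop_Cons using assms(1) Cons.prems by (intro delta_sum) (auto intro: cholo_Dop sym_Eab)
  finally show ?case .
qed simp

lemma Dop_cmult:
  assumes "cholo f" "Z \<in> siegel_H"
  shows "Dop \<sigma> xs (\<lambda>Z. c * f Z) Z = c * Dop \<sigma> xs f Z"
  using assms(2)
proof (induction xs arbitrary: Z)
  case (Cons a xs)
  have "Dop \<sigma> (a # xs) (\<lambda>Z. c * f Z) Z = delta (Eab a (\<sigma> a)) (\<lambda>Z. c * Dop \<sigma> xs f Z) Z"
    unfolding Dop_Cons by (rule delta_cong) (use Cons sym_Eab in auto)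
  also have "\<dots> = c * Dop \<sigma> (a # xs) f Z"
    unfolding Dop_Cons using assms(1) Cons.prems
    by (subst delta_mult) (auto intro: cholo_Dop sym_Eab cholo_const simp: delta_const)
  finally show ?case .
qed simp

lemma Dop_add:
  assumes "cholo f" "cholo g" "Z \<in> siegel_H"
  shows "Dop \<sigma> xs (\<lambda>Z. f Z + g Z) Z = Dop \<sigma> xs f Z + Dop \<sigma> xs g Z"
  using Dop_sum[of "{True,False}" "\<lambda>b. if b then f else g" Z \<sigma> xs] assms by (simp split: if_splits)

lemma Dop_perm_cong: "(\<And>a. a \<in> set xs \<Longrightarrow> \<sigma> a = \<tau> a) \<Longrightarrow> Dop \<sigma> xs f = Dop \<tau> xs f"
  by (induction xs) (auto simp: Dop_Cons)

lemma loc_summable_Dop: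
  assumes "loc_summable L u"
  shows "loc_summable L (\<lambda>T. Dop \<sigma> xs (u T))"
  by (induction xs) (auto simp: Dop_Cons assms intro: loc_summable_delta sym_Eab)

lemma Dop_infsum:
  fixes u :: "'i \<Rightarrow> ('n::finite) cmat \<Rightarrow> complex"
  assumes u: "loc_summable L u" and Z: "Z \<in> siegel_H"
  shows "Dop \<sigma> xs (\<lambda>Z. \<Sum>\<^sub>\<infinity>T\<in>L. u T Z) Z = (\<Sum>\<^sub>\<infinity>T\<in>L. Dop \<sigma> xs (u T) Z)"
  using Z
proof (induction xs arbitrary: Z)
  case (Cons a xs)
  have "Dop \<sigma> (a # xs) (\<lambda>Z. \<Sum>\<^sub>\<infinity>T\<in>L. u T Z) Z = delta (Eab a (\<sigma> a)) (\<lambda>Z. \<Sum>\<^sub>\<infinity>T\<in>L. Dop \<sigma> xs (u T) Z) Z"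
    unfolding Dop_Cons by (rule delta_cong) (use Cons sym_Eab in auto)
  also have "\<dots> = (\<Sum>\<^sub>\<infinity>T\<in>L. Dop \<sigma> (a # xs) (u T) Z)"
    unfolding Dop_Cons
    by (rule loc_summable_cholo_delta(2)[OF loc_summable_Dop[OF u]]) (use Cons.prems sym_Eab in auto)
  finally show ?case .
qed simp

text \<open>If \<open>xs\<close> lists all indices and J does not depend on \<sigma>, this is the
  determinant of the matrix of derivatives applied to J. A J depending on \<sigma> holds the rows
  already differentiated, with their columns still tied to the same permutation.\<close>

definition Aop :: "'n list \<Rightarrow> (('n \<Rightarrow> 'n) \<Rightarrow> ('n::finite) cmat \<Rightarrow> complex) \<Rightarrow> 'n cmat \<Rightarrow> complex" where
  "Aop xs J Z = (\<Sum>\<sigma> | \<sigma> permutes UNIV. of_int (sign \<sigma>) * Dop \<sigma> xs (J \<sigma>) Z)"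

lemma Aop_cong:
  assumes "\<And>\<sigma> Z. Z \<in> siegel_H \<Longrightarrow> J \<sigma> Z = J' \<sigma> Z" "Z \<in> siegel_H"
  shows "Aop xs J Z = Aop xs J' Z"
  unfolding Aop_def using assms by (intro sum.cong refl arg_cong2[where f = "(*)"] Dop_cong) auto

lemma Aop_add:
  assumes "\<And>\<sigma>. cholo (J \<sigma>)" "\<And>\<sigma>. cholo (J' \<sigma>)" "Z \<in> siegel_H"
  shows "Aop xs (\<lambda>\<sigma> Z. J \<sigma> Z + J' \<sigma> Z) Z = Aop xs J Z + Aop xs J' Z"
  unfolding Aop_def using assms by (simp add: Dop_add distrib_left sum.distrib)

lemma Aop_cmult:
  assumes "\<And>\<sigma>. cholo (J \<sigma>)" "Z \<in> siegel_H"
  shows "Aop xs (\<lambda>\<sigma> Z. c * J \<sigma> Z) Z = c * Aop xs J Z"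
  unfolding Aop_def using assms by (simp add: Dop_cmult sum_distrib_left mult_ac)

lemma Aop_sum:
  assumes "\<And>i \<sigma>. i \<in> I \<Longrightarrow> cholo (J i \<sigma>)" "Z \<in> siegel_H"
  shows "Aop xs (\<lambda>\<sigma> Z. \<Sum>i\<in>I. J i \<sigma> Z) Z = (\<Sum>i\<in>I. Aop xs (J i) Z)"
  unfolding Aop_def using assms
  by (subst sum.swap) (simp add: Dop_sum sum_distrib_left)

text \<open>The operators in \<open>xs\<close> do not look at the columns of a and i, so exchanging
  these two columns changes nothing but the sign of the permutation.\<close>

lemma Aop_swap:
  fixes a i :: "'n::finite"
  assumes "a \<noteq> i" "a \<notin> set xs" "i \<notin> set xs"
  shows "Aop xs (\<lambda>\<sigma>. J (\<sigma> \<circ> Transposition.transpose a i)) Z = - Aop xs J Z"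
proof -
  let ?t = "Transposition.transpose a i"
  have t: "?t permutes UNIV" by (rule permutes_swap_id) auto
  have "Aop xs J Z = (\<Sum>\<sigma> | \<sigma> permutes UNIV. of_int (sign (\<sigma> \<circ> ?t)) * Dop (\<sigma> \<circ> ?t) xs (J (\<sigma> \<circ> ?t)) Z)"
    unfolding Aop_def by (rule sum_permutations_compose_right[OF t])
  also have "\<dots> = (\<Sum>\<sigma> | \<sigma> permutes UNIV. - (of_int (sign \<sigma>) * Dop \<sigma> xs (J (\<sigma> \<circ> ?t)) Z))"
  proof (rule sum.cong[OF refl])
    fix \<sigma> :: "'n \<Rightarrow> 'n" assume "\<sigma> \<in> {\<sigma>. \<sigma> permutes UNIV}"
    then have "permutation \<sigma>" by (auto intro: permutes_imp_permutation[OF finite_class.finite_UNIV])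
    then have "sign (\<sigma> \<circ> ?t) = sign \<sigma> * sign ?t"
      by (intro sign_compose) (auto simp: permutation_swap_id)
    then have "sign (\<sigma> \<circ> ?t) = - sign \<sigma>" using assms(1) by (simp add: sign_swap_id)
    moreover have "Dop (\<sigma> \<circ> ?t) xs f = Dop \<sigma> xs f" for f
      by (rule Dop_perm_cong) (use assms in \<open>auto simp: Transposition.transpose_def\<close>)
    ultimately show "of_int (sign (\<sigma> \<circ> ?t)) * Dop (\<sigma> \<circ> ?t) xs (J (\<sigma> \<circ> ?t)) Z = - (of_int (sign \<sigma>) * Dop \<sigma> xs (J (\<sigma> \<circ> ?t)) Z)"
      by simp
  qed
  finally show ?thesis by (simp add: Aop_def sum_negf)
qed

text \<open>A summand symmetric in the two columns contributes the negative of itself.\<close>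

lemma Aop_swap_inv:
  assumes "a \<noteq> i" "a \<notin> set xs" "i \<notin> set xs" "Z \<in> siegel_H"
    and "\<And>\<sigma> Z. Z \<in> siegel_H \<Longrightarrow> J (\<sigma> \<circ> Transposition.transpose a i) Z = J \<sigma> Z"
  shows "Aop xs J Z = 0"
proof -
  have "Aop xs J Z = Aop xs (\<lambda>\<sigma>. J (\<sigma> \<circ> Transposition.transpose a i)) Z"
    by (rule Aop_cong) (use assms in auto)
  also have "\<dots> = - Aop xs J Z" by (rule Aop_swap) (use assms in auto)
  finally show ?thesis by simp
qed

text \<open>Entry (i, j) of a mixed matrix whose rows in S come from Z^(-1), the kind produced by
  the automorphy factor, and whose other rows come from Z^(-1) T Z^(-1), the kind produced by the
  exponential.\<close>

definition fac :: "real^('n::finite)^'n \<Rightarrow> 'n set \<Rightarrow> 'n \<Rightarrow> 'n \<Rightarrow> 'n cmat \<Rightarrow> complex" where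
  "fac T S i j Z = (if i \<in> S then matrix_inv Z $ i $ j else Qinv T Z $ i $ j)"

definition Mfac :: "real^('n::finite)^'n \<Rightarrow> ('n cmat \<Rightarrow> complex) \<Rightarrow> 'n set \<Rightarrow> 'n set \<Rightarrow> ('n \<Rightarrow> 'n) \<Rightarrow> 'n cmat \<Rightarrow> complex" where
  "Mfac T u S I \<sigma> Z = (\<Prod>i\<in>I. fac T S i (\<sigma> i) Z) * u Z"

text \<open>The coefficients of the expansion, one new row a at a time. A new row in S comes from
  the automorphy factor, with -k, or from differentiating an earlier row, with 1/2 for each. A new
  row outside S comes from the exponential, with 2 pi i, or from a derivative that at the same time
  turns an earlier row i into a row of Z^(-1), with 1/2.\<close>

fun dco :: "complex \<Rightarrow> 'n list \<Rightarrow> 'n set \<Rightarrow> complex" where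
  "dco k [] S = 1"
| "dco k (a # xs) S = (if a \<in> S then (- k + of_nat (length xs) / 2) * dco k xs (S - {a})
      else 2 * of_real pi * \<i> * dco k xs S + (\<Sum>i\<in>S. dco k xs (S - {i})) / 2)"

text \<open>With every row in S only the first branch of the recursion occurs. The product is the
  one in Cayley's identity for symmetric matrices and vanishes only if 2k is one of the integers
  from 0 to the number of rows minus 1.\<close>

lemma dco_full: "distinct xs \<Longrightarrow> dco k xs (set xs) = (\<Prod>j<length xs. - k + of_nat j / 2)"
  by (induction xs) (auto simp: mult.commute)

lemma cholo_fac: "cholo (fac T S i j)"
  unfolding fac_def by (intro cholo_if cholo_Pinv cholo_Qinv)

lemma cholo_Mfac: "cholo u \<Longrightarrow> cholo (Mfac T u S I \<sigma>)"
  unfolding Mfac_def by (intro cholo_mult cholo_prod cholo_fac)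

context
  fixes T :: "real^('n::finite)^'n" and u :: "'n cmat \<Rightarrow> complex" and k :: complex
  assumes T: "sym_mat T" and u: "cholo u"
    and du: "\<And>a b Z. Z \<in> siegel_H \<Longrightarrow>
      delta (Eab a b) u Z = (- k * Pinv a b Z + 2 * of_real pi * \<i> * Qinv T Z $ a $ b) * u Z"
begin

lemma delta_Mfac:
  assumes Z: "Z \<in> siegel_H"
  shows "delta (Eab a b) (Mfac T u S I \<sigma>) Z =
     - k * (Pinv a b Z * Mfac T u S I \<sigma> Z) + 2 * of_real pi * \<i> * (Qinv T Z $ a $ b * Mfac T u S I \<sigma> Z)
     + (\<Sum>i\<in>I. delta (Eab a b) (fac T S i (\<sigma> i)) Z * ((\<Prod>j\<in>I - {i}. fac T S j (\<sigma> j) Z) * u Z))"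
proof -
  have "delta (Eab a b) (Mfac T u S I \<sigma>) Z =
     delta (Eab a b) (\<lambda>Z. \<Prod>i\<in>I. fac T S i (\<sigma> i) Z) Z * u Z + (\<Prod>i\<in>I. fac T S i (\<sigma> i) Z) * delta (Eab a b) u Z"
    unfolding Mfac_def by (intro delta_mult cholo_prod cholo_fac u sym_Eab Z)
  also have "delta (Eab a b) (\<lambda>Z. \<Prod>i\<in>I. fac T S i (\<sigma> i) Z) Z
     = (\<Sum>i\<in>I. delta (Eab a b) (fac T S i (\<sigma> i)) Z * (\<Prod>j\<in>I - {i}. fac T S j (\<sigma> j) Z))"
    by (rule delta_prod) (auto intro: cholo_fac sym_Eab Z)
  finally show ?thesis unfolding du[OF Z] Mfac_def by (simp add: sum_distrib_left sum_distrib_right algebra_simps)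
qed

text \<open>Differentiating row i yields products in which the indices of a and i are mixed. If both
  columns sit in one symmetric factor, antisymmetrisation cancels the product. Otherwise the two
  columns are exchanged; the sign of this exchange cancels the sign from the derivative of an
  inverse, and an ordinary diagonal product returns with factor 1/2. A row outside S has two such
  products, and in the second of them row i passes into S while row a becomes a row of Z^(-1) T
  Z^(-1).\<close>

lemma Aop_factor_derivative:
  assumes Z: "Z \<in> siegel_H" and ai: "a \<noteq> i" "a \<notin> set rest" "i \<notin> set rest" and I: "a \<notin> I" "i \<in> I"
  shows "Aop rest (\<lambda>\<sigma> Z. delta (Eab a (\<sigma> a)) (fac T S i (\<sigma> i)) Z * ((\<Prod>j\<in>I - {i}. fac T S j (\<sigma> j) Z) * u Z)) Z
    = (1/2) * Aop rest (\<lambda>\<sigma> Z. Pinv a (\<sigma> a) Z * Mfac T u S I \<sigma> Z) Z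
      + (if i \<in> S then 0 else (1/2) * Aop rest (\<lambda>\<sigma> Z. Qinv T Z $ a $ (\<sigma> a) * Mfac T u (insert i S) I \<sigma> Z) Z)"
proof -
  let ?t = "Transposition.transpose a i"
  define R where "R = (\<lambda>S \<sigma> Z. (\<Prod>j\<in>I - {i}. fac T S j (\<sigma> j) Z) * u Z)"
  have cR: "cholo (R S \<sigma>)" for S \<sigma> unfolding R_def by (intro cholo_mult cholo_prod cholo_fac u)
  \<comment> \<open>The remaining factors involve neither the column of a nor that of i.\<close>
  have Rt: "R S (\<sigma> \<circ> ?t) = R S \<sigma>" for S \<sigma>
  proof -
    have f: "fac T S j ((\<sigma> \<circ> ?t) j) = fac T S j (\<sigma> j)" if "j \<in> I - {i}" for j
    proof -
      have "j \<noteq> a" "j \<noteq> i" using that I by auto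
      then show ?thesis by (simp add: Transposition.transpose_def)
    qed
    show ?thesis unfolding R_def by (intro ext arg_cong2[where f = "(*)"] prod.cong refl) (simp only: f)
  qed
  have st: "(\<sigma> \<circ> ?t) a = \<sigma> i" "(\<sigma> \<circ> ?t) i = \<sigma> a" for \<sigma> by (simp_all add: Transposition.transpose_def)
  have MR: "Mfac T u S I \<sigma> Z = fac T S i (\<sigma> i) Z * R S \<sigma> Z" for S \<sigma> Z
    unfolding Mfac_def R_def using I(2) by (simp add: prod.remove[of I i])
  have Rins: "R (insert i S) \<sigma> = R S \<sigma>" for \<sigma>
    unfolding R_def by (auto simp: fun_eq_iff fac_def intro!: prod.cong)
  note P = cholo_Pinv and Q = cholo_Qinv
  have main: "Aop rest (\<lambda>\<sigma> Z. (f i (\<sigma> a) Z * g a (\<sigma> i) Z) * R S \<sigma> Z) Z = - Aop rest (\<lambda>\<sigma> Z. (f i (\<sigma> i) Z * g a (\<sigma> a) Z) * R S \<sigma> Z) Z"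
    for f g :: "'n \<Rightarrow> 'n \<Rightarrow> 'n cmat \<Rightarrow> complex"
    using Aop_swap[OF ai, of "\<lambda>\<sigma> Z. (f i (\<sigma> i) Z * g a (\<sigma> a) Z) * R S \<sigma> Z" Z] by (simp only: st Rt)
  have junk: "Aop rest (\<lambda>\<sigma> Z. (f i a Z * g (\<sigma> a) (\<sigma> i) Z) * R S \<sigma> Z) Z = 0"
    if "\<And>Z i j. Z \<in> siegel_H \<Longrightarrow> g i j Z = g j i Z" for f g :: "'n \<Rightarrow> 'n \<Rightarrow> 'n cmat \<Rightarrow> complex"
    by (rule Aop_swap_inv[OF ai Z]) (simp only: st Rt, use that in metis)
  have Qs: "Qinv T Z $ i $ j = Qinv T Z $ j $ i" if "Z \<in> siegel_H" for i j Z by (rule Qinv_sym[OF that T])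
  let ?Q = "\<lambda>i j Z. Qinv T Z $ i $ j"
  show ?thesis
  proof (cases "i \<in> S")
    case True
    have "Aop rest (\<lambda>\<sigma> Z. delta (Eab a (\<sigma> a)) (fac T S i (\<sigma> i)) Z * ((\<Prod>j\<in>I - {i}. fac T S j (\<sigma> j) Z) * u Z)) Z
      = Aop rest (\<lambda>\<sigma> Z. (-1/2) * ((Pinv i a Z * Pinv (\<sigma> a) (\<sigma> i) Z) * R S \<sigma> Z) + (-1/2) * ((Pinv i (\<sigma> a) Z * Pinv a (\<sigma> i) Z) * R S \<sigma> Z)) Z"
    proof (rule Aop_cong[OF _ Z])
      fix \<sigma> and Z :: "'n cmat" assume Z: "Z \<in> siegel_H"
      have "fac T S i j = Pinv i j" for j using True by (simp add: fac_def fun_eq_iff)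
      then show "delta (Eab a (\<sigma> a)) (fac T S i (\<sigma> i)) Z * ((\<Prod>j\<in>I - {i}. fac T S j (\<sigma> j) Z) * u Z)
        = (-1/2) * ((Pinv i a Z * Pinv (\<sigma> a) (\<sigma> i) Z) * R S \<sigma> Z) + (-1/2) * ((Pinv i (\<sigma> a) Z * Pinv a (\<sigma> i) Z) * R S \<sigma> Z)"
        by (simp only: delta_Pinv[OF Z] R_def) (simp add: field_simps)
    qed
    also have "\<dots> = (-1/2) * Aop rest (\<lambda>\<sigma> Z. (Pinv i a Z * Pinv (\<sigma> a) (\<sigma> i) Z) * R S \<sigma> Z) Z
        + (-1/2) * Aop rest (\<lambda>\<sigma> Z. (Pinv i (\<sigma> a) Z * Pinv a (\<sigma> i) Z) * R S \<sigma> Z) Z"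
      by ((subst Aop_add, (intro cholo_add cholo_mult cholo_const P Q cR Z)+)+,
         (subst Aop_cmult, (intro cholo_mult P Q cR Z)+)+, rule refl)
    also have "\<dots> = (1/2) * Aop rest (\<lambda>\<sigma> Z. (Pinv i (\<sigma> i) Z * Pinv a (\<sigma> a) Z) * R S \<sigma> Z) Z"
      using junk[of "\<lambda>i j Z. Pinv i j Z" "\<lambda>i j Z. Pinv i j Z", OF Pinv_sym] main[of "\<lambda>i j Z. Pinv i j Z" "\<lambda>i j Z. Pinv i j Z"] by simp
    also have "Aop rest (\<lambda>\<sigma> Z. (Pinv i (\<sigma> i) Z * Pinv a (\<sigma> a) Z) * R S \<sigma> Z) Z = Aop rest (\<lambda>\<sigma> Z. Pinv a (\<sigma> a) Z * Mfac T u S I \<sigma> Z) Z"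
      using True by (simp add: MR fac_def mult_ac)
    finally show ?thesis using True by simp
  next
    case False
    have "Aop rest (\<lambda>\<sigma> Z. delta (Eab a (\<sigma> a)) (fac T S i (\<sigma> i)) Z * ((\<Prod>j\<in>I - {i}. fac T S j (\<sigma> j) Z) * u Z)) Z
      = Aop rest (\<lambda>\<sigma> Z. (-1/2) * ((Pinv i a Z * ?Q (\<sigma> a) (\<sigma> i) Z) * R S \<sigma> Z) + ((-1/2) * ((Pinv i (\<sigma> a) Z * ?Q a (\<sigma> i) Z) * R S \<sigma> Z)
           + ((-1/2) * ((?Q i a Z * Pinv (\<sigma> a) (\<sigma> i) Z) * R S \<sigma> Z) + (-1/2) * ((?Q i (\<sigma> a) Z * Pinv a (\<sigma> i) Z) * R S \<sigma> Z)))) Z"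
    proof (rule Aop_cong[OF _ Z])
      fix \<sigma> and Z :: "'n cmat" assume Z: "Z \<in> siegel_H"
      have "fac T S i j = ?Q i j" for j using False by (simp add: fac_def fun_eq_iff)
      then show "delta (Eab a (\<sigma> a)) (fac T S i (\<sigma> i)) Z * ((\<Prod>j\<in>I - {i}. fac T S j (\<sigma> j) Z) * u Z)
        = (-1/2) * ((Pinv i a Z * ?Q (\<sigma> a) (\<sigma> i) Z) * R S \<sigma> Z) + ((-1/2) * ((Pinv i (\<sigma> a) Z * ?Q a (\<sigma> i) Z) * R S \<sigma> Z)
           + ((-1/2) * ((?Q i a Z * Pinv (\<sigma> a) (\<sigma> i) Z) * R S \<sigma> Z) + (-1/2) * ((?Q i (\<sigma> a) Z * Pinv a (\<sigma> i) Z) * R S \<sigma> Z)))"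
        by (simp only: delta_Qinv[OF Z] R_def) (simp add: field_simps)
    qed
    also have "\<dots> = (-1/2) * Aop rest (\<lambda>\<sigma> Z. (Pinv i a Z * ?Q (\<sigma> a) (\<sigma> i) Z) * R S \<sigma> Z) Z
        + ((-1/2) * Aop rest (\<lambda>\<sigma> Z. (Pinv i (\<sigma> a) Z * ?Q a (\<sigma> i) Z) * R S \<sigma> Z) Z
        + ((-1/2) * Aop rest (\<lambda>\<sigma> Z. (?Q i a Z * Pinv (\<sigma> a) (\<sigma> i) Z) * R S \<sigma> Z) Z
        + (-1/2) * Aop rest (\<lambda>\<sigma> Z. (?Q i (\<sigma> a) Z * Pinv a (\<sigma> i) Z) * R S \<sigma> Z) Z))"
      by ((subst Aop_add, (intro cholo_add cholo_mult cholo_const P Q cR Z)+)+,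
         (subst Aop_cmult, (intro cholo_mult P Q cR Z)+)+, rule refl)
    also have "\<dots> = (1/2) * Aop rest (\<lambda>\<sigma> Z. (Pinv i (\<sigma> i) Z * ?Q a (\<sigma> a) Z) * R S \<sigma> Z) Z
         + (1/2) * Aop rest (\<lambda>\<sigma> Z. (?Q i (\<sigma> i) Z * Pinv a (\<sigma> a) Z) * R S \<sigma> Z) Z"
      using junk[of "\<lambda>i j Z. ?Q i j Z" "\<lambda>i j Z. Pinv i j Z", OF Qs] junk[of "\<lambda>i j Z. Pinv i j Z" "\<lambda>i j Z. ?Q i j Z", OF Pinv_sym] main[of "\<lambda>i j Z. Pinv i j Z" "\<lambda>i j Z. ?Q i j Z"] main[of "\<lambda>i j Z. ?Q i j Z" "\<lambda>i j Z. Pinv i j Z"] by simp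
    also have "Aop rest (\<lambda>\<sigma> Z. (?Q i (\<sigma> i) Z * Pinv a (\<sigma> a) Z) * R S \<sigma> Z) Z = Aop rest (\<lambda>\<sigma> Z. Pinv a (\<sigma> a) Z * Mfac T u S I \<sigma> Z) Z"
      using False by (simp add: MR fac_def mult_ac)
    also have "Aop rest (\<lambda>\<sigma> Z. (Pinv i (\<sigma> i) Z * ?Q a (\<sigma> a) Z) * R S \<sigma> Z) Z = Aop rest (\<lambda>\<sigma> Z. ?Q a (\<sigma> a) Z * Mfac T u (insert i S) I \<sigma> Z) Z"
      by (simp add: MR Rins fac_def mult_ac)
    finally show ?thesis using False by simp
  qed
qed

text \<open>Summing over all permutations antisymmetrises in the column indices, so each application of
  a further derivative only contributes the diagonal terms.\<close>
lemma Aop_expand: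
  assumes "distinct (rest @ xs)" "Z \<in> siegel_H"
  shows "Aop (rest @ xs) (\<lambda>\<sigma>. u) Z = (\<Sum>S\<in>Pow (set xs). dco k xs S * Aop rest (Mfac T u S (set xs)) Z)"
  using assms
proof (induction xs arbitrary: rest)
  case Nil
  then show ?case by (simp add: Mfac_def[abs_def])
next
  case (Cons a xs)
  define I where "I = set xs"
  have Z: "Z \<in> siegel_H" by fact
  have a: "a \<notin> I" "a \<notin> set rest" "finite I" and dis: "\<And>i. i \<in> I \<Longrightarrow> i \<notin> set rest" and len: "length xs = card I"
    using Cons.prems by (auto simp: I_def distinct_card)
  define V where "V = (\<lambda>S. Aop rest (Mfac T u S (insert a I)) Z)"
  have VP: "Aop rest (\<lambda>\<sigma> Z. Pinv a (\<sigma> a) Z * Mfac T u S I \<sigma> Z) Z = V (insert a S)" for S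
  proof -
    have "Pinv a (\<sigma> a) Z * Mfac T u S I \<sigma> Z = Mfac T u (insert a S) (insert a I) \<sigma> Z" for \<sigma> Z
      using a by (auto simp: Mfac_def fac_def intro!: prod.cong)
    then show ?thesis unfolding V_def by presburger
  qed
  have VQ: "Aop rest (\<lambda>\<sigma> Z. Qinv T Z $ a $ (\<sigma> a) * Mfac T u S I \<sigma> Z) Z = V S" if "a \<notin> S" for S
  proof -
    have "Qinv T Z $ a $ (\<sigma> a) * Mfac T u S I \<sigma> Z = Mfac T u S (insert a I) \<sigma> Z" for \<sigma> Z
      using a that by (auto simp: Mfac_def fac_def intro!: prod.cong)
    then show ?thesis unfolding V_def by presburger
  qed
  have step: "Aop (rest @ [a]) (Mfac T u S I) Z
      = (- k + of_nat (card I) / 2) * V (insert a S) + 2 * of_real pi * \<i> * V S + (\<Sum>i\<in>I - S. V (insert i S)) / 2"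
    if S: "S \<subseteq> I" for S
  proof -
    have aS: "a \<notin> S" using S a by auto
    have "Aop (rest @ [a]) (Mfac T u S I) Z = Aop rest (\<lambda>\<sigma>. delta (Eab a (\<sigma> a)) (Mfac T u S I \<sigma>)) Z"
      by (simp add: Aop_def Dop_append Dop_Cons)
    also have "\<dots> = Aop rest (\<lambda>\<sigma> Z. - k * (Pinv a (\<sigma> a) Z * Mfac T u S I \<sigma> Z) + (2 * of_real pi * \<i> * (Qinv T Z $ a $ (\<sigma> a) * Mfac T u S I \<sigma> Z)
       + (\<Sum>i\<in>I. delta (Eab a (\<sigma> a)) (fac T S i (\<sigma> i)) Z * ((\<Prod>j\<in>I - {i}. fac T S j (\<sigma> j) Z) * u Z)))) Z"
      by (rule Aop_cong[OF _ Z]) (simp add: delta_Mfac)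
    also have "\<dots> = - k * Aop rest (\<lambda>\<sigma> Z. Pinv a (\<sigma> a) Z * Mfac T u S I \<sigma> Z) Z
       + (2 * of_real pi * \<i> * Aop rest (\<lambda>\<sigma> Z. Qinv T Z $ a $ (\<sigma> a) * Mfac T u S I \<sigma> Z) Z
       + (\<Sum>i\<in>I. Aop rest (\<lambda>\<sigma> Z. delta (Eab a (\<sigma> a)) (fac T S i (\<sigma> i)) Z * ((\<Prod>j\<in>I - {i}. fac T S j (\<sigma> j) Z) * u Z)) Z))"
      by ((subst Aop_add, (intro cholo_add cholo_mult cholo_const cholo_sum cholo_prod cholo_Pinv cholo_Qinv cholo_Mfac cholo_fac cholo_delta sym_Eab u Z)+)+,
         (subst Aop_sum Aop_cmult, (intro cholo_mult cholo_prod cholo_Pinv cholo_Qinv cholo_Mfac cholo_fac cholo_delta sym_Eab u Z)+)+, rule refl)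
    also have "(\<Sum>i\<in>I. Aop rest (\<lambda>\<sigma> Z. delta (Eab a (\<sigma> a)) (fac T S i (\<sigma> i)) Z * ((\<Prod>j\<in>I - {i}. fac T S j (\<sigma> j) Z) * u Z)) Z)
       = (\<Sum>i\<in>I. (1/2) * V (insert a S) + (if i \<in> S then 0 else (1/2) * V (insert i S)))"
    proof (rule sum.cong[OF refl])
      fix i assume i: "i \<in> I"
      then have ne: "a \<noteq> i" "a \<notin> insert i S" using a aS by auto
      show "Aop rest (\<lambda>\<sigma> Z. delta (Eab a (\<sigma> a)) (fac T S i (\<sigma> i)) Z * ((\<Prod>j\<in>I - {i}. fac T S j (\<sigma> j) Z) * u Z)) Z
        = (1/2) * V (insert a S) + (if i \<in> S then 0 else (1/2) * V (insert i S))"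
        unfolding Aop_factor_derivative[OF Z ne(1) a(2) dis[OF i] a(1) i] VP VQ[OF ne(2)] ..
    qed
    also have "\<dots> = of_nat (card I) / 2 * V (insert a S) + (\<Sum>i\<in>I - S. V (insert i S)) / 2"
    proof -
      have "(\<Sum>i\<in>I. if i \<in> S then 0 else (1/2) * V (insert i S)) = (\<Sum>i\<in>I - S. (1/2) * V (insert i S))"
        using a(3) by (intro sum.mono_neutral_cong_right) auto
      then show ?thesis by (simp add: sum.distrib sum_divide_distrib)
    qed
    finally show ?thesis unfolding VP VQ[OF aS] by (simp add: algebra_simps)
  qed
  have "Aop (rest @ a # xs) (\<lambda>\<sigma>. u) Z = (\<Sum>S\<in>Pow I. dco k xs S * Aop (rest @ [a]) (Mfac T u S I) Z)"
    using Cons.IH[of "rest @ [a]"] Cons.prems by (simp add: I_def)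
  also have "\<dots> = (\<Sum>S\<in>Pow I. dco k xs S * ((- k + of_nat (card I) / 2) * V (insert a S)
        + 2 * of_real pi * \<i> * V S + (\<Sum>i\<in>I - S. V (insert i S)) / 2))"
    by (intro sum.cong refl) (simp add: step)
  also have "\<dots> = (\<Sum>S\<in>Pow I. (- k + of_nat (card I) / 2) * dco k xs S * V (insert a S))
     + (\<Sum>S\<in>Pow I. 2 * of_real pi * \<i> * dco k xs S * V S)
     + (\<Sum>S\<in>Pow I. \<Sum>i\<in>I - S. dco k xs S * V (insert i S)) / 2"
    unfolding sum_divide_distrib sum.distrib[symmetric]
    by (intro sum.cong refl) (simp add: sum_distrib_left sum_divide_distrib algebra_simps)
  \<comment> \<open>Pairs (S, i) with i outside S are renamed to (S with i added, i); this produces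
    the sum over i in the recursion of \<open>dco\<close>.\<close>
  also have "(\<Sum>S\<in>Pow I. \<Sum>i\<in>I - S. dco k xs S * V (insert i S)) = (\<Sum>S\<in>Pow I. \<Sum>i\<in>S. dco k xs (S - {i}) * V S)"
    using a(3) unfolding sum.Sigma[of "Pow I"]
    by (subst sum.Sigma, simp, simp, subst sum.Sigma, simp, use finite_subset in blast)
       (rule sum.reindex_bij_witness[of _ "\<lambda>(S,i). (S - {i}, i)" "\<lambda>(S,i). (insert i S, i)"]; auto simp: insert_absorb)
  also have "(\<Sum>S\<in>Pow I. (- k + of_nat (card I) / 2) * dco k xs S * V (insert a S))
     + (\<Sum>S\<in>Pow I. 2 * of_real pi * \<i> * dco k xs S * V S)
     + (\<Sum>S\<in>Pow I. \<Sum>i\<in>S. dco k xs (S - {i}) * V S) / 2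
     = (\<Sum>S\<in>Pow I. dco k (a # xs) S * V S) + (\<Sum>S\<in>Pow I. dco k (a # xs) (insert a S) * V (insert a S))"
  proof -
    have "dco k (a # xs) (insert a S) = (- k + of_nat (card I) / 2) * dco k xs S" if "S \<in> Pow I" for S
    proof -
      have "insert a S - {a} = S" using that a by auto
      then show ?thesis by (simp add: len)
    qed
    moreover have "dco k (a # xs) S * V S = 2 * of_real pi * \<i> * dco k xs S * V S + (\<Sum>i\<in>S. dco k xs (S - {i}) * V S) / 2"
      if "S \<in> Pow I" for S
      using that a by (auto simp: sum_distrib_right sum_divide_distrib distrib_right)
    ultimately show ?thesis by (simp add: sum.distrib sum_divide_distrib)
  qed
  \<comment> \<open>Subsets of the enlarged set are split by whether they contain the new row
    a.\<close>
  also have "\<dots> = (\<Sum>S\<in>Pow (insert a I). dco k (a # xs) S * V S)"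
  proof -
    have inj: "inj_on (insert a) (Pow I)" using a by (auto simp: inj_on_def)
    have "Pow I \<inter> insert a ` Pow I = {}" using a by auto
    then show ?thesis unfolding Pow_insert using a inj
      by (subst sum.union_disjoint) (auto simp: sum.reindex)
  qed
  finally show ?case by (simp add: V_def I_def)
qed

end

subsection \<open>Lattice sums weighted by determinants\<close>

text \<open>A common index set for the two expansions to be compared: linear changes of variable
  take the frequencies out of \<open>Lambda\<close> but leave them semidefinite with a fixed
  denominator.\<close>

definition Lq :: "nat \<Rightarrow> (real^('n::finite)^'n) set" where
  "Lq q = {T. pos_semidef T \<and> (\<forall>i j. real q * T$i$j \<in> \<int>)}"

lemma LqD: "T \<in> Lq q \<Longrightarrow> pos_semidef T" "T \<in> Lq q \<Longrightarrow> sym_mat T" "T \<in> Lq q \<Longrightarrow> real q * T$i$j \<in> \<int>"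
  by (auto simp: Lq_def pos_semidef_def)

lemma infsum_finite_sum:
  fixes f :: "'i \<Rightarrow> 'b \<Rightarrow> complex"
  assumes "finite I" "\<And>i. i \<in> I \<Longrightarrow> f i summable_on A"
  shows "(\<Sum>i\<in>I. infsum (f i) A) = infsum (\<lambda>x. \<Sum>i\<in>I. f i x) A \<and> (\<lambda>x. \<Sum>i\<in>I. f i x) summable_on A"
  using assms by (induction I rule: finite_induct) (auto simp: infsum_add summable_on_add)

lemma norm_infsum_le_infsum:
  fixes f :: "'i \<Rightarrow> complex"
  assumes "g summable_on A" "\<And>x. x \<in> A \<Longrightarrow> norm (f x) \<le> g x"
  shows "norm (infsum f A) \<le> infsum g A"
proof -
  have s: "(\<lambda>x. norm (f x)) summable_on A"
    by (rule Infinite_Sum.abs_summable_on_comparison_test'[OF assms])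
  have "norm (infsum f A) \<le> (\<Sum>\<^sub>\<infinity>x\<in>A. norm (f x))" by (rule norm_infsum_bound[OF s])
  also have "\<dots> \<le> infsum g A" by (rule infsum_mono[OF s assms])
  finally show ?thesis .
qed

text \<open>For t > 0 the constant is the maximum of s^t exp(-bs), attained at s = t/b.\<close>

lemma powr_le_exp:
  fixes t b :: real
  assumes "t \<ge> 0" "b > 0"
  obtains C where "C > 0" "\<And>s. s \<ge> 0 \<Longrightarrow> s powr t \<le> C * exp (b * s)"
proof (cases "t = 0")
  case True
  have "s powr t \<le> 1 * exp (b * s)" if "s \<ge> 0" for s using True that assms by (auto simp: powr_def)
  then show ?thesis using that[of 1] by simp
next
  case False
  then have t: "t > 0" using assms by simp
  define C where "C = exp (t * ln (t / b) - t)"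
  have "s powr t \<le> C * exp (b * s)" if s: "s \<ge> 0" for s
  proof (cases "s = 0")
    case True then show ?thesis using t by (simp add: C_def)
  next
    case False
    then have s: "s > 0" using s by simp
    have "ln (b * s / t) \<le> b * s / t - 1" using s t assms by (intro ln_le_minus_one) simp
    then have "t * ln (b * s / t) \<le> t * (b * s / t - 1)" using t by (intro mult_left_mono) auto
    also have "\<dots> = b * s - t" using t by (simp add: field_simps)
    also have "ln (b * s / t) = ln s - ln (t / b)" using s t assms by (simp add: ln_mult ln_div)
    finally have "t * ln s \<le> (t * ln (t / b) - t) + b * s" by (simp add: algebra_simps)
    then have "exp (t * ln s) \<le> exp ((t * ln (t / b) - t) + b * s)" by simp
    then show ?thesis using s by (simp add: powr_def C_def exp_add)
  qed
  moreover have "C > 0" by (simp add: C_def)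
  ultimately show ?thesis using that by blast
qed

text \<open>Hadamard's bound up to the factor n!: each Leibniz term is at most a product of square
  roots of diagonal entries in which every index occurs twice.\<close>

lemma det_le_diag_prod:
  fixes T :: "real^'n^'n"
  assumes "pos_semidef T"
  shows "\<bar>det T\<bar> \<le> fact CARD('n) * (\<Prod>i\<in>UNIV. T$i$i)"
proof -
  have "\<bar>det T\<bar> \<le> (\<Sum>\<sigma> | \<sigma> permutes (UNIV::'n set). \<bar>of_int (sign \<sigma>) * (\<Prod>i\<in>UNIV. T$i$\<sigma> i)\<bar>)"
    unfolding det_def by (rule sum_abs)
  also have "\<dots> \<le> (\<Sum>\<sigma> | \<sigma> permutes (UNIV::'n set). (\<Prod>i\<in>UNIV. T$i$i))"
  proof (rule sum_mono)
    fix \<sigma> :: "'n \<Rightarrow> 'n" assume "\<sigma> \<in> {\<sigma>. \<sigma> permutes UNIV}"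
    then have \<sigma>: "\<sigma> permutes UNIV" by simp
    have "\<bar>of_int (sign \<sigma>) * (\<Prod>i\<in>UNIV. T$i$\<sigma> i)\<bar> = (\<Prod>i\<in>UNIV. \<bar>T$i$\<sigma> i\<bar>)"
      by (simp add: abs_mult abs_prod sign_def)
    also have "\<dots> \<le> (\<Prod>i\<in>UNIV. sqrt (T$i$i) * sqrt (T$\<sigma> i$\<sigma> i))"
      by (intro prod_mono) (auto intro: pos_semidef_entry_le[OF assms])
    also have "\<dots> = (\<Prod>i\<in>UNIV. sqrt (T$i$i)) * (\<Prod>i\<in>UNIV. sqrt (T$\<sigma> i$\<sigma> i))" by (rule prod.distrib)
    also have "(\<Prod>i\<in>UNIV. sqrt (T$\<sigma> i$\<sigma> i)) = (\<Prod>i\<in>UNIV. sqrt (T$i$i))"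
      using prod.permute[OF \<sigma>, of "\<lambda>i. sqrt (T$i$i)"] by (simp add: o_def)
    also have "(\<Prod>i\<in>UNIV. sqrt (T$i$i)) * (\<Prod>i\<in>UNIV. sqrt (T$i$i)) = (\<Prod>i\<in>UNIV. T$i$i)"
      unfolding prod.distrib[symmetric] using pos_semidef_diag[OF assms] by simp
    finally show "\<bar>of_int (sign \<sigma>) * (\<Prod>i\<in>UNIV. T$i$\<sigma> i)\<bar> \<le> (\<Prod>i\<in>UNIV. T$i$i)" .
  qed
  also have "\<dots> = fact CARD('n) * (\<Prod>i\<in>UNIV. T$i$i)"
    by (simp add: card_permutations[OF refl finite_class.finite_UNIV])
  finally show ?thesis .
qed

text \<open>The trace of T against the diagonal matrix with entry 1/y at p and 1 elsewhere. Up to a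
  constant it bounds the imaginary part of the exponent from below at the points where y tends to
  infinity.\<close>

definition sy :: "'n \<Rightarrow> real \<Rightarrow> real^('n::finite)^'n \<Rightarrow> real" where
  "sy p y T = (\<Sum>i\<in>UNIV. T$i$i * (if i = p then 1 / y else 1))"

text \<open>Rescaling row and column p by the square root of 1/y keeps T semidefinite and gives it
  the trace \<open>sy p y T\<close>, which bounds all its entries.\<close>

lemma sy_entry:
  assumes T: "pos_semidef T" and y: "y \<ge> 1"
  shows "sqrt (if i = p then 1/y else 1) * sqrt (if j = p then 1/y else 1) * \<bar>T$i$j\<bar> \<le> sy p y T"
proof -
  define d where "d = (\<lambda>i::'a. if i = p then 1/y else (1::real))"
  have d: "d i \<ge> 0" for i using y by (simp add: d_def)
  have sd: "sy p y T = (\<Sum>i\<in>UNIV. T$i$i * d i)" by (simp add: sy_def d_def)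
  have e: "T$i$i * d i \<le> sy p y T" for i
    unfolding sd by (rule member_le_sum) (auto simp: d pos_semidef_diag[OF T])
  have e0: "0 \<le> sy p y T" unfolding sy_def using y by (intro sum_nonneg) (auto simp: pos_semidef_diag[OF T])
  have "sqrt (d i) * sqrt (d j) * \<bar>T$i$j\<bar> \<le> sqrt (d i) * sqrt (d j) * (sqrt (T$i$i) * sqrt (T$j$j))"
    by (intro mult_left_mono pos_semidef_entry_le[OF T] mult_nonneg_nonneg) (auto simp: d)
  also have "\<dots> = sqrt (T$i$i * d i) * sqrt (T$j$j * d j)" by (simp add: real_sqrt_mult)
  also have "\<dots> \<le> sqrt (sy p y T) * sqrt (sy p y T)"
    using e e0 pos_semidef_diag[OF T] d by (intro mult_mono) (auto simp: real_sqrt_le_iff)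
  also have "\<dots> = sy p y T" using e0 by simp
  finally show ?thesis by (simp add: d_def)
qed

lemma sy_nonneg: "pos_semidef T \<Longrightarrow> y \<ge> 1 \<Longrightarrow> sy p y T \<ge> 0"
  unfolding sy_def by (intro sum_nonneg) (auto simp: pos_semidef_diag)

text \<open>For bounded x a two-sided geometric series costs at most a constant times 1/x; the
  powers of y in the lattice estimate arise from this.\<close>

lemma one_minus_exp_ge: "(x::real) > 0 \<Longrightarrow> 2 / (1 - exp (- x)) \<le> 2 * (1 + x) / x"
proof -
  assume x: "x > 0"
  have "1 + x \<le> exp x" by (rule exp_ge_add_one_self)
  then have "exp (- x) \<le> 1 / (1 + x)" using x by (simp add: exp_minus field_simps)
  then have "x / (1 + x) \<le> 1 - exp (- x)" using x by (simp add: field_simps)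
  moreover have "0 < x / (1 + x)" using x by simp
  ultimately have "2 / (1 - exp (- x)) \<le> 2 / (x / (1 + x))" using x by (intro divide_left_mono mult_pos_pos) auto
  then show ?thesis by simp
qed

text \<open>The row of index p of T has entries of size up to the square root of y, its diagonal entry up to
  y; the number of relevant T therefore grows like the power y to the (n+1)/2.\<close>
lemma lattice_det_sum:
  fixes p :: "'n::finite"
  assumes q: "q > 0" and a: "a > 0" and \<gamma>: "\<gamma> \<ge> 0"
  obtains C where "\<And>y A. y \<ge> 1 \<Longrightarrow> finite A \<Longrightarrow> A \<subseteq> Lq q \<Longrightarrow>
    (\<Sum>T\<in>A. \<bar>det T\<bar> powr \<gamma> * exp (- a * sy p y T)) \<le> C * y powr (\<gamma> + (real CARD('n) + 1) / 2)"
proof -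
  let ?n = "CARD('n)"
  obtain C1 where C1: "C1 > 0" "\<And>s. s \<ge> 0 \<Longrightarrow> s powr (real ?n * \<gamma>) \<le> C1 * exp (a/2 * s)"
    using powr_le_exp[of "real ?n * \<gamma>" "a/2"] a \<gamma> by auto
  define N :: real where "N = (real ?n)^2"
  have N: "N > 0" by (simp add: N_def)
  \<comment> \<open>Chosen so that the weights on at most n^2 coordinates use half of the
    exponential; the other half absorbs the power of the determinant.\<close>
  define D where "D = a / (2 * real q * N)"
  have D: "D > 0" using a q N by (simp add: D_def)
  let ?B = "\<lambda>i j. axis i (axis j 1) :: real^'n^'n"
  have Bij: "T \<bullet> ?B i j = T$i$j" for T i j by (simp add: inner_axis)
  have Binj: "?B i j = ?B k l \<longleftrightarrow> i = k \<and> j = l" for i j k l by (auto simp: axis_eq_axis)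
  have Bas: "(Basis :: (real^'n^'n) set) = (\<lambda>(i,j). ?B i j) ` UNIV"
    unfolding Basis_vec_def by auto
  \<comment> \<open>Row p together with the block away from p; column p is its mirror image. Listing
    column p as well would double the (n-1)/2 powers of y that come from the off-diagonal entries of
    row p.\<close>
  define K0 where "K0 = {(i,j). i = p \<or> j \<noteq> p}"
  define K where "K = (\<lambda>(i,j). ?B i j) ` K0"
  have injK: "inj_on (\<lambda>(i,j). ?B i j) X" for X by (auto simp: inj_on_def Binj)
  have KB: "K \<subseteq> Basis" unfolding K_def Bas by auto
  have fK: "finite K0" by simp
  \<comment> \<open>One factor y^(-1/2) for each index equal to p, the reciprocal of the size that
    this entry of T may have.\<close>
  define \<omega> where "\<omega> = (\<lambda>y (i,j). sqrt (if i = p then 1/y else 1) * sqrt (if j = p then 1/y else (1::real)))"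
  define w where "w = (\<lambda>y b. D * \<omega> y (inv_into UNIV (\<lambda>(i,j). ?B i j) b))"
  have w: "w y (?B i j) = D * \<omega> y (i,j)" for y i j
    unfolding w_def using inv_into_f_f[OF injK[of UNIV], of "(i,j)"] by simp
  define C2 where "C2 = (2 * (1 + D) / D) ^ card K0"
  have key: "(\<Sum>T\<in>A. \<bar>det T\<bar> powr \<gamma> * exp (- a * sy p y T))
      \<le> (fact ?n powr \<gamma> * C1 * C2) * y powr (\<gamma> + (real ?n + 1) / 2)"
    if y: "y \<ge> 1" and A: "finite A" "A \<subseteq> Lq q" for y and A :: "(real^'n^'n) set"
  proof -
    have \<omega>: "0 < \<omega> y ij" "\<omega> y ij \<le> 1" for ij using y by (auto simp: \<omega>_def split: prod.splits)
    define A' where "A' = (\<lambda>T. real q *\<^sub>R T) ` A"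
    have inj: "inj_on (\<lambda>T. real q *\<^sub>R T) A" using q by (auto simp: inj_on_def)
    have b1: "\<bar>det T\<bar> powr \<gamma> * exp (- a * sy p y T) \<le> (fact ?n powr \<gamma> * y powr \<gamma> * C1) * exp (- (\<Sum>b\<in>K. w y b * \<bar>(real q *\<^sub>R T) \<bullet> b\<bar>))"
      if T: "T \<in> A" for T
    proof -
      have Tp: "pos_semidef T" using T A LqD by blast
      define s where "s = sy p y T"
      have s0: "s \<ge> 0" unfolding s_def by (rule sy_nonneg[OF Tp y])
      have "(\<Prod>i\<in>UNIV. T$i$i) = (\<Prod>i\<in>UNIV. (T$i$i * (if i = p then 1/y else 1)) * (if i = p then y else 1))"
        using y by (intro prod.cong) auto
      also have "\<dots> = (\<Prod>i\<in>UNIV. T$i$i * (if i = p then 1/y else 1)) * y"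
        by (simp add: prod.distrib)
      also have "\<dots> \<le> s ^ ?n * y"
      proof (rule mult_right_mono)
        have "T$i$i * (if i = p then 1/y else 1) \<le> s" for i
        proof -
          have "sqrt (if i = p then 1/y else 1) * sqrt (if i = p then 1/y else 1) * \<bar>T$i$i\<bar> \<le> s"
            unfolding s_def by (rule sy_entry[OF Tp y])
          then show ?thesis using pos_semidef_diag[OF Tp, of i] y by (simp add: mult.commute split: if_splits)
        qed
        then have "(\<Prod>i\<in>(UNIV::'n set). T$i$i * (if i = p then 1/y else 1)) \<le> (\<Prod>i\<in>(UNIV::'n set). s)"
          using y by (intro prod_mono) (auto simp: pos_semidef_diag[OF Tp])
        then show "(\<Prod>i\<in>UNIV. T$i$i * (if i = p then 1/y else 1)) \<le> s ^ ?n" by simp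
      qed (use y in simp)
      finally have "\<bar>det T\<bar> \<le> fact ?n * (s ^ ?n * y)"
        using det_le_diag_prod[OF Tp] by (meson fact_ge_zero mult_left_mono order_trans)
      then have "\<bar>det T\<bar> powr \<gamma> \<le> (fact ?n * (s ^ ?n * y)) powr \<gamma>" using \<gamma> by (intro powr_mono2) auto
      also have "\<dots> = fact ?n powr \<gamma> * y powr \<gamma> * (s ^ ?n) powr \<gamma>"
        using s0 y by (simp add: powr_mult mult_ac)
      also have "(s ^ ?n) powr \<gamma> \<le> C1 * exp (a/2 * s)"
      proof (cases "s = 0")
        case True then show ?thesis using C1 by (simp add: zero_power)
      next
        case False
        then have "(s ^ ?n) powr \<gamma> = s powr (real ?n * \<gamma>)" using s0 by (simp add: powr_powr flip: powr_realpow)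
        then show ?thesis using C1(2)[OF s0] by simp
      qed
      finally have 1: "\<bar>det T\<bar> powr \<gamma> \<le> fact ?n powr \<gamma> * y powr \<gamma> * (C1 * exp (a/2 * s))"
        by (simp add: mult_left_mono)
      have 2: "(\<Sum>b\<in>K. w y b * \<bar>(real q *\<^sub>R T) \<bullet> b\<bar>) \<le> a/2 * s"
      proof -
        have "(\<Sum>b\<in>K. w y b * \<bar>(real q *\<^sub>R T) \<bullet> b\<bar>) = (\<Sum>(i,j)\<in>K0. D * real q * (\<omega> y (i,j) * \<bar>T$i$j\<bar>))"
          unfolding K_def using q by (subst sum.reindex[OF injK]) (auto simp: case_prod_beta w Bij abs_mult mult_ac intro!: sum.cong)
        also have "\<dots> \<le> (\<Sum>(i,j)\<in>K0. D * real q * s)"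
          using D q sy_entry[OF Tp y] by (intro sum_mono) (auto simp: \<omega>_def s_def intro!: mult_left_mono)
        also have "\<dots> = real (card K0) * (D * real q * s)" by simp
        also have "\<dots> \<le> N * (D * real q * s)"
        proof (rule mult_right_mono)
          have "card K0 \<le> card (UNIV :: ('n \<times> 'n) set)" by (intro card_mono) auto
          also have "card (UNIV :: ('n \<times> 'n) set) = ?n * ?n" using card_cartesian_product[of "UNIV::'n set" "UNIV::'n set"] by simp
          finally show "real (card K0) \<le> N" by (simp add: N_def power2_eq_square flip: of_nat_mult)
        qed (use D q s0 in simp)
        also have "\<dots> = a/2 * s" using q N by (simp add: D_def)
        finally show ?thesis .
      qed
      have "\<bar>det T\<bar> powr \<gamma> * exp (- a * s) \<le> fact ?n powr \<gamma> * y powr \<gamma> * (C1 * exp (a/2 * s)) * exp (- a * s)"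
        by (rule mult_right_mono[OF 1]) simp
      also have "\<dots> = fact ?n powr \<gamma> * y powr \<gamma> * C1 * exp (- (a/2 * s))"
        by (simp add: mult.assoc flip: exp_add)
      also have "\<dots> \<le> fact ?n powr \<gamma> * y powr \<gamma> * C1 * exp (- (\<Sum>b\<in>K. w y b * \<bar>(real q *\<^sub>R T) \<bullet> b\<bar>))"
        using 2 C1 by (intro mult_left_mono) auto
      finally show ?thesis by (simp add: s_def)
    qed
    have "(\<Sum>T\<in>A. exp (- (\<Sum>b\<in>K. w y b * \<bar>(real q *\<^sub>R T) \<bullet> b\<bar>))) = (\<Sum>m\<in>A'. exp (- (\<Sum>b\<in>K. w y b * \<bar>m \<bullet> b\<bar>)))"
      unfolding A'_def by (simp add: sum.reindex[OF inj])
    also have "\<dots> \<le> (\<Prod>b\<in>K. 2 / (1 - exp (- w y b)))"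
    proof (rule lattice_exp_sum_le[OF _ _ KB])
      show "finite A'" using A by (simp add: A'_def)
      have "real q * T$i$j \<in> \<int>" if "T \<in> A" for T i j using that A(2) LqD(3) by blast
      then show "A' \<subseteq> zlat" unfolding A'_def zlat_def Bas by (auto simp: Bij)
      show "w y b > 0" if "b \<in> K" for b using that D \<omega> by (auto simp: K_def w)
      fix m m' assume m: "m \<in> A'" "m' \<in> A'" and eq: "\<And>b. b \<in> K \<Longrightarrow> m \<bullet> b = m' \<bullet> b"
      have sm: "sym_mat m" if m: "m \<in> A'" for m
      proof -
        obtain T where T: "T \<in> A" "m = real q *\<^sub>R T" using m by (auto simp: A'_def)
        then have "sym_mat T" using A(2) LqD(2) by blast
        then show ?thesis using T(2) by (simp add: sym_mat_iff)
      qed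
      have eq': "m$i$j = m'$i$j" if "(i,j) \<in> K0" for i j
      proof -
        have "?B i j \<in> K" unfolding K_def using that by (intro image_eqI[of _ _ "(i,j)"]) auto
        from eq[OF this] show ?thesis by (simp only: Bij)
      qed
      have "m$i$j = m'$i$j" for i j
      proof (cases "(i,j) \<in> K0")
        case False
        then have "(j,i) \<in> K0" by (auto simp: K0_def)
        then show ?thesis using eq' sym_matD[OF sm[OF m(1)], of i j] sym_matD[OF sm[OF m(2)], of i j] by metis
      qed (rule eq')
      then show "m = m'" by (simp add: vec_eq_iff)
    qed
    also have "\<dots> = (\<Prod>ij\<in>K0. 2 / (1 - exp (- (D * \<omega> y ij))))"
      unfolding K_def by (subst prod.reindex[OF injK]) (auto simp: w case_prod_beta)
    also have "\<dots> \<le> (\<Prod>ij\<in>K0. (2 * (1 + D) / D) * (1 / \<omega> y ij))"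
    proof (intro prod_mono conjI)
      fix ij
      have x: "D * \<omega> y ij > 0" "D * \<omega> y ij \<le> D" using D \<omega>[of ij] by (auto simp: mult_le_cancel_left1)
      show "0 \<le> 2 / (1 - exp (- (D * \<omega> y ij)))" using x by simp
      have "2 / (1 - exp (- (D * \<omega> y ij))) \<le> 2 * (1 + D * \<omega> y ij) / (D * \<omega> y ij)" by (rule one_minus_exp_ge[OF x(1)])
      also have "\<dots> \<le> 2 * (1 + D) / (D * \<omega> y ij)" using x by (intro divide_right_mono) auto
      finally show "2 / (1 - exp (- (D * \<omega> y ij))) \<le> (2 * (1 + D) / D) * (1 / \<omega> y ij)" by simp
    qed
    also have "\<dots> = C2 * (\<Prod>ij\<in>K0. 1 / \<omega> y ij)" unfolding C2_def by (simp only: prod.distrib prod_constant)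
    \<comment> \<open>The entry (p, p) contributes y, each of the other n - 1 entries of row p a
      square root of y, and the rest nothing.\<close>
    also have "(\<Prod>ij\<in>K0. 1 / \<omega> y ij) = y powr ((real ?n + 1) / 2)"
    proof -
      have "K0 = {(p,p)} \<union> (Pair p ` (UNIV - {p}) \<union> (UNIV - {p}) \<times> (UNIV - {p}))" by (auto simp: K0_def)
      then have "(\<Prod>ij\<in>K0. 1 / \<omega> y ij) = (\<Prod>ij\<in>{(p,p)} \<union> (Pair p ` (UNIV - {p}) \<union> (UNIV - {p}) \<times> (UNIV - {p})). 1 / \<omega> y ij)" by simp
      also have "\<dots> = (1 / \<omega> y (p,p)) * ((\<Prod>ij\<in>Pair p ` (UNIV - {p}). 1 / \<omega> y ij) * (\<Prod>ij\<in>(UNIV - {p}) \<times> (UNIV - {p}). 1 / \<omega> y ij))"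
      proof -
        have 1: "(\<Prod>ij\<in>Pair p ` (UNIV - {p}) \<union> (UNIV - {p}) \<times> (UNIV - {p}). 1 / \<omega> y ij)
            = (\<Prod>ij\<in>Pair p ` (UNIV - {p}). 1 / \<omega> y ij) * (\<Prod>ij\<in>(UNIV - {p}) \<times> (UNIV - {p}). 1 / \<omega> y ij)"
          by (rule prod.union_disjoint) auto
        have 2: "(\<Prod>ij\<in>{(p,p)} \<union> (Pair p ` (UNIV - {p}) \<union> (UNIV - {p}) \<times> (UNIV - {p})). 1 / \<omega> y ij)
            = (\<Prod>ij\<in>{(p,p)}. 1 / \<omega> y ij) * (\<Prod>ij\<in>Pair p ` (UNIV - {p}) \<union> (UNIV - {p}) \<times> (UNIV - {p}). 1 / \<omega> y ij)"
          by (rule prod.union_disjoint) auto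
        show ?thesis unfolding 2 1 by simp
      qed
      also have "(\<Prod>ij\<in>(UNIV - {p}) \<times> (UNIV - {p}). 1 / \<omega> y ij) = 1" by (rule prod.neutral) (auto simp: \<omega>_def)
      also have "(\<Prod>ij\<in>Pair p ` (UNIV - {p}). 1 / \<omega> y ij) = (\<Prod>j\<in>UNIV - {p}. sqrt y)"
        by (subst prod.reindex) (auto simp: inj_on_def \<omega>_def real_sqrt_divide)
      also have "\<dots> = sqrt y ^ (?n - 1)" by (simp add: card_Diff_singleton)
      also have "1 / \<omega> y (p,p) = y" using y by (simp add: \<omega>_def)
      also have "y * (sqrt y ^ (?n - 1) * 1) = y powr 1 * (y powr (1/2)) powr real (?n - 1)"
      proof -
        have "sqrt y powr real (?n - 1) = sqrt y ^ (?n - 1)" by (rule powr_realpow) (use y in simp)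
        moreover have "y powr (1/2) = sqrt y" "y powr 1 = y" using y by (simp_all add: powr_half_sqrt)
        ultimately show ?thesis by (simp only: mult_1_right)
      qed
      also have "\<dots> = y powr (1 + (1/2) * real (?n - 1))" by (simp add: powr_powr powr_add)
      also have "1 + (1/2) * real (?n - 1) = (real ?n + 1) / 2"
      proof -
        have "real (?n - 1) = real ?n - 1" by (simp add: of_nat_diff Suc_leI)
        then show ?thesis by (simp add: field_simps)
      qed
      finally show ?thesis .
    qed
    finally have 3: "(\<Sum>T\<in>A. exp (- (\<Sum>b\<in>K. w y b * \<bar>(real q *\<^sub>R T) \<bullet> b\<bar>))) \<le> C2 * y powr ((real ?n + 1) / 2)" .
    have "(\<Sum>T\<in>A. \<bar>det T\<bar> powr \<gamma> * exp (- a * sy p y T))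
       \<le> (\<Sum>T\<in>A. (fact ?n powr \<gamma> * y powr \<gamma> * C1) * exp (- (\<Sum>b\<in>K. w y b * \<bar>(real q *\<^sub>R T) \<bullet> b\<bar>)))"
      by (rule sum_mono[OF b1])
    also have "\<dots> = (fact ?n powr \<gamma> * y powr \<gamma> * C1) * (\<Sum>T\<in>A. exp (- (\<Sum>b\<in>K. w y b * \<bar>(real q *\<^sub>R T) \<bullet> b\<bar>)))"
      by (simp add: sum_distrib_left)
    also have "\<dots> \<le> (fact ?n powr \<gamma> * y powr \<gamma> * C1) * (C2 * y powr ((real ?n + 1) / 2))"
      using C1 by (intro mult_left_mono[OF 3]) auto
    also have "\<dots> = (fact ?n powr \<gamma> * C1 * C2) * y powr (\<gamma> + (real ?n + 1) / 2)"
      by (simp add: powr_add mult_ac)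
    finally show ?thesis .
  qed
  show ?thesis by (rule that[OF key])
qed

section \<open>The expanded operator at diagonal points\<close>

lemma det_row_col_scale:
  fixes A :: "complex^'n^'n"
  shows "det (\<chi> i j. a i * A$i$j * b j) = (\<Prod>i\<in>UNIV. a i) * (\<Prod>i\<in>UNIV. b i) * det A"
proof -
  have "of_int (sign \<sigma>) * (\<Prod>i\<in>UNIV. (\<chi> i j. a i * A$i$j * b j) $ i $ \<sigma> i)
      = (\<Prod>i\<in>UNIV. a i) * (\<Prod>i\<in>UNIV. b i) * (of_int (sign \<sigma>) * (\<Prod>i\<in>UNIV. A$i$\<sigma> i))"
    if "\<sigma> \<in> {\<sigma>. \<sigma> permutes (UNIV::'n set)}" for \<sigma>
  proof -
    have "(\<Prod>i\<in>UNIV. b (\<sigma> i)) = (\<Prod>i\<in>UNIV. b i)" using prod.permute[of \<sigma> UNIV b] that by (simp add: o_def)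
    then show ?thesis by (simp add: prod.distrib mult_ac)
  qed
  then show ?thesis unfolding det_def sum_distrib_left by (intro sum.cong refl)
qed

text \<open>The operator sum obtained from the Capelli type expansion, as a polynomial in T and the inverse of Z.\<close>
definition Pol :: "complex \<Rightarrow> 'n list \<Rightarrow> real^('n::finite)^'n \<Rightarrow> 'n cmat \<Rightarrow> complex" where
  "Pol k xs T Z = (\<Sum>S\<in>Pow UNIV. dco k xs S * (\<Sum>\<sigma> | \<sigma> permutes UNIV. of_int (sign \<sigma>) * (\<Prod>i\<in>UNIV. fac T S i (\<sigma> i) Z)))"

text \<open>The principal minor of T on the complement of S, kept at full size by unit rows for the
  indices in S.\<close>

definition wminor :: "'n set \<Rightarrow> real^('n::finite)^'n \<Rightarrow> complex" where
  "wminor S T = det (\<chi> i j. if i \<in> S then (if i = j then 1 else 0) else of_real (T$i$j))"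

text \<open>With Z^(-1) = -diag(v), column j of every mixed matrix has the factor v_j, and row i has
  the factor v_i, or the sign -1 if i lies in S. Hence the product of all v_i comes out of every
  term.\<close>

lemma Pol_diag:
  assumes V: "matrix_inv Z = - (\<chi> i j. if i = j then v i else 0)"
  shows "Pol k xs T Z = (\<Sum>S\<in>Pow UNIV. dco k xs S * ((\<Prod>i\<in>UNIV. if i \<in> S then -1 else v i) * (\<Prod>i\<in>UNIV. v i) * wminor S T))"
  unfolding Pol_def
proof (intro sum.cong refl arg_cong2[where f = "(*)"])
  fix S :: "'a set"
  have Q: "Qinv T Z $ i $ j = v i * of_real (T$i$j) * v j" for i j
    unfolding Qinv_def matrix_mult3_nth V by (simp add: if_distrib if_distribR cong: if_cong)
  have "(\<Sum>\<sigma> | \<sigma> permutes UNIV. of_int (sign \<sigma>) * (\<Prod>i\<in>UNIV. fac T S i (\<sigma> i) Z)) = det (\<chi> i j. fac T S i j Z)"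
    by (simp add: det_def)
  also have "(\<chi> i j. fac T S i j Z) = (\<chi> i j. (if i \<in> S then -1 else v i) * (\<chi> i j. if i \<in> S then (if i = j then 1 else 0) else of_real (T$i$j)) $ i $ j * v j)"
    by (simp add: vec_eq_iff fac_def Q V)
  also have "det \<dots> = (\<Prod>i\<in>UNIV. if i \<in> S then -1 else v i) * (\<Prod>i\<in>UNIV. v i) * wminor S T"
    unfolding wminor_def by (rule det_row_col_scale)
  finally show "(\<Sum>\<sigma> | \<sigma> permutes UNIV. of_int (sign \<sigma>) * (\<Prod>i\<in>UNIV. fac T S i (\<sigma> i) Z))
     = (\<Prod>i\<in>UNIV. if i \<in> S then -1 else v i) * (\<Prod>i\<in>UNIV. v i) * wminor S T" .
qed

lemma norm_det_le:
  fixes A :: "complex^'n^'n"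
  assumes "\<And>i j. norm (A$i$j) \<le> B"
  shows "norm (det A) \<le> fact CARD('n) * B ^ CARD('n)"
proof -
  have "norm (det A) \<le> (\<Sum>\<sigma> | \<sigma> permutes (UNIV::'n set). norm (of_int (sign \<sigma>) * (\<Prod>i\<in>UNIV. A$i$\<sigma> i)))"
    unfolding det_def by (rule norm_sum)
  also have "\<dots> \<le> (\<Sum>\<sigma> | \<sigma> permutes (UNIV::'n set). B ^ CARD('n))"
  proof (rule sum_mono)
    fix \<sigma> :: "'n \<Rightarrow> 'n"
    have "norm (of_int (sign \<sigma>) * (\<Prod>i\<in>UNIV. A$i$\<sigma> i)) = (\<Prod>i\<in>UNIV. norm (A$i$\<sigma> i))"
      by (simp add: norm_mult prod_norm sign_def)
    also have "\<dots> \<le> (\<Prod>i\<in>(UNIV::'n set). B)" by (intro prod_mono) (auto simp: assms)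
    finally show "norm (of_int (sign \<sigma>) * (\<Prod>i\<in>UNIV. A$i$\<sigma> i)) \<le> B ^ CARD('n)" by simp
  qed
  also have "\<dots> = fact CARD('n) * B ^ CARD('n)"
    by (simp add: card_permutations[OF refl finite_class.finite_UNIV])
  finally show ?thesis .
qed

lemma norm_wminor_le:
  fixes T :: "real^'n^'n"
  assumes "pos_semidef T"
  shows "norm (wminor S T) \<le> fact CARD('n) * (1 + trace T) ^ CARD('n)"
  unfolding wminor_def
proof (rule norm_det_le)
  fix i j
  have "\<bar>T$i$j\<bar> \<le> trace T" "0 \<le> trace T"
    using assms by (auto intro: pos_semidef_entry_trace pos_semidef_trace_nonneg)
  then show "norm ((\<chi> i j. if i \<in> S then (if i = j then 1 else 0) else complex_of_real (T$i$j)) $ i $ j) \<le> 1 + trace T"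
    by simp
qed

lemma wminor_UNIV: "wminor UNIV T = 1"
proof -
  have "(\<chi> i j. if i = j then 1 else 0) = (mat 1 :: complex^'a^'a)" by (simp add: mat_def)
  then show ?thesis by (simp add: wminor_def)
qed

text \<open>A semidefinite T with T_pp = 0 has zero row p, so for it only the sets S containing p
  survive.\<close>

lemma wminor_zero_row:
  assumes "p \<notin> S" "\<And>j. T$p$j = 0" shows "wminor S T = 0"
  unfolding wminor_def det_def
  by (intro sum.neutral ballI) (use assms in \<open>auto intro!: prod_zero bexI[of _ p]\<close>)

subsection \<open>Vanishing of the singular part\<close>

text \<open>At a zero of a nonnegative form the first-order term must vanish in every direction y;
  otherwise a suitable multiple of y would make the form negative.\<close>

lemma pos_semidef_kernel:
  fixes T :: "real^'n^'n"
  assumes T: "pos_semidef T" and x: "x \<bullet> (T *v x) = 0"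
  shows "T *v x = 0"
proof -
  have sT: "transpose T = T" using T by (simp add: pos_semidef_def sym_mat_def)
  have sym: "y \<bullet> (T *v x) = x \<bullet> (T *v y)" for x y
    by (metis sT dot_lmul_matrix inner_commute transpose_matrix_vector)
  have "y \<bullet> (T *v x) = 0" for y
  proof (rule ccontr)
    assume ne: "y \<bullet> (T *v x) \<noteq> 0"
    define b c where "b = y \<bullet> (T *v x)" and "c = y \<bullet> (T *v y)"
    have c: "c \<ge> 0" using T by (simp add: c_def pos_semidef_def)
    have "0 \<le> (x + t *\<^sub>R y) \<bullet> (T *v (x + t *\<^sub>R y))" for t using T by (simp add: pos_semidef_def)
    then have q: "0 \<le> 2 * t * b + t^2 * c" for t
      using x sym[of x y] by (simp add: matrix_vector_right_distrib matrix_vector_mult_scaleR inner_add_left inner_add_right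
          b_def c_def power2_eq_square algebra_simps)
    show False
    proof (cases "c = 0")
      case True
      then have "b^2 \<le> 0" using q[of "- b"] by (simp add: power2_eq_square)
      moreover have "b^2 > 0" using ne by (simp add: b_def)
      ultimately show ?thesis by linarith
    next
      case False
      then have "2 * (- b / c) * b + (- b / c)^2 * c = - (b^2 / c)" using c by (simp add: power2_eq_square field_simps)
      moreover have "b^2 / c > 0" using ne c False by (simp add: b_def)
      ultimately show ?thesis using q[of "- b / c"] by linarith
    qed
  qed
  then show ?thesis by (metis inner_eq_zero_iff)
qed

lemma det_nonzero_kernel:
  fixes T :: "'a::field^'n^'n"
  assumes "det T \<noteq> 0" "T *v x = 0" shows "x = 0"
proof -
  have "x = matrix_inv T *v (T *v x)"
    by (simp add: matrix_vector_mul_assoc matrix_inv_right[OF assms(1)])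
  then show ?thesis by (simp add: assms(2))
qed

lemma det_zero_kernel:
  fixes T :: "'a::field^'n^'n"
  assumes "det T = 0" obtains x where "x \<noteq> 0" "T *v x = 0"
  using matrix_left_invertible_ker[of T] invertible_left_inverse[of T] invertible_det_nz[of T] assms by auto

lemma pos_def_det_nonzero: "pos_def T \<Longrightarrow> det T \<noteq> 0" for T :: "real^'n^'n"
proof
  assume T: "pos_def T" and "det T = 0"
  then obtain x where "x \<noteq> 0" "T *v x = 0" using det_zero_kernel by blast
  with T show False unfolding pos_def_def by force
qed

lemma pos_def_one: "pos_def (mat 1 :: real^'n^'n)"
  by (simp add: pos_def_def sym_mat_def)

lemma pos_def_convex_comb:
  assumes "pos_def A" "pos_def B" "0 \<le> t" "t \<le> 1"
  shows "pos_def (t *\<^sub>R A + (1 - t) *\<^sub>R B)"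
  unfolding pos_def_def
proof (intro conjI allI impI)
  show "sym_mat (t *\<^sub>R A + (1 - t) *\<^sub>R B)" using assms by (auto simp: pos_def_def sym_mat_iff)
  fix x :: "real^'a" assume "x \<noteq> 0"
  then have ab: "x \<bullet> (A *v x) > 0" "x \<bullet> (B *v x) > 0" using assms by (auto simp: pos_def_def)
  have "t * (x \<bullet> (A *v x)) + (1 - t) * (x \<bullet> (B *v x)) > 0"
  proof (cases "t = 0")
    case False
    then have "t * (x \<bullet> (A *v x)) > 0" using ab assms by simp
    moreover have "(1 - t) * (x \<bullet> (B *v x)) \<ge> 0" using ab assms by simp
    ultimately show ?thesis by linarith
  qed (use ab in simp)
  then show "0 < x \<bullet> ((t *\<^sub>R A + (1 - t) *\<^sub>R B) *v x)"
    by (simp add: matrix_vector_mult_add_rdistrib inner_add_right scaleR_matrix_vector_assoc[symmetric])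
qed

text \<open>The segment to the identity consists of positive definite matrices, and on these the
  determinant is never zero, so it keeps the sign it has at the identity.\<close>

lemma pos_def_det_pos:
  fixes T :: "real^'n^'n"
  assumes T: "pos_def T" shows "det T > 0"
proof (rule ccontr)
  assume "\<not> det T > 0"
  define f where "f = (\<lambda>t. det (t *\<^sub>R T + (1 - t) *\<^sub>R mat 1))"
  have "continuous_on {0..1} f" unfolding f_def det_def by (intro continuous_intros)
  moreover have "f 0 = 1" "f 1 \<le> 0" using \<open>\<not> det T > 0\<close> by (auto simp: f_def)
  ultimately obtain t where t: "0 \<le> t" "t \<le> 1" "f t = 0" using IVT2'[of f 1 0 0] by force
  then show False using pos_def_det_nonzero[OF pos_def_convex_comb[OF T pos_def_one t(1,2)]] by (simp add: f_def)
qed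

lemma pos_semidef_not_def_det:
  fixes T :: "real^'n^'n"
  assumes "pos_semidef T" "\<not> pos_def T" shows "det T = 0"
proof -
  obtain x where x: "x \<noteq> 0" "\<not> x \<bullet> (T *v x) > 0" using assms by (auto simp: pos_def_def pos_semidef_def)
  moreover have "x \<bullet> (T *v x) \<ge> 0" using assms by (simp add: pos_semidef_def)
  ultimately have "T *v x = 0" using pos_semidef_kernel[OF assms(1)] by (simp add: less_le)
  then show ?thesis using det_nonzero_kernel x(1) by blast
qed

section \<open>Diagonal points and the operator applied to both expansions\<close>

definition dmat :: "('n \<Rightarrow> complex) \<Rightarrow> ('n::finite) cmat" where
  "dmat v = (\<chi> i j. if i = j then v i else 0)"

lemma dmat_nth [simp]: "dmat v $ i $ j = (if i = j then v i else 0)" by (simp add: dmat_def)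

lemma dmat_mult: "dmat v ** dmat w = dmat (\<lambda>i. v i * w i)"
proof -
  have "(\<Sum>k\<in>UNIV. dmat v $ i $ k * dmat w $ k $ j) = dmat (\<lambda>i. v i * w i) $ i $ j" for i j
  proof -
    have "(\<Sum>k\<in>UNIV. dmat v $ i $ k * dmat w $ k $ j) = (\<Sum>k\<in>UNIV. if k = i then v i * dmat w $ i $ j else 0)"
      by (rule sum.cong) auto
    then show ?thesis by simp
  qed
  then show ?thesis unfolding vec_eq_iff matrix_matrix_mult_def vec_lambda_beta by blast
qed

lemma quad_form_Im_dmat: "x \<bullet> (Im_mat (dmat v) *v x) = (\<Sum>i\<in>UNIV. Im (v i) * (x$i)^2)"
proof -
  have "(Im_mat (dmat v) *v x) $ i = Im (v i) * x$i" for i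
  proof -
    have "(\<Sum>j\<in>UNIV. Im_mat (dmat v) $ i $ j * x $ j) = (\<Sum>j\<in>UNIV. if j = i then Im (v i) * x $ i else 0)"
      by (rule sum.cong) auto
    then show ?thesis by (simp add: matrix_vector_mult_def)
  qed
  then show ?thesis by (simp add: inner_vec_def power2_eq_square mult_ac)
qed

lemma dmat_in_H:
  fixes v :: "'n::finite \<Rightarrow> complex"
  assumes "\<And>i. Im (v i) > 0" shows "dmat v \<in> siegel_H"
  unfolding siegel_H_def pos_def_def mem_Collect_eq quad_form_Im_dmat
proof (intro conjI allI impI)
  fix x :: "real^'n" assume "x \<noteq> 0"
  then obtain i where i: "x$i \<noteq> 0" by (auto simp: vec_eq_iff)
  show "0 < (\<Sum>i\<in>UNIV. Im (v i) * (x$i)^2)"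
    using assms i by (intro sum_pos2[of UNIV i]) (auto intro!: mult_nonneg_nonneg less_imp_le[OF assms])
qed (auto simp: sym_mat_iff)

lemma cpair_dmat: "cpair T (dmat v) = (\<Sum>i\<in>UNIV. of_real (T$i$i) * v i)"
  unfolding cpair_def
proof (rule sum.cong[OF refl])
  fix i
  have "(\<Sum>j\<in>UNIV. of_real (T$i$j) * dmat v $ j $ i) = (\<Sum>j\<in>UNIV. if j = i then of_real (T$i$i) * v i else 0)"
    by (rule sum.cong) auto
  then show "(\<Sum>j\<in>UNIV. of_real (T$i$j) * dmat v $ j $ i) = of_real (T$i$i) * v i" by simp
qed

lemma det_dmat: "det (dmat v) = (\<Prod>i\<in>UNIV. v i)"
  by (subst det_diagonal) auto

lemma Dop_e_cpair:
  assumes T: "sym_mat T" and Z: "Z \<in> siegel_H"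
  shows "Dop \<sigma> xs (\<lambda>Z. c * e (cpair T Z)) Z = (\<Prod>a\<leftarrow>xs. 2 * of_real pi * \<i> * of_real (T$a$\<sigma> a)) * (c * e (cpair T Z))"
  using Z
proof (induction xs arbitrary: Z)
  case (Cons a xs)
  let ?C = "(\<Prod>a\<leftarrow>xs. 2 * of_real pi * \<i> * of_real (T$a$\<sigma> a)) * c"
  have ce: "cholo (\<lambda>Z. e (cpair T Z))" by (intro cholo_e cholo_cpair cholo_nth)
  have "Dop \<sigma> (a # xs) (\<lambda>Z. c * e (cpair T Z)) Z = delta (Eab a (\<sigma> a)) (\<lambda>Z. ?C * e (cpair T Z)) Z"
    unfolding Dop_Cons by (rule delta_cong) (use Cons sym_Eab in auto)
  also have "\<dots> = ?C * delta (Eab a (\<sigma> a)) (\<lambda>Z. e (cpair T Z)) Z"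
    using delta_mult[OF cholo_const ce sym_Eab Cons.prems, of a "\<sigma> a" ?C] by (simp add: delta_const)
  finally show ?case by (simp add: delta_e_cpair cpair_Eab[OF T])
qed simp

lemma Aop_e_cpair:
  fixes T :: "real^'n^'n"
  assumes T: "sym_mat T" and Z: "Z \<in> siegel_H" and xs: "distinct xs" "set xs = UNIV"
  shows "Aop xs (\<lambda>\<sigma> Z. c * e (cpair T Z)) Z = (2 * of_real pi * \<i>) ^ CARD('n) * of_real (det T) * (c * e (cpair T Z))"
proof -
  have "Dop \<sigma> xs (\<lambda>Z. c * e (cpair T Z)) Z = (2 * of_real pi * \<i>) ^ CARD('n) * (\<Prod>a\<in>UNIV. of_real (T$a$\<sigma> a)) * (c * e (cpair T Z))" for \<sigma>
    unfolding Dop_e_cpair[OF T Z] prod.distinct_set_conv_list[OF xs(1), symmetric] xs(2) prod.distrib by (simp add: power_mult_distrib)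
  then show ?thesis unfolding Aop_def det_def
    by (simp add: sum_distrib_left sum_distrib_right mult_ac)
qed

lemma Aop_infsum:
  fixes u :: "'i \<Rightarrow> ('n::finite) cmat \<Rightarrow> complex"
  assumes u: "loc_summable L u" and Z: "Z \<in> siegel_H"
  shows "Aop xs (\<lambda>\<sigma> Z. \<Sum>\<^sub>\<infinity>T\<in>L. u T Z) Z = (\<Sum>\<^sub>\<infinity>T\<in>L. Aop xs (\<lambda>\<sigma>. u T) Z)"
    and "(\<lambda>T. Aop xs (\<lambda>\<sigma>. u T) Z) summable_on L"
proof -
  have s: "(\<lambda>T. of_int (sign \<sigma>) * Dop \<sigma> xs (u T) Z) summable_on L" for \<sigma>
    by (rule summable_on_cmult_right, rule abs_summable_summable, rule loc_summable_summable[OF loc_summable_Dop[OF u] Z])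
  have fin: "finite {\<sigma>. \<sigma> permutes (UNIV::'n set)}" by (simp add: finite_permutations)
  note I = infsum_finite_sum[of "{\<sigma>. \<sigma> permutes (UNIV::'n set)}" "\<lambda>\<sigma> T. of_int (sign \<sigma>) * Dop \<sigma> xs (u T) Z" L, OF fin s]
  show "(\<lambda>T. Aop xs (\<lambda>\<sigma>. u T) Z) summable_on L" using I unfolding Aop_def by blast
  show "Aop xs (\<lambda>\<sigma> Z. \<Sum>\<^sub>\<infinity>T\<in>L. u T Z) Z = (\<Sum>\<^sub>\<infinity>T\<in>L. Aop xs (\<lambda>\<sigma>. u T) Z)"
    using I unfolding Aop_def Dop_infsum[OF u Z] infsum_cmult_right'[symmetric] by blast
qed

text \<open>The product rule puts each term of the inverted series into the form for which the
  expansion of the operator was established: the logarithmic derivative of \<open>\<kappa>\<close>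
  plus the gradient of the exponent.\<close>

lemma delta_inverse_exponential:
  fixes T :: "real^'n^'n"
  assumes T: "sym_mat T" and \<kappa>: "cholo \<kappa>" and d\<kappa>: "delta (Eab a b) \<kappa> Z = - k * Pinv a b Z * \<kappa> Z" and Z: "Z \<in> siegel_H"
  shows "delta (Eab a b) (\<lambda>Z. \<kappa> Z * (\<beta> * e (cpair T (- matrix_inv Z)))) Z
    = (- k * Pinv a b Z + 2 * of_real pi * \<i> * Qinv T Z $ a $ b) * (\<kappa> Z * (\<beta> * e (cpair T (- matrix_inv Z))))"
proof -
  let ?X = "Eab a b"
  define f where "f = (\<lambda>Z. cpair T (- matrix_inv Z))"
  define t where "t = (\<lambda>i j. complex_of_real (- T$i$j))"
  have f: "f = (\<lambda>Z. \<Sum>i\<in>UNIV. \<Sum>j\<in>UNIV. t i j * Pinv j i Z)" by (simp add: f_def cpair_def t_def)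
  have cf: "cholo f" unfolding f by (intro cholo_sum cholo_mult cholo_const cholo_Pinv)
  have df: "delta ?X f Z = Qinv T Z $ a $ b"
  proof -
    have "delta ?X f Z = (\<Sum>i\<in>UNIV. \<Sum>j\<in>UNIV. t i j * delta ?X (Pinv j i) Z)"
      unfolding f by (simp add: delta_sum delta_mult delta_const cholo_Pinv cholo_mult cholo_sum cholo_const Z sym_Eab)
    also have "\<dots> = (\<Sum>i\<in>UNIV. \<Sum>j\<in>UNIV. (Pinv b i Z * of_real (T$i$j)) * Pinv j a Z) / 2
         + (\<Sum>i\<in>UNIV. \<Sum>j\<in>UNIV. (Pinv a i Z * of_real (T$i$j)) * Pinv j b Z) / 2"
      unfolding delta_Pinv[OF Z] sum_divide_distrib sum.distrib[symmetric]
    proof (intro sum.cong refl)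
      fix i j
      have "Pinv a i Z = Pinv i a Z" by (rule Pinv_sym[OF Z])
      then show "t i j * (- (Pinv j a Z * Pinv b i Z + Pinv j b Z * Pinv a i Z) / 2)
        = Pinv b i Z * of_real (T$i$j) * Pinv j a Z / 2 + Pinv a i Z * of_real (T$i$j) * Pinv j b Z / 2"
        by (simp add: t_def field_simps)
    qed
    also have "(\<Sum>i\<in>UNIV. \<Sum>j\<in>UNIV. (Pinv c i Z * of_real (T$i$j)) * Pinv j d Z) = Qinv T Z $ c $ d" for c d
      unfolding Qinv_def matrix_mult3_nth by (subst sum.swap) (simp add: sum_distrib_right)
    finally show ?thesis using Qinv_sym[OF Z T, of b a]
      by (simp add: Qinv_def matrix_mult3_nth sum_distrib_right) (subst sum.swap, simp)?
  qed
  have de: "delta ?X (\<lambda>Z. e (f Z)) Z = (2 * of_real pi * \<i> * e (f Z)) * delta ?X f Z"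
    by (rule delta_compose[OF cf _ sym_Eab Z]) (auto simp: e_def intro!: derivative_eq_intros)
  have ce: "cholo (\<lambda>Z. e (f Z))" by (intro cholo_e cf)
  have "delta ?X (\<lambda>Z. \<kappa> Z * (\<beta> * e (f Z))) Z = delta ?X \<kappa> Z * (\<beta> * e (f Z)) + \<kappa> Z * (\<beta> * delta ?X (\<lambda>Z. e (f Z)) Z)"
    using ce \<kappa> Z by (simp add: delta_mult cholo_mult cholo_const sym_Eab delta_const)
  then show ?thesis unfolding de df d\<kappa> by (simp add: f_def algebra_simps)
qed

text \<open>Both sides of \<open>rel\<close> are differentiated termwise: an exponential on the left
  yields det T, a term on the right reproduces itself times \<open>Pol\<close>. Prescribing only the
  square of \<open>\<kappa>\<close> treats integral and half-integral weight alike.\<close>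

lemma operator_identity:
  fixes \<alpha> \<beta> :: "real^'n^'n \<Rightarrow> complex"
  assumes Fs: "\<And>Z. Z \<in> siegel_H \<Longrightarrow> ((\<lambda>T. \<alpha> T * e (cpair T Z)) has_sum F Z) (Lq q)"
    and Hs: "\<And>Z. Z \<in> siegel_H \<Longrightarrow> ((\<lambda>T. \<beta> T * e (cpair T Z)) has_sum Hf Z) (Lq q)"
    and \<kappa>c: "continuous_on siegel_H \<kappa>" and \<kappa>2: "\<And>Z. Z \<in> siegel_H \<Longrightarrow> (\<kappa> Z)^2 * det Z ^ m = c0" and c0: "c0 \<noteq> 0"
    and rel: "\<And>Z. Z \<in> siegel_H \<Longrightarrow> F Z = \<kappa> Z * Hf (- matrix_inv Z)"
    and xs: "distinct xs" "set xs = (UNIV::'n set)" and Z: "Z \<in> siegel_H"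
  shows "(\<Sum>\<^sub>\<infinity>T\<in>Lq q. (2 * of_real pi * \<i>) ^ CARD('n) * of_real (det T) * (\<alpha> T * e (cpair T Z)))
       = \<kappa> Z * (\<Sum>\<^sub>\<infinity>T\<in>Lq q. Pol (of_nat m / 2) xs T Z * (\<beta> T * e (cpair T (- matrix_inv Z))))"
    and "(\<lambda>T. (2 * of_real pi * \<i>) ^ CARD('n) * of_real (det T) * (\<alpha> T * e (cpair T Z))) summable_on Lq q"
    and "(\<lambda>T. Pol (of_nat m / 2) xs T Z * (\<beta> T * e (cpair T (- matrix_inv Z)))) summable_on Lq q"
proof -
  define u1 where "u1 = (\<lambda>T Z. \<alpha> T * e (cpair T Z))"
  define u2 where "u2 = (\<lambda>T Z. \<kappa> Z * (\<beta> T * e (cpair T (- matrix_inv Z))))"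
  define k :: complex where "k = of_nat m / 2"
  have \<kappa>1: "cholo \<kappa>" by (rule half_power_det(1)[OF \<kappa>c _ c0]) (rule \<kappa>2)
  have \<kappa>d: "delta (Eab a b) \<kappa> Z = - (of_nat m / 2) * Pinv a b Z * \<kappa> Z" if "Z \<in> siegel_H" for a b Z
    by (rule half_power_det(2)[OF \<kappa>c _ c0 that]) (rule \<kappa>2)
  have abs1: "(\<lambda>T. norm (\<alpha> T * e (cpair T Z))) summable_on Lq q" if "Z \<in> siegel_H" for Z
    using has_sum_imp_summable[OF Fs[OF that]] unfolding summable_on_iff_abs_summable_on_complex .
  have abs2: "(\<lambda>T. norm (\<beta> T * e (cpair T Z))) summable_on Lq q" if "Z \<in> siegel_H" for Z
    using has_sum_imp_summable[OF Hs[OF that]] unfolding summable_on_iff_abs_summable_on_complex .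
  have ls1: "loc_summable (Lq q) u1"
    using loc_summable_series[OF abs1 LqD(1) cholo_nth _ cholo_const[of 1]] by (simp add: u1_def)
  have cinv: "cholo (\<lambda>Z. (- matrix_inv Z) $ i $ j)" for i j
    using cholo_mult[OF cholo_const[of "-1"] cholo_Pinv[of i j]] by simp
  have ls2: "loc_summable (Lq q) u2"
    unfolding u2_def by (rule loc_summable_series[OF abs2 LqD(1) cinv siegel_H_inv(2) \<kappa>1])
  have F1: "F Z = (\<Sum>\<^sub>\<infinity>T\<in>Lq q. u1 T Z)" if "Z \<in> siegel_H" for Z
    using Fs[OF that] by (simp add: u1_def infsumI)
  have F2: "F Z = (\<Sum>\<^sub>\<infinity>T\<in>Lq q. u2 T Z)" if "Z \<in> siegel_H" for Z
    unfolding rel[OF that] u2_def infsum_cmult_right' using Hs[OF siegel_H_inv(2)[OF that]] by (simp add: infsumI)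
  have eq: "Aop xs (\<lambda>\<sigma> Z. \<Sum>\<^sub>\<infinity>T\<in>Lq q. u1 T Z) Z = Aop xs (\<lambda>\<sigma> Z. \<Sum>\<^sub>\<infinity>T\<in>Lq q. u2 T Z) Z"
    by (rule Aop_cong[OF _ Z]) (simp add: F1[symmetric] F2[symmetric])
  have A1: "Aop xs (\<lambda>\<sigma>. u1 T) Z = (2 * of_real pi * \<i>) ^ CARD('n) * of_real (det T) * (\<alpha> T * e (cpair T Z))" if "T \<in> Lq q" for T
    unfolding u1_def by (rule Aop_e_cpair[OF LqD(2)[OF that] Z xs])
  have A2: "Aop xs (\<lambda>\<sigma>. u2 T) Z = \<kappa> Z * (Pol k xs T Z * (\<beta> T * e (cpair T (- matrix_inv Z))))" if T: "T \<in> Lq q" for T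
  proof -
    have cu: "cholo (u2 T)" using ls2 T by (simp add: loc_summable_def)
    have du: "delta (Eab a b) (u2 T) Z = (- k * Pinv a b Z + 2 * of_real pi * \<i> * Qinv T Z $ a $ b) * u2 T Z" if "Z \<in> siegel_H" for a b Z
      unfolding u2_def k_def by (rule delta_inverse_exponential[OF LqD(2)[OF T] \<kappa>1 _ that]) (rule \<kappa>d[OF that])
    have "Aop ([] @ xs) (\<lambda>\<sigma>. u2 T) Z = (\<Sum>S\<in>Pow (set xs). dco k xs S * Aop [] (Mfac T (u2 T) S (set xs)) Z)"
      by (rule Aop_expand[OF LqD(2)[OF T] cu du _ Z]) (use xs in auto)
    then show ?thesis unfolding xs(2)
      by (simp add: Aop_def Mfac_def Pol_def u2_def sum_distrib_left sum_distrib_right mult_ac)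
  qed
  note S1 = Aop_infsum[OF ls1 Z, of xs] and S2 = Aop_infsum[OF ls2 Z, of xs]
  have "(\<Sum>\<^sub>\<infinity>T\<in>Lq q. Aop xs (\<lambda>\<sigma>. u1 T) Z) = (\<Sum>\<^sub>\<infinity>T\<in>Lq q. Aop xs (\<lambda>\<sigma>. u2 T) Z)"
    using eq S1(1) S2(1) by simp
  moreover have "(\<Sum>\<^sub>\<infinity>T\<in>Lq q. Aop xs (\<lambda>\<sigma>. u2 T) Z) = \<kappa> Z * (\<Sum>\<^sub>\<infinity>T\<in>Lq q. Pol k xs T Z * (\<beta> T * e (cpair T (- matrix_inv Z))))"
    unfolding infsum_cmult_right'[symmetric] by (rule infsum_cong[OF A2])
  moreover have "(\<Sum>\<^sub>\<infinity>T\<in>Lq q. Aop xs (\<lambda>\<sigma>. u1 T) Z) = (\<Sum>\<^sub>\<infinity>T\<in>Lq q. (2 * of_real pi * \<i>) ^ CARD('n) * of_real (det T) * (\<alpha> T * e (cpair T Z)))"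
    by (rule infsum_cong[OF A1])
  ultimately show "(\<Sum>\<^sub>\<infinity>T\<in>Lq q. (2 * of_real pi * \<i>) ^ CARD('n) * of_real (det T) * (\<alpha> T * e (cpair T Z)))
       = \<kappa> Z * (\<Sum>\<^sub>\<infinity>T\<in>Lq q. Pol (of_nat m / 2) xs T Z * (\<beta> T * e (cpair T (- matrix_inv Z))))" by (simp add: k_def)
  show "(\<lambda>T. (2 * of_real pi * \<i>) ^ CARD('n) * of_real (det T) * (\<alpha> T * e (cpair T Z))) summable_on Lq q"
    by (rule iffD1[OF summable_on_cong S1(2)]) (rule A1)
  have "(\<lambda>T. \<kappa> Z * (Pol k xs T Z * (\<beta> T * e (cpair T (- matrix_inv Z))))) summable_on Lq q"
    by (rule iffD1[OF summable_on_cong S2(2)]) (rule A2)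
  moreover have "\<kappa> Z \<noteq> 0" using \<kappa>2[OF Z] c0 by auto
  ultimately show "(\<lambda>T. Pol (of_nat m / 2) xs T Z * (\<beta> T * e (cpair T (- matrix_inv Z)))) summable_on Lq q"
    unfolding k_def using summable_on_cmult_right'[of "\<kappa> Z"] by blast
qed

lemma Im_neg_inverse: "Im (- 1 / z) = Im z / (norm z)^2"
  by (simp add: Im_divide cmod_power2)

lemma Im_of_real_mult: "Im (complex_of_real t * w) = t * Im w" by simp

text \<open>As y grows, the left side of the operator identity is of order at most c + 1 + (n+1)/2
  and \<open>\<kappa>\<close> has exact order m/2, so the sum on the right is
  O(y^\<open>\<zeta>\<close>) with \<open>\<zeta>\<close> < 1. Its part with T_pp = 0 is y times a
  constant and the rest is bounded, so the constant is zero. Varying the common value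
  \<open>lm\<close> of the other diagonal entries then isolates the contribution of the full set S,
  in which the minor of T is 1.\<close>

lemma zero_diagonal_sum_vanishes:
  fixes p :: "'n::finite" and \<alpha> \<beta> :: "real^'n^'n \<Rightarrow> complex"
  assumes q: "q > 0"
    and Fs: "\<And>Z. Z \<in> siegel_H \<Longrightarrow> ((\<lambda>T. \<alpha> T * e (cpair T Z)) has_sum F Z) (Lq q)"
    and Hs: "\<And>Z. Z \<in> siegel_H \<Longrightarrow> ((\<lambda>T. \<beta> T * e (cpair T Z)) has_sum Hf Z) (Lq q)"
    and \<kappa>c: "continuous_on siegel_H \<kappa>" and \<kappa>2: "\<And>Z. Z \<in> siegel_H \<Longrightarrow> (\<kappa> Z)^2 * det Z ^ m = c0" and c0: "c0 \<noteq> 0"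
    and rel: "\<And>Z. Z \<in> siegel_H \<Longrightarrow> F Z = \<kappa> Z * Hf (- matrix_inv Z)"
    and m: "m \<ge> CARD('n)" and c1: "c \<ge> -1" and c2: "c < real m / 2 - (real CARD('n) + 1) / 2"
    and bd: "\<And>T. T \<in> Lq q \<Longrightarrow> pos_def T \<Longrightarrow> norm (\<alpha> T) \<le> C0 * det T powr c"
    and \<eta>: "\<eta> > 0"
  shows "(\<Sum>\<^sub>\<infinity>T\<in>{T\<in>Lq q. T$p$p = 0}. \<beta> T * of_real (exp (-2 * pi * \<eta> * trace T))) = 0"
proof -
  let ?n = "CARD('n)"
  define k :: complex where "k = of_nat m / 2"
  obtain xs :: "'n list" where xs: "distinct xs" "set xs = UNIV"
    using finite_distinct_list[of "UNIV :: 'n set"] by auto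
  define L0 where "L0 = {T\<in>Lq q. T$p$p = 0}"
  define L1 where "L1 = {T\<in>Lq q. T$p$p \<noteq> 0}"
  have L01: "L0 \<union> L1 = Lq q" "L0 \<inter> L1 = {}" "L0 \<subseteq> Lq q" "L1 \<subseteq> Lq q" by (auto simp: L0_def L1_def)
  have tr0: "trace T \<ge> 0" if "T \<in> Lq q" for T by (rule pos_semidef_trace_nonneg[OF LqD(1)[OF that]])
  \<comment> \<open>What remains of \<open>Pol\<close> for T_pp = 0 after removal of the common
    factor i y lm^(n-1).\<close>
  define \<phi> where "\<phi> = (\<lambda>lm' T. \<Sum>S\<in>{S. p \<in> S}. dco k xs S * ((-1) ^ card S * lm' ^ card (- S)) * wminor S T)"
  \<comment> \<open>The moduli of the terms at height eta/2: half of the decay is kept for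
    summability, the other half absorbs the power of 1 + trace T that bounds the minors.\<close>
  define BT where "BT = (\<lambda>T. norm (\<beta> T) * exp (- pi * \<eta> * trace T))"
  have sBT: "BT summable_on Lq q"
  proof -
    define Z where "Z = (dmat (\<lambda>i. \<i> * of_real (\<eta>/2)) :: 'n cmat)"
    have "Z \<in> siegel_H" unfolding Z_def by (rule dmat_in_H) (use \<eta> in simp)
    then have "(\<lambda>T. norm (\<beta> T * e (cpair T Z))) summable_on Lq q"
      using has_sum_imp_summable[OF Hs] unfolding summable_on_iff_abs_summable_on_complex by blast
    moreover have "norm (\<beta> T * e (cpair T Z)) = BT T" for T
    proof -
      have "cpair T Z = \<i> * of_real (\<eta>/2 * trace T)"
        unfolding Z_def cpair_dmat trace_def by (simp add: sum_distrib_left mult_ac)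
      then have "Im (cpair T Z) = \<eta>/2 * trace T" by (simp only: Im_i_times Re_complex_of_real)
      then show ?thesis by (simp add: BT_def norm_mult norm_e)
    qed
    ultimately show ?thesis by simp
  qed
  obtain C4 where C4: "C4 > 0" "\<And>s. s \<ge> 0 \<Longrightarrow> s powr real ?n \<le> C4 * exp (pi * \<eta> * s)"
    using powr_le_exp[of "real ?n" "pi * \<eta>"] \<eta> by auto
  define C4' where "C4' = C4 * exp (pi * \<eta>)"
  have C4': "(1 + trace T) ^ ?n * (norm (\<beta> T) * exp (-2 * pi * \<eta> * trace T)) \<le> C4' * BT T" if T: "T \<in> Lq q" for T
  proof -
    have "(1 + trace T) ^ ?n = (1 + trace T) powr real ?n" using tr0[OF T] by (simp add: powr_realpow)
    also have "\<dots> \<le> C4 * exp (pi * \<eta> * (1 + trace T))" using tr0[OF T] by (intro C4(2)) simp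
    finally have "(1 + trace T) ^ ?n * (norm (\<beta> T) * exp (-2 * pi * \<eta> * trace T))
        \<le> C4 * exp (pi * \<eta> * (1 + trace T)) * (norm (\<beta> T) * exp (-2 * pi * \<eta> * trace T))"
      by (intro mult_right_mono) auto
    also have "\<dots> = C4 * norm (\<beta> T) * exp (pi * \<eta> * (1 + trace T) + (-2 * pi * \<eta> * trace T))"
      by (simp only: exp_add mult_ac)
    also have "pi * \<eta> * (1 + trace T) + (-2 * pi * \<eta> * trace T) = pi * \<eta> + (- pi * \<eta> * trace T)" by (simp add: algebra_simps)
    also have "C4 * norm (\<beta> T) * exp (pi * \<eta> + (- pi * \<eta> * trace T)) = C4' * BT T"
      by (simp only: C4'_def BT_def exp_add mult_ac)
    finally show ?thesis .
  qed
  have sOm: "(\<lambda>T. wminor S T * (\<beta> T * of_real (exp (-2 * pi * \<eta> * trace T)))) summable_on L0" for S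
  proof (rule abs_summable_summable, rule Infinite_Sum.abs_summable_on_comparison_test')
    show "(\<lambda>T. fact ?n * (C4' * BT T)) summable_on L0"
      by (intro summable_on_cmult_right summable_on_subset_banach[OF sBT L01(3)])
    fix T assume "T \<in> L0"
    then have T: "T \<in> Lq q" using L01 by blast
    have "norm (wminor S T * (\<beta> T * of_real (exp (-2 * pi * \<eta> * trace T))))
        \<le> (fact ?n * (1 + trace T) ^ ?n) * (norm (\<beta> T) * exp (-2 * pi * \<eta> * trace T))"
      unfolding norm_mult using norm_wminor_le[OF LqD(1)[OF T], of S] by (simp add: mult_right_mono)
    also have "\<dots> \<le> fact ?n * (C4' * BT T)" using C4'[OF T] by (simp add: mult.assoc mult_left_mono)
    finally show "norm (wminor S T * (\<beta> T * of_real (exp (-2 * pi * \<eta> * trace T)))) \<le> fact ?n * (C4' * BT T)" .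
  qed
  define Om where "Om = (\<lambda>S. \<Sum>\<^sub>\<infinity>T\<in>L0. wminor S T * (\<beta> T * of_real (exp (-2 * pi * \<eta> * trace T))))"
  \<comment> \<open>The shift by q j is invisible to the exponentials with T_pp = 0, because q times
    the trace of T is an integer, yet it makes \<open>lm\<close> run through infinitely many
    values.\<close>
  have lim: "(\<Sum>\<^sub>\<infinity>T\<in>L0. \<phi> lm T * (\<beta> T * of_real (exp (-2 * pi * \<eta> * trace T)))) = 0"
    if lam: "lm = \<i> * of_real \<eta> + of_nat (q * j)" for lm j
  proof -
    have Iml: "Im lm = \<eta>" "lm \<noteq> 0" using lam \<eta> by (auto simp: complex_eq_iff)
    \<comment> \<open>One more than c because the operator has multiplied each term by det
      T.\<close>
    define \<gamma> where "\<gamma> = c + 1"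
    have \<gamma>: "\<gamma> \<ge> 0" using c1 by (simp add: \<gamma>_def)
    \<comment> \<open>The constant in the lower bounds for the imaginary parts of -1/v_i:
      \<open>a0\<close>/y at p and \<open>a0\<close> elsewhere.\<close>
    define a0 where "a0 = min (\<eta> / (norm lm)^2) 1"
    have a0: "a0 > 0" using Iml \<eta> by (simp add: a0_def)
    obtain CL where CL: "\<And>y A. y \<ge> 1 \<Longrightarrow> finite A \<Longrightarrow> A \<subseteq> Lq q \<Longrightarrow>
       (\<Sum>T\<in>A. \<bar>det T\<bar> powr \<gamma> * exp (- (2 * pi * a0) * sy p y T)) \<le> CL * y powr (\<gamma> + (real ?n + 1) / 2)"
      using lattice_det_sum[OF q _ \<gamma>, of "2 * pi * a0"] a0 by auto
    define \<rho> where "\<rho> = max 1 (norm lm)"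
    define v where "v = (\<lambda>y i. if i = p then \<i> * of_real y else lm)"
    define Zy where "Zy = (\<lambda>y. dmat (\<lambda>i. - 1 / v y i) :: 'n cmat)"
    have v0: "v y i \<noteq> 0" "Im (v y i) > 0" if "y > 0" for y i using that Iml \<eta> by (auto simp: v_def)
    have ZH: "Zy y \<in> siegel_H" if "y > 0" for y
      unfolding Zy_def
    proof (rule dmat_in_H)
      fix i show "Im (- 1 / v y i) > 0" unfolding Im_neg_inverse using v0[OF that, of i] by simp
    qed
    have Vinv: "matrix_inv (Zy y) = - dmat (v y)" if "y > 0" for y
    proof (rule matrix_inv_unique)
      have "Zy y ** dmat (v y) = - mat 1"
        unfolding Zy_def dmat_mult using v0(1)[OF that] by (simp add: vec_eq_iff mat_def)
      then show "Zy y ** - dmat (v y) = mat 1" by (simp add: mat_mult_minus_right)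
    qed
    have pv: "(\<Prod>i\<in>UNIV. v y i) = \<i> * of_real y * lm ^ (?n - 1)" for y
    proof -
      have "(\<Prod>i\<in>UNIV. v y i) = v y p * (\<Prod>i\<in>UNIV - {p}. v y i)" by (rule prod.remove) auto
      also have "(\<Prod>i\<in>UNIV - {p}. v y i) = (\<Prod>i\<in>UNIV - {p}. lm)" by (rule prod.cong) (auto simp: v_def)
      finally show ?thesis by (simp add: v_def card_Diff_singleton)
    qed
    define X where "X = (\<lambda>y. \<Sum>\<^sub>\<infinity>T\<in>Lq q. Pol k xs T (Zy y) * (\<beta> T * e (cpair T (dmat (v y)))))"
    have idX: "(\<Sum>\<^sub>\<infinity>T\<in>Lq q. (2 * of_real pi * \<i>) ^ ?n * of_real (det T) * (\<alpha> T * e (cpair T (Zy y)))) = \<kappa> (Zy y) * X y"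
      and sumX: "(\<lambda>T. Pol k xs T (Zy y) * (\<beta> T * e (cpair T (dmat (v y))))) summable_on Lq q"
      and sumF: "(\<lambda>T. (2 * of_real pi * \<i>) ^ ?n * of_real (det T) * (\<alpha> T * e (cpair T (Zy y)))) summable_on Lq q"
      if y: "y > 0" for y
      using operator_identity[OF Fs Hs \<kappa>c \<kappa>2 c0 rel xs ZH[OF y]] unfolding Vinv[OF y] X_def k_def by simp_all
    have bF: "norm (\<kappa> (Zy y) * X y) \<le> (2 * pi) ^ ?n * max C0 0 * CL * y powr (\<gamma> + (real ?n + 1) / 2)" if y: "y \<ge> 1" for y
    proof -
      have y0: "y > 0" using y by simp
      let ?f = "\<lambda>T. (2 * of_real pi * \<i>) ^ ?n * of_real (det T) * (\<alpha> T * e (cpair T (Zy y)))"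
      have bT: "norm (?f T) \<le> (2 * pi) ^ ?n * max C0 0 * (\<bar>det T\<bar> powr \<gamma> * exp (- (2 * pi * a0) * sy p y T))" if T: "T \<in> Lq q" for T
      proof (cases "pos_def T")
        case False
        then have "det T = 0" using pos_semidef_not_def_det LqD(1)[OF T] by blast
        then show ?thesis by simp
      next
        case True
        have d: "det T > 0" by (rule pos_def_det_pos[OF True])
        have "a0 * sy p y T \<le> Im (cpair T (Zy y))"
        proof -
          have "a0 * sy p y T = (\<Sum>i\<in>UNIV. T$i$i * (a0 * (if i = p then 1 / y else 1)))"
            unfolding sy_def sum_distrib_left by (simp add: mult_ac)
          also have "\<dots> \<le> (\<Sum>i\<in>UNIV. T$i$i * Im (- 1 / v y i))"
          proof (intro sum_mono mult_left_mono pos_semidef_diag LqD(1)[OF T])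
            fix i show "a0 * (if i = p then 1 / y else 1) \<le> Im (- 1 / v y i)"
            proof (cases "i = p")
              case True
              have "Im (- 1 / (\<i> * complex_of_real y)) = 1 / y"
                unfolding Im_neg_inverse using y0 by (simp add: norm_mult power2_eq_square)
              moreover have "a0 * (1 / y) \<le> 1 * (1 / y)" using y0 by (intro mult_right_mono) (auto simp: a0_def)
              ultimately show ?thesis using True by (simp add: v_def)
            next
              case False
              have "Im (- 1 / lm) = \<eta> / (norm lm)^2" unfolding Im_neg_inverse Iml(1) ..
              then show ?thesis using False by (simp add: v_def a0_def)
            qed
          qed
          also have "\<dots> = Im (cpair T (Zy y))" unfolding Zy_def cpair_dmat Im_sum Im_of_real_mult ..
          finally show ?thesis .
        qed
        then have "norm (e (cpair T (Zy y))) \<le> exp (- (2 * pi * a0) * sy p y T)"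
          unfolding norm_e by (simp add: mult.assoc)
        moreover have "norm (\<alpha> T) \<le> max C0 0 * det T powr c"
          using bd[OF T True] by (rule order_trans) (intro mult_right_mono, auto)
        ultimately have "\<bar>det T\<bar> * (norm (\<alpha> T) * norm (e (cpair T (Zy y)))) \<le> \<bar>det T\<bar> * ((max C0 0 * det T powr c) * exp (- (2 * pi * a0) * sy p y T))"
          by (intro mult_left_mono mult_mono) auto
        also have "\<dots> = max C0 0 * (\<bar>det T\<bar> powr \<gamma> * exp (- (2 * pi * a0) * sy p y T))"
          using d by (simp add: \<gamma>_def powr_add mult_ac)
        finally have "\<bar>det T\<bar> * (norm (\<alpha> T) * norm (e (cpair T (Zy y)))) \<le> max C0 0 * (\<bar>det T\<bar> powr \<gamma> * exp (- (2 * pi * a0) * sy p y T))" .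
        from mult_left_mono[OF this, of "(2 * pi) ^ ?n"] show ?thesis
          by (simp add: norm_mult norm_power mult.assoc)
      qed
      have "norm (infsum ?f (Lq q)) \<le> infsum (\<lambda>T. norm (?f T)) (Lq q)"
        using sumF[OF y0] unfolding summable_on_iff_abs_summable_on_complex by (rule norm_infsum_bound)
      also have "\<dots> \<le> (2 * pi) ^ ?n * max C0 0 * CL * y powr (\<gamma> + (real ?n + 1) / 2)"
      proof (rule infsum_le_finite_sums)
        show "(\<lambda>T. norm (?f T)) summable_on Lq q"
          using sumF[OF y0] unfolding summable_on_iff_abs_summable_on_complex .
        fix A :: "(real^'n^'n) set" assume A: "finite A" "A \<subseteq> Lq q"
        have "(\<Sum>T\<in>A. norm (?f T)) \<le> (\<Sum>T\<in>A. (2 * pi) ^ ?n * max C0 0 * (\<bar>det T\<bar> powr \<gamma> * exp (- (2 * pi * a0) * sy p y T)))"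
          using A bT by (intro sum_mono) blast
        also have "\<dots> = (2 * pi) ^ ?n * max C0 0 * (\<Sum>T\<in>A. \<bar>det T\<bar> powr \<gamma> * exp (- (2 * pi * a0) * sy p y T))"
          by (simp only: sum_distrib_left)
        also have "\<dots> \<le> (2 * pi) ^ ?n * max C0 0 * (CL * y powr (\<gamma> + (real ?n + 1) / 2))"
          by (intro mult_left_mono CL[OF y A]) simp
        finally show "(\<Sum>T\<in>A. norm (?f T)) \<le> (2 * pi) ^ ?n * max C0 0 * CL * y powr (\<gamma> + (real ?n + 1) / 2)"
          by (simp only: mult.assoc)
      qed
      finally show ?thesis unfolding idX[OF y0] .
    qed
    define K1 where "K1 = sqrt (norm c0) * (norm lm ^ (?n - 1)) powr (real m / 2)"
    have K1: "K1 > 0" using c0 Iml by (simp add: K1_def)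
    \<comment> \<open>An exact size and not only an upper bound, because this factor has to be
      divided out.\<close>
    have nk: "norm (\<kappa> (Zy y)) = K1 * y powr (real m / 2)" if y: "y > 0" for y
    proof -
      define D where "D = norm lm ^ (?n - 1) * y"
      have D: "D > 0" using y Iml by (simp add: D_def)
      have "det (Zy y) * (\<Prod>i\<in>UNIV. v y i) = (\<Prod>i\<in>UNIV. - 1 / v y i * v y i)"
        by (simp only: Zy_def det_dmat prod.distrib)
      also have "\<dots> = (\<Prod>i\<in>(UNIV::'n set). -1)" using v0(1)[OF y] by (intro prod.cong) auto
      finally have "norm (det (Zy y) * (\<Prod>i\<in>UNIV. v y i)) = 1" by (simp add: norm_power)
      then have dD: "norm (det (Zy y)) * D = 1" unfolding pv using y by (simp add: norm_mult norm_power D_def mult_ac)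
      have "(norm (\<kappa> (Zy y)))^2 * norm (det (Zy y)) ^ m = norm c0"
        using arg_cong[OF \<kappa>2[OF ZH[OF y]], of norm] by (simp add: norm_mult norm_power)
      then have "(norm (\<kappa> (Zy y)))^2 * (norm (det (Zy y)) * D) ^ m = norm c0 * D ^ m"
        by (simp add: power_mult_distrib)
      then have "(norm (\<kappa> (Zy y)))^2 = norm c0 * D ^ m" unfolding dD by simp
      then have "norm (\<kappa> (Zy y)) = sqrt (norm c0 * D ^ m)" by (metis norm_ge_zero real_sqrt_unique)
      also have "\<dots> = sqrt (norm c0) * sqrt (D powr real m)" using D by (simp add: real_sqrt_mult powr_realpow)
      also have "sqrt (D powr real m) = D powr (real m / 2)"
        using D by (simp add: powr_half_sqrt[symmetric] powr_powr)
      also have "D powr (real m / 2) = (norm lm ^ (?n - 1)) powr (real m / 2) * y powr (real m / 2)"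
        unfolding D_def by (rule powr_mult)
      finally show ?thesis by (simp add: K1_def)
    qed
    \<comment> \<open>The exponent left after division by \<open>\<kappa>\<close>; that it is below
      1 is exactly the hypothesis \<open>c2\<close>.\<close>
    define \<zeta> where "\<zeta> = \<gamma> + (real ?n + 1) / 2 - real m / 2"
    have \<zeta>: "\<zeta> - 1 < 0" using c2 by (simp add: \<zeta>_def \<gamma>_def)
    define K2 where "K2 = (2 * pi) ^ ?n * max C0 0 * CL / K1"
    have bX: "norm (X y) \<le> K2 * y powr \<zeta>" if y: "y \<ge> 1" for y
    proof -
      have "K1 * y powr (real m / 2) * norm (X y) \<le> (2 * pi) ^ ?n * max C0 0 * CL * y powr (\<gamma> + (real ?n + 1) / 2)"
        using bF[OF y] nk[of y] y by (simp add: norm_mult)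
      also have "y powr (\<gamma> + (real ?n + 1) / 2) = y powr \<zeta> * y powr (real m / 2)"
        by (simp add: \<zeta>_def flip: powr_add)
      finally have "(K1 * norm (X y)) * y powr (real m / 2) \<le> ((2 * pi) ^ ?n * max C0 0 * CL * y powr \<zeta>) * y powr (real m / 2)"
        by (simp only: mult_ac)
      then have "K1 * norm (X y) \<le> (2 * pi) ^ ?n * max C0 0 * CL * y powr \<zeta>" using y by simp
      then show ?thesis using K1 by (simp add: K2_def field_simps)
    qed
    have rho: "\<rho> \<ge> 1" by (simp add: \<rho>_def)
    have vle: "norm (v y i) \<le> \<rho> * y" if "y \<ge> 1" for y i
    proof (cases "i = p")
      case True
      then show ?thesis using that rho by (simp add: v_def norm_mult mult_le_cancel_right1)
    next
      case False
      have "norm lm * 1 \<le> \<rho> * y" using that by (intro mult_mono) (auto simp: \<rho>_def)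
      then show ?thesis using False by (simp add: v_def)
    qed
    define K3 where "K3 = (\<Sum>S\<in>Pow (UNIV::'n set). norm (dco k xs S)) * \<rho> ^ (2 * ?n) * fact ?n"
    \<comment> \<open>A crude power of y is enough: this bound is applied only to terms with T_pp
      different from 0, whose exponentials decay in y.\<close>
    have bPol: "norm (Pol k xs T (Zy y)) \<le> K3 * y ^ (2 * ?n) * (1 + trace T) ^ ?n" if y: "y \<ge> 1" and T: "T \<in> Lq q" for y T
    proof -
      have y0: "y > 0" using y by simp
      have ry: "\<rho> * y \<ge> 1" using mult_mono[of 1 \<rho> 1 y] rho y by simp
      have "norm (Pol k xs T (Zy y)) \<le> (\<Sum>S\<in>Pow UNIV. norm (dco k xs S) * ((\<rho> * y) ^ ?n * (\<rho> * y) ^ ?n * (fact ?n * (1 + trace T) ^ ?n)))"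
        unfolding Pol_diag[OF Vinv[OF y0, unfolded dmat_def]]
      proof (intro sum_norm_le)
        fix S :: "'n set"
        have 1: "norm (\<Prod>i\<in>UNIV. if i \<in> S then -1 else v y i) \<le> (\<rho> * y) ^ ?n"
        proof -
          have "norm (\<Prod>i\<in>UNIV. if i \<in> S then -1 else v y i) = (\<Prod>i\<in>UNIV. norm (if i \<in> S then -1 else v y i))" by (simp add: prod_norm)
          also have "\<dots> \<le> (\<Prod>i\<in>(UNIV::'n set). \<rho> * y)" using vle[OF y] ry by (intro prod_mono) auto
          finally show ?thesis by simp
        qed
        have 2: "norm (\<Prod>i\<in>UNIV. v y i) \<le> (\<rho> * y) ^ ?n"
        proof -
          have "norm (\<Prod>i\<in>UNIV. v y i) = (\<Prod>i\<in>UNIV. norm (v y i))" by (simp add: prod_norm)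
          also have "\<dots> \<le> (\<Prod>i\<in>(UNIV::'n set). \<rho> * y)" using vle[OF y] by (intro prod_mono) auto
          finally show ?thesis by simp
        qed
        show "norm (dco k xs S * ((\<Prod>i\<in>UNIV. if i \<in> S then -1 else v y i) * (\<Prod>i\<in>UNIV. v y i) * wminor S T))
           \<le> norm (dco k xs S) * ((\<rho> * y) ^ ?n * (\<rho> * y) ^ ?n * (fact ?n * (1 + trace T) ^ ?n))"
          unfolding norm_mult using 1 2 norm_wminor_le[OF LqD(1)[OF T], of S] ry
          by (intro mult_left_mono mult_mono) auto
      qed
      also have "\<dots> = K3 * y ^ (2 * ?n) * (1 + trace T) ^ ?n"
        unfolding K3_def sum_distrib_right mult_2 power_add
        by (intro sum.cong refl) (simp add: power_mult_distrib mult_ac)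
      finally show ?thesis .
    qed
    \<comment> \<open>Row p of T is zero, so S contains p and v_p enters only through the product of
      all v_i; the dependence on y is exactly linear.\<close>
    have P0: "Pol k xs T (Zy y) * (\<beta> T * e (cpair T (dmat (v y))))
        = (\<i> * of_real y * lm ^ (?n - 1)) * (\<phi> lm T * (\<beta> T * of_real (exp (-2 * pi * \<eta> * trace T))))"
      if y: "y > 0" and T: "T \<in> L0" for y T
    proof -
      have Tq: "T \<in> Lq q" and Tp: "T$p$p = 0" using T by (auto simp: L0_def)
      have row: "T$p$j = 0" for j
        using pos_semidef_entry[OF LqD(1)[OF Tq], of p j] Tp by simp
      have "Pol k xs T (Zy y) = (\<Sum>S\<in>{S. p \<in> S}. dco k xs S * ((\<Prod>i\<in>UNIV. if i \<in> S then -1 else v y i) * (\<Prod>i\<in>UNIV. v y i) * wminor S T))"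
        unfolding Pol_diag[OF Vinv[OF y, unfolded dmat_def]]
        by (rule sum.mono_neutral_right) (auto simp: wminor_zero_row[OF _ row])
      also have "\<dots> = (\<Sum>S\<in>{S. p \<in> S}. (\<i> * of_real y * lm ^ (?n - 1)) * (dco k xs S * ((-1) ^ card S * lm ^ card (- S)) * wminor S T))"
      proof (rule sum.cong[OF refl])
        fix S assume "S \<in> {S. p \<in> S}"
        then have "(\<Prod>i\<in>UNIV. if i \<in> S then -1 else v y i) = (\<Prod>i\<in>UNIV. if i \<in> S then -1 else lm)"
          by (intro prod.cong) (auto simp: v_def)
        also have "\<dots> = (-1) ^ card S * lm ^ card (- S)"
          by (subst prod.If_cases) (auto simp: Compl_eq[symmetric])
        finally show "dco k xs S * ((\<Prod>i\<in>UNIV. if i \<in> S then -1 else v y i) * (\<Prod>i\<in>UNIV. v y i) * wminor S T)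
          = (\<i> * of_real y * lm ^ (?n - 1)) * (dco k xs S * ((-1) ^ card S * lm ^ card (- S)) * wminor S T)"
          unfolding pv by (simp only: mult_ac)
      qed
      finally have 1: "Pol k xs T (Zy y) = (\<i> * of_real y * lm ^ (?n - 1)) * \<phi> lm T"
        by (simp add: \<phi>_def sum_distrib_left)
      have "cpair T (dmat (v y)) = (\<Sum>i\<in>UNIV. of_real (T$i$i) * lm)"
        unfolding cpair_dmat by (rule sum.cong) (auto simp: v_def Tp)
      also have "\<dots> = \<i> * of_real (\<eta> * trace T) + of_nat j * of_real (real q * trace T)"
        unfolding trace_def lam sum_distrib_right[symmetric] of_real_sum[symmetric] by (simp add: algebra_simps)
      finally have cp: "cpair T (dmat (v y)) = \<i> * of_real (\<eta> * trace T) + of_nat j * of_real (real q * trace T)" .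
      have "real q * trace T \<in> \<int>" unfolding trace_def sum_distrib_left by (intro Ints_sum LqD(3)[OF Tq])
      then have "complex_of_real (real q * trace T) \<in> \<int>" by (metis Ints_cases Ints_of_int of_real_of_int_eq)
      then have "of_nat j * complex_of_real (real q * trace T) \<in> \<int>" by (intro Ints_mult) auto
      then have "e (cpair T (dmat (v y))) = e (\<i> * of_real (\<eta> * trace T))" unfolding cp e_add by (simp only: e_Ints mult_1_right)
      also have "\<dots> = of_real (exp (-2 * pi * \<eta> * trace T))"
        unfolding e_def exp_of_real[symmetric] by (rule arg_cong[where f = exp]) (simp add: complex_eq_iff)
      finally show ?thesis unfolding 1 by (simp only: mult_ac)
    qed
    obtain C5 where C5: "C5 > 0" "\<And>s. s \<ge> 0 \<Longrightarrow> s powr real (2 * ?n) \<le> C5 * exp (2 * pi / real q * s)"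
      using powr_le_exp[of "real (2 * ?n)" "2 * pi / real q"] q by auto
    define K4 where "K4 = K3 * C5 * exp (2 * pi * \<eta> / real q) * C4'"
    have K3: "K3 \<ge> 0" unfolding K3_def using rho by (intro mult_nonneg_nonneg sum_nonneg) auto
    \<comment> \<open>Here T_pp is at least 1/q, so the exponential supplies exp(-2 pi y/q), which
      beats y^(2n). The condition y \<ge> eta keeps the surplus y - eta nonnegative.\<close>
    have P1: "norm (Pol k xs T (Zy y) * (\<beta> T * e (cpair T (dmat (v y))))) \<le> K4 * BT T"
      if y: "y \<ge> max 1 \<eta>" and T: "T \<in> L1" for y T
    proof -
      have y1: "y \<ge> 1" "y \<ge> \<eta>" "y > 0" using y by auto
      have Tq: "T \<in> Lq q" and Tp: "T$p$p \<noteq> 0" using T by (auto simp: L1_def)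
      have Tpp: "T$p$p \<ge> 1 / real q"
      proof -
        have "real q * T$p$p \<in> \<int>" by (rule LqD(3)[OF Tq])
        moreover have "real q * T$p$p > 0" using Tp pos_semidef_diag[OF LqD(1)[OF Tq], of p] q by simp
        ultimately have "real q * T$p$p \<ge> 1" by (auto elim!: Ints_cases)
        then show ?thesis using q by (simp add: field_simps)
      qed
      have "Im (cpair T (dmat (v y))) = (\<Sum>i\<in>UNIV. T$i$i * (if i = p then y else \<eta>))"
        unfolding cpair_dmat by (simp add: v_def Iml if_distrib cong: if_cong)
      also have "\<dots> = (\<Sum>i\<in>UNIV. \<eta> * T$i$i + (if i = p then (y - \<eta>) * T$p$p else 0))"
        by (intro sum.cong) (auto simp: algebra_simps)
      also have "\<dots> = \<eta> * trace T + (y - \<eta>) * T$p$p"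
        by (simp add: sum.distrib trace_def sum_distrib_left)
      also have "\<dots> \<ge> \<eta> * trace T + (y - \<eta>) * (1 / real q)"
        using y1 Tpp by (intro add_left_mono mult_left_mono) auto
      finally have "- 2 * pi * Im (cpair T (dmat (v y))) \<le> - 2 * pi * (\<eta> * trace T + (y - \<eta>) * (1 / real q))"
        by simp
      also have "\<dots> = -2 * pi * \<eta> * trace T + (2 * pi * \<eta> / real q - 2 * pi / real q * y)"
        using q by (simp add: field_simps)
      finally have ne: "norm (e (cpair T (dmat (v y)))) \<le> exp (-2 * pi * \<eta> * trace T) * (exp (2 * pi * \<eta> / real q) * exp (- (2 * pi / real q * y)))"
        unfolding norm_e by (simp flip: exp_add)
      have y2n: "y ^ (2 * ?n) * exp (- (2 * pi / real q * y)) \<le> C5"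
      proof -
        have "y ^ (2 * ?n) = y powr real (2 * ?n)" by (rule powr_realpow[symmetric]) (use y1 in simp)
        also have "\<dots> \<le> C5 * exp (2 * pi / real q * y)" using y1 by (intro C5(2)) simp
        finally have "y ^ (2 * ?n) * exp (- (2 * pi / real q * y)) \<le> C5 * exp (2 * pi / real q * y) * exp (- (2 * pi / real q * y))"
          by (intro mult_right_mono) auto
        then show ?thesis by (simp add: mult.assoc flip: exp_add)
      qed
      have "norm (Pol k xs T (Zy y) * (\<beta> T * e (cpair T (dmat (v y)))))
         \<le> (K3 * y ^ (2 * ?n) * (1 + trace T) ^ ?n) * (norm (\<beta> T) * (exp (-2 * pi * \<eta> * trace T) * (exp (2 * pi * \<eta> / real q) * exp (- (2 * pi / real q * y)))))"
        unfolding norm_mult using bPol[OF y1(1) Tq] ne K3 y1 tr0[OF Tq] by (intro mult_mono mult_left_mono) auto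
      also have "\<dots> = K3 * exp (2 * pi * \<eta> / real q) * (y ^ (2 * ?n) * exp (- (2 * pi / real q * y))) * ((1 + trace T) ^ ?n * (norm (\<beta> T) * exp (-2 * pi * \<eta> * trace T)))"
        by (simp only: mult_ac)
      also have "\<dots> \<le> K3 * exp (2 * pi * \<eta> / real q) * C5 * (C4' * BT T)"
      proof (rule mult_mono[OF mult_left_mono[OF y2n] C4'[OF Tq]])
        show "0 \<le> K3 * exp (2 * pi * \<eta> / real q)" using K3 by simp
        then show "0 \<le> K3 * exp (2 * pi * \<eta> / real q) * C5" using C5 by simp
        show "0 \<le> (1 + trace T) ^ ?n * (norm (\<beta> T) * exp (-2 * pi * \<eta> * trace T))" using tr0[OF Tq] by simp
      qed
      finally show ?thesis by (simp add: K4_def mult_ac)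
    qed
    define G where "G = (\<Sum>\<^sub>\<infinity>T\<in>L0. \<phi> lm T * (\<beta> T * of_real (exp (-2 * pi * \<eta> * trace T))))"
    define K5 where "K5 = infsum (\<lambda>T. K4 * BT T) L1"
    have main: "y * (norm lm ^ (?n - 1) * norm G) \<le> K2 * y powr \<zeta> + K5" if y: "y \<ge> max 1 \<eta>" for y
    proof -
      have y1: "y \<ge> 1" "y > 0" using y by auto
      let ?g = "\<lambda>T. Pol k xs T (Zy y) * (\<beta> T * e (cpair T (dmat (v y))))"
      have "X y = infsum ?g L0 + infsum ?g L1"
        unfolding X_def L01(1)[symmetric]
        using summable_on_subset_banach[OF sumX[OF y1(2)]] L01 by (intro infsum_Un_disjoint) auto
      moreover have "infsum ?g L0 = (\<i> * of_real y * lm ^ (?n - 1)) * G"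
        unfolding G_def infsum_cmult_right'[symmetric] by (rule infsum_cong) (rule P0[OF y1(2)])
      moreover have "norm (infsum ?g L1) \<le> K5"
        unfolding K5_def using P1[OF y] summable_on_subset_banach[OF sBT L01(4)]
        by (intro norm_infsum_le_infsum summable_on_cmult_right) auto
      ultimately have "norm ((\<i> * of_real y * lm ^ (?n - 1)) * G) \<le> norm (X y) + K5"
        using norm_triangle_ineq4[of "X y" "infsum ?g L1"] by simp
      then show ?thesis using bX[OF y1(1)] y1 by (simp add: norm_mult norm_power mult_ac)
    qed
    have "norm lm ^ (?n - 1) * norm G \<le> 0"
    proof (rule tendsto_lowerbound)
      show "((\<lambda>y. K2 * y powr (\<zeta> - 1) + K5 / y) \<longlongrightarrow> 0) at_top"
      proof -
        have "((\<lambda>y. K2 * y powr (\<zeta> - 1) + K5 / y) \<longlongrightarrow> K2 * 0 + 0) at_top"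
          by (intro tendsto_add tendsto_mult tendsto_const tendsto_neg_powr \<zeta> filterlim_ident tendsto_divide_0[OF tendsto_const] filterlim_at_top_imp_at_infinity)
        then show ?thesis by simp
      qed
      show "\<forall>\<^sub>F y in at_top. norm lm ^ (?n - 1) * norm G \<le> K2 * y powr (\<zeta> - 1) + K5 / y"
        using eventually_ge_at_top[of "max 1 \<eta>"]
      proof eventually_elim
        case (elim y)
        have y: "y > 0" using elim by auto
        have "norm lm ^ (?n - 1) * norm G \<le> (K2 * y powr \<zeta> + K5) / y"
          using main[OF elim] y by (simp add: field_simps)
        also have "\<dots> = K2 * y powr (\<zeta> - 1) + K5 / y"
          using y by (simp add: add_divide_distrib powr_diff)
        finally show ?case .
      qed
    qed simp
    moreover have "0 < norm lm ^ (?n - 1)" using Iml by (intro zero_less_power) simp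
    ultimately have "norm G = 0" by (simp add: mult_le_0_iff)
    then show ?thesis by (simp add: G_def)
  qed
  \<comment> \<open>The sums that vanish for all the values of \<open>lm\<close>, as one polynomial
    in \<open>lm\<close>. The exponent card (- S) is zero only for the full set, so the constant
    coefficient is a single term.\<close>
  define P where "P = (\<Sum>S\<in>{S. p \<in> S}. monom (dco k xs S * (-1) ^ card S * Om S) (card (- S)))"
  have "poly P lm = 0" if lam: "lm = \<i> * of_real \<eta> + of_nat (q * j)" for lm j
  proof -
    have "(\<Sum>\<^sub>\<infinity>T\<in>L0. \<phi> lm T * (\<beta> T * of_real (exp (-2 * pi * \<eta> * trace T))))
       = (\<Sum>\<^sub>\<infinity>T\<in>L0. \<Sum>S\<in>{S. p \<in> S}. (dco k xs S * ((-1) ^ card S * lm ^ card (- S))) * (wminor S T * (\<beta> T * of_real (exp (-2 * pi * \<eta> * trace T)))))"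
      by (rule infsum_cong, unfold \<phi>_def sum_distrib_right, rule sum.cong[OF refl]) (simp only: mult_ac)
    also have "\<dots> = (\<Sum>S\<in>{S. p \<in> S}. \<Sum>\<^sub>\<infinity>T\<in>L0. (dco k xs S * ((-1) ^ card S * lm ^ card (- S))) * (wminor S T * (\<beta> T * of_real (exp (-2 * pi * \<eta> * trace T)))))"
      by (rule infsum_finite_sum[THEN conjunct1, symmetric]) (simp, intro summable_on_cmult_right sOm)
    also have "\<dots> = (\<Sum>S\<in>{S. p \<in> S}. (dco k xs S * ((-1) ^ card S * lm ^ card (- S))) * Om S)"
      unfolding Om_def infsum_cmult_right' ..
    also have "\<dots> = poly P lm" unfolding P_def poly_sum poly_monom by (simp add: mult_ac)
    finally show ?thesis using lim[OF lam] by simp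
  qed
  then have "range (\<lambda>j. \<i> * of_real \<eta> + of_nat (q * j)) \<subseteq> {x. poly P x = 0}" by auto
  moreover have "infinite (range (\<lambda>j::nat. \<i> * of_real \<eta> + of_nat (q * j) :: complex))"
    using q by (intro range_inj_infinite) (auto simp: inj_on_def)
  ultimately have "infinite {x. poly P x = 0}" using finite_subset by blast
  then have "P = 0" using poly_roots_finite by blast
  then have "0 = coeff P 0" by simp
  also have "\<dots> = (\<Sum>S\<in>{S. p \<in> S}. if S = UNIV then dco k xs S * (-1) ^ card S * Om S else 0)"
    unfolding P_def coeff_sum
  proof (rule sum.cong[OF refl])
    fix S :: "'n set"
    have "card (- S) = 0 \<longleftrightarrow> S = UNIV" by (simp add: card_eq_0_iff) blast
    then show "coeff (monom (dco k xs S * (-1) ^ card S * Om S) (card (- S))) 0 = (if S = UNIV then dco k xs S * (-1) ^ card S * Om S else 0)"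
      by simp
  qed
  also have "\<dots> = dco k xs UNIV * (-1) ^ ?n * Om UNIV" by (subst sum.delta) auto
  finally have "dco k xs UNIV * Om UNIV = 0" by simp
  \<comment> \<open>The factors are (j - m)/2 with j < n, and m is at least n.\<close>
  moreover have "dco k xs UNIV \<noteq> 0"
  proof -
    have len: "length xs = ?n" using xs distinct_card by metis
    have "- k + of_nat j / 2 \<noteq> 0" if "j < length xs" for j
    proof
      assume "- k + of_nat j / 2 = 0"
      then have "(of_nat m :: complex) = of_nat j" by (simp add: k_def)
      then show False using that m len by simp
    qed
    then show ?thesis unfolding dco_full[OF xs(1), of k, unfolded xs(2)] by (simp add: prod_zero_iff)
  qed
  ultimately have "Om UNIV = 0" by simp
  then show ?thesis by (simp add: Om_def wminor_UNIV L0_def)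
qed

subsection \<open>The symplectic group and symmetries of slashed forms\<close>

lemma sp_mult_assoc: "sp_mult (sp_mult f g) h = sp_mult f (sp_mult g h)"
  by (cases f; cases g; cases h)
     (simp add: mat_add_rdistrib matrix_add_ldistrib matrix_mul_assoc add_ac)

lemma sp_mult_one [simp]: "sp_mult sp_one g = g" "sp_mult g sp_one = g"
  by (cases g; simp add: sp_one_def mat_mult_0_left mat_mult_0_right)+

text \<open>Quadruples are also added blockwise, so that an element of a principal congruence
  subgroup can be written as the identity plus a multiple of N and conjugated linearly.\<close>

lemma sp_mult_add: "sp_mult (f + g) h = sp_mult f h + sp_mult g h" "sp_mult f (g + h) = sp_mult f g + sp_mult f h"
  by (cases f; cases g; cases h; simp add: mat_add_rdistrib matrix_add_ldistrib add_ac)+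

lemma sp_inv_mult: "sp_inv (sp_mult g h) = sp_mult (sp_inv h) (sp_inv g)"
  by (cases g; cases h)
     (simp add: matrix_transpose_mul transpose_add mat_mult_minus_left mat_mult_minus_right add.commute)

text \<open>The off-diagonal blocks of the product are the two symmetry relations, and its two
  diagonal blocks are transposes of each other, so the three defining relations give all four
  blocks.\<close>

lemma Sp_iff: "g \<in> Sp \<longleftrightarrow> sp_mult (sp_inv g) g = sp_one"
proof -
  obtain A B C D where g: "g = (A,B,C,D)" by (cases g) auto
  have "transpose D ** A - transpose B ** C = transpose (transpose A ** D - transpose C ** B)"
    by (simp add: transpose_diff matrix_transpose_mul)
  moreover have "mat 1 = transpose (mat 1 :: 'a imat)" by simp
  ultimately have "transpose D ** A - transpose B ** C = mat 1 \<longleftrightarrow> transpose A ** D - transpose C ** B = mat 1"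
    by (metis transpose_transpose)
  then show ?thesis
    by (auto simp: g Sp_def sp_one_def mat_mult_minus_left algebra_simps)
qed

lemma sp_mult_Sp: "g \<in> Sp \<Longrightarrow> h \<in> Sp \<Longrightarrow> sp_mult g h \<in> Sp"
  unfolding Sp_iff sp_inv_mult by (metis sp_mult_assoc sp_mult_one(1))

text \<open>A left inverse in Sp becomes a right inverse by passing to square matrices over a field.\<close>
definition spblock :: "('n::finite) spel \<Rightarrow> real^('n + 'n)^('n + 'n)" where
  "spblock g = (case g of (A,B,C,D) \<Rightarrow> \<chi> i j. of_int (case i of
      Inl i \<Rightarrow> (case j of Inl j \<Rightarrow> A$i$j | Inr j \<Rightarrow> B$i$j)
    | Inr i \<Rightarrow> (case j of Inl j \<Rightarrow> C$i$j | Inr j \<Rightarrow> D$i$j)))"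

lemma spblock_mult: "spblock (sp_mult g h) = spblock g ** spblock h"
proof -
  have s: "(\<Sum>i\<in>UNIV. f i) = (\<Sum>i\<in>UNIV. f (Inl i)) + (\<Sum>i\<in>UNIV. f (Inr i))" for f :: "'a + 'a \<Rightarrow> real"
    by (subst UNIV_sum, subst sum.union_disjoint) (auto simp: sum.reindex)
  show ?thesis
    by (cases g; cases h) (auto simp: spblock_def matrix_matrix_mult_def vec_eq_iff s split: sum.split)
qed

lemma spblock_eq_iff: "spblock g = spblock h \<longleftrightarrow> g = h"
proof
  assume eq: "spblock g = spblock h"
  obtain A B C D A' B' C' D' where gh: "g = (A,B,C,D)" "h = (A',B',C',D')" by (cases g; cases h) auto
  have "spblock g $ i $ j = spblock h $ i $ j" for i j by (simp add: eq)
  from this[of "Inl _" "Inl _"] this[of "Inl _" "Inr _"] this[of "Inr _" "Inl _"] this[of "Inr _" "Inr _"]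
  show "g = h" by (simp add: gh spblock_def vec_eq_iff)
qed simp

lemma spblock_one: "spblock sp_one = mat 1"
  by (auto simp: spblock_def sp_one_def vec_eq_iff mat_def split: sum.split)

lemma Sp_right_inv: "g \<in> Sp \<Longrightarrow> sp_mult g (sp_inv g) = sp_one"
proof -
  assume "g \<in> Sp"
  then have "spblock (sp_inv g) ** spblock g = mat 1"
    unfolding Sp_iff spblock_mult[symmetric] by (simp add: spblock_one)
  then have "spblock g ** spblock (sp_inv g) = mat 1" using matrix_left_right_inverse by blast
  then show ?thesis unfolding spblock_mult[symmetric] spblock_one[symmetric] spblock_eq_iff .
qed

lemma Sp_inv: "g \<in> Sp \<Longrightarrow> sp_inv g \<in> Sp"
proof -
  assume "g \<in> Sp"
  then have "sp_mult g (sp_inv g) = sp_one" by (rule Sp_right_inv)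
  moreover have "sp_inv (sp_inv g) = g" by (cases g) (simp add: transpose_minus)
  ultimately show ?thesis unfolding Sp_iff by simp
qed

section \<open>Principal congruence subgroups and their normality\<close>

definition mat_dvd :: "int \<Rightarrow> ('n::finite) imat \<Rightarrow> bool" where
  "mat_dvd N X \<longleftrightarrow> (\<forall>i j. N dvd X$i$j)"

lemma mat_dvd_intros:
  "mat_dvd N X \<Longrightarrow> mat_dvd N Y \<Longrightarrow> mat_dvd N (X + Y)"
  "mat_dvd N X \<Longrightarrow> mat_dvd N (X ** Z)" "mat_dvd N X \<Longrightarrow> mat_dvd N (Z ** X)"
  by (auto simp: mat_dvd_def matrix_matrix_mult_def intro!: dvd_sum)

lemma principal_congruence_iff: "(A,B,C,D) \<in> principal_congruence N \<longleftrightarrow>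
  (A,B,C,D) \<in> Sp \<and> mat_dvd N (A - mat 1) \<and> mat_dvd N B \<and> mat_dvd N C \<and> mat_dvd N (D - mat 1)"
  by (auto simp: principal_congruence_def mat_dvd_def)

fun spel_dvd :: "int \<Rightarrow> ('n::finite) spel \<Rightarrow> bool" where
  "spel_dvd N (A,B,C,D) \<longleftrightarrow> mat_dvd N A \<and> mat_dvd N B \<and> mat_dvd N C \<and> mat_dvd N D"

lemma spel_dvd_mult: "spel_dvd N g \<Longrightarrow> spel_dvd N (sp_mult g h)" "spel_dvd N g \<Longrightarrow> spel_dvd N (sp_mult h g)"
  by (cases g; cases h; auto intro!: mat_dvd_intros(1,2))
     (cases g; cases h; auto intro!: mat_dvd_intros(1,3))

lemma principal_congruence_iff': "g \<in> principal_congruence N \<longleftrightarrow> g \<in> Sp \<and> spel_dvd N (g - sp_one)"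
  by (cases g) (simp add: principal_congruence_iff sp_one_def)

text \<open>Conjugation takes 1 + \<epsilon> to 1 plus the conjugate of \<epsilon>, and divisibility
  of all blocks by N is stable under multiplication from both sides.\<close>

lemma principal_congruence_normal:
  assumes g: "\<gamma> \<in> Sp" and d: "\<delta> \<in> principal_congruence N"
  obtains g where "g \<in> principal_congruence N" "sp_mult g \<gamma> = sp_mult \<gamma> \<delta>"
proof
  define g where "g = sp_mult \<gamma> (sp_mult \<delta> (sp_inv \<gamma>))"
  define \<epsilon> where "\<epsilon> = \<delta> - sp_one"
  have d: "\<delta> \<in> Sp" "spel_dvd N \<epsilon>" using d unfolding principal_congruence_iff' \<epsilon>_def by auto
  have "\<delta> = \<epsilon> + sp_one" by (simp add: \<epsilon>_def)
  then have g_eq: "g - sp_one = sp_mult \<gamma> (sp_mult \<epsilon> (sp_inv \<gamma>))"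
    by (simp add: g_def sp_mult_add Sp_right_inv[OF \<open>\<gamma> \<in> Sp\<close>])
  have "g \<in> Sp" unfolding g_def by (intro sp_mult_Sp g d Sp_inv)
  then show "g \<in> principal_congruence N"
    unfolding principal_congruence_iff' g_eq using spel_dvd_mult(2)[OF spel_dvd_mult(1)[OF d(2)]] by blast
  show "sp_mult g \<gamma> = sp_mult \<gamma> \<delta>"
    unfolding g_def sp_mult_assoc using g by (simp add: Sp_iff)
qed

lemma translation_in_principal:
  assumes "sym_mat S"
  shows "(mat 1, (\<chi> i j. N * S$i$j), 0, mat 1) \<in> principal_congruence N"
proof -
  have "transpose 0 = (0::'a imat)" by (simp add: vec_eq_iff)
  moreover have "transpose (\<chi> i j. N * S$i$j) = (\<chi> i j. N * S$i$j)"
    using assms by (simp add: vec_eq_iff sym_mat_iff)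
  ultimately show ?thesis
    by (simp add: principal_congruence_iff Sp_def mat_mult_0_left mat_mult_0_right) (simp add: mat_dvd_def)
qed

lemma levi_in_principal:
  assumes "U ** V = mat 1" "V ** U = mat 1" "mat_dvd N (U - mat 1)" "mat_dvd N (V - mat 1)"
  shows "(U, 0, 0, transpose V) \<in> principal_congruence N"
proof -
  have "transpose U ** transpose V = mat 1" unfolding matrix_transpose_mul[symmetric] assms by simp
  moreover have "mat_dvd N (transpose V - mat 1)"
    unfolding mat_dvd_def
  proof (intro allI)
    fix i j
    have "(transpose V - mat 1) $ i $ j = (V - mat 1) $ j $ i" by (simp add: mat_def)
    then show "N dvd (transpose V - mat 1) $ i $ j" using assms(4) by (simp only: mat_dvd_def)
  qed
  moreover have "transpose 0 = (0::'a imat)" by (simp add: vec_eq_iff)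
  ultimately show ?thesis
    using assms by (simp add: principal_congruence_iff Sp_def mat_mult_0_left mat_mult_0_right) (simp add: mat_dvd_def)
qed

section \<open>Slashed forms under the principal congruence subgroup\<close>

lemma continuous_on_sp_act: "g \<in> Sp \<Longrightarrow> continuous_on siegel_H (sp_act g)"
  by (rule continuous_on_matrix) (rule cholo_sp_act[unfolded cholo_def, THEN conjunct1])

lemma sp_act_H: "g \<in> Sp \<Longrightarrow> Z \<in> siegel_H \<Longrightarrow> sp_act g Z \<in> siegel_H"
  by (cases g) (auto simp del: sp_act.simps intro: sp_act_in_H)

lemma j_det_nz: "g \<in> Sp \<Longrightarrow> Z \<in> siegel_H \<Longrightarrow> j_det g Z \<noteq> 0"
  by (cases g) (simp only: j_det.simps j_det_nonzero not_False_eq_True)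

lemma MpD:
  assumes "(\<gamma>, \<phi>) \<in> Mp"
  shows "\<gamma> \<in> Sp" "continuous_on siegel_H \<phi>" "Z \<in> siegel_H \<Longrightarrow> (\<phi> Z)\<^sup>2 = j_det \<gamma> Z" "Z \<in> siegel_H \<Longrightarrow> \<phi> Z \<noteq> 0"
  using assms j_det_nz[of \<gamma> Z] by (auto simp: Mp_def)

lemma slash_eq:
  assumes "\<lfloor>2 * k\<rfloor> = int m"
  shows "slash k (\<gamma>,\<phi>) F Z = F (sp_act \<gamma> Z) / \<phi> Z ^ m"
  using assms by (simp add: power_int_minus divide_inverse mult.commute)

lemma cholo_j_det: "g \<in> Sp \<Longrightarrow> cholo (j_det g)"
proof -
  obtain A B C D where g: "g = (A,B,C,D)" by (cases g) auto
  have "cholo (\<lambda>Z. (cmat C ** Z + cmat D) $ i $ j)" for i j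
    unfolding vector_add_component by (intro cholo_add cholo_matrix_mult cholo_nth cholo_const)
  then have "cholo (\<lambda>Z. det (cmat C ** Z + cmat D))" by (rule cholo_det)
  then show ?thesis by (rule cholo_cong) (simp add: g)
qed

lemma cholo_Mp: "(\<gamma>, \<phi>) \<in> Mp \<Longrightarrow> cholo \<phi>"
proof -
  assume x: "(\<gamma>, \<phi>) \<in> Mp"
  have "cholo (\<lambda>Z. (\<phi> Z)^2)" by (rule cholo_cong[OF cholo_j_det[OF MpD(1)[OF x]]]) (simp add: MpD(3)[OF x])
  then show ?thesis by (rule cholo_sqrt[OF MpD(2)[OF x]]) (rule MpD(4)[OF x])
qed

text \<open>Moving \<open>\<delta>\<close> through \<open>\<gamma>\<close> turns it into an element
  of the group under which F is invariant. The resulting factor is the m-th power of a square root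
  of the automorphy factor of \<open>\<delta>\<close>; which root it is depends on the lifts and is
  left open.\<close>

lemma slash_equivariance:
  fixes F :: "('n::finite) cmat \<Rightarrow> complex"
  assumes m: "\<lfloor>2 * k\<rfloor> = int m" and G: "G \<subseteq> Mp" and inv: "\<And>x Z. x \<in> G \<Longrightarrow> Z \<in> siegel_H \<Longrightarrow> slash k x F Z = F Z"
    and g: "\<gamma> \<in> Sp" and ex: "g \<in> fst ` G" and comm: "sp_mult g \<gamma> = sp_mult \<gamma> \<delta>" and x: "(\<gamma>, \<phi>) \<in> Mp" and d: "\<delta> \<in> Sp"
  obtains \<theta> where "continuous_on siegel_H \<theta>" "\<And>Z. Z \<in> siegel_H \<Longrightarrow> (\<theta> Z)\<^sup>2 = j_det \<delta> Z"
    "\<And>Z. Z \<in> siegel_H \<Longrightarrow> slash k (\<gamma>,\<phi>) F (sp_act \<delta> Z) = \<theta> Z ^ m * slash k (\<gamma>,\<phi>) F Z"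
proof -
  obtain \<psi> where p: "(g, \<psi>) \<in> G" using ex by auto
  then have pM: "(g, \<psi>) \<in> Mp" using G by auto
  \<comment> \<open>The quotient of the square roots along the two ways of reading the product g
    \<gamma> = \<gamma> \<delta>.\<close>
  let ?t = "\<lambda>Z. \<psi> (sp_act \<gamma> Z) * \<phi> Z / \<phi> (sp_act \<delta> Z)"
  show thesis
  proof (rule that[of ?t])
    show "continuous_on siegel_H ?t"
    proof (rule continuous_on_divide[OF continuous_on_mult[OF _ MpD(2)[OF x]]])
      show "continuous_on siegel_H (\<lambda>Z. \<psi> (sp_act \<gamma> Z))"
        by (rule continuous_on_compose_H[OF MpD(2)[OF pM] continuous_on_sp_act[OF g] sp_act_H[OF g]])
      show "continuous_on siegel_H (\<lambda>Z. \<phi> (sp_act \<delta> Z))"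
        by (rule continuous_on_compose_H[OF MpD(2)[OF x] continuous_on_sp_act[OF d] sp_act_H[OF d]])
      show "\<forall>Z\<in>siegel_H. \<phi> (sp_act \<delta> Z) \<noteq> 0" using MpD(4)[OF x sp_act_H[OF d]] by blast
    qed
    fix Z :: "'n cmat" assume Z: "Z \<in> siegel_H"
    have H: "sp_act \<gamma> Z \<in> siegel_H" "sp_act \<delta> Z \<in> siegel_H" by (rule sp_act_H[OF g Z], rule sp_act_H[OF d Z])
    have gS: "g \<in> Sp" using MpD(1)[OF pM] .
    have "j_det g (sp_act \<gamma> Z) * j_det \<gamma> Z = j_det \<gamma> (sp_act \<delta> Z) * j_det \<delta> Z"
      unfolding sp_cocycle(2)[OF gS g Z, symmetric] sp_cocycle(2)[OF g d Z, symmetric] comm ..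
    then show "(?t Z)\<^sup>2 = j_det \<delta> Z"
      using j_det_nz[OF g H(2)] by (simp add: power_divide power_mult_distrib MpD(3)[OF x] MpD(3)[OF pM] Z H)
    have "F (sp_act g (sp_act \<gamma> Z)) = F (sp_act \<gamma> Z) * \<psi> (sp_act \<gamma> Z) ^ m"
      using inv[OF p H(1)] MpD(4)[OF pM H(1)] by (simp add: slash_eq[OF m] nonzero_divide_eq_eq del: slash.simps)
    moreover have "sp_act g (sp_act \<gamma> Z) = sp_act \<gamma> (sp_act \<delta> Z)"
      unfolding sp_cocycle(1)[OF gS g Z, symmetric] sp_cocycle(1)[OF g d Z, symmetric] comm ..
    ultimately show "slash k (\<gamma>,\<phi>) F (sp_act \<delta> Z) = ?t Z ^ m * slash k (\<gamma>,\<phi>) F Z"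
      using MpD(4)[OF x Z] MpD(4)[OF x H(2)]
      by (simp add: slash_eq[OF m] power_divide power_mult_distrib del: slash.simps)
  qed
qed

text \<open>For translations the square of \<theta> is 1, so \<theta> is a constant sign on the
  connected half-space and a double translation removes it. For block diagonal elements det U is a
  unit, so \<theta> has modulus 1; absolute values are all that the Koecher principle will
  use.\<close>

lemma slash_symmetries:
  fixes F :: "('n::finite) cmat \<Rightarrow> complex"
  assumes m: "\<lfloor>2 * k\<rfloor> = int m" and \<Gamma>: "congruence_subgroup \<Gamma>" and G: "mp_subgroup G" "fst ` G = \<Gamma>" and F: "modular_form k G F"
    and x: "(\<gamma>, \<phi>) \<in> Mp"
  obtains N :: nat where "N > 0"
    "\<And>S Z. sym_mat S \<Longrightarrow> Z \<in> siegel_H \<Longrightarrow> slash k (\<gamma>,\<phi>) F (Z + msc (of_nat N) (cmat S)) = slash k (\<gamma>,\<phi>) F Z"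
    "\<And>U V Z. U ** V = mat 1 \<Longrightarrow> V ** U = mat 1 \<Longrightarrow> mat_dvd (int N) (U - mat 1) \<Longrightarrow> mat_dvd (int N) (V - mat 1) \<Longrightarrow> Z \<in> siegel_H
       \<Longrightarrow> norm (slash k (\<gamma>,\<phi>) F (cmat U ** Z ** transpose (cmat U))) = norm (slash k (\<gamma>,\<phi>) F Z)"
proof -
  obtain N where N: "N > 0" "principal_congruence N \<subseteq> \<Gamma>" using \<Gamma> by (auto simp: congruence_subgroup_def)
  define h where "h = slash k (\<gamma>,\<phi>) F"
  have g: "\<gamma> \<in> Sp" by (rule MpD(1)[OF x])
  have G': "G \<subseteq> Mp" using G by (simp add: mp_subgroup_def)
  have inv: "\<And>x Z. x \<in> G \<Longrightarrow> Z \<in> siegel_H \<Longrightarrow> slash k x F Z = F Z" using F by (auto simp: modular_form_def)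
  have th: "\<exists>\<theta>. continuous_on siegel_H \<theta> \<and> (\<forall>Z\<in>siegel_H. (\<theta> Z)\<^sup>2 = j_det \<delta> Z) \<and> (\<forall>Z\<in>siegel_H. h (sp_act \<delta> Z) = \<theta> Z ^ m * h Z)"
    if d: "\<delta> \<in> principal_congruence N" for \<delta>
  proof -
    obtain g' where g': "g' \<in> principal_congruence N" "sp_mult g' \<gamma> = sp_mult \<gamma> \<delta>" by (rule principal_congruence_normal[OF g d])
    have dS: "\<delta> \<in> Sp" using d by (auto simp: principal_congruence_def)
    have "g' \<in> fst ` G" using g'(1) N(2) G(2) by auto
    from slash_equivariance[OF m G' inv g this g'(2) x dS] show ?thesis unfolding h_def by metis
  qed
  show thesis
  \<comment> \<open>The doubled level turns every translation into the square of one of level N, so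
    the unknown sign occurs an even number of times.\<close>
  proof (rule that[of "nat (2 * N)"])
    show "nat (2 * N) > 0" using N by simp
    fix S :: "'n imat" and Z :: "'n cmat" assume S: "sym_mat S" and Z: "Z \<in> siegel_H"
    let ?d = "(mat 1, (\<chi> i j. N * S$i$j), 0, mat 1) :: 'n spel"
    let ?B = "msc (of_int N) (cmat S)"
    have d: "?d \<in> principal_congruence N" by (rule translation_in_principal[OF S])
    have mi: "matrix_inv (mat 1 :: 'n cmat) = mat 1" by (rule matrix_inv_unique) simp
    have cB: "cmat (\<chi> i j. N * S$i$j) = ?B" by (simp add: vec_eq_iff)
    have act: "sp_act ?d Z = Z + ?B" "j_det ?d Z = 1" for Z by (simp_all add: mat_mult_0_left mi cB)
    obtain \<theta> where t: "continuous_on siegel_H \<theta>" "\<And>Z. Z \<in> siegel_H \<Longrightarrow> (\<theta> Z)\<^sup>2 = 1" "\<And>Z. Z \<in> siegel_H \<Longrightarrow> h (Z + ?B) = \<theta> Z ^ m * h Z"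
      using th[OF d] unfolding act by auto
    have t1: "\<theta> ` siegel_H \<subseteq> {1, -1}" using t(2) by (auto simp: power2_eq_1_iff)
    have "connected (siegel_H :: 'n cmat set)" using convex_siegel_H convex_connected by blast
    then have "\<theta> constant_on siegel_H"
      by (rule continuous_finite_range_constant[OF _ t(1)]) (rule finite_subset[OF t1], simp)
    then obtain c where c: "\<And>Z. Z \<in> siegel_H \<Longrightarrow> \<theta> Z = c" unfolding constant_on_def by blast
    have ZB: "Z + ?B \<in> siegel_H" using sp_act_H[of ?d Z] d Z unfolding act by (auto simp: principal_congruence_def)
    have "Z + msc (of_nat (nat (2 * N))) (cmat S) = Z + ?B + ?B" using N by (simp add: vec_eq_iff algebra_simps)
    then have "h (Z + msc (of_nat (nat (2 * N))) (cmat S)) = c ^ m * (c ^ m * h Z)"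
      by (simp only: t(3)[OF ZB] t(3)[OF Z] c[OF Z] c[OF ZB])
    also have "\<dots> = (c^2) ^ m * h Z" by (simp add: power2_eq_square power_mult_distrib)
    also have "c^2 = 1" using t(2)[OF Z] c[OF Z] by simp
    finally show "slash k (\<gamma>,\<phi>) F (Z + msc (of_nat (nat (2 * N))) (cmat S)) = slash k (\<gamma>,\<phi>) F Z" unfolding h_def by (simp only: power_one mult_1)
  next
    fix U V :: "'n imat" and Z :: "'n cmat"
    assume UV: "U ** V = mat 1" "V ** U = mat 1" "mat_dvd (int (nat (2 * N))) (U - mat 1)" "mat_dvd (int (nat (2 * N))) (V - mat 1)" and Z: "Z \<in> siegel_H"
    let ?d = "(U, 0, 0, transpose V) :: 'n spel"
    have "N dvd int (nat (2 * N))" using N by simp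
    then have "mat_dvd N (U - mat 1)" "mat_dvd N (V - mat 1)" using UV(3,4) unfolding mat_dvd_def by (meson dvd_trans)+
    then have d: "?d \<in> principal_congruence N" by (intro levi_in_principal UV)
    have "transpose (cmat V) ** transpose (cmat U) = mat 1"
      unfolding matrix_transpose_mul[symmetric] cmat_mult[symmetric] UV by simp
    then have mi: "matrix_inv (cmat (transpose V)) = transpose (cmat U)"
      unfolding cmat_transpose by (rule matrix_inv_unique)
    have act: "sp_act ?d Z = cmat U ** Z ** transpose (cmat U)" by (simp add: mat_mult_0_left mi)
    have "det U * det V = 1" unfolding det_mul[symmetric] UV by simp
    then have "\<bar>det V\<bar> = 1" by (metis abs_1 abs_mult abs_zmult_eq_1 mult.commute)
    then have j: "norm (j_det ?d Z) = 1"
      by (simp add: mat_mult_0_left cmat_transpose det_transpose det_cmat)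
    obtain \<theta> where t: "(\<theta> Z)\<^sup>2 = j_det ?d Z" "h (sp_act ?d Z) = \<theta> Z ^ m * h Z"
      using th[OF d] Z by blast
    have "norm (\<theta> Z) ^ 2 = 1" using j unfolding t(1)[symmetric] by (simp add: norm_power)
    then have "norm (\<theta> Z) = 1" by (simp add: power2_eq_1_iff) (use norm_ge_zero[of "\<theta> Z"] in linarith)
    then show "norm (slash k (\<gamma>,\<phi>) F (cmat U ** Z ** transpose (cmat U))) = norm (slash k (\<gamma>,\<phi>) F Z)"
      using t(2) unfolding act h_def by (simp add: norm_mult norm_power)
  qed
qed

text \<open>Joint continuity is read off from the given expansion: its terms, composed with the
  action and divided by \<phi>^m, form a locally dominated series.\<close>

lemma cholo_slash:
  assumes m: "\<lfloor>2 * k\<rfloor> = int m" and F: "fourier_expansion F M a" and x: "(\<gamma>, \<phi>) \<in> Mp"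
  shows "cholo (slash k (\<gamma>,\<phi>) F)"
proof -
  let ?\<nu> = "\<lambda>T. (1 / real M) *\<^sub>R T"
  have M: "M \<ge> 1" and hs: "\<And>Z. Z \<in> siegel_H \<Longrightarrow> ((\<lambda>T. a T * e (trace (rcmat T ** Z) / of_nat M)) has_sum F Z) Lambda"
    using F by (auto simp: fourier_expansion_def)
  have eq: "trace (rcmat T ** Z) / of_nat M = cpair (?\<nu> T) Z" for T Z
    by (simp add: trace_rcmat_mult cpair_scaleR_left)
  have g: "\<gamma> \<in> Sp" by (rule MpD(1)[OF x])
  have "loc_summable Lambda (\<lambda>T Z. 1 / (\<Prod>i\<in>{..<m}. \<phi> Z) * (a T * e (cpair (?\<nu> T) (sp_act \<gamma> Z))))"
  proof (rule loc_summable_series)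
    fix Z :: "'a cmat" assume "Z \<in> siegel_H"
    from hs[OF this, unfolded eq] have "(\<lambda>T. a T * e (cpair (?\<nu> T) Z)) summable_on Lambda"
      by (auto simp: summable_on_def)
    then show "(\<lambda>T. norm (a T * e (cpair (?\<nu> T) Z))) summable_on Lambda"
      by (simp only: summable_on_iff_abs_summable_on_complex)
  next
    show "pos_semidef (?\<nu> T)" if "T \<in> Lambda" for T
      using that M by (auto simp: Lambda_def pos_semidef_def sym_mat_iff simp flip: scaleR_matrix_vector_assoc)
    show "cholo (\<lambda>Z. 1 / (\<Prod>i\<in>{..<m}. \<phi> Z))"
      by (intro cholo_divide cholo_const cholo_prod cholo_Mp[OF x]) (simp add: MpD(4)[OF x])
  qed (auto intro: cholo_sp_act[OF g] sp_act_H[OF g])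
  from loc_summable_cholo_delta(1)[OF this] show ?thesis
  proof (rule cholo_cong)
    fix Z :: "'a cmat" assume Z: "Z \<in> siegel_H"
    have "(\<Sum>\<^sub>\<infinity>T\<in>Lambda. 1 / (\<Prod>i\<in>{..<m}. \<phi> Z) * (a T * e (cpair (?\<nu> T) (sp_act \<gamma> Z))))
        = 1 / \<phi> Z ^ m * F (sp_act \<gamma> Z)"
      unfolding infsum_cmult_right' using infsumI[OF hs[OF sp_act_H[OF g Z], unfolded eq]] by simp
    then show "(\<Sum>\<^sub>\<infinity>T\<in>Lambda. 1 / (\<Prod>i\<in>{..<m}. \<phi> Z) * (a T * e (cpair (?\<nu> T) (sp_act \<gamma> Z)))) = slash k (\<gamma>,\<phi>) F Z"
      by (simp add: slash_eq[OF m] del: slash.simps)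
  qed
qed

subsection \<open>Fourier expansions and the Koecher principle\<close>

lemma norm_fcoef_le:
  assumes f: "periodic f" and m: "m \<in> zlat" and B: "\<And>x. x \<in> cbox 0 One \<Longrightarrow> norm (f x) \<le> B"
  shows "norm (fcoef f m) \<le> B"
proof -
  have "norm (fcoef f m) \<le> integral (cbox 0 One) (\<lambda>x::'a. B)"
    unfolding fcoef_def
    by (rule integral_norm_bound_integral[OF fcoef_integrable[OF f m]]) (auto simp: norm_mult norm_er B)
  also have "\<dots> = B" by (simp add: content_cbox')
  finally show ?thesis .
qed

text \<open>The Fourier transform is taken over all matrices X, which enter only through X + X^T; hence the
  coefficient at a non-symmetric frequency vanishes.\<close>
definition realsym :: "nat \<Rightarrow> real^('n::finite)^'n \<Rightarrow> 'n cmat" where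
  "realsym N X = rcmat (real N *\<^sub>R (X + transpose X))"

definition tslice :: "nat \<Rightarrow> ('n::finite cmat \<Rightarrow> complex) \<Rightarrow> 'n cmat \<Rightarrow> real^'n^'n \<Rightarrow> complex" where
  "tslice N h Z X = h (Z + realsym N X)"

lemma realsym_nth [simp]: "realsym N X $ i $ j = of_real (real N * (X$i$j + X$j$i))"
  by (simp add: realsym_def)

lemma realsym_add: "realsym N (X + Y) = realsym N X + realsym N Y"
  by (simp add: vec_eq_iff algebra_simps)

lemma realsym_half: "N > 0 \<Longrightarrow> sym_mat A \<Longrightarrow> realsym N ((1 / (2 * real N)) *\<^sub>R A) = rcmat A"
  by (simp add: vec_eq_iff sym_mat_iff field_simps flip: of_real_add)

lemma continuous_on_realsym [continuous_intros]:
  assumes "continuous_on S g" shows "continuous_on S (\<lambda>x. realsym N (g x))"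
  by (rule continuous_on_matrix) (simp, intro continuous_intros assms)

lemma siegel_H_add_real:
  assumes "Z \<in> siegel_H" "sym_mat A" shows "Z + rcmat A \<in> siegel_H"
proof -
  have "Im_mat (Z + rcmat A) = Im_mat Z" by (simp add: vec_eq_iff)
  then show ?thesis using assms by (auto simp: siegel_H_def sym_mat_iff)
qed

lemma siegel_H_add_realsym: "Z \<in> siegel_H \<Longrightarrow> Z + realsym N X \<in> siegel_H"
  unfolding realsym_def by (rule siegel_H_add_real) (simp_all add: sym_mat_iff)

lemma matrix_Basis: "b \<in> Basis \<Longrightarrow> \<exists>i j. b = axis i (axis j (1::real))" for b :: "real^'n^'n"
  by (auto simp: Basis_vec_def)

lemma axis_in_Basis: "axis i (axis j (1::real)) \<in> (Basis :: (real^'n^'n) set)"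
  by (auto simp: Basis_vec_def)

lemma inner_matrix_axis: "(m :: real^'n^'n) \<bullet> axis i (axis j 1) = m$i$j"
  by (simp add: inner_axis)

lemma zlat_matrix: "(m :: real^'n^'n) \<in> zlat \<longleftrightarrow> (\<forall>i j. m$i$j \<in> \<int>)"
proof
  assume m: "m \<in> zlat"
  have "m \<bullet> axis i (axis j 1) \<in> \<int>" for i j
    using m axis_in_Basis[of i j] unfolding zlat_def by blast
  then show "\<forall>i j. m$i$j \<in> \<int>" unfolding inner_matrix_axis by blast
next
  assume m: "\<forall>i j. m$i$j \<in> \<int>"
  have "m \<bullet> b \<in> \<int>" if b: "b \<in> Basis" for b
  proof -
    obtain i j where "b = axis i (axis j 1)" using matrix_Basis[OF b] by blast
    then show ?thesis using m by (simp only: inner_matrix_axis)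
  qed
  then show "m \<in> zlat" unfolding zlat_def by blast
qed

lemma trace_eq_inner: "sym_mat m \<Longrightarrow> trace (m ** S) = m \<bullet> S" for m S :: "real^'n^'n"
  unfolding trace_def matrix_matrix_mult_def inner_vec_def
  by (simp add: sym_mat_iff) (subst sum.swap, simp)

lemma cpair_rcmat: "sym_mat A \<Longrightarrow> cpair m (rcmat A) = of_real (m \<bullet> A)"
  by (simp add: cpair_def inner_vec_def sym_mat_iff)

context
  fixes h :: "('n::finite) cmat \<Rightarrow> complex" and N :: nat
  assumes h: "cholo h" and N: "N > 0"
    and per: "\<And>S Z. sym_mat S \<Longrightarrow> Z \<in> siegel_H \<Longrightarrow> h (Z + msc (of_nat N) (cmat S)) = h Z"
begin

lemma tslice_periodic:
  assumes Z: "Z \<in> siegel_H" shows "periodic (tslice N h Z)"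
  unfolding periodic_def
proof (intro conjI allI ballI)
  show "continuous_on UNIV (tslice N h Z)"
  proof -
    have "continuous_on UNIV (\<lambda>X. Z + realsym N X)" by (intro continuous_intros)
    then have "continuous_on UNIV (\<lambda>X. h (Z + realsym N X))"
      by (rule continuous_on_compose_H[OF h[unfolded cholo_def, THEN conjunct1]]) (rule siegel_H_add_realsym[OF Z])
    then show ?thesis unfolding tslice_def .
  qed
  fix X b :: "real^'n^'n" assume "b \<in> Basis"
  then obtain i j where b: "b = axis i (axis j 1)" using matrix_Basis by blast
  \<comment> \<open>The matrix unit plus its transpose; a diagonal unit counts twice, so the result
    is integral and symmetric in all cases.\<close>
  define S :: "'n imat" where "S = (\<chi> k l. (if k = i \<and> l = j then 1 else 0) + (if k = j \<and> l = i then 1 else 0))"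
  have ax: "axis i (axis j (1::real)) $ k $ l = (if k = i \<and> l = j then 1 else 0)" for k l by (simp add: axis_def)
  have "realsym N b $ k $ l = msc (of_nat N) (cmat S) $ k $ l" for k l
    unfolding realsym_nth b ax msc_nth cmat_nth S_def vec_lambda_beta
    by (cases "k = i"; cases "k = j"; cases "l = i"; cases "l = j") simp_all
  then have "realsym N b = msc (of_nat N) (cmat S)" unfolding vec_eq_iff by blast
  moreover have "S $ k $ l = S $ l $ k" for k l
    by (cases "k = i"; cases "k = j"; cases "l = i"; cases "l = j") (simp_all add: S_def)
  then have "sym_mat S" unfolding sym_mat_iff by blast
  ultimately show "tslice N h Z (X + b) = tslice N h Z X"
    unfolding tslice_def realsym_add add.assoc[symmetric] by (simp only: per siegel_H_add_realsym[OF Z])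
qed

text \<open>An antisymmetric shift leaves the slice unchanged, yet its size can be chosen so that it
  multiplies this coefficient by -1.\<close>

lemma fcoef_tslice_nonsym:
  assumes Z: "Z \<in> siegel_H" and m: "m \<in> zlat" "\<not> sym_mat m"
  shows "fcoef (tslice N h Z) m = 0"
proof -
  obtain i j where ij: "m$i$j \<noteq> m$j$i" using m(2) by (auto simp: sym_mat_iff)
  define t where "t = 1 / (2 * (m$i$j - m$j$i))"
  define V :: "real^'n^'n" where "V = t *\<^sub>R (axis i (axis j 1) - axis j (axis i 1))"
  have "realsym N V = 0" by (auto simp: vec_eq_iff V_def axis_def)
  then have "(\<lambda>X. tslice N h Z (X + V)) = tslice N h Z" by (simp add: tslice_def realsym_add fun_eq_iff)
  then have "fcoef (tslice N h Z) m = er (m \<bullet> V) * fcoef (tslice N h Z) m"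
    using fcoef_shift[OF tslice_periodic[OF Z] m(1), of V] by simp
  moreover have "m \<bullet> V = 1 / 2" using ij by (simp add: V_def inner_diff_right inner_matrix_axis t_def)
  moreover have "er (1 / 2) = -1" by (simp add: er_def e_def)
  ultimately show ?thesis by (simp add: equation_minus_iff)
qed

text \<open>The Fourier coefficient with its expected dependence on Z divided out, so that it ought
  to be constant. The factor 1/(2N) appears because \<open>realsym N X\<close> equals a symmetric A
  for X = A/(2N).\<close>

definition fG :: "real^'n^'n \<Rightarrow> 'n cmat \<Rightarrow> complex" where
  "fG m Z = fcoef (tslice N h Z) m * e (- cpair ((1 / (2 * real N)) *\<^sub>R m) Z)"

lemma fG_real_shift:
  assumes Z: "Z \<in> siegel_H" and m: "m \<in> zlat" and A: "sym_mat A"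
  shows "fG m (Z + rcmat A) = fG m Z"
proof -
  let ?V = "(1 / (2 * real N)) *\<^sub>R A"
  have "tslice N h (Z + rcmat A) = (\<lambda>X. tslice N h Z (X + ?V))"
    by (simp add: tslice_def realsym_add realsym_half[OF N A] fun_eq_iff add_ac)
  then have "fcoef (tslice N h (Z + rcmat A)) m = er (m \<bullet> ?V) * fcoef (tslice N h Z) m"
    using fcoef_shift[OF tslice_periodic[OF Z] m, of ?V] by simp
  moreover have "e (- cpair ((1 / (2 * real N)) *\<^sub>R m) (Z + rcmat A)) = e (- cpair ((1 / (2 * real N)) *\<^sub>R m) Z) * er (- (m \<bullet> ?V))"
    by (simp only: cpair_add_right cpair_rcmat[OF A] minus_add_distrib e_add er_def) simp
  moreover have "er (m \<bullet> ?V) * er (- (m \<bullet> ?V)) = 1" by (simp add: er_0 flip: er_add)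
  ultimately show ?thesis unfolding fG_def by (simp add: mult_ac)
qed

text \<open>Along the line the function is holomorphic in w and invariant when w moves by a real
  number, so its complex derivative is zero.\<close>

lemma fG_line:
  assumes Z: "Z \<in> siegel_H" and m: "m \<in> zlat" and E: "sym_mat E" and w: "Z + msc w (rcmat E) \<in> siegel_H"
  shows "fG m (Z + msc w (rcmat E)) = fG m Z"
proof -
  let ?X = "rcmat E"
  define U where "U = {w. Z + msc w ?X \<in> siegel_H}"
  have X: "sym_mat ?X" using E by (simp add: sym_mat_iff)
  have U: "open U" "convex U" unfolding U_def by (rule open_line[OF X] convex_line)+
  define \<phi> where "\<phi> = (\<lambda>w. fG m (Z + msc w ?X))"
  have "(\<lambda>w. integral (cbox 0 One) (\<lambda>Y. tslice N h (Z + msc w ?X) Y * er (- (m \<bullet> Y)))) holomorphic_on U"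
  proof (rule leibniz_rule_holomorphic[where fx = "\<lambda>w Y. delta ?X h (Z + msc w ?X + realsym N Y) * er (- (m \<bullet> Y))"])
    fix w and Y :: "real^'n^'n" assume w: "w \<in> U"
    then have "Z + realsym N Y + msc w ?X \<in> siegel_H"
      using siegel_H_add_realsym[of "Z + msc w ?X" N Y] by (simp add: U_def add_ac)
    from siegel_holomorphic_DERIV[OF _ X this] h
    have "((\<lambda>w. h (Z + realsym N Y + msc w ?X)) has_field_derivative delta ?X h (Z + realsym N Y + msc w ?X)) (at w)"
      by (simp add: cholo_def)
    then have "((\<lambda>w. tslice N h (Z + msc w ?X) Y) has_field_derivative delta ?X h (Z + msc w ?X + realsym N Y)) (at w)"
      unfolding tslice_def by (simp add: add_ac)
    from DERIV_cmult_right[OF this, of "er (- (m \<bullet> Y))"]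
    show "((\<lambda>w. tslice N h (Z + msc w ?X) Y * er (- (m \<bullet> Y))) has_field_derivative
       delta ?X h (Z + msc w ?X + realsym N Y) * er (- (m \<bullet> Y))) (at w within U)"
      by (rule has_field_derivative_at_within)
  next
    fix w assume "w \<in> U"
    then show "(\<lambda>Y. tslice N h (Z + msc w ?X) Y * er (- (m \<bullet> Y))) integrable_on cbox 0 One"
      by (intro fcoef_integrable tslice_periodic m) (simp add: U_def)
  next
    have "continuous_on (U \<times> cbox 0 One) (\<lambda>p. delta ?X h (Z + msc (fst p) ?X + realsym N (snd p)) * er (- (m \<bullet> snd p)))"
      by (intro continuous_intros continuous_on_compose_H[OF continuous_on_delta[OF h X]])
         (auto simp: U_def intro!: siegel_H_add_realsym)
    then show "continuous_on (U \<times> cbox 0 One) (\<lambda>(w, Y). delta ?X h (Z + msc w ?X + realsym N Y) * er (- (m \<bullet> Y)))"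
      by (simp add: case_prod_beta)
  qed (rule U(2))
  moreover have "(\<lambda>w. e (- cpair ((1 / (2 * real N)) *\<^sub>R m) (Z + msc w ?X))) holomorphic_on U"
    unfolding e_def cpair_def by (simp, intro holomorphic_intros) (use N in simp)
  ultimately have hol: "\<phi> holomorphic_on U"
    unfolding \<phi>_def fG_def fcoef_def by (rule holomorphic_on_mult)
  have "(\<phi> has_field_derivative 0) (at w within U)" if w: "w \<in> U" for w
  proof -
    obtain D where D: "(\<phi> has_field_derivative D) (at w)"
      using hol U(1) w by (meson holomorphic_on_open)
    have c: "\<phi> (w + of_real t) = \<phi> w" for t
    proof -
      have "Z + msc (w + of_real t) ?X = (Z + msc w ?X) + rcmat (t *\<^sub>R E)" by (simp add: vec_eq_iff algebra_simps)
      moreover have "Z + msc w ?X \<in> siegel_H" "sym_mat (t *\<^sub>R E)" using w E by (auto simp: U_def sym_mat_iff)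
      ultimately show ?thesis unfolding \<phi>_def by (simp only: fG_real_shift m)
    qed
    have "((\<lambda>t. w + of_real t) has_vector_derivative 1) (at (0::real))" by (auto intro!: derivative_eq_intros)
    from field_vector_diff_chain_at[OF this, of \<phi> D] D
    have "(\<phi> \<circ> (\<lambda>t. w + of_real t) has_vector_derivative D) (at (0::real))" by simp
    moreover have "\<phi> \<circ> (\<lambda>t. w + of_real t) = (\<lambda>t::real. \<phi> w)" by (simp add: c fun_eq_iff)
    ultimately have "((\<lambda>t. \<phi> w) has_vector_derivative D) (at (0::real))" by simp
    then have "D = 0" using vector_derivative_unique_at has_vector_derivative_const by blast
    then show ?thesis using D has_field_derivative_at_within by blast
  qed
  then obtain c where c: "\<And>w. w \<in> U \<Longrightarrow> \<phi> w = c"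
    using has_field_derivative_zero_constant[OF U(2), of \<phi>] by blast
  have "w \<in> U" "0 \<in> U" using w Z by (auto simp: U_def msc_0)
  then have "\<phi> w = \<phi> 0" using c by simp
  then show ?thesis by (simp add: \<phi>_def msc_0)
qed

text \<open>Two points are joined by a purely imaginary move inside a complex line, followed by a
  real translation.\<close>

lemma fG_const:
  assumes Z: "Z \<in> siegel_H" and W: "W \<in> siegel_H" and m: "m \<in> zlat"
  shows "fG m W = fG m Z"
proof -
  define E where "E = Im_mat W - Im_mat Z"
  define A :: "real^'n^'n" where "A = (\<chi> i j. Re (W$i$j) - Re (Z$i$j))"
  have s: "sym_mat E" "sym_mat A" using siegel_HD(1)[OF Z] siegel_HD(1)[OF W] by (auto simp: E_def A_def sym_mat_iff)
  have W': "W = (Z + msc \<i> (rcmat E)) + rcmat A" by (simp add: vec_eq_iff E_def A_def complex_eq_iff)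
  have "Im_mat (Z + msc \<i> (rcmat E)) = Im_mat W" by (simp add: vec_eq_iff E_def)
  then have H: "Z + msc \<i> (rcmat E) \<in> siegel_H"
    using siegel_HD(2)[OF W] siegel_HD(1)[OF Z] s by (auto simp: siegel_H_def sym_mat_iff)
  show ?thesis
    using fG_line[OF Z m s(1) H] fG_real_shift[OF H m s(2)] by (simp add: W')
qed

lemma fcoef_tslice:
  assumes Z: "Z \<in> siegel_H" and W: "W \<in> siegel_H" and m: "m \<in> zlat"
  shows "fcoef (tslice N h W) m = fG m Z * e (cpair ((1 / (2 * real N)) *\<^sub>R m) W)"
  unfolding fG_const[OF Z W m, symmetric] unfolding fG_def by (simp add: e_0 mult.assoc flip: e_add)

text \<open>Since \<open>fG\<close> is constant, a coefficient at Z can be estimated from a nearby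
  point. Lowering the imaginary part by \<open>\<delta>\<close> times the sign matrix of m gains
  exp(-a times the sum of the moduli of the entries of m), and compactness of a neighbourhood gives
  one bound for all m.\<close>

lemma fcoef_tslice_summable:
  assumes Z: "Z \<in> siegel_H"
  shows "(\<lambda>m. norm (fcoef (tslice N h Z) m)) summable_on zlat"
proof -
  obtain r where r: "r > 0" "\<And>Z'. sym_mat Z' \<Longrightarrow> dist Z' Z < r \<Longrightarrow> Z' \<in> siegel_H"
    using siegel_H_nbhd[OF Z] by metis
  define K where "K = {Z' :: 'n cmat. \<forall>i j. Z'$i$j = Z'$j$i} \<inter> cball Z (r / 2)"
  have "compact K" unfolding K_def
    by (intro closed_Int_compact closed_Collect_all closed_Collect_eq continuous_intros) simp
  have KH: "Z' \<in> siegel_H" if "Z' \<in> K" for Z'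
    using that r by (intro r(2)) (auto simp: K_def sym_mat_iff dist_commute)
  have "compact ((\<lambda>p. h (fst p + realsym N (snd p))) ` (K \<times> cbox 0 One))"
  proof (rule compact_continuous_image)
    show "compact (K \<times> cbox (0::real^'n^'n) One)" using \<open>compact K\<close> by (rule compact_Times) (rule compact_cbox)
    have "continuous_on (K \<times> cbox 0 One) (\<lambda>p. fst p + realsym N (snd p))" by (intro continuous_intros)
    then show "continuous_on (K \<times> cbox 0 One) (\<lambda>p. h (fst p + realsym N (snd p)))"
      by (rule continuous_on_compose_H[OF h[unfolded cholo_def, THEN conjunct1]]) (simp only: mem_Times_iff siegel_H_add_realsym KH)
  qed
  then have "bounded ((\<lambda>p. h (fst p + realsym N (snd p))) ` (K \<times> cbox 0 One))" by (rule compact_imp_bounded)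
  then obtain B where "\<forall>y\<in>(\<lambda>p. h (fst p + realsym N (snd p))) ` (K \<times> cbox 0 One). norm y \<le> B"
    unfolding bounded_iff by blast
  then have B: "norm (h (Z' + realsym N X)) \<le> B" if "Z' \<in> K" "X \<in> cbox 0 One" for Z' X
    using that by fastforce
  \<comment> \<open>The sign matrix has norm at most the dimension, so the shifted point stays
    within r/2 of Z.\<close>
  define \<delta> where "\<delta> = r / (2 * real DIM(real^'n^'n))"
  have \<delta>: "\<delta> > 0" unfolding \<delta>_def using r(1) by (intro divide_pos_pos mult_pos_pos) (simp_all add: DIM_positive)
  define a where "a = pi * \<delta> / real N"
  have a: "a > 0" using \<delta> N by (simp add: a_def)
  have ZK: "Z \<in> K" using siegel_HD(1)[OF Z] r by (auto simp: K_def sym_mat_iff)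
  have B0: "B \<ge> 0" using order_trans[OF norm_ge_zero B[OF ZK, of 0]] by (simp add: mem_box)
  have bd: "norm (fcoef (tslice N h Z) m) \<le> B * exp (- a * (\<Sum>b\<in>Basis. \<bar>m \<bullet> b\<bar>))" if m: "m \<in> zlat" for m
  proof (cases "sym_mat m")
    case False
    then show ?thesis using fcoef_tslice_nonsym[OF Z m] B0 by simp
  next
    case sm: True
    define S where "S = (\<Sum>b\<in>Basis. sgn (m \<bullet> b) *\<^sub>R b)"
    have Sn: "S $ i $ j = sgn (m$i$j)" for i j
    proof -
      have "S \<bullet> axis i (axis j 1) = sgn (m \<bullet> axis i (axis j 1))"
        unfolding S_def by (rule inner_sum_left_Basis[OF axis_in_Basis])
      then show ?thesis unfolding inner_matrix_axis .
    qed
    have sS: "sym_mat S" using sm by (simp add: sym_mat_iff Sn)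
    have mS: "trace (m ** S) = (\<Sum>b\<in>Basis. \<bar>m \<bullet> b\<bar>)"
      unfolding trace_eq_inner[OF sm] S_def inner_sum_right by (simp add: abs_sgn mult.commute)
    have "norm S \<le> (\<Sum>b\<in>(Basis :: (real^'n^'n) set). norm (sgn (m \<bullet> b) *\<^sub>R b))" unfolding S_def by (rule norm_sum)
    also have "\<dots> \<le> (\<Sum>b\<in>(Basis :: (real^'n^'n) set). 1)" by (intro sum_mono) (simp add: abs_sgn_eq)
    finally have nS: "norm S \<le> real DIM(real^'n^'n)" by simp
    define Z' where "Z' = Z - msc \<i> (rcmat (\<delta> *\<^sub>R S))"
    have "norm (rcmat (\<delta> *\<^sub>R S)) = \<delta> * norm S"
    proof -
      have "norm (rcmat (\<delta> *\<^sub>R S)) = norm (\<delta> *\<^sub>R S)" by (simp only: norm_vec_def rcmat_nth norm_of_real real_norm_def)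
      then show ?thesis using \<delta> by simp
    qed
    also have "\<dots> \<le> \<delta> * real DIM(real^'n^'n)" using nS \<delta> by (intro mult_left_mono) auto
    also have "\<dots> = r / 2" unfolding \<delta>_def by (simp add: field_simps)
    finally have "dist Z Z' \<le> r / 2" by (simp add: Z'_def dist_norm norm_msc)
    moreover have "sym_mat Z'" using siegel_HD(1)[OF Z] sS by (simp add: Z'_def sym_mat_iff)
    ultimately have Z'K: "Z' \<in> K" by (simp add: K_def sym_mat_iff)
    have "norm (fcoef (tslice N h Z') m) \<le> B"
      by (rule norm_fcoef_le[OF tslice_periodic[OF KH[OF Z'K]] m]) (simp add: tslice_def B[OF Z'K])
    then have "norm (fG m Z) * exp (- 2 * pi * trace ((1 / (2 * real N)) *\<^sub>R m ** Im_mat Z')) \<le> B"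
      unfolding fcoef_tslice[OF Z KH[OF Z'K] m] norm_mult norm_e_cpair .
    then have "(norm (fG m Z) * exp (- 2 * pi * trace ((1 / (2 * real N)) *\<^sub>R m ** Im_mat Z'))) * exp (- a * (\<Sum>b\<in>Basis. \<bar>m \<bullet> b\<bar>))
       \<le> B * exp (- a * (\<Sum>b\<in>Basis. \<bar>m \<bullet> b\<bar>))" by (rule mult_right_mono) simp
    moreover have "- 2 * pi * trace ((1 / (2 * real N)) *\<^sub>R m ** Im_mat Z) = - 2 * pi * trace ((1 / (2 * real N)) *\<^sub>R m ** Im_mat Z') + (- a * (\<Sum>b\<in>Basis. \<bar>m \<bullet> b\<bar>))"
    proof -
      have "Im_mat Z = Im_mat Z' + \<delta> *\<^sub>R S" by (simp add: vec_eq_iff Z'_def)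
      moreover have "trace ((1 / (2 * real N)) *\<^sub>R m ** (\<delta> *\<^sub>R S)) = (\<delta> / (2 * real N)) * trace (m ** S)"
        by (simp add: trace_def matrix_matrix_mult_def sum_distrib_left mult_ac)
      ultimately show ?thesis using N unfolding mS[symmetric] by (simp add: matrix_add_ldistrib trace_add a_def field_simps)
    qed
    ultimately show ?thesis unfolding fcoef_tslice[OF Z Z m] norm_mult norm_e_cpair by (simp only: exp_add mult.assoc)
  qed
  show ?thesis
    by (rule Infinite_Sum.abs_summable_on_comparison_test'[OF summable_on_cmult_right[OF lattice_exp_summable[OF a]] bd])
qed

text \<open>The expansion is the Fourier series of the slice evaluated at X = 0, with coefficients
  normalised at i times the identity. The coefficient bound involves only the real translates of one
  point, which may be chosen freely; the Koecher principle lets that point run to infinity.\<close>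

lemma periodic_expansion:
  obtains b where
    "\<And>Z. Z \<in> siegel_H \<Longrightarrow> ((\<lambda>m. b m * e (cpair ((1 / (2 * real N)) *\<^sub>R m) Z)) has_sum h Z) zlat"
    "\<And>m. m \<in> zlat \<Longrightarrow> \<not> sym_mat m \<Longrightarrow> b m = 0"
    "\<And>Z m B. Z \<in> siegel_H \<Longrightarrow> m \<in> zlat \<Longrightarrow> (\<And>A. sym_mat A \<Longrightarrow> norm (h (Z + rcmat A)) \<le> B) \<Longrightarrow>
       norm (b m) \<le> B * exp (2 * pi * trace ((1 / (2 * real N)) *\<^sub>R m ** Im_mat Z))"
    "\<And>Z. Z \<in> siegel_H \<Longrightarrow> \<exists>B. \<forall>A. sym_mat A \<longrightarrow> norm (h (Z + rcmat A)) \<le> B"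
proof -
  define Z0 :: "'n cmat" where "Z0 = dmat (\<lambda>_. \<i>)"
  have Z0: "Z0 \<in> siegel_H" unfolding Z0_def by (rule dmat_in_H) simp
  have r0: "realsym N 0 = 0" by (simp add: vec_eq_iff)
  have hs: "((\<lambda>m. fG m Z0 * e (cpair ((1 / (2 * real N)) *\<^sub>R m) Z)) has_sum h Z) zlat" if Z: "Z \<in> siegel_H" for Z
  proof -
    from fourier_has_sum[OF tslice_periodic[OF Z] fcoef_tslice_summable[OF Z], of 0]
    have "(fcoef (tslice N h Z) has_sum h Z) zlat" by (simp add: er_0 tslice_def r0)
    then show ?thesis by (rule has_sum_cong[THEN iffD1, rotated]) (rule fcoef_tslice[OF Z0 Z])
  qed
  show thesis
  proof (rule that[of "\<lambda>m. fG m Z0"])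
    show "fG m Z0 = 0" if "m \<in> zlat" "\<not> sym_mat m" for m
      using fcoef_tslice_nonsym[OF Z0 that] by (simp add: fG_def)
    show "norm (fG m Z0) \<le> B * exp (2 * pi * trace ((1 / (2 * real N)) *\<^sub>R m ** Im_mat Z))"
      if Z: "Z \<in> siegel_H" and m: "m \<in> zlat" and B: "\<And>A. sym_mat A \<Longrightarrow> norm (h (Z + rcmat A)) \<le> B" for Z m B
    proof -
      have "norm (fcoef (tslice N h Z) m) \<le> B"
        by (rule norm_fcoef_le[OF tslice_periodic[OF Z] m]) (simp add: tslice_def realsym_def B sym_mat_iff)
      then have "norm (fG m Z0) * exp (- (2 * pi * trace ((1 / (2 * real N)) *\<^sub>R m ** Im_mat Z))) \<le> B"
        unfolding fcoef_tslice[OF Z0 Z m] norm_mult norm_e_cpair by simp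
      then show ?thesis by (simp add: exp_minus field_simps)
    qed
    show "\<exists>B. \<forall>A. sym_mat A \<longrightarrow> norm (h (Z + rcmat A)) \<le> B" if Z: "Z \<in> siegel_H" for Z
    proof (intro exI allI impI)
      fix A :: "real^'n^'n" assume A: "sym_mat A"
      let ?g = "\<lambda>Z m. fG m Z0 * e (cpair ((1 / (2 * real N)) *\<^sub>R m) Z)"
      have n: "norm (?g (Z + rcmat A) m) = norm (?g Z m)" for m
      proof -
        have "Im_mat (Z + rcmat A) = Im_mat Z" by (simp add: vec_eq_iff)
        then show ?thesis by (simp add: norm_mult norm_e_cpair)
      qed
      have "?g Z summable_on zlat" using hs[OF Z] by (auto simp: summable_on_def)
      then have "(\<lambda>m. norm (?g Z m)) summable_on zlat" by (simp only: summable_on_iff_abs_summable_on_complex)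
      then have "norm (infsum (?g (Z + rcmat A)) zlat) \<le> infsum (\<lambda>m. norm (?g Z m)) zlat"
        by (rule norm_infsum_le_infsum) (simp only: n order_refl)
      then show "norm (h (Z + rcmat A)) \<le> infsum (\<lambda>m. norm (?g Z m)) zlat"
        using infsumI[OF hs[OF siegel_H_add_real[OF Z A]]] by simp
    qed
  qed (rule hs)
qed

end

section \<open>Congruence transformations and the Koecher principle\<close>

lemma quad_form_congr: "x \<bullet> ((K ** Y ** transpose K) *v x) = (transpose K *v x) \<bullet> (Y *v (transpose K *v x))" for Y :: "real^'n^'n"
proof -
  have "x \<bullet> ((K ** Y ** transpose K) *v x) = x \<bullet> (K *v (Y *v (transpose K *v x)))"
    by (simp only: matrix_vector_mul_assoc matrix_mul_assoc)
  also have "\<dots> = (transpose K *v x) \<bullet> (Y *v (transpose K *v x))" by (simp only: dot_lmul_matrix[symmetric] transpose_matrix_vector)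
  finally show ?thesis .
qed

lemma sym_mat_congr: "sym_mat Y \<Longrightarrow> sym_mat (K ** Y ** transpose K)" for Y :: "'a::comm_semiring_1^'n^'n"
  unfolding sym_mat_def by (simp add: matrix_transpose_mul matrix_mul_assoc)

lemma pos_semidef_congr: "pos_semidef Y \<Longrightarrow> pos_semidef (K ** Y ** transpose K)"
  unfolding pos_semidef_def by (simp only: quad_form_congr sym_mat_congr simp_thms)

lemma pos_def_congr:
  assumes "pos_def Y" "det K \<noteq> 0" shows "pos_def (K ** Y ** transpose K)"
  unfolding pos_def_def quad_form_congr
proof (intro conjI allI impI)
  show "sym_mat (K ** Y ** transpose K)" using assms by (intro sym_mat_congr) (simp add: pos_def_def)
  fix x :: "real^'a" assume "x \<noteq> 0"
  then have "transpose K *v x \<noteq> 0"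
    using det_nonzero_kernel[of "transpose K" x] assms(2) by (auto simp: det_transpose)
  then show "0 < (transpose K *v x) \<bullet> (Y *v (transpose K *v x))" using assms(1) by (simp add: pos_def_def)
qed

lemma Im_mat_congr: "Im_mat (rcmat K ** Z ** transpose (rcmat K)) = K ** Im_mat Z ** transpose K"
  by (simp add: vec_eq_iff matrix_matrix_mult_def sum_distrib_right)

lemma siegel_H_congr: "Z \<in> siegel_H \<Longrightarrow> det K \<noteq> 0 \<Longrightarrow> rcmat K ** Z ** transpose (rcmat K) \<in> siegel_H"
  unfolding siegel_H_def by (simp only: mem_Collect_eq Im_mat_congr sym_mat_congr pos_def_congr simp_thms)

text \<open>The set on which the form is negative is open and stable under nonzero scaling, so a
  real vector in it can be replaced by the integer part of a large multiple.\<close>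

lemma negative_integer_vector:
  fixes m :: "real^'n^'n"
  assumes "\<not> pos_semidef m" "sym_mat m"
  obtains g :: "'n \<Rightarrow> int" where "(\<chi> i. of_int (g i)) \<bullet> (m *v (\<chi> i. of_int (g i))) < 0"
proof -
  let ?q = "\<lambda>x. x \<bullet> (m *v x)"
  obtain x where x: "?q x < 0" using assms by (auto simp: pos_semidef_def not_le)
  have "continuous_on UNIV ?q" unfolding quad_form_sum by (intro continuous_intros)
  then have "open {y. ?q y < 0}" by (rule open_Collect_less[OF _ continuous_on_const])
  then obtain d where d: "d > 0" "\<And>y. dist y x < d \<Longrightarrow> ?q y < 0"
    using x unfolding open_dist by (auto dest!: bspec[of _ _ x])
  obtain k :: nat where k: "real k > real CARD('n) / d" using reals_Archimedean2 by blast
  then have k0: "real k > 0" using d divide_nonneg_pos[of "real CARD('n)" d] by linarith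
  let ?g = "(\<chi> i. of_int \<lfloor>real k * x$i\<rfloor>) :: real^'n"
  have "dist ((1 / real k) *\<^sub>R ?g) x \<le> (\<Sum>i\<in>UNIV. \<bar>((1 / real k) *\<^sub>R ?g - x) $ i\<bar>)"
    unfolding dist_norm by (rule norm_le_l1_cart)
  also have "\<dots> \<le> (\<Sum>i\<in>(UNIV::'n set). 1 / real k)"
  proof (rule sum_mono)
    fix i
    have "\<bar>of_int \<lfloor>real k * x$i\<rfloor> - real k * x$i\<bar> \<le> 1" by linarith
    then have "\<bar>of_int \<lfloor>real k * x$i\<rfloor> - real k * x$i\<bar> / real k \<le> 1 / real k" using k0 by (intro divide_right_mono) auto
    moreover have "((1 / real k) *\<^sub>R ?g - x) $ i = (of_int \<lfloor>real k * x$i\<rfloor> - real k * x$i) / real k"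
      using k0 by (simp add: field_simps)
    ultimately show "\<bar>((1 / real k) *\<^sub>R ?g - x) $ i\<bar> \<le> 1 / real k" using k0 by (simp add: abs_divide)
  qed
  also have "\<dots> < d" using k k0 d by (simp add: field_simps)
  finally have "?q ((1 / real k) *\<^sub>R ?g) < 0" by (rule d(2))
  then have "(1 / real k)^2 * ?q ?g < 0"
    by (simp add: matrix_vector_mult_scaleR power2_eq_square)
  then have "?q ?g < 0" using k0 by (simp add: mult_less_0_iff)
  then show thesis using that[of "\<lambda>i. \<lfloor>real k * x$i\<rfloor>"] by simp
qed

lemma exp_decay_le_0:
  fixes r c d :: real
  assumes "d < 0" "\<forall>\<^sub>F j in sequentially. r \<le> c * exp d ^ j"
  shows "r \<le> 0"
proof (rule tendsto_lowerbound[OF _ assms(2)])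
  show "(\<lambda>j. c * exp d ^ j) \<longlonglongrightarrow> 0"
    using assms(1) by (intro tendsto_mult_right_zero LIMSEQ_realpow_zero) auto
qed simp

text \<open>In degree one the boundedness condition at the cusp is the input: at imaginary part j
  the coefficient is at most C exp(jd) with d < 0.\<close>

lemma koecher_card_1:
  fixes h :: "('n::finite) cmat \<Rightarrow> complex" and m :: "real^'n^'n"
  assumes n1: "CARD('n) = 1" and m: "sym_mat m" "\<not> pos_semidef m" and N: "N > 0"
    and C: "\<And>Z. Z \<in> siegel_H \<Longrightarrow> (\<forall>i. Im (Z$i$i) \<ge> 1) \<Longrightarrow> norm (h Z) \<le> C"
    and bd: "\<And>Z B. Z \<in> siegel_H \<Longrightarrow> (\<And>A. sym_mat A \<Longrightarrow> norm (h (Z + rcmat A)) \<le> B) \<Longrightarrow>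
       norm b \<le> B * exp (2 * pi * trace ((1 / (2 * real N)) *\<^sub>R m ** Im_mat Z))"
  shows "b = (0::complex)"
proof -
  obtain i :: 'n where U: "UNIV = {i}" using n1 card_1_singletonE by blast
  obtain x where x: "x \<bullet> (m *v x) < 0" using m by (auto simp: pos_semidef_def not_le)
  have "x$i * m$i$i * x$i < 0" using x unfolding quad_form_sum U by simp
  then have mi: "m$i$i < 0" by (metis mult.assoc mult.commute mult_less_0_iff not_square_less_zero)
  define d where "d = pi * m$i$i / real N"
  have "norm b \<le> 0"
  proof (rule exp_decay_le_0)
    show "d < 0" using mi N by (simp add: d_def divide_neg_pos mult_pos_neg)
    show "\<forall>\<^sub>F j in sequentially. norm b \<le> C * exp d ^ j"
      using eventually_ge_at_top[of 1]
    proof eventually_elim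
      case (elim j)
      let ?Z = "dmat (\<lambda>_. \<i> * of_nat j) :: 'n cmat"
      have Z: "?Z \<in> siegel_H" by (rule dmat_in_H) (use elim in simp)
      have "norm (h (?Z + rcmat A)) \<le> C" if "sym_mat A" for A
        by (rule C[OF siegel_H_add_real[OF Z that]]) (use elim in simp)
      from bd[OF Z this] have "norm b \<le> C * exp (2 * pi * trace ((1 / (2 * real N)) *\<^sub>R m ** Im_mat ?Z))" .
      also have "2 * pi * trace ((1 / (2 * real N)) *\<^sub>R m ** Im_mat ?Z) = real j * d"
        unfolding trace_def matrix_matrix_mult_def by (simp add: U d_def)
      finally show ?case by (simp only: exp_of_nat_mult)
    qed
  qed
  then show ?thesis by simp
qed

text \<open>Let R(t) = 1 + t g v^T with v orthogonal to g; these unipotent matrices are integral and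
  close to the identity modulo N when N divides t. Along the transforms of a fixed point by R(t) the
  form h stays bounded, while the exponent in the coefficient bound is quadratic in t with leading
  coefficient a positive multiple of the value of m at g. A negative value therefore forces the
  coefficient to be 0.\<close>

lemma koecher_card_ge_2:
  fixes h :: "('n::finite) cmat \<Rightarrow> complex" and m :: "real^'n^'n"
  assumes n2: "CARD('n) \<noteq> 1" and m: "sym_mat m" "\<not> pos_semidef m" and N: "N > 0"
    and levi: "\<And>U V Z. U ** V = mat 1 \<Longrightarrow> V ** U = mat 1 \<Longrightarrow> mat_dvd (int N) (U - mat 1) \<Longrightarrow> mat_dvd (int N) (V - mat 1) \<Longrightarrow> Z \<in> siegel_H
       \<Longrightarrow> norm (h (cmat U ** Z ** transpose (cmat U))) = norm (h Z)"
    and fin: "\<And>Z. Z \<in> siegel_H \<Longrightarrow> \<exists>B. \<forall>A. sym_mat A \<longrightarrow> norm (h (Z + rcmat A)) \<le> B"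
    and bd: "\<And>Z B. Z \<in> siegel_H \<Longrightarrow> (\<And>A. sym_mat A \<Longrightarrow> norm (h (Z + rcmat A)) \<le> B) \<Longrightarrow>
       norm b \<le> B * exp (2 * pi * trace ((1 / (2 * real N)) *\<^sub>R m ** Im_mat Z))"
  shows "b = (0::complex)"
proof -
  obtain g :: "'n \<Rightarrow> int" where g: "(\<chi> i. of_int (g i)) \<bullet> (m *v (\<chi> i. of_int (g i))) < 0"
    by (rule negative_integer_vector[OF m(2,1)])
  obtain i where i: "g i \<noteq> 0"
  proof (rule ccontr)
    assume "\<not> thesis"
    then have "\<And>i. g i = 0" using that by blast
    then show False using g by (simp add: quad_form_sum)
  qed
  obtain j where j: "j \<noteq> i"
  proof (rule ccontr)
    assume "\<not> thesis"
    then have "(UNIV :: 'n set) = {i}" using that by blast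
    then show False using n2 by (metis card_1_singleton_iff One_nat_def)
  qed
  \<comment> \<open>An integral vector orthogonal to g, supported on i and j and nonzero at j; two
    different indices are available because the degree is not 1.\<close>
  define v where "v = (\<lambda>c. (if c = i then g j else 0) - (if c = j then g i else 0))"
  have vg: "(\<Sum>c\<in>UNIV. v c * g c) = 0"
  proof -
    have "v c * g c = (if c = i then g j * g i else 0) - (if c = j then g j * g i else 0)" for c by (simp add: v_def)
    then show ?thesis by (simp add: sum_subtractf)
  qed
  have vj: "v j \<noteq> 0" using i j by (simp add: v_def)
  define X1 :: "real^'n^'n" where "X1 = (\<chi> a b. of_int (g a * v b))"
  define R where "R = (\<lambda>t::real. mat 1 + t *\<^sub>R X1)"
  define Z0 :: "'n cmat" where "Z0 = dmat (\<lambda>_. \<i>)"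
  have Z0: "Z0 \<in> siegel_H" unfolding Z0_def by (rule dmat_in_H) simp
  have Im0: "Im_mat Z0 = mat 1" by (simp add: vec_eq_iff Z0_def mat_def)
  obtain B where B: "\<And>A. sym_mat A \<Longrightarrow> norm (h (Z0 + rcmat A)) \<le> B" using fin[OF Z0] by blast
  have B0: "B \<ge> 0" using order_trans[OF norm_ge_zero B[of 0]] by (simp add: sym_mat_iff)
  have RR: "R t ** R (- t) = mat 1" for t
  proof -
    have "X1 ** X1 = 0"
    proof -
      have "(X1 ** X1) $ a $ b = of_int (g a * v b * (\<Sum>c\<in>UNIV. v c * g c))" for a b
        by (simp add: X1_def matrix_matrix_mult_def sum_distrib_left mult_ac)
      then show ?thesis by (simp add: vec_eq_iff vg)
    qed
    then have "(t *\<^sub>R X1) ** (t *\<^sub>R X1) = 0" by (simp add: matrix_scalar_ac scalar_matrix_assoc flip: scalar_matrix_assoc)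
    then show ?thesis by (simp add: R_def mat_add_rdistrib matrix_add_ldistrib mat_mult_minus_right mat_diff_ldistrib)
  qed
  \<comment> \<open>The pairing of m with R(t) times its transpose is \<alpha> + t \<beta> + t^2
    \<gamma>.\<close>
  define \<alpha> \<beta> \<gamma> where "\<alpha> = m \<bullet> mat 1" and "\<beta> = m \<bullet> (X1 + transpose X1)" and "\<gamma> = m \<bullet> (X1 ** transpose X1)"
  have \<gamma>: "\<gamma> < 0"
  proof -
    have X: "(X1 ** transpose X1) $ a $ b = (\<Sum>c\<in>UNIV. (of_int (v c))^2) * (of_int (g a) * of_int (g b))" for a b
      by (simp add: X1_def matrix_matrix_mult_def sum_distrib_left power2_eq_square mult_ac)
    have "\<gamma> = (\<Sum>a\<in>UNIV. \<Sum>b\<in>UNIV. m$a$b * (X1 ** transpose X1)$a$b)"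
      unfolding \<gamma>_def by (simp add: inner_vec_def)
    also have "\<dots> = (\<Sum>c\<in>UNIV. (of_int (v c))^2) * ((\<chi> i. of_int (g i)) \<bullet> (m *v (\<chi> i. of_int (g i))))"
      unfolding X quad_form_sum sum_distrib_left by (simp add: mult_ac)
    finally have "\<gamma> = (\<Sum>c\<in>UNIV. (of_int (v c))^2) * ((\<chi> i. of_int (g i)) \<bullet> (m *v (\<chi> i. of_int (g i))))" .
    moreover have "(\<Sum>c\<in>UNIV. (real_of_int (v c))^2) > 0" using vj by (intro sum_pos2[of _ j]) auto
    ultimately show ?thesis using g by (simp only: mult_pos_neg)
  qed
  have tr: "trace ((1 / (2 * real N)) *\<^sub>R m ** (R t ** transpose (R t))) = (\<alpha> + t * \<beta> + t^2 * \<gamma>) / (2 * real N)" for t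
  proof -
    have t1: "transpose (R t) = mat 1 + t *\<^sub>R transpose X1" by (simp add: R_def vec_eq_iff mat_def)
    have "R t ** transpose (R t) = mat 1 + t *\<^sub>R (X1 + transpose X1) + t^2 *\<^sub>R (X1 ** transpose X1)"
    proof -
      have "(t *\<^sub>R X1) ** (t *\<^sub>R transpose X1) = t^2 *\<^sub>R (X1 ** transpose X1)"
        by (simp add: vec_eq_iff matrix_matrix_mult_def sum_distrib_left power2_eq_square mult_ac)
      then show ?thesis unfolding t1 unfolding R_def
        by (simp only: mat_add_rdistrib matrix_add_ldistrib matrix_mul_lid matrix_mul_rid scaleR_add_right add_ac)
    qed
    then show ?thesis
      using m(1) by (subst trace_eq_inner) (simp_all add: sym_mat_iff inner_add_right distrib_left add_divide_distrib \<alpha>_def \<beta>_def \<gamma>_def)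
  qed
  have main: "norm b \<le> B * exp (2 * pi * ((\<alpha> + t * \<beta> + t^2 * \<gamma>) / (2 * real N)))" if t: "t = real (k * N)" for t k
  proof -
    define W where "W = (\<lambda>s::int. mat 1 + (\<chi> a b. s * (g a * v b)) :: 'n imat)"
    let ?s = "int (k * N)"
    have cW: "cmat (W s) = rcmat (R (of_int s))" for s by (simp add: vec_eq_iff W_def R_def X1_def mat_def)
    have Wi: "W s ** W (- s) = mat 1" for s
    proof -
      have "cmat (W s ** W (- s)) = rcmat (R (of_int s) ** R (- of_int s))" by (simp add: cmat_mult cW rcmat_mult)
      also have "\<dots> = cmat (mat 1)" by (simp add: RR)
      finally show ?thesis by (simp add: vec_eq_iff del: cmat_1)
    qed
    have Wi': "W (- ?s) ** W ?s = mat 1" using Wi[of "- ?s"] by simp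
    have dv: "mat_dvd (int N) (W s - mat 1)" if "int N dvd s" for s using that by (simp add: mat_dvd_def W_def)
    have dt: "det (R t) \<noteq> 0" using det_nz_if_right_inverse[OF RR] .
    let ?Z = "rcmat (R t) ** Z0 ** transpose (rcmat (R t))"
    have Z: "?Z \<in> siegel_H" by (rule siegel_H_congr[OF Z0 dt])
    have "norm (h (?Z + rcmat A)) \<le> B" if A: "sym_mat A" for A
    proof -
      \<comment> \<open>The real translation pulled back by R(t): translates of the transformed
        point are transforms of translates of \<open>Z0\<close>, so the bound B carries
        over.\<close>
      define A' where "A' = R (- t) ** A ** transpose (R (- t))"
      have sA': "sym_mat A'" unfolding A'_def by (rule sym_mat_congr[OF A])
      have "transpose (R (- t)) ** transpose (R t) = mat 1" unfolding matrix_transpose_mul[symmetric] RR by simp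
      then have "R t ** A' ** transpose (R t) = A"
        unfolding A'_def using RR[of t] by (simp only: matrix_mul_assoc matrix_mul_lid) (simp only: matrix_mul_assoc[symmetric] matrix_mul_rid)
      then have "rcmat (R t) ** rcmat A' ** transpose (rcmat (R t)) = rcmat A" by (simp only: rcmat_mult[symmetric] rcmat_transpose[symmetric])
      then have "?Z + rcmat A = cmat (W ?s) ** (Z0 + rcmat A') ** transpose (cmat (W ?s))"
        unfolding cW using t by (simp add: matrix_add_ldistrib mat_add_rdistrib)
      then have "norm (h (?Z + rcmat A)) = norm (h (Z0 + rcmat A'))"
        using levi[OF Wi[of ?s] Wi' dv dv siegel_H_add_real[OF Z0 sA']] by simp
      then show ?thesis using B[OF sA'] by simp
    qed
    from bd[OF Z this] show ?thesis unfolding Im_mat_congr Im0 matrix_mul_rid tr .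
  qed
  define d where "d = - (pi / real N)"
  have "norm b \<le> 0"
  proof (rule exp_decay_le_0)
    show "d < 0" using N by (simp add: d_def)
    \<comment> \<open>From here on the quadratic term dominates the linear one by at least k, which
      leaves exponential decay in k.\<close>
    obtain k0 :: nat where k0: "real k0 > (\<bar>\<beta> * real N\<bar> + 1) / (- \<gamma> * (real N)^2)" using reals_Archimedean2 by blast
    have gN: "- \<gamma> * (real N)^2 > 0" using \<gamma> N by (simp add: mult_neg_pos)
    show "\<forall>\<^sub>F k in sequentially. norm b \<le> (B * exp (pi * \<alpha> / real N)) * exp d ^ k"
      using eventually_ge_at_top[of k0]
    proof eventually_elim
      case (elim k)
      have "(\<bar>\<beta> * real N\<bar> + 1) / (- \<gamma> * (real N)^2) \<le> real k" using k0 elim by linarith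
      then have "\<bar>\<beta> * real N\<bar> + 1 \<le> real k * (- \<gamma> * (real N)^2)" using gN by (simp only: pos_divide_le_eq)
      then have "real k * (\<beta> * real N + 1) \<le> real k * (real k * (- \<gamma> * (real N)^2))" by (intro mult_left_mono) auto
      then have "real (k * N) * \<beta> + (real (k * N))^2 * \<gamma> \<le> - real k" by (simp add: algebra_simps power2_eq_square)
      then have "(\<alpha> + real (k * N) * \<beta> + (real (k * N))^2 * \<gamma>) \<le> \<alpha> - real k" by simp
      then have "pi / real N * (\<alpha> + real (k * N) * \<beta> + (real (k * N))^2 * \<gamma>) \<le> pi / real N * (\<alpha> - real k)"
        by (intro mult_left_mono) auto
      also have "\<dots> = pi * \<alpha> / real N + real k * d" using N by (simp add: d_def field_simps)
      also have "pi / real N * (\<alpha> + real (k * N) * \<beta> + (real (k * N))^2 * \<gamma>) = 2 * pi * ((\<alpha> + real (k * N) * \<beta> + (real (k * N))^2 * \<gamma>) / (2 * real N))"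
        by simp
      finally have "exp (2 * pi * ((\<alpha> + real (k * N) * \<beta> + (real (k * N))^2 * \<gamma>) / (2 * real N))) \<le> exp (pi * \<alpha> / real N + real k * d)"
        by simp
      then have "B * exp (2 * pi * ((\<alpha> + real (k * N) * \<beta> + (real (k * N))^2 * \<gamma>) / (2 * real N))) \<le> B * exp (pi * \<alpha> / real N + real k * d)"
        by (rule mult_left_mono[OF _ B0])
      from order_trans[OF main[OF refl] this] show ?case by (simp only: exp_add exp_of_nat_mult mult.assoc)
    qed
  qed
  then show ?thesis by simp
qed

text \<open>The frequencies are integral matrices over 2N; vanishing at nonsymmetric ones and the
  Koecher principle leave only members of \<open>Lambda\<close>. Members of \<open>Lambda\<close>
  with a non-integral entry receive the coefficient 0.\<close>

lemma slash_fourier_expansion: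
  fixes F :: "('n::finite) cmat \<Rightarrow> complex"
  assumes m: "\<lfloor>2 * k\<rfloor> = int m" and \<Gamma>: "congruence_subgroup \<Gamma>" and G: "mp_subgroup G" "fst ` G = \<Gamma>" and F: "modular_form k G F"
    and fe: "fourier_expansion F M a" and x: "(\<gamma>, \<phi>) \<in> Mp"
  obtains M' b where "fourier_expansion (slash k (\<gamma>,\<phi>) F) M' b"
proof -
  define h where "h = slash k (\<gamma>,\<phi>) F"
  obtain N :: nat where N: "N > 0"
    and per: "\<And>S Z. sym_mat S \<Longrightarrow> Z \<in> siegel_H \<Longrightarrow> h (Z + msc (of_nat N) (cmat S)) = h Z"
    and levi: "\<And>U V Z. U ** V = mat 1 \<Longrightarrow> V ** U = mat 1 \<Longrightarrow> mat_dvd (int N) (U - mat 1) \<Longrightarrow> mat_dvd (int N) (V - mat 1) \<Longrightarrow> Z \<in> siegel_H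
       \<Longrightarrow> norm (h (cmat U ** Z ** transpose (cmat U))) = norm (h Z)"
    unfolding h_def by (rule slash_symmetries[OF m \<Gamma> G F x]) blast
  have ch: "cholo h" unfolding h_def by (rule cholo_slash[OF m fe x])
  obtain b where hs: "\<And>Z. Z \<in> siegel_H \<Longrightarrow> ((\<lambda>m. b m * e (cpair ((1 / (2 * real N)) *\<^sub>R m) Z)) has_sum h Z) zlat"
    and ns: "\<And>m. m \<in> zlat \<Longrightarrow> \<not> sym_mat m \<Longrightarrow> b m = 0"
    and bd: "\<And>Z m B. Z \<in> siegel_H \<Longrightarrow> m \<in> zlat \<Longrightarrow> (\<And>A. sym_mat A \<Longrightarrow> norm (h (Z + rcmat A)) \<le> B) \<Longrightarrow>
       norm (b m) \<le> B * exp (2 * pi * trace ((1 / (2 * real N)) *\<^sub>R m ** Im_mat Z))"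
    and fin: "\<And>Z. Z \<in> siegel_H \<Longrightarrow> \<exists>B. \<forall>A. sym_mat A \<longrightarrow> norm (h (Z + rcmat A)) \<le> B"
    using periodic_expansion[OF ch N per] by blast
  have psd: "b m = 0" if mz: "m \<in> zlat" and np: "\<not> pos_semidef m" for m
  proof (cases "sym_mat m")
    case False then show ?thesis by (rule ns[OF mz])
  next
    case sm: True
    show ?thesis
    proof (cases "CARD('n) = 1")
      case True
      obtain C where C: "\<And>Z. Z \<in> siegel_H \<Longrightarrow> (\<forall>i. Im (Z$i$i) \<ge> 1) \<Longrightarrow> norm (h Z) \<le> C"
        using F True x unfolding modular_form_def h_def by blast
      show ?thesis by (rule koecher_card_1[OF True sm np N C bd[OF _ mz]])
    next
      case False
      show ?thesis by (rule koecher_card_ge_2[OF False sm np N levi fin bd[OF _ mz]])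
    qed
  qed
  define b' where "b' T = (if T \<in> zlat then b T else 0)" for T
  have "fourier_expansion h (2 * N) b'"
    unfolding fourier_expansion_def
  proof (intro conjI ballI)
    show "1 \<le> 2 * N" using N by simp
    fix Z :: "'n cmat" assume Z: "Z \<in> siegel_H"
    have eq: "trace (rcmat T ** Z) / of_nat (2 * N) = cpair ((1 / (2 * real N)) *\<^sub>R T) Z" for T
      by (simp add: trace_rcmat_mult cpair_scaleR_left)
    have L: "m \<in> Lambda" if "m \<in> zlat" "pos_semidef m" for m :: "real^'n^'n"
      using that by (auto simp: Lambda_def half_integral_def pos_semidef_def zlat_matrix intro!: Ints_mult)
    show "((\<lambda>T. b' T * e (trace (rcmat T ** Z) / of_nat (2 * N))) has_sum h Z) Lambda"
      unfolding eq
    proof (rule has_sum_cong_neutral[THEN iffD1, OF _ _ _ hs[OF Z]])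
      fix T :: "real^'n^'n" assume "T \<in> zlat - Lambda"
      then have "b T = 0" using L psd by blast
      then show "b T * e (cpair ((1 / (2 * real N)) *\<^sub>R T) Z) = 0" by simp
    qed (auto simp: b'_def)
  qed
  then show thesis unfolding h_def by (rule that)
qed

subsection \<open>Singular coefficients\<close>

definition rmat :: "('n::finite) imat \<Rightarrow> real^'n^'n" where "rmat A = (\<chi> i j. of_int (A$i$j))"

lemma rmat_nth [simp]: "rmat A $ i $ j = of_int (A$i$j)" by (simp add: rmat_def)
lemma rmat_mult: "rmat (A ** B) = rmat A ** rmat B" by (simp add: vec_eq_iff matrix_matrix_mult_def)
lemma rmat_diff: "rmat (A - B) = rmat A - rmat B" by (simp add: vec_eq_iff)
lemma rmat_1: "rmat (mat 1) = mat 1" by (simp add: vec_eq_iff mat_def)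
lemma rmat_transpose: "rmat (transpose A) = transpose (rmat A)" by (simp add: vec_eq_iff)
lemma det_rmat: "det (rmat A) = of_int (det A)" by (simp add: det_def)
lemma rcmat_rmat: "rcmat (rmat A) = cmat A" by (simp add: vec_eq_iff)

lemma det_Ints: "(\<And>i j. A$i$j \<in> \<int>) \<Longrightarrow> det A \<in> \<int>" for A :: "'a::comm_ring_1^'n^'n"
  unfolding det_def by (intro Ints_sum Ints_mult Ints_prod) auto

lemma det_scaleR: "det (r *\<^sub>R A) = r ^ CARD('n) * det A" for A :: "real^'n^'n"
  unfolding det_def by (simp add: prod.distrib sum_distrib_left mult_ac)

lemma pos_semidef_scaleR: "pos_semidef T \<Longrightarrow> r \<ge> 0 \<Longrightarrow> pos_semidef (r *\<^sub>R T)"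
  unfolding pos_semidef_def by (simp add: sym_mat_iff flip: scaleR_matrix_vector_assoc)

lemma pos_def_scaleR: "pos_def T \<Longrightarrow> r > 0 \<Longrightarrow> pos_def (r *\<^sub>R T)"
  unfolding pos_def_def by (simp add: sym_mat_iff flip: scaleR_matrix_vector_assoc)

lemma LambdaD: "T \<in> Lambda \<Longrightarrow> pos_semidef T" "T \<in> Lambda \<Longrightarrow> 2 * T$i$j \<in> \<int>" "T \<in> Lambda \<Longrightarrow> T$i$j = T$j$i"
  by (auto simp: Lambda_def half_integral_def sym_mat_iff)

lemma cpair_congr: "cpair T (transpose (rcmat K) ** Z ** rcmat K) = cpair (K ** T ** transpose K) Z"
proof -
  have "trace (rcmat T ** (transpose (rcmat K) ** Z ** rcmat K)) = trace ((rcmat T ** transpose (rcmat K) ** Z) ** rcmat K)"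
    by (simp only: matrix_mul_assoc)
  also have "\<dots> = trace (rcmat K ** (rcmat T ** transpose (rcmat K) ** Z))" by (rule trace_mul_sym)
  also have "\<dots> = trace (rcmat (K ** T ** transpose K) ** Z)"
    by (simp only: matrix_mul_assoc rcmat_mult rcmat_transpose)
  finally show ?thesis unfolding trace_rcmat_mult .
qed

lemma norm_e_cpair_real: "norm (e (cpair T (rcmat S))) = 1"
proof -
  have "Im_mat (rcmat S) = 0" by (simp add: vec_eq_iff)
  then show ?thesis by (simp add: norm_e_cpair mat_mult_0_right trace_def)
qed

text \<open>The frequency T/M after the substitution of K^T Z K for Z; \<open>bwd\<close> is the
  inverse change of index.\<close>

definition fwd :: "nat \<Rightarrow> real^('n::finite)^'n \<Rightarrow> real^'n^'n \<Rightarrow> real^'n^'n" where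
  "fwd M K T = (1 / real M) *\<^sub>R (K ** T ** transpose K)"

definition bwd :: "nat \<Rightarrow> real^('n::finite)^'n \<Rightarrow> real^'n^'n \<Rightarrow> real^'n^'n" where
  "bwd M K S = real M *\<^sub>R (matrix_inv K ** S ** transpose (matrix_inv K))"

text \<open>The original coefficient in the new indexing, with the phase caused by the real
  translation \<open>S0\<close>, extended by zero so that the sum can run over
  \<open>Lq\<close>.\<close>

definition twist :: "(real^('n::finite)^'n \<Rightarrow> complex) \<Rightarrow> nat \<Rightarrow> real^'n^'n \<Rightarrow> real^'n^'n \<Rightarrow> real^'n^'n \<Rightarrow> complex" where
  "twist a M K S0 S = (if bwd M K S \<in> Lambda then a (bwd M K S) * e (cpair ((1 / real M) *\<^sub>R bwd M K S) (rcmat S0)) else 0)"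

lemma scaleR_mult_matrix: "r *\<^sub>R A ** B = r *\<^sub>R (A ** B)" "A ** r *\<^sub>R B = r *\<^sub>R (A ** B)" for A B :: "real^'n^'n"
  by (simp_all add: vec_eq_iff matrix_matrix_mult_def sum_distrib_left mult_ac)

lemma congr_inverse:
  fixes K T :: "real^'n^'n"
  assumes "det K \<noteq> 0"
  shows "matrix_inv K ** (K ** T ** transpose K) ** transpose (matrix_inv K) = T"
    and "K ** (matrix_inv K ** T ** transpose (matrix_inv K)) ** transpose K = T"
proof -
  have "transpose K ** transpose (matrix_inv K) = mat 1" "transpose (matrix_inv K) ** transpose K = mat 1"
    unfolding matrix_transpose_mul[symmetric] matrix_inv_right[OF assms] by simp_all
  then show "matrix_inv K ** (K ** T ** transpose K) ** transpose (matrix_inv K) = T"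
    "K ** (matrix_inv K ** T ** transpose (matrix_inv K)) ** transpose K = T"
    using matrix_inv_right[OF assms]
    by (simp_all only: matrix_mul_assoc matrix_mul_lid) (simp_all only: matrix_mul_assoc[symmetric] matrix_mul_rid)
qed

lemma bwd_fwd: "det K \<noteq> 0 \<Longrightarrow> M > 0 \<Longrightarrow> bwd M K (fwd M K T) = T"
  and fwd_bwd: "det K \<noteq> 0 \<Longrightarrow> M > 0 \<Longrightarrow> fwd M K (bwd M K T) = T"
  by (simp_all add: bwd_def fwd_def scaleR_mult_matrix congr_inverse)

text \<open>The denominator M belongs to the expansion, 2 to half-integrality, and d enters once for
  each of the two factors K.\<close>

lemma fwd_Lq:
  assumes T: "T \<in> Lambda" and dK: "\<And>i j. real d * K$i$j \<in> \<int>" and q: "2 * M * d^2 dvd q" "M > 0"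
  shows "fwd M K T \<in> Lq q"
proof -
  obtain c where c: "q = 2 * M * d^2 * c" using q by auto
  have "real q * fwd M K T $ i $ j \<in> \<int>" for i j
  proof -
    have "real q * fwd M K T $ i $ j = real c * (\<Sum>l\<in>UNIV. \<Sum>k\<in>UNIV. (real d * K$i$k) * (2 * T$k$l) * (real d * K$j$l))"
      using q(2) by (simp add: fwd_def c matrix_matrix_mult_def sum_distrib_left sum_distrib_right power2_eq_square mult_ac)
    also have "\<dots> \<in> \<int>" by (intro Ints_mult Ints_sum dK LambdaD(2)[OF T] Ints_of_nat)
    finally show ?thesis .
  qed
  moreover have "pos_semidef (fwd M K T)"
    unfolding fwd_def by (intro pos_semidef_scaleR pos_semidef_congr LambdaD(1)[OF T]) simp
  ultimately show ?thesis by (simp add: Lq_def)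
qed

lemma fourier_congr:
  assumes fe: "fourier_expansion F M a" and K: "det K \<noteq> 0" and dK: "\<And>i j. real d * K$i$j \<in> \<int>" and q: "2 * M * d^2 dvd q"
    and Z: "rcmat S0 + transpose (rcmat K) ** Z ** rcmat K \<in> siegel_H"
  shows "((\<lambda>S. twist a M K S0 S * e (cpair S Z)) has_sum F (rcmat S0 + transpose (rcmat K) ** Z ** rcmat K)) (Lq q)"
proof -
  have M: "M > 0" using fe by (simp add: fourier_expansion_def)
  let ?Z = "rcmat S0 + transpose (rcmat K) ** Z ** rcmat K"
  let ?g = "\<lambda>S. twist a M K S0 S * e (cpair S Z)"
  have inj: "inj_on (fwd M K) Lambda" by (rule inj_on_inverseI[of _ "bwd M K"]) (rule bwd_fwd[OF K M])
  have "((\<lambda>T. a T * e (trace (rcmat T ** ?Z) / of_nat M)) has_sum F ?Z) Lambda"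
    using fe Z by (simp add: fourier_expansion_def)
  also have "?this \<longleftrightarrow> (?g \<circ> fwd M K has_sum F ?Z) Lambda"
  proof (rule has_sum_cong)
    fix T :: "real^'a^'a" assume T: "T \<in> Lambda"
    have "trace (rcmat T ** ?Z) / of_nat M = cpair ((1 / real M) *\<^sub>R T) (rcmat S0) + cpair (fwd M K T) Z"
      unfolding trace_rcmat_mult cpair_add_right cpair_congr fwd_def cpair_scaleR_left by (simp add: add_divide_distrib)
    then show "a T * e (trace (rcmat T ** ?Z) / of_nat M) = (?g \<circ> fwd M K) T"
      using T by (simp add: twist_def bwd_fwd[OF K M] e_add)
  qed
  also have "\<dots> \<longleftrightarrow> (?g has_sum F ?Z) (fwd M K ` Lambda)" by (rule has_sum_reindex[OF inj, symmetric])
  also have "\<dots> \<longleftrightarrow> (?g has_sum F ?Z) (Lq q)"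
  proof (rule has_sum_cong_neutral)
    fix S :: "real^'a^'a" assume S: "S \<in> Lq q - fwd M K ` Lambda"
    have "bwd M K S \<notin> Lambda" using S fwd_bwd[OF K M, of S] by (metis DiffD2 imageI)
    then show "?g S = 0" by (simp add: twist_def)
  next
    fix S :: "real^'a^'a" assume S: "S \<in> fwd M K ` Lambda - Lq q"
    then show "?g S = 0" using fwd_Lq[OF _ dK q M] by blast
  qed simp
  finally show ?thesis .
qed

lemma Sp_C_D_sym:
  assumes "(A,B,C,D) \<in> Sp" shows "C ** transpose D = D ** transpose C"
  using Sp_right_inv[OF assms] by (simp add: sp_one_def mat_mult_minus_right)

lemma continuous_on_sandwich:
  fixes w :: "'a::topological_space \<Rightarrow> complex^'n^'n"
  assumes "continuous_on S w" shows "continuous_on S (\<lambda>x. P + Q ** w x ** R)"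
  by (rule continuous_on_matrix) (simp add: matrix_matrix_mult_def, intro continuous_intros assms)

text \<open>The element sends -C^(-1) D + R (-Z^(-1)) R^T to A C^(-1) + K^T Z K with K = (CR)^(-1).
  So F at an affine image of Z is expressed by the slashed form at an affine image of -Z^(-1), as
  the growth comparison demands. The integral matrix R is free and selects the direction in which
  the diagonal entry of T is tested; the phases \<open>\<omega>\<close> come from the real
  translation by -C^(-1) D.\<close>

lemma slash_zero_diagonal_sum_vanishes:
  fixes F :: "('n::finite) cmat \<Rightarrow> complex" and p :: 'n and R :: "'n imat"
  assumes mk: "\<lfloor>2 * k\<rfloor> = int m" and x: "((A,B,C,D), \<phi>) \<in> Mp" and dC: "det C \<noteq> 0"
    and fe: "fourier_expansion F M a" and fh: "fourier_expansion (slash k ((A,B,C,D), \<phi>) F) M' b"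
    and bd: "\<forall>T\<in>Lambda_plus. norm (a T) \<le> C0 * det T powr c"
    and m: "m \<ge> CARD('n)" and c1: "c \<ge> -1" and c2: "c < real m / 2 - (real CARD('n) + 1) / 2"
    and R: "det R \<noteq> 0"
  shows "\<exists>\<omega>. (\<forall>T. norm (\<omega> T) = 1) \<and> (\<forall>\<eta>>0. (\<Sum>\<^sub>\<infinity>T\<in>{T\<in>Lambda. (transpose (rmat R) ** T ** rmat R)$p$p = 0}.
        b T * \<omega> T * of_real (exp (- 2 * pi * \<eta> * trace (transpose (rmat R) ** T ** rmat R) / real M'))) = 0)"
proof -
  let ?h = "slash k ((A,B,C,D), \<phi>) F"
  let ?g = "(A,B,C,D)"
  have g: "?g \<in> Sp" by (rule MpD(1)[OF x])
  define cr r X E S1 K where "cr = rmat C" and "r = rmat R" and "X = rmat (C ** R)"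
    and "E = matrix_inv cr ** rmat D" and "S1 = rmat A ** matrix_inv cr" and "K = matrix_inv X"
  have dcr: "det cr \<noteq> 0" using dC by (simp add: cr_def det_rmat)
  have dr: "det r \<noteq> 0" using R by (simp add: r_def det_rmat)
  have X: "X = cr ** r" by (simp add: X_def cr_def r_def rmat_mult)
  have dX: "det X \<noteq> 0" using dcr dr by (simp add: X det_mul)
  have KX: "K ** X = mat 1" "X ** K = mat 1" unfolding K_def by (rule matrix_inv_right[OF dX])+
  have dK: "det K \<noteq> 0" by (rule det_nz_if_right_inverse[OF KX(1)])
  have ci: "cr ** matrix_inv cr = mat 1" "matrix_inv cr ** cr = mat 1" by (rule matrix_inv_right[OF dcr])+
  \<comment> \<open>By Cramer's rule the determinant of CR clears the denominators of its inverse
    K.\<close>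
  define d where "d = nat \<bar>det (C ** R)\<bar>"
  have dKi: "real d * K$i$j \<in> \<int>" for i j
  proof -
    let ?Y = "(\<chi> k l. if l = i then (if k = j then 1 else 0) else X$k$l) :: real^'n^'n"
    have "det X * K$i$j = det ?Y" unfolding K_def matrix_inv_nth[OF dX] using dX by simp
    moreover have "det ?Y \<in> \<int>" by (rule det_Ints) (simp add: X_def)
    moreover have "real d = \<bar>det X\<bar>" by (simp add: d_def X_def det_rmat)
    ultimately show ?thesis by (cases "det X \<ge> 0") auto
  qed
  have M: "M > 0" "M' > 0" using fe fh by (simp_all add: fourier_expansion_def)
  have d0: "d > 0" using dC R by (simp add: d_def det_mul)
  \<comment> \<open>A common multiple, so that the frequencies of both reindexed expansions lie in
    one \<open>Lq\<close>.\<close>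
  define q where "q = 2 * M * M' * d^2"
  have q: "q > 0" "2 * M * d^2 dvd q" "2 * M' * 1^2 dvd q" using M d0 by (auto simp: q_def)
  have crE: "cr ** E = rmat D" by (simp add: E_def matrix_mul_assoc ci)
  have sE: "sym_mat E"
  proof -
    have "transpose cr ** transpose (matrix_inv cr) = mat 1" unfolding matrix_transpose_mul[symmetric] ci by simp
    moreover have "cr ** transpose (rmat D) = rmat D ** transpose cr"
      unfolding cr_def rmat_transpose[symmetric] rmat_mult[symmetric] Sp_C_D_sym[OF g] ..
    ultimately have "transpose (rmat D) ** transpose (matrix_inv cr) = matrix_inv cr ** rmat D"
      by (metis ci(2) matrix_mul_assoc matrix_mul_lid matrix_mul_rid)
    then show ?thesis by (simp add: sym_mat_def E_def matrix_transpose_mul)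
  qed
  \<comment> \<open>The relation A^T D - C^T B = 1 solved for B - A C^(-1) D; it supplies the
    constant term in the numerator when the action is computed at \<open>V Z\<close>.\<close>
  have AE: "rmat B - rmat A ** E = - transpose (matrix_inv cr)"
  proof -
    have 1: "transpose A ** C = transpose C ** A" "transpose A ** D - transpose C ** B = mat 1" using g by (auto simp: Sp_def)
    have "transpose cr ** (rmat A ** E) = rmat (transpose C ** A) ** E"
      by (simp add: cr_def rmat_mult rmat_transpose matrix_mul_assoc)
    also have "\<dots> = rmat (transpose A) ** (cr ** E)" unfolding 1(1)[symmetric] by (simp add: rmat_mult cr_def matrix_mul_assoc)
    also have "\<dots> = rmat (transpose A ** D)" by (simp add: crE rmat_mult)
    finally have "transpose cr ** - (rmat B - rmat A ** E) = rmat (transpose A ** D - transpose C ** B)"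
      by (simp add: mat_diff_ldistrib rmat_diff cr_def rmat_mult rmat_transpose)
    then have "transpose cr ** - (rmat B - rmat A ** E) = mat 1" by (simp only: 1(2) rmat_1)
    then have "matrix_inv (transpose cr) = - (rmat B - rmat A ** E)" by (rule matrix_inv_unique)
    then show ?thesis by (simp add: transpose_matrix_inv[OF dcr])
  qed
  define V where "V = (\<lambda>Z :: 'n cmat. rcmat (- E) + rcmat r ** (- matrix_inv Z) ** transpose (rcmat r))"
  have VH: "rcmat (- E) + rcmat r ** W ** transpose (rcmat r) \<in> siegel_H" if "W \<in> siegel_H" for W
    using siegel_H_add_real[OF siegel_H_congr[OF that dr], of "- E"] sE by (simp add: sym_mat_iff add.commute)
  have VH': "V Z \<in> siegel_H" if "Z \<in> siegel_H" for Z unfolding V_def by (rule VH[OF siegel_H_inv(2)[OF that]])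
  have CV: "cmat C ** V Z + cmat D = cmat C ** (rcmat r ** (- matrix_inv Z) ** transpose (rcmat r))" for Z
  proof -
    have "cmat C ** rcmat (- E) = - cmat D"
    proof -
      have "rcmat (cr ** (- E)) = - cmat D" by (simp add: mat_mult_minus_right crE vec_eq_iff)
      then show ?thesis by (simp add: rcmat_mult cr_def rcmat_rmat)
    qed
    then show ?thesis by (simp add: V_def matrix_add_ldistrib)
  qed
  have act: "sp_act ?g (V Z) = rcmat S1 + transpose (rcmat K) ** Z ** rcmat K" if Z: "Z \<in> siegel_H" for Z
  proof -
    define W Y where "W = - matrix_inv Z" and "Y = rcmat r ** W ** transpose (rcmat r)"
    have ZW: "Z ** W = - mat 1" by (simp add: W_def mat_mult_minus_right matrix_inv_right[OF siegel_H_inv(1)[OF Z]])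
    have nz: "det (cmat C ** Y) \<noteq> 0"
      using j_det_nz[OF g VH'[OF Z]] CV[of Z] by (simp add: Y_def W_def)
    have "K ** cr ** r = mat 1" using KX(1) by (simp add: X matrix_mul_assoc)
    then have kcr: "rcmat K ** cmat C ** rcmat r = mat 1"
      by (metis cr_def rcmat_1 rcmat_mult rcmat_rmat)
    have kr: "transpose (rcmat K) ** transpose (rcmat r) = rcmat (transpose (matrix_inv cr))"
    proof -
      have "r ** K = matrix_inv cr"
        by (rule matrix_inv_unique[symmetric]) (simp add: matrix_mul_assoc X[symmetric] KX)
      then show ?thesis by (metis matrix_transpose_mul rcmat_mult rcmat_transpose)
    qed
    have "(transpose (rcmat K) ** Z ** rcmat K) ** (cmat C ** Y) = transpose (rcmat K) ** Z ** (rcmat K ** cmat C ** rcmat r) ** W ** transpose (rcmat r)"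
      by (simp only: Y_def matrix_mul_assoc)
    also have "\<dots> = transpose (rcmat K) ** (Z ** W) ** transpose (rcmat r)" by (simp only: kcr matrix_mul_assoc matrix_mul_rid)
    also have "\<dots> = - rcmat (transpose (matrix_inv cr))" by (simp add: ZW mat_mult_minus_right mat_mult_minus_left kr)
    also have "\<dots> = rcmat (rmat B - rmat A ** E)" by (simp add: AE vec_eq_iff)
    finally have 1: "(transpose (rcmat K) ** Z ** rcmat K) ** (cmat C ** Y) = rcmat (rmat B - rmat A ** E)" .
    have "rcmat S1 ** cmat C = cmat A"
    proof -
      have "S1 ** cr = rmat A" by (simp add: S1_def ci flip: matrix_mul_assoc)
      then show ?thesis by (metis cr_def rcmat_mult rcmat_rmat)
    qed
    then have 2: "rcmat S1 ** (cmat C ** Y) = cmat A ** Y" by (simp add: matrix_mul_assoc)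
    have "cmat A ** V Z + cmat B = cmat A ** Y + (rcmat (rmat A ** (- E)) + rcmat (rmat B))"
      by (simp add: V_def Y_def W_def matrix_add_ldistrib rcmat_mult rcmat_rmat)
    also have "rcmat (rmat A ** (- E)) + rcmat (rmat B) = rcmat (rmat B - rmat A ** E)"
      by (simp add: mat_mult_minus_right vec_eq_iff)
    finally have "cmat A ** V Z + cmat B = (rcmat S1 + transpose (rcmat K) ** Z ** rcmat K) ** (cmat C ** Y)"
      by (simp add: mat_add_rdistrib 1 2)
    moreover have "cmat C ** V Z + cmat D = cmat C ** Y" unfolding CV Y_def W_def ..
    ultimately have "sp_act ?g (V Z) = (rcmat S1 + transpose (rcmat K) ** Z ** rcmat K) ** (cmat C ** Y) ** matrix_inv (cmat C ** Y)" by simp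
    then show ?thesis by (simp only: matrix_mul_assoc[symmetric, of _ "cmat C ** Y"] matrix_inv_right(1)[OF nz] matrix_mul_rid)
  qed
  define c1n where "c1n = det (- mat 1 :: 'n cmat)"
  have c1n: "c1n \<noteq> 0"
    unfolding c1n_def by (rule det_nz_if_right_inverse[of _ "- mat 1"]) (simp add: mat_mult_minus_left mat_mult_minus_right)
  define \<kappa> where "\<kappa> = (\<lambda>Z. \<phi> (V Z) ^ m)"
  define Hf where "Hf = (\<lambda>W. ?h (rcmat (- E) + rcmat r ** W ** transpose (rcmat r)))"
  define Ff where "Ff = (\<lambda>Z. F (rcmat S1 + transpose (rcmat K) ** Z ** rcmat K))"
  let ?\<alpha> = "twist a M K S1" and ?\<beta> = "twist b M' (transpose r) (- E)"
  have dtr: "det (transpose r) \<noteq> 0" using dr by (simp add: det_transpose)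
  \<comment> \<open>The square of \<phi> at \<open>V Z\<close> is det C times the square of det R
    times det(-Z^(-1)); multiplied by det Z it is constant, and the m-th power of this constant is
    the prescribed one. The coefficient bound is rescaled by the determinant of the change of
    index.\<close>
  have main: "(\<Sum>\<^sub>\<infinity>S\<in>{S\<in>Lq q. S$p$p = 0}. ?\<beta> S * of_real (exp (-2 * pi * \<eta> * trace S))) = 0" if \<eta>: "\<eta> > 0" for \<eta>
  proof (rule zero_diagonal_sum_vanishes[of q ?\<alpha> Ff ?\<beta> Hf \<kappa> m "(of_int (det C) * of_int (det R)^2 * c1n) ^ m" c "\<bar>C0\<bar> * (real M ^ CARD('n) * (det (matrix_inv K))^2) powr c" \<eta> p])
    show "0 < q" by (rule q(1))
    show "(of_int (det C) * of_int (det R)^2 * c1n) ^ m \<noteq> 0" using dC R c1n by simp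
    show "CARD('n) \<le> m" "- 1 \<le> c" "c < real m / 2 - (real CARD('n) + 1) / 2" "0 < \<eta>" by (rule m c1 c2 \<eta>)+
    fix Z :: "'n cmat" assume Z: "Z \<in> siegel_H"
    have "sp_act ?g (V Z) \<in> siegel_H" by (rule sp_act_H[OF g VH'[OF Z]])
    then show "((\<lambda>T. ?\<alpha> T * e (cpair T Z)) has_sum Ff Z) (Lq q)"
      unfolding Ff_def act[OF Z] by (rule fourier_congr[OF fe dK dKi q(2)])
    have ri: "real 1 * transpose r $ i $ j \<in> \<int>" for i j by (simp add: r_def)
    have "rcmat (- E) + transpose (rcmat (transpose r)) ** Z ** rcmat (transpose r) \<in> siegel_H"
      using VH[OF Z] by (simp add: rcmat_transpose)
    from fourier_congr[OF fh dtr ri q(3) this]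
    show "((\<lambda>T. ?\<beta> T * e (cpair T Z)) has_sum Hf Z) (Lq q)"
      by (simp add: Hf_def rcmat_transpose del: slash.simps)
    have nz: "\<phi> (V Z) \<noteq> 0" by (rule MpD(4)[OF x VH'[OF Z]])
    have "Hf (- matrix_inv Z) = ?h (V Z)" by (simp only: Hf_def V_def)
    then have "\<kappa> Z * Hf (- matrix_inv Z) = F (sp_act ?g (V Z))"
      using nz unfolding \<kappa>_def slash_eq[OF mk] by simp
    then show "Ff Z = \<kappa> Z * Hf (- matrix_inv Z)" unfolding Ff_def act[OF Z] ..
    have "det (- matrix_inv Z) * det Z = c1n"
      unfolding det_mul[symmetric] c1n_def by (simp add: mat_mult_minus_left matrix_inv_right[OF siegel_H_inv(1)[OF Z]])
    moreover have "(\<phi> (V Z))\<^sup>2 = of_int (det C) * of_int (det R)^2 * det (- matrix_inv Z)"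
      unfolding MpD(3)[OF x VH'[OF Z]] j_det.simps CV det_mul det_transpose
      by (simp add: det_cmat r_def rcmat_rmat power2_eq_square)
    ultimately have "(\<phi> (V Z))\<^sup>2 * det Z = of_int (det C) * of_int (det R)^2 * c1n" by (simp add: mult.assoc)
    moreover have "(\<kappa> Z)^2 * det Z ^ m = ((\<phi> (V Z))\<^sup>2 * det Z) ^ m"
      by (simp add: \<kappa>_def power_mult_distrib mult.commute flip: power_mult)
    ultimately show "(\<kappa> Z)^2 * det Z ^ m = (of_int (det C) * of_int (det R)^2 * c1n) ^ m" by simp
  next
    have "continuous_on siegel_H (\<lambda>Z :: 'n cmat. - matrix_inv Z)"
      by (rule continuous_on_cong[THEN iffD1, OF refl _ continuous_on_sp_act[OF J_in_Sp]])
         (simp add: mat_mult_0_left cmat_minus mat_mult_minus_left)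
    then have "continuous_on siegel_H V" unfolding V_def by (rule continuous_on_sandwich)
    then have "continuous_on siegel_H (\<lambda>Z. \<phi> (V Z))" by (rule continuous_on_compose_H[OF MpD(2)[OF x]]) (rule VH')
    then show "continuous_on siegel_H \<kappa>" unfolding \<kappa>_def by (rule continuous_on_power)
  next
    fix S :: "real^'n^'n" assume S: "S \<in> Lq q" "pos_def S"
    define T where "T = bwd M K S"
    have dKi': "det (matrix_inv K) \<noteq> 0" by (rule det_nz_if_right_inverse[OF matrix_inv_right(2)[OF dK]])
    have dT: "det T = (real M ^ CARD('n) * (det (matrix_inv K))^2) * det S"
      by (simp add: T_def bwd_def det_scaleR det_mul det_transpose power2_eq_square)
    have Tp: "pos_def T" unfolding T_def bwd_def using M by (intro pos_def_scaleR pos_def_congr S dKi') simp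
    show "norm (?\<alpha> S) \<le> \<bar>C0\<bar> * (real M ^ CARD('n) * (det (matrix_inv K))^2) powr c * det S powr c"
    proof (cases "T \<in> Lambda")
      case True
      then have "T \<in> Lambda_plus" using Tp by (simp add: Lambda_def Lambda_plus_def)
      then have "norm (a T) \<le> C0 * det T powr c" using bd by blast
      also have "\<dots> \<le> \<bar>C0\<bar> * det T powr c" by (intro mult_right_mono) auto
      also have "det T powr c = (real M ^ CARD('n) * (det (matrix_inv K))^2) powr c * det S powr c"
        unfolding dT by (rule powr_mult)
      finally show ?thesis using True unfolding twist_def T_def[symmetric] by (simp add: norm_mult norm_e_cpair_real mult.assoc)
    next
      case False
      then show ?thesis by (simp add: twist_def T_def[symmetric])
    qed
  qed
  define \<omega> where "\<omega> = (\<lambda>T. e (cpair ((1 / real M') *\<^sub>R T) (rcmat (- E))))"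
  show ?thesis
  proof (intro exI[of _ \<omega>] conjI allI impI)
    show "norm (\<omega> T) = 1" for T by (simp only: \<omega>_def norm_e_cpair_real)
    fix \<eta> :: real assume "\<eta> > 0"
    let ?L = "{T\<in>Lambda. (transpose (rmat R) ** T ** rmat R)$p$p = 0}"
    let ?f = "fwd M' (transpose r)"
    have f: "?f T = (1 / real M') *\<^sub>R (transpose (rmat R) ** T ** rmat R)" for T by (simp add: fwd_def r_def)
    have inj: "inj_on ?f ?L" by (rule inj_on_inverseI[of _ "bwd M' (transpose r)"]) (rule bwd_fwd[OF dtr M(2)])
    have ri: "real 1 * transpose r $ i $ j \<in> \<int>" for i j by (simp add: r_def)
    have "0 = (\<Sum>\<^sub>\<infinity>S\<in>{S\<in>Lq q. S$p$p = 0}. ?\<beta> S * of_real (exp (-2 * pi * \<eta> * trace S)))" using main[OF \<open>\<eta> > 0\<close>] by simp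
    also have "\<dots> = (\<Sum>\<^sub>\<infinity>S\<in>?f ` ?L. ?\<beta> S * of_real (exp (-2 * pi * \<eta> * trace S)))"
    proof (rule infsum_cong_neutral)
      fix S assume "S \<in> ?f ` ?L - {S\<in>Lq q. S$p$p = 0}"
      then obtain T where T: "T \<in> Lambda" "S = ?f T" "(transpose (rmat R) ** T ** rmat R)$p$p = 0" "\<not> (S \<in> Lq q \<and> S$p$p = 0)" by blast
      moreover have "S \<in> Lq q" unfolding T(2) by (rule fwd_Lq[OF T(1) ri q(3) M(2)])
      moreover have "S$p$p = 0" unfolding T(2) f by (simp add: T(3))
      ultimately show "?\<beta> S * of_real (exp (-2 * pi * \<eta> * trace S)) = 0" by blast
    next
      fix S assume S: "S \<in> {S\<in>Lq q. S$p$p = 0} - ?f ` ?L"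
      define T where "T = bwd M' (transpose r) S"
      have fT: "?f T = S" unfolding T_def by (rule fwd_bwd[OF dtr M(2)])
      have "(transpose (rmat R) ** T ** rmat R)$p$p = 0"
      proof -
        have "(1 / real M') * (transpose (rmat R) ** T ** rmat R)$p$p = S$p$p" unfolding fT[symmetric] f by simp
        then show ?thesis using S M by simp
      qed
      then have "T \<notin> Lambda" using S fT by blast
      then show "?\<beta> S * of_real (exp (-2 * pi * \<eta> * trace S)) = 0" by (simp add: twist_def T_def)
    qed simp
    also have "\<dots> = infsum ((\<lambda>S. ?\<beta> S * of_real (exp (-2 * pi * \<eta> * trace S))) \<circ> ?f) ?L" by (rule infsum_reindex[OF inj])
    also have "\<dots> = (\<Sum>\<^sub>\<infinity>T\<in>?L. b T * \<omega> T * of_real (exp (- 2 * pi * \<eta> * trace (transpose (rmat R) ** T ** rmat R) / real M')))"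
    proof (rule infsum_cong)
      fix T assume T: "T \<in> ?L"
      have "trace (?f T) = trace (transpose (rmat R) ** T ** rmat R) / real M'"
        unfolding f by (simp add: trace_def sum_divide_distrib)
      then show "((\<lambda>S. ?\<beta> S * of_real (exp (-2 * pi * \<eta> * trace S))) \<circ> ?f) T
          = b T * \<omega> T * of_real (exp (- 2 * pi * \<eta> * trace (transpose (rmat R) ** T ** rmat R) / real M'))"
        using T by (simp add: twist_def bwd_fwd[OF dtr M(2)] \<omega>_def)
    qed
    finally show "(\<Sum>\<^sub>\<infinity>T\<in>?L. b T * \<omega> T * of_real (exp (- 2 * pi * \<eta> * trace (transpose (rmat R) ** T ** rmat R) / real M'))) = 0" by simp
  qed
qed

text \<open>After multiplication by exp(eta w(s)) the term at s is fixed, while the sum of all the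
  others decays exponentially in eta by the gap.\<close>

lemma isolation:
  fixes \<beta> :: "'i \<Rightarrow> complex" and w :: "'i \<Rightarrow> real"
  assumes s: "s \<in> A" and \<epsilon>: "\<epsilon> > 0" and gap: "\<And>T. T \<in> A \<Longrightarrow> T \<noteq> s \<Longrightarrow> \<beta> T \<noteq> 0 \<Longrightarrow> w s + \<epsilon> \<le> w T"
    and sm: "\<And>\<eta>. \<eta> > 0 \<Longrightarrow> (\<lambda>T. norm (\<beta> T * of_real (exp (- \<eta> * w T)))) summable_on A"
    and z: "\<And>\<eta>. \<eta> > 0 \<Longrightarrow> (\<Sum>\<^sub>\<infinity>T\<in>A. \<beta> T * of_real (exp (- \<eta> * w T))) = 0"
  shows "\<beta> s = 0"
proof -
  define K where "K = infsum (\<lambda>T. norm (\<beta> T * of_real (exp (- 1 * w T)))) (A - {s})"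
  have "norm (\<beta> s) \<le> 0"
  proof (rule exp_decay_le_0)
    show "- \<epsilon> < 0" using \<epsilon> by simp
    show "\<forall>\<^sub>F j in sequentially. norm (\<beta> s) \<le> (K * exp (w s)) * exp (- \<epsilon>) ^ j"
    proof (rule always_eventually, rule allI)
      fix j :: nat
      \<comment> \<open>One unit of eta is reserved for the summability of the tail, the other j
        units provide the decay.\<close>
      define \<eta> where "\<eta> = real j + 1"
      have \<eta>: "\<eta> > 0" by (simp add: \<eta>_def)
      let ?f = "\<lambda>T. \<beta> T * of_real (exp (- \<eta> * w T)) :: complex"
      have "?f summable_on A" using sm[OF \<eta>] by (rule abs_summable_summable)
      then have sf: "?f summable_on (A - {s})" by (rule summable_on_subset_banach) blast
      have "0 = infsum ?f ({s} \<union> (A - {s}))" using z[OF \<eta>] s by (simp add: insert_absorb)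
      also have "\<dots> = ?f s + infsum ?f (A - {s})" using sf by (subst infsum_Un_disjoint) auto
      finally have "norm (?f s) = norm (infsum ?f (A - {s}))" by (metis add_eq_0_iff norm_minus_cancel)
      also have "\<dots> \<le> infsum (\<lambda>T. exp (- real j * (w s + \<epsilon>)) * norm (\<beta> T * of_real (exp (- 1 * w T)))) (A - {s})"
      proof (rule norm_infsum_le_infsum)
        show "(\<lambda>T. exp (- real j * (w s + \<epsilon>)) * norm (\<beta> T * of_real (exp (- 1 * w T)))) summable_on (A - {s})"
          by (intro summable_on_cmult_right summable_on_subset_banach[OF sm[of 1]]) auto
        fix T assume T: "T \<in> A - {s}"
        show "norm (?f T) \<le> exp (- real j * (w s + \<epsilon>)) * norm (\<beta> T * of_real (exp (- 1 * w T)))"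
        proof (cases "\<beta> T = 0")
          case False
          then have "w s + \<epsilon> \<le> w T" using gap T by blast
          then have "real j * (w s + \<epsilon>) \<le> real j * w T" by (intro mult_left_mono) auto
          then have "- \<eta> * w T \<le> - real j * (w s + \<epsilon>) + (- 1 * w T)" by (simp add: \<eta>_def algebra_simps)
          then have "exp (- \<eta> * w T) \<le> exp (- real j * (w s + \<epsilon>)) * exp (- 1 * w T)" unfolding exp_add[symmetric] by (simp only: exp_le_cancel_iff)
          then have "norm (\<beta> T) * exp (- \<eta> * w T) \<le> norm (\<beta> T) * (exp (- real j * (w s + \<epsilon>)) * exp (- 1 * w T))"
            by (rule mult_left_mono) simp
          then show ?thesis by (simp only: norm_mult norm_of_real abs_exp_cancel mult_ac)
        qed simp
      qed
      also have "\<dots> = exp (- real j * (w s + \<epsilon>)) * K" unfolding K_def by (rule infsum_cmult_right')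
      finally have "norm (\<beta> s) * exp (- \<eta> * w s) \<le> exp (- real j * (w s + \<epsilon>)) * K"
        by (simp only: norm_mult norm_of_real abs_exp_cancel)
      then have "norm (\<beta> s) * exp (- \<eta> * w s) * exp (\<eta> * w s) \<le> exp (- real j * (w s + \<epsilon>)) * K * exp (\<eta> * w s)"
        by (rule mult_right_mono) simp
      also have "exp (- real j * (w s + \<epsilon>)) * K * exp (\<eta> * w s) = K * (exp (- real j * (w s + \<epsilon>)) * exp (\<eta> * w s))"
        by (simp only: mult_ac)
      finally have "norm (\<beta> s) * (exp (- \<eta> * w s) * exp (\<eta> * w s)) \<le> K * (exp (- real j * (w s + \<epsilon>)) * exp (\<eta> * w s))"
        by (simp only: mult.assoc)
      moreover have "exp (- \<eta> * w s) * exp (\<eta> * w s) = 1" unfolding exp_add[symmetric] by simp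
      moreover have "exp (- real j * (w s + \<epsilon>)) * exp (\<eta> * w s) = exp (w s) * exp (real j * (- \<epsilon>))"
        unfolding exp_add[symmetric] by (rule arg_cong[where f = exp]) (simp add: \<eta>_def algebra_simps)
      ultimately have "norm (\<beta> s) \<le> K * (exp (w s) * exp (real j * (- \<epsilon>)))" by (simp only: mult_1_right)
      then show "norm (\<beta> s) \<le> (K * exp (w s)) * exp (- \<epsilon>) ^ j" by (simp only: exp_of_nat_mult mult.assoc)
    qed
  qed
  then show ?thesis by simp
qed

lemma of_int_floor_Ints: "x \<in> \<int> \<Longrightarrow> of_int \<lfloor>x\<rfloor> = (x::real)"
  by (elim Ints_cases) simp

lemma nat_floor_leD: "nat \<lfloor>x\<rfloor> \<le> nat \<lfloor>y\<rfloor> \<Longrightarrow> 0 \<le> y \<Longrightarrow> \<lfloor>x\<rfloor> \<le> \<lfloor>y::real\<rfloor>"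
  by linarith

text \<open>The determinant vanishes over the rationals as well, so there is a rational kernel
  vector; multiplying it by the product of its denominators makes it integral.\<close>

lemma integer_kernel:
  fixes z :: "('n::finite) imat"
  assumes "det z = 0"
  obtains u p where "u p \<noteq> 0" "\<And>i. (\<Sum>j\<in>UNIV. z$i$j * u j) = 0"
proof -
  define Q :: "rat^'n^'n" where "Q = (\<chi> i j. of_int (z$i$j))"
  have "det Q = of_int (det z)" by (simp add: Q_def det_def)
  then obtain x where x: "x \<noteq> 0" "Q *v x = 0" using det_zero_kernel[of Q] assms by auto
  define num den where "num = (\<lambda>i. fst (quotient_of (x$i)))" and "den = (\<lambda>i. snd (quotient_of (x$i)))"
  have nd: "den i > 0" "x$i = of_int (num i) / of_int (den i)" for i
    using quotient_of_denom_pos[of "x$i"] quotient_of_div[of "x$i"] by (auto simp: num_def den_def prod_eq_iff)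
  define u where "u = (\<lambda>i. num i * (\<Prod>j\<in>UNIV - {i}. den j))"
  define D where "D = (\<Prod>j\<in>UNIV. den j)"
  have D: "D \<noteq> 0" using nd(1) by (simp add: D_def less_imp_neq[symmetric])
  have u: "of_int (u i) = of_int D * x$i" for i
  proof -
    have "D = den i * (\<Prod>j\<in>UNIV - {i}. den j)" unfolding D_def by (rule prod.remove) auto
    moreover have "of_int (den i) \<noteq> (0::rat)" using nd(1)[of i] by simp
    ultimately show ?thesis by (simp add: nd(2) u_def)
  qed
  obtain p where p: "x$p \<noteq> 0" using x(1) by (auto simp: vec_eq_iff)
  show thesis
  proof (rule that[of u p])
    show "u p \<noteq> 0" using u[of p] p D by auto
    fix i
    have "of_int (\<Sum>j\<in>UNIV. z$i$j * u j) = of_int D * (Q *v x) $ i"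
      by (simp add: u Q_def matrix_vector_mult_def sum_distrib_left mult_ac)
    then have "of_int (\<Sum>j\<in>UNIV. z$i$j * u j) = (0::rat)" by (simp add: x(2))
    then show "(\<Sum>j\<in>UNIV. z$i$j * u j) = 0" by (simp only: of_int_eq_0_iff)
  qed
qed

lemma trace_scaleR: "trace (r *\<^sub>R X) = r * trace X" for X :: "real^'n^'n"
  by (simp add: trace_def sum_distrib_left)

text \<open>Makes squared norms of half-integral matrices discrete, so that a bounded set of them
  attains a maximum.\<close>

lemma half_integral_inner_Ints:
  fixes X :: "real^'n^'n"
  assumes "\<And>i j. 2 * X$i$j \<in> \<int>" shows "4 * (X \<bullet> X) \<in> \<int>"
proof -
  have "4 * (X \<bullet> X) = (\<Sum>i\<in>UNIV. \<Sum>j\<in>UNIV. (2 * X$i$j) * (2 * X$i$j))"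
    by (simp add: inner_vec_def sum_distrib_left)
  also have "\<dots> \<in> \<int>" by (intro Ints_sum Ints_mult assms)
  finally show ?thesis .
qed

text \<open>A kernel vector of \<open>T0\<close> as a column of the change of variables puts
  \<open>T0\<close> into a vanishing sum. Many indices may share the same trace, so a further change
  of variables is needed to separate them. The coefficient then shown to vanish is that of an
  extremal index \<open>T1\<close>, possibly different from \<open>T0\<close>; since
  \<open>T1\<close> was selected among indices with nonzero coefficient, this is a
  contradiction.\<close>

lemma singular_coefficients_vanish:
  fixes F :: "('n::finite) cmat \<Rightarrow> complex"
  assumes mk: "\<lfloor>2 * k\<rfloor> = int m" and x: "((A,B,C,D), \<phi>) \<in> Mp" and dC: "det C \<noteq> 0"
    and fe: "fourier_expansion F M a" and fh: "fourier_expansion (slash k ((A,B,C,D), \<phi>) F) M' b"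
    and bd: "\<forall>T\<in>Lambda_plus. norm (a T) \<le> C0 * det T powr c"
    and m: "m \<ge> CARD('n)" and c1: "c \<ge> -1" and c2: "c < real m / 2 - (real CARD('n) + 1) / 2"
    and T0: "T0 \<in> Lambda" "\<not> pos_def T0"
  shows "b T0 = 0"
proof (rule ccontr)
  assume b0: "b T0 \<noteq> 0"
  define z :: "'n imat" where "z = (\<chi> i j. \<lfloor>2 * T0$i$j\<rfloor>)"
  have z: "of_int (z$i$j) = 2 * T0$i$j" for i j
    unfolding z_def using of_int_floor_Ints[OF LambdaD(2)[OF T0(1)], of i j] by simp
  have "rmat z = 2 *\<^sub>R T0" by (simp add: vec_eq_iff z)
  then have "real_of_int (det z) = 2 ^ CARD('n) * det T0" by (simp only: det_rmat[symmetric] det_scaleR)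
  then have "det z = 0" using pos_semidef_not_def_det[OF LambdaD(1)[OF T0(1)] T0(2)] by simp
  then obtain u p where u: "u p \<noteq> 0" "\<And>i. (\<Sum>j\<in>UNIV. z$i$j * u j) = 0" by (rule integer_kernel) blast
  have T0u: "(\<Sum>j\<in>UNIV. T0$i$j * of_int (u j)) = 0" for i
  proof -
    have "2 * (\<Sum>j\<in>UNIV. T0$i$j * of_int (u j)) = of_int (\<Sum>j\<in>UNIV. z$i$j * u j)"
      by (simp add: z sum_distrib_left mult.assoc)
    then show ?thesis by (simp add: u(2))
  qed
  \<comment> \<open>The identity with column p replaced by u: invertible since u p is nonzero, and
    the transform of \<open>T0\<close> gets the entry 0 at (p, p).\<close>
  define R0 :: "'n imat" where "R0 = (\<chi> i j. if j = p then u i else if j = i then 1 else 0)"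
  define r0 where "r0 = rmat R0"
  have dR0: "det R0 \<noteq> 0"
  proof
    assume "det R0 = 0"
    then have "det r0 = 0" by (simp add: r0_def det_rmat)
    then obtain y where y: "y \<noteq> 0" "r0 *v y = 0" by (rule det_zero_kernel)
    have e: "(r0 *v y) $ i = of_int (u i) * y$p + (if i = p then 0 else y$i)" for i
    proof -
      have "(r0 *v y) $ i = (\<Sum>j\<in>UNIV. (if j = p then of_int (u i) * y$p else 0) + (if j = i then (if i = p then 0 else y$i) else 0))"
        unfolding matrix_vector_mult_def vec_lambda_beta by (rule sum.cong) (auto simp: r0_def R0_def)
      then show ?thesis by (simp add: sum.distrib)
    qed
    have "y$p = 0" using e[of p] u(1) y(2) by simp
    then have "y$i = 0" for i using e[of i] y(2) by (cases "i = p") auto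
    then show False using y(1) by (simp add: vec_eq_iff)
  qed
  have dr0: "det r0 \<noteq> 0" using dR0 by (simp add: r0_def det_rmat)
  define P where "P = (\<lambda>T. transpose r0 ** T ** r0)"
  have P: "P T = transpose r0 ** T ** transpose (transpose r0)" for T by (simp add: P_def)
  have Pinv: "matrix_inv (transpose r0) ** P T ** transpose (matrix_inv (transpose r0)) = T" for T
    unfolding P by (rule congr_inverse(1)) (simp add: det_transpose dr0)
  have Pinj: "T = T'" if "P T = P T'" for T T'
  proof -
    have "T = matrix_inv (transpose r0) ** P T ** transpose (matrix_inv (transpose r0))" by (rule Pinv[symmetric])
    also have "\<dots> = T'" unfolding that by (rule Pinv)
    finally show ?thesis .
  qed
  have Ppsd: "pos_semidef (P T)" if "T \<in> Lambda" for T unfolding P by (rule pos_semidef_congr[OF LambdaD(1)[OF that]])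
  have Psym: "sym_mat (P T)" if "T \<in> Lambda" for T using Ppsd[OF that] by (simp add: pos_semidef_def)
  have Pint: "2 * P T $ i $ j \<in> \<int>" if T: "T \<in> Lambda" for T i j
  proof -
    have "2 * P T $ i $ j = (\<Sum>l\<in>UNIV. \<Sum>k\<in>UNIV. of_int (R0$k$i) * (2 * T$k$l) * of_int (R0$l$j))"
      by (simp add: P_def r0_def matrix_matrix_mult_def sum_distrib_left sum_distrib_right mult_ac)
    also have "\<dots> \<in> \<int>" by (intro Ints_sum Ints_mult LambdaD(2)[OF T]) auto
    finally show ?thesis .
  qed
  have Ptr: "2 * trace (P T) \<in> \<int>" "trace (P T) \<ge> 0" if "T \<in> Lambda" for T
    using Pint[OF that] pos_semidef_trace_nonneg[OF Ppsd[OF that]] by (auto simp: trace_def sum_distrib_left intro: Ints_sum)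
  have P0: "P T0 $ p $ p = 0"
  proof -
    have "(\<Sum>k\<in>UNIV. r0$k$p * T0$k$l) = 0" for l
      using T0u[of l] by (simp add: r0_def R0_def LambdaD(3)[OF T0(1), of l] mult.commute)
    then show ?thesis by (simp add: P_def matrix_matrix_mult_def)
  qed
  \<comment> \<open>The indices that effectively occur in the vanishing sum; \<open>T0\<close> is
    one of them by assumption.\<close>
  define BB where "BB = {T\<in>Lambda. b T \<noteq> 0 \<and> P T $ p $ p = 0}"
  have BL: "T \<in> Lambda" if "T \<in> BB" for T using that by (simp add: BB_def)
  have "T0 \<in> BB" using b0 P0 T0 by (simp add: BB_def)
  from ex_has_least_nat[of "\<lambda>T. T \<in> BB", OF this, of "\<lambda>T. nat \<lfloor>2 * trace (P T)\<rfloor>"]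
  obtain S0 where S0: "S0 \<in> BB" "\<And>T. T \<in> BB \<Longrightarrow> nat \<lfloor>2 * trace (P S0)\<rfloor> \<le> nat \<lfloor>2 * trace (P T)\<rfloor>" by blast
  define \<tau> where "\<tau> = trace (P S0)"
  have \<tau>0: "\<tau> \<ge> 0" unfolding \<tau>_def by (rule Ptr(2)[OF BL[OF S0(1)]])
  have \<tau>min: "trace (P T) = \<tau> \<or> trace (P T) \<ge> \<tau> + 1 / 2" if T: "T \<in> BB" for T
  proof -
    have i: "of_int \<lfloor>2 * trace (P T)\<rfloor> = 2 * trace (P T)" "of_int \<lfloor>2 * \<tau>\<rfloor> = 2 * \<tau>"
      unfolding \<tau>_def using Ptr(1)[OF BL[OF T]] Ptr(1)[OF BL[OF S0(1)]] by (auto intro: of_int_floor_Ints)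
    have "\<lfloor>2 * \<tau>\<rfloor> \<le> \<lfloor>2 * trace (P T)\<rfloor>" unfolding \<tau>_def by (rule nat_floor_leD[OF S0(2)[OF T]]) (simp add: Ptr(2)[OF BL[OF T]])
    then have "\<lfloor>2 * \<tau>\<rfloor> = \<lfloor>2 * trace (P T)\<rfloor> \<or> \<lfloor>2 * \<tau>\<rfloor> + 1 \<le> \<lfloor>2 * trace (P T)\<rfloor>" by linarith
    then have "real_of_int \<lfloor>2 * \<tau>\<rfloor> = of_int \<lfloor>2 * trace (P T)\<rfloor> \<or> real_of_int \<lfloor>2 * \<tau>\<rfloor> + 1 \<le> of_int \<lfloor>2 * trace (P T)\<rfloor>" by linarith
    then show ?thesis unfolding i by linarith
  qed
  define \<nu> where "\<nu> = real CARD('n) * real CARD('n)"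
  have inb: "\<bar>X \<bullet> Y\<bar> \<le> \<nu> * (s * t)" if "\<And>i j. \<bar>X$i$j\<bar> \<le> s" "\<And>i j. \<bar>Y$i$j\<bar> \<le> t" "s \<ge> 0" for X Y :: "real^'n^'n" and s t
  proof -
    have "\<bar>X \<bullet> Y\<bar> \<le> (\<Sum>i\<in>UNIV. \<bar>\<Sum>j\<in>UNIV. X$i$j * Y$i$j\<bar>)" by (simp add: inner_vec_def sum_abs)
    also have "\<dots> \<le> (\<Sum>i\<in>(UNIV::'n set). \<Sum>j\<in>UNIV. \<bar>X$i$j * Y$i$j\<bar>)" by (intro sum_mono sum_abs)
    also have "\<dots> \<le> (\<Sum>i\<in>(UNIV::'n set). \<Sum>j\<in>(UNIV::'n set). s * t)"
      unfolding abs_mult by (intro sum_mono mult_mono that abs_ge_zero)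
    finally show ?thesis by (simp add: \<nu>_def mult_ac)
  qed
  \<comment> \<open>At fixed trace the entries are bounded, hence so are the squared norms; being
    integers after multiplication by 4, they attain a maximum.\<close>
  have "\<forall>T. T \<in> BB \<and> trace (P T) = \<tau> \<longrightarrow> nat \<lfloor>4 * (P T \<bullet> P T)\<rfloor> < nat \<lfloor>4 * (\<nu> * (\<tau> * \<tau>))\<rfloor> + 1"
  proof (intro allI impI)
    fix T assume T: "T \<in> BB \<and> trace (P T) = \<tau>"
    have "\<bar>P T $ i $ j\<bar> \<le> \<tau>" for i j using pos_semidef_entry_trace[OF Ppsd[OF BL], of T i j] T by simp
    then have "\<bar>P T \<bullet> P T\<bar> \<le> \<nu> * (\<tau> * \<tau>)" by (intro inb \<tau>0)
    then have "4 * (P T \<bullet> P T) \<le> 4 * (\<nu> * (\<tau> * \<tau>))" by simp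
    then have "nat \<lfloor>4 * (P T \<bullet> P T)\<rfloor> \<le> nat \<lfloor>4 * (\<nu> * (\<tau> * \<tau>))\<rfloor>" by (intro nat_mono floor_mono)
    then show "nat \<lfloor>4 * (P T \<bullet> P T)\<rfloor> < nat \<lfloor>4 * (\<nu> * (\<tau> * \<tau>))\<rfloor> + 1" by simp
  qed
  from ex_has_greatest_nat[of "\<lambda>T. T \<in> BB \<and> trace (P T) = \<tau>", OF _ this, of S0]
  obtain T1 where T1: "T1 \<in> BB" "trace (P T1) = \<tau>"
    and T1max: "\<And>T. T \<in> BB \<Longrightarrow> trace (P T) = \<tau> \<Longrightarrow> nat \<lfloor>4 * (P T \<bullet> P T)\<rfloor> \<le> nat \<lfloor>4 * (P T1 \<bullet> P T1)\<rfloor>"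
    using S0(1) \<tau>_def by blast
  define A1 where "A1 = P T1"
  have T1L: "T1 \<in> Lambda" by (rule BL[OF T1(1)])
  have max: "P T \<bullet> P T \<le> A1 \<bullet> A1" if T: "T \<in> BB" "trace (P T) = \<tau>" for T
  proof -
    have i: "of_int \<lfloor>4 * (P T \<bullet> P T)\<rfloor> = 4 * (P T \<bullet> P T)" "of_int \<lfloor>4 * (A1 \<bullet> A1)\<rfloor> = 4 * (A1 \<bullet> A1)"
      unfolding A1_def using half_integral_inner_Ints[OF Pint[OF BL[OF T(1)]]] half_integral_inner_Ints[OF Pint[OF T1L]]
      by (auto intro: of_int_floor_Ints)
    have "\<lfloor>4 * (P T \<bullet> P T)\<rfloor> \<le> \<lfloor>4 * (A1 \<bullet> A1)\<rfloor>"
      unfolding A1_def by (rule nat_floor_leD[OF T1max[OF T]]) simp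
    then have "real_of_int \<lfloor>4 * (P T \<bullet> P T)\<rfloor> \<le> of_int \<lfloor>4 * (A1 \<bullet> A1)\<rfloor>" by (simp only: of_int_le_iff)
    then show ?thesis unfolding i by simp
  qed
  have sA: "sym_mat A1" and psA: "pos_semidef A1" unfolding A1_def by (rule Psym[OF T1L] Ppsd[OF T1L])+
  have Ap: "A1 $ p $ j = 0" "A1 $ j $ p = 0" for j
  proof -
    have "A1 $ p $ p = 0" using T1(1) by (simp add: BB_def A1_def)
    then show "A1 $ p $ j = 0" using pos_semidef_entry[OF psA, of p j] by simp
    then show "A1 $ j $ p = 0" using sA by (simp add: sym_mat_iff)
  qed
  define \<kappa>3 where "\<kappa>3 = trace (A1 ** A1 ** A1)"
  define \<theta> where "\<theta> = \<nu> * \<tau>"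
  have \<theta>0: "\<theta> \<ge> 0" using \<tau>0 by (simp add: \<theta>_def \<nu>_def)
  \<comment> \<open>The first summand beats the indices of larger trace, the second the constant
    \<open>\<kappa>3\<close> for equal as well as for larger trace, and the third makes N - 2
    \<open>A1\<close> invertible.\<close>
  obtain N :: nat where N': "real N \<ge> 8 * \<theta> * (\<tau> + 1 / 2) + 8 * \<bar>\<kappa>3\<bar> + 2 * norm A1 + 4" using real_arch_simple by blast
  have N: "real N \<ge> 8 * \<theta> * (\<tau> + 1 / 2) + 2" "real N \<ge> 8 * \<kappa>3 + 2" "real N \<ge> 4 * \<kappa>3 + 1" "real N > 2 * norm A1" "real N > 0"
  proof -
    have "8 * \<theta> * (\<tau> + 1 / 2) \<ge> 0" using \<theta>0 \<tau>0 by simp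
    then show "real N \<ge> 8 * \<theta> * (\<tau> + 1 / 2) + 2" "real N \<ge> 8 * \<kappa>3 + 2" "real N \<ge> 4 * \<kappa>3 + 1" "real N > 2 * norm A1" "real N > 0"
      using N' norm_ge_zero[of A1] abs_ge_zero[of \<kappa>3] abs_ge_self[of \<kappa>3] by linarith+
  qed
  have N4: "real N \<ge> 4 * \<theta>"
  proof -
    have "8 * \<theta> * (\<tau> + 1 / 2) = 8 * (\<theta> * \<tau>) + 4 * \<theta>" by (simp add: algebra_simps)
    moreover have "\<theta> * \<tau> \<ge> 0" using \<theta>0 \<tau>0 by simp
    ultimately show ?thesis using N(1) by linarith
  qed
  (* Among the matrices of minimal trace the one of largest norm, A1, is the unique minimiser of
     trace (Qr X Qr) for N large, because the linear term in N is - 4 N (X \<bullet> A1). *)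
  define Q :: "'n imat" where "Q = (\<chi> i j. (if i = j then int N else 0) - \<lfloor>2 * A1$i$j\<rfloor>)"
  define Qr where "Qr = real N *\<^sub>R mat 1 - 2 *\<^sub>R A1"
  have Qr: "rmat Q = Qr"
    using of_int_floor_Ints[OF Pint[OF T1L]] by (simp add: vec_eq_iff Q_def Qr_def A1_def mat_def)
  have sQ: "transpose Qr = Qr" using sA by (simp add: vec_eq_iff Qr_def mat_def sym_mat_iff)
  have dQ: "det Q \<noteq> 0"
  proof
    assume "det Q = 0"
    then have "det Qr = 0" by (simp add: det_rmat flip: Qr)
    then obtain y where y: "y \<noteq> 0" "Qr *v y = 0" by (rule det_zero_kernel)
    have "Qr *v y = real N *\<^sub>R y - 2 *\<^sub>R (A1 *v y)"
      by (simp add: Qr_def matrix_vector_mult_diff_rdistrib scaleR_matrix_vector_assoc[symmetric])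
    then have "y \<bullet> (real N *\<^sub>R y) = y \<bullet> (2 *\<^sub>R (A1 *v y))" using y(2) by simp
    then have "real N * (norm y)^2 = 2 * (y \<bullet> (A1 *v y))" by (simp add: power2_norm_eq_inner)
    also have "\<dots> \<le> 2 * (norm A1 * (norm y)^2)" using quad_form_bound[of y A1] by simp
    finally have "(real N - 2 * norm A1) * (norm y)^2 \<le> 0" by (simp add: algebra_simps)
    then show False using N(4) y(1) by (simp add: mult_le_0_iff)
  qed
  define R where "R = R0 ** Q"
  have dR: "det R \<noteq> 0" using dR0 dQ by (simp add: R_def det_mul)
  have RT: "transpose (rmat R) ** T ** rmat R = Qr ** P T ** Qr" for T
    unfolding R_def rmat_mult Qr matrix_transpose_mul sQ r0_def[symmetric] P_def by (simp only: matrix_mul_assoc)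
  \<comment> \<open>Row and column p of \<open>A1\<close> are zero, so the second change of
    variables only rescales the coordinate p and does not disturb the condition on the diagonal
    entry.\<close>
  have pp: "(Qr ** P T ** Qr) $ p $ p = real N * real N * P T $ p $ p" for T
  proof -
    have q: "Qr $ p $ k = (if k = p then real N else 0)" "Qr $ k $ p = (if k = p then real N else 0)" for k
      by (auto simp: Qr_def mat_def Ap)
    have "(Qr ** P T) $ p $ l = real N * P T $ p $ l" for l
      unfolding matrix_matrix_mult_def by (simp add: q if_distribR if_distrib[of "\<lambda>x. x * _"] cong: if_cong)
    then show ?thesis
      unfolding matrix_matrix_mult_def[of "Qr ** P T"] by (simp add: q if_distrib[of "\<lambda>x. _ * x"] cong: if_cong)
  qed
  define w0 where "w0 = (\<lambda>T. trace (Qr ** P T ** Qr))"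
  have w0: "w0 T = (real N)^2 * trace (P T) - 4 * real N * (P T \<bullet> A1) + 4 * trace (A1 ** P T ** A1)" if "T \<in> Lambda" for T
  proof -
    have "Qr ** P T ** Qr = (real N * real N) *\<^sub>R P T - (2 * real N) *\<^sub>R (A1 ** P T) - ((2 * real N) *\<^sub>R (P T ** A1) - 4 *\<^sub>R (A1 ** P T ** A1))"
      unfolding Qr_def by (simp add: mat_diff_rdistrib mat_diff_ldistrib scaleR_mult_matrix scaleR_diff_right mult_ac)
    then have "w0 T = (real N)^2 * trace (P T) - 2 * real N * trace (A1 ** P T) - (2 * real N * trace (P T ** A1) - 4 * trace (A1 ** P T ** A1))"
      unfolding w0_def by (simp add: trace_sub trace_scaleR power2_eq_square)
    moreover have "trace (A1 ** P T) = trace (P T ** A1)" by (rule trace_mul_sym)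
    ultimately show ?thesis unfolding trace_eq_inner[OF Psym[OF that]] by simp
  qed
  have w1: "w0 T1 = (real N)^2 * \<tau> - 4 * real N * (A1 \<bullet> A1) + 4 * \<kappa>3"
    unfolding \<kappa>3_def using w0[OF T1L] T1(2) unfolding A1_def[symmetric] by simp
  have w0_ge: "w0 T \<ge> (real N)^2 * trace (P T) - 4 * real N * (P T \<bullet> A1)" if T: "T \<in> Lambda" for T
  proof -
    have "pos_semidef (A1 ** P T ** transpose A1)" by (rule pos_semidef_congr[OF Ppsd[OF T]])
    then have "trace (A1 ** P T ** A1) \<ge> 0" using sA pos_semidef_trace_nonneg by (simp add: sym_mat_def)
    then show ?thesis unfolding w0[OF T] by simp
  qed
  have gap: "w0 T1 + 1 \<le> w0 T" if T: "T \<in> BB" "T \<noteq> T1" for T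
  proof (cases "trace (P T) = \<tau>")
    case True
    have TL: "T \<in> Lambda" by (rule BL[OF T(1)])
    \<comment> \<open>Distinct half-integral matrices have distance at least 1/2. Together with the
      maximality of the norm of \<open>A1\<close> this makes the pairing of \<open>P T\<close> with
      \<open>A1\<close> smaller by at least 1/8 than that of \<open>A1\<close> with itself.\<close>
    define X where "X = P T - A1"
    have "X \<noteq> 0" using Pinj[of T T1] T(2) by (auto simp: X_def A1_def)
    then obtain i j where ij: "X$i$j \<noteq> 0" by (auto simp: vec_eq_iff)
    have "2 * X$i$j \<in> \<int>"
      using Ints_diff[OF Pint[OF TL, of i j] Pint[OF T1L, of i j]] by (simp add: X_def A1_def right_diff_distrib)
    then have "\<bar>2 * X$i$j\<bar> \<ge> 1" using ij by (intro Ints_nonzero_abs_ge1) auto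
    then have "1 / 2 \<le> norm (X$i$j)" by simp
    also have "\<dots> \<le> norm (X$i)" by (rule Finite_Cartesian_Product.norm_nth_le)
    also have "\<dots> \<le> norm X" by (rule Finite_Cartesian_Product.norm_nth_le)
    finally have "(1 / 2)^2 \<le> (norm X)^2" by (intro power_mono) auto
    then have "1 / 4 \<le> X \<bullet> X" unfolding power2_norm_eq_inner by (simp add: power2_eq_square)
    also have "\<dots> = P T \<bullet> P T - 2 * (P T \<bullet> A1) + A1 \<bullet> A1" by (simp add: X_def inner_diff_left inner_diff_right inner_commute)
    finally have "1 / 8 \<le> A1 \<bullet> A1 - P T \<bullet> A1" using max[OF T(1) True] by simp
    then have "4 * real N * (1 / 8) \<le> 4 * real N * (A1 \<bullet> A1 - P T \<bullet> A1)" by (intro mult_left_mono) auto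
    then have "real N / 2 \<le> 4 * real N * (A1 \<bullet> A1) - 4 * real N * (P T \<bullet> A1)" by (simp add: right_diff_distrib)
    then show ?thesis using w0_ge[OF TL] N(2) unfolding w1 True by linarith
  next
    case False
    have TL: "T \<in> Lambda" by (rule BL[OF T(1)])
    \<comment> \<open>The pairing with \<open>A1\<close> is at most \<open>\<theta>\<close> t, so
      the main part is at least N (N - 4 \<open>\<theta>\<close>) t, and the surplus 1/2 in the
      trace decides for large N.\<close>
    define t where "t = trace (P T)"
    have t: "t \<ge> \<tau> + 1 / 2" using \<tau>min[OF T(1)] False by (simp add: t_def)
    have "\<bar>P T \<bullet> A1\<bar> \<le> \<nu> * (t * \<tau>)"
      using pos_semidef_entry_trace[OF Ppsd[OF TL]] pos_semidef_entry_trace[OF psA] Ptr(2)[OF TL] T1(2)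
      by (intro inb) (simp_all add: t_def A1_def)
    then have "P T \<bullet> A1 \<le> \<theta> * t" by (simp add: \<theta>_def mult_ac)
    then have "4 * real N * (P T \<bullet> A1) \<le> 4 * real N * (\<theta> * t)" by (intro mult_left_mono) auto
    then have 1: "w0 T \<ge> (real N * (real N - 4 * \<theta>)) * t"
      using w0_ge[OF TL] unfolding t_def[symmetric] by (simp add: algebra_simps power2_eq_square)
    have "(real N * (real N - 4 * \<theta>)) * t \<ge> (real N * (real N - 4 * \<theta>)) * (\<tau> + 1 / 2)"
      using t N4 by (intro mult_left_mono mult_nonneg_nonneg) auto
    also have "(real N * (real N - 4 * \<theta>)) * (\<tau> + 1 / 2) = (real N)^2 * \<tau> + real N * (real N - 8 * \<theta> * (\<tau> + 1 / 2)) / 2"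
      by (simp add: field_simps power2_eq_square)
    finally have 2: "w0 T \<ge> (real N)^2 * \<tau> + real N * (real N - 8 * \<theta> * (\<tau> + 1 / 2)) / 2" using 1 by linarith
    have "real N * 2 \<le> real N * (real N - 8 * \<theta> * (\<tau> + 1 / 2))" using N(1) by (intro mult_left_mono) auto
    moreover have "4 * real N * (A1 \<bullet> A1) \<ge> 0" by simp
    ultimately show ?thesis using 2 N(3) unfolding w1 by linarith
  qed
  have M': "real M' > 0" using fh by (simp add: fourier_expansion_def)
  from slash_zero_diagonal_sum_vanishes[OF mk x dC fe fh bd m c1 c2 dR, of p]
  obtain \<omega> where \<omega>': "\<forall>T. norm (\<omega> T) = 1"
    "\<forall>\<eta>>0. (\<Sum>\<^sub>\<infinity>T\<in>{T\<in>Lambda. (transpose (rmat R) ** T ** rmat R)$p$p = 0}.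
        b T * \<omega> T * of_real (exp (- 2 * pi * \<eta> * trace (transpose (rmat R) ** T ** rmat R) / real M'))) = 0"
    by (elim exE conjE)
  note \<omega> = \<omega>'[rule_format]
  define LL where "LL = {T\<in>Lambda. (Qr ** P T ** Qr) $ p $ p = 0}"
  have LB: "T \<in> BB" if "T \<in> LL" "b T \<noteq> 0" for T using that N(5) by (simp add: LL_def BB_def pp)
  have "b T1 * \<omega> T1 = 0"
  proof (rule isolation[of T1 LL "2 * pi / real M'" "\<lambda>T. b T * \<omega> T" "\<lambda>T. 2 * pi / real M' * w0 T"])
    show "T1 \<in> LL" using T1(1) by (simp add: LL_def BB_def pp)
    show "2 * pi / real M' > 0" using M' by simp
    fix T assume T: "T \<in> LL" "T \<noteq> T1" "b T * \<omega> T \<noteq> 0"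
    then have "w0 T1 + 1 \<le> w0 T" using LB[of T] by (intro gap) auto
    then have "2 * pi / real M' * (w0 T1 + 1) \<le> 2 * pi / real M' * w0 T" using M' by (intro mult_left_mono) auto
    then show "2 * pi / real M' * w0 T1 + 2 * pi / real M' \<le> 2 * pi / real M' * w0 T" by (simp only: distrib_left mult_1_right)
  next
    fix \<eta> :: real assume \<eta>: "\<eta> > 0"
    have ex: "- \<eta> * (2 * pi / real M' * w0 T) = - 2 * pi * \<eta> * trace (Qr ** P T ** Qr) / real M'" for T by (simp add: w0_def)
    show "(\<Sum>\<^sub>\<infinity>T\<in>LL. b T * \<omega> T * of_real (exp (- \<eta> * (2 * pi / real M' * w0 T)))) = 0"
      unfolding ex using \<omega>(2)[OF \<eta>] unfolding RT LL_def[symmetric] .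
    define Z0 :: "'n cmat" where "Z0 = dmat (\<lambda>_. \<i> * of_real \<eta>)"
    define Z where "Z = rcmat (rmat R) ** Z0 ** transpose (rcmat (rmat R))"
    have Z0: "Z0 \<in> siegel_H" unfolding Z0_def by (rule dmat_in_H) (use \<eta> in simp)
    have Z: "Z \<in> siegel_H" unfolding Z_def using dR by (intro siegel_H_congr Z0) (simp add: det_rmat)
    have tZ: "trace (T ** Im_mat Z) = \<eta> * w0 T" for T
    proof -
      have "Im_mat Z0 = \<eta> *\<^sub>R mat 1" by (simp add: vec_eq_iff Z0_def mat_def)
      then have "Im_mat Z = \<eta> *\<^sub>R (rmat R ** transpose (rmat R))"
        unfolding Z_def Im_mat_congr by (simp add: scaleR_mult_matrix)
      then have "trace (T ** Im_mat Z) = \<eta> * trace ((T ** rmat R) ** transpose (rmat R))"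
        by (simp add: scaleR_mult_matrix trace_scaleR matrix_mul_assoc)
      also have "trace ((T ** rmat R) ** transpose (rmat R)) = trace (transpose (rmat R) ** (T ** rmat R))" by (rule trace_mul_sym)
      also have "\<dots> = w0 T" unfolding w0_def RT[symmetric] by (simp only: matrix_mul_assoc)
      finally show ?thesis .
    qed
    have "(\<lambda>T. b T * e (trace (rcmat T ** Z) / of_nat M')) summable_on Lambda"
      using fh Z by (auto simp: fourier_expansion_def summable_on_def)
    then have s: "(\<lambda>T. norm (b T * e (trace (rcmat T ** Z) / of_nat M'))) summable_on LL"
      unfolding summable_on_iff_abs_summable_on_complex by (rule summable_on_subset_banach) (auto simp: LL_def)
    have "norm (b T * e (trace (rcmat T ** Z) / of_nat M')) = norm (b T * \<omega> T * of_real (exp (- \<eta> * (2 * pi / real M' * w0 T))))" for T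
    proof -
      have "trace (rcmat T ** Z) / of_nat M' = cpair ((1 / real M') *\<^sub>R T) Z" by (simp add: trace_rcmat_mult cpair_scaleR_left)
      then have "norm (e (trace (rcmat T ** Z) / of_nat M')) = exp (- \<eta> * (2 * pi / real M' * w0 T))"
        by (simp add: norm_e_cpair scaleR_mult_matrix trace_scaleR tZ)
      then show ?thesis by (simp add: norm_mult \<omega>(1))
    qed
    then show "(\<lambda>T. norm (b T * \<omega> T * of_real (exp (- \<eta> * (2 * pi / real M' * w0 T))))) summable_on LL"
      using s by simp
  qed
  then show False using \<omega>(1)[of T1] T1(1) by (auto simp: BB_def)
qed

text \<open>The polynomial det(C + wA) does not vanish at w = i: there it is, up to a power of i,
  the automorphy factor of the inverse element at i times the identity. So it has finitely many
  zeros, and some multiple of N avoids them.\<close>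

lemma translate_lower_left_nonsingular:
  fixes A B C D :: "('n::finite) imat"
  assumes g: "(A,B,C,D) \<in> Sp" and N: "N > 0"
  obtains t :: int where "det ((\<chi> i j. N * t * A$i$j) + C) \<noteq> 0"
proof -
  define Pm where "Pm = det ((\<chi> i j. [: of_int (C$i$j), of_int (A$i$j) :]) :: complex poly^'n^'n)"
  have Pm: "poly Pm w = det (\<chi> i j. of_int (C$i$j) + w * of_int (A$i$j))" for w
    unfolding Pm_def det_def by (simp add: poly_sum poly_prod)
  have "poly Pm \<i> \<noteq> 0"
  proof -
    let ?Z = "dmat (\<lambda>_. \<i>) :: 'n cmat"
    define X where "X = cmat (- transpose C) ** ?Z + cmat (transpose A)"
    have "?Z \<in> siegel_H" by (rule dmat_in_H) simp
    from j_det_nz[OF Sp_inv[OF g] this] have dX: "det X \<noteq> 0" by (simp add: X_def)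
    have Xn: "X $ i $ j = of_int (A$j$i) - \<i> * of_int (C$j$i)" for i j
      by (simp add: X_def matrix_matrix_mult_def if_distrib[of "\<lambda>x. _ * x"] cong: if_cong)
    have "(\<chi> i j. of_int (C$i$j) + \<i> * of_int (A$i$j)) = (\<chi> i j. \<i> * transpose X $ i $ j * 1)"
      by (simp add: vec_eq_iff Xn algebra_simps)
    then have "poly Pm \<i> = (\<Prod>i\<in>(UNIV::'n set). \<i>) * (\<Prod>j\<in>(UNIV::'n set). 1) * det (transpose X)"
      unfolding Pm by (simp only: det_row_col_scale)
    then show ?thesis using dX by (simp add: det_transpose)
  qed
  then have "Pm \<noteq> 0" by auto
  then have "finite {w. poly Pm w = 0}" by (rule poly_roots_finite)
  moreover have "infinite (range (\<lambda>t::int. of_int (N * t) :: complex))"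
  proof
    assume "finite (range (\<lambda>t::int. of_int (N * t) :: complex))"
    moreover have "inj (\<lambda>t::int. of_int (N * t) :: complex)" using N by (auto simp: inj_on_def)
    ultimately show False using finite_imageD infinite_UNIV_int by blast
  qed
  ultimately have "\<not> range (\<lambda>t::int. of_int (N * t)) \<subseteq> {w. poly Pm w = 0}" using finite_subset by blast
  then obtain t where t: "poly Pm (of_int (N * t)) \<noteq> 0" by blast
  have "poly Pm (of_int (N * t)) = det (cmat ((\<chi> i j. N * t * A$i$j) + C))"
    unfolding Pm by (rule arg_cong[where f = det]) (simp add: vec_eq_iff)
  then show thesis using t that[of t] by (simp add: det_cmat)
qed

text \<open>The determinant of 2T is a positive integer. The lower bound allows the exponent in the
  coefficient estimate to be raised.\<close>

lemma det_half_integral_lower: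
  fixes T :: "real^('n::finite)^'n"
  assumes "T \<in> Lambda_plus" shows "det T \<ge> (1 / 2) ^ CARD('n)"
proof -
  have "2 ^ CARD('n) * det T = det (2 *\<^sub>R T)" by (simp only: det_scaleR)
  moreover have "det (2 *\<^sub>R T) \<in> \<int>" by (rule det_Ints) (use assms in \<open>simp add: Lambda_plus_def half_integral_def\<close>)
  moreover have "det T > 0" using assms by (intro pos_def_det_pos) (simp add: Lambda_plus_def)
  moreover from this have "2 ^ CARD('n) * det T > 0" by simp
  ultimately have "2 ^ CARD('n) * det T \<ge> 1" using Ints_nonzero_abs_ge1[of "det (2 *\<^sub>R T)"] by simp
  then show ?thesis by (simp add: field_simps)
qed

section \<open>Change of representative at a cusp and conclusion\<close>

lemma mp_mult_Mp:
  assumes y: "(l, \<psi>) \<in> Mp" and x: "(\<gamma>, \<phi>) \<in> Mp"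
  shows "mp_mult (l, \<psi>) (\<gamma>, \<phi>) \<in> Mp"
proof -
  have S: "l \<in> Sp" "\<gamma> \<in> Sp" by (rule MpD(1)[OF y] MpD(1)[OF x])+
  have "continuous_on siegel_H (\<lambda>Z. \<psi> (sp_act \<gamma> Z) * \<phi> Z)"
    by (rule continuous_on_mult[OF continuous_on_compose_H[OF MpD(2)[OF y] continuous_on_sp_act[OF S(2)] sp_act_H[OF S(2)]] MpD(2)[OF x]])
  then have "continuous_on siegel_H (\<lambda>Z. if Z \<in> siegel_H then \<psi> (sp_act \<gamma> Z) * \<phi> Z else 0)"
    by (rule continuous_on_cong[THEN iffD1, rotated 2]) auto
  then show ?thesis
    using sp_mult_Sp[OF S] MpD(3)[OF y sp_act_H[OF S(2)]] MpD(3)[OF x] sp_cocycle(2)[OF S]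
    by (auto simp: Mp_def power_mult_distrib)
qed

lemma slash_mp_mult:
  assumes mk: "\<lfloor>2 * k\<rfloor> = int m" and y: "(l, \<psi>) \<in> Mp" and x: "(\<gamma>, \<phi>) \<in> Mp"
    and inv: "\<And>Z. Z \<in> siegel_H \<Longrightarrow> slash k (l, \<psi>) F Z = F Z" and Z: "Z \<in> siegel_H"
  shows "slash k (mp_mult (l, \<psi>) (\<gamma>, \<phi>)) F Z = slash k (\<gamma>, \<phi>) F Z"
proof -
  have S: "l \<in> Sp" "\<gamma> \<in> Sp" by (rule MpD(1)[OF y] MpD(1)[OF x])+
  have "F (sp_act l (sp_act \<gamma> Z)) / \<psi> (sp_act \<gamma> Z) ^ m = F (sp_act \<gamma> Z)"
    using inv[OF sp_act_H[OF S(2) Z]] by (simp only: slash_eq[OF mk])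
  then show ?thesis
    using Z by (simp only: mp_mult.simps slash_eq[OF mk] sp_cocycle(1)[OF S Z] if_True power_mult_distrib divide_divide_eq_left[symmetric])
qed

theorem theorem1p2:
  fixes k c :: real
    and \<Gamma> :: "('n::finite) spel set"
    and G :: "'n mpel set"
    and F :: "'n cmat \<Rightarrow> complex"
    and M :: nat
    and a :: "real^'n^'n \<Rightarrow> complex"
  assumes "2 * k \<in> \<int>"
    and "k \<ge> real CARD('n) / 2"
    and "congruence_subgroup \<Gamma>"
    and "mp_subgroup G"
    and "fst ` G = \<Gamma>"
    and "modular_form k G F"
    and "fourier_expansion F M a"
    and "c < k - (real CARD('n) + 1) / 2"
    and "\<exists>C. \<forall>T\<in>Lambda_plus. norm (a T) \<le> C * det T powr c"
  shows "cusp_form k G F"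
proof -
  define m where "m = nat \<lfloor>2 * k\<rfloor>"
  have k0: "k \<ge> 0" using assms(2) by (meson divide_nonneg_pos of_nat_0_le_iff order_trans zero_less_numeral)
  have mk: "\<lfloor>2 * k\<rfloor> = int m" using k0 by (simp add: m_def)
  have rm: "real m = 2 * k"
  proof -
    have "real m = of_int \<lfloor>2 * k\<rfloor>" by (simp add: mk)
    then show ?thesis using of_int_floor_Ints[OF assms(1)] by simp
  qed
  have m: "m \<ge> CARD('n)"
  proof -
    have "real CARD('n) \<le> real m" using assms(2) by (simp add: rm)
    then show ?thesis by (simp only: of_nat_le_iff)
  qed
  \<comment> \<open>The lattice estimate wants a nonnegative exponent c + 1. Raising c to -1 costs
    only a constant, as determinants are bounded below, and -1 is still below k - (n+1)/2 because k
    \<ge> n/2.\<close>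
  define c' where "c' = max c (-1)"
  have c1: "c' \<ge> -1" by (simp add: c'_def)
  have c2: "c' < real m / 2 - (real CARD('n) + 1) / 2"
    using assms(2,8) by (simp add: c'_def rm add_divide_distrib)
  obtain C where C: "\<And>T. T \<in> Lambda_plus \<Longrightarrow> norm (a T) \<le> C * det T powr c" using assms(9) by blast
  define C0 where "C0 = \<bar>C\<bar> * ((1 / 2) ^ CARD('n)) powr (c - c')"
  have bd: "norm (a T) \<le> C0 * det T powr c'" if T: "T \<in> Lambda_plus" for T
  proof -
    have d: "(1 / 2) ^ CARD('n) \<le> det T" by (rule det_half_integral_lower[OF T])
    have d0: "0 < det T" by (rule less_le_trans[OF _ d]) simp
    have "det T powr (c - c') \<le> ((1 / 2) ^ CARD('n)) powr (c - c')"
      by (rule powr_mono2'[OF _ _ d]) (simp_all add: c'_def)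
    have "norm (a T) \<le> \<bar>C\<bar> * det T powr c" using C[OF T] by (rule order_trans) (intro mult_right_mono, auto)
    also have "det T powr c = det T powr (c - c') * det T powr c'" unfolding powr_add[symmetric] by simp
    also have "\<bar>C\<bar> * (det T powr (c - c') * det T powr c') \<le> \<bar>C\<bar> * (((1 / 2) ^ CARD('n)) powr (c - c') * det T powr c')"
      by (intro mult_left_mono mult_right_mono \<open>det T powr (c - c') \<le> _\<close>) auto
    finally show ?thesis by (simp only: C0_def mult.assoc)
  qed
  then have bd': "\<forall>T\<in>Lambda_plus. norm (a T) \<le> C0 * det T powr c'" by blast
  have GM: "G \<subseteq> Mp" using assms(4) by (simp add: mp_subgroup_def)
  have inv: "slash k y F Z = F Z" if "y \<in> G" "Z \<in> siegel_H" for y Z using assms(6) that by (auto simp: modular_form_def)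
  have "\<exists>M a. fourier_expansion (slash k x F) M a \<and> (\<forall>T \<in> Lambda - Lambda_plus. a T = 0)" if xM: "x \<in> Mp" for x
  proof -
    obtain \<gamma> \<phi> where x: "x = (\<gamma>, \<phi>)" by (cases x) auto
    have x': "(\<gamma>, \<phi>) \<in> Mp" using xM x by simp
    obtain A B C D where g: "\<gamma> = (A,B,C,D)" by (cases \<gamma>) auto
    have gS: "(A,B,C,D) \<in> Sp" using MpD(1)[OF x'] by (simp add: g)
    obtain M' b where fh: "fourier_expansion (slash k (\<gamma>,\<phi>) F) M' b"
      by (rule slash_fourier_expansion[OF mk assms(3-7) x'])
    obtain N where N: "N > 0" "principal_congruence N \<subseteq> \<Gamma>" using assms(3) by (auto simp: congruence_subgroup_def)
    obtain t where t: "det ((\<chi> i j. N * t * A$i$j) + C) \<noteq> 0" by (rule translate_lower_left_nonsingular[OF gS N(1)])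
    \<comment> \<open>Left multiplication by this lower unipotent element replaces C by N t A + C
      and keeps A and B. It lies in the principal congruence subgroup, so F is invariant under a
      lift of it and the slashed form does not change.\<close>
    let ?S = "(\<chi> i j. if i = j then N * t else 0) :: 'n imat"
    let ?l = "(mat 1, 0, ?S, mat 1) :: 'n spel"
    have SA: "?S ** A = (\<chi> i j. N * t * A$i$j)"
      by (simp add: vec_eq_iff matrix_matrix_mult_def if_distrib[of "\<lambda>x. x * _"] cong: if_cong)
    have "transpose ?S = ?S" by (simp add: vec_eq_iff)
    moreover have "transpose 0 = (0 :: 'n imat)" by (simp add: vec_eq_iff)
    ultimately have "?l \<in> principal_congruence N"
      by (simp add: principal_congruence_iff Sp_def mat_mult_0_left mat_mult_0_right) (simp add: mat_dvd_def)
    then have "?l \<in> fst ` G" using N(2) assms(5) by blast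
    then obtain \<psi> where y: "(?l, \<psi>) \<in> G" by auto
    have yM: "(?l, \<psi>) \<in> Mp" using y GM by blast
    let ?\<theta> = "\<lambda>Z. if Z \<in> siegel_H then \<psi> (sp_act (A,B,C,D) Z) * \<phi> Z else 0"
    have mm: "mp_mult (?l, \<psi>) (\<gamma>, \<phi>) = ((A, B, (\<chi> i j. N * t * A$i$j) + C, ?S ** B + D), ?\<theta>)"
      by (simp add: g SA mat_mult_0_left)
    \<comment> \<open>The same \<open>M'\<close> and \<open>b\<close> serve for the new
      representative, so coefficients that vanish there vanish for \<open>\<gamma>\<close>.\<close>
    have "fourier_expansion (slash k (mp_mult (?l, \<psi>) (\<gamma>, \<phi>)) F) M' b"
      using fh slash_mp_mult[OF mk yM x' inv[OF y]] unfolding fourier_expansion_def by (simp del: slash.simps mp_mult.simps)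
    note fh' = this[unfolded mm]
    have "b T = 0" if T: "T \<in> Lambda - Lambda_plus" for T
    proof (rule singular_coefficients_vanish[OF mk mp_mult_Mp[OF yM x', unfolded mm] t assms(7) fh' bd' m c1 c2])
      show "T \<in> Lambda" "\<not> pos_def T" using T by (auto simp: Lambda_def Lambda_plus_def)
    qed
    then show ?thesis using fh unfolding x by blast
  qed
  then show ?thesis using assms(6) by (simp add: cusp_form_def)
qed

end
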